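(* Let $d\ge2$, $k\in\mathbb{N}_0$, and let $\Omega=\Omega_z\times\Omega_t$ with $\Omega_z\subseteq\mathbb{R}^{d-1}$ and $\Omega_t\subseteq\mathbb{R}$ compact. Let $\{z_n\}_{n\in I}\subseteq\mathbb{R}^{d-1}$ be spatial sampling points with Voronoi cells $V_n\subseteq\mathbb{R}^{d-1}$ (with respect to a norm $|\cdot|_*$ on $\mathbb{R}^{d-1}$) and, for each $n\in I$, let $\{t_{m,n}\}_{m\in J}\subseteq\mathbb{R}$, $J=\mathbb{Z}$, be sampling times with $t_{m,n}<t_{m+1,n}$. Put $$\delta_z=\sup_{z\in\mathbb{R}^{d-1}}\inf_{n\in I}|z-z_n|_*,\qquad\delta_t=\sup_{n\in I}\sup_{t\in\mathbb{R}}\inf_{m\in J}|t-t_{m,n}|,$$ and, for $\alpha\in\mathbb{N}_0^{d-1}$, let the weights be $$\mu_{m,n,\alpha}=\frac{t_{m+1,n}-t_{m-1,n}}{2\,\alpha!}\int_{V_n}(z-z_n)^{2\alpha}\,\mathrm{d}z.$$ If $$\delta_t<\frac{\pi}{2m_{\Omega_t}},\qquad\delta_z<\frac{C(k,d)}{m_{\Omega_z}b},\qquad C(k,d)=\begin{cases}1/c_{k+1}&d=2\\ \max\{H_k(1),G_{k,d}(1)\}&d\ge3,\end{cases}$$ then $$\left(1-\frac{2\delta_tm_{\Omega_t}}{\pi}\right)^2A_z\|f\|^2\le\sum_{m\in J}\sum_{n\in I}\sum_{|\alpha|_1\le k}\mu_{m,n,\alpha}|D_z^\alpha f(z_n,t_{m,n})|^2\le\left(1+\frac{2\delta_tm_{\Omega_t}}{\pi}\right)^2B_z\|f\|^2$$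 for all $f\in\mathrm{B}(\Omega)$, where $A_z$ and $B_z$ satisfy, for $d=2$, $$A_z\ge e^{-1}\left(1-(m_{\Omega_z}c_{k+1}\delta_z)^{k+1}\right)^2,\qquad B_z\le(1+2m_{\Omega_z}\delta_z/\pi)^2e^{(m_{\Omega_z}\delta_z)^2},$$ and, for $d\ge3$, $$A_z\ge e^{-d}\left(1-\min\{h_k(m_{\Omega_z}b\delta_z),g_{k,d}(m_{\Omega_z}b\delta_z)\}\right)^2,\qquad B_z\le\exp\left(2m_{\Omega_z}b\delta_z+(m_{\Omega_z}b\delta_z)^2\right).$$ Equivalently, the set $\{\sqrt{\mu_{m,n,\alpha}}D_z^\alpha\Phi_\Omega(\cdot-x_{n,m}):n\in I,m\in J,|\alpha|_1\le k\}$, where $x_{n,m}=(z_n,t_{m,n})$, forms a frame for $\mathrm{B}(\Omega)$ with bounds $$A\ge(1-2\delta_tm_{\Omega_t}/\pi)^2A_z,\qquad B\le(1+2\delta_tm_{\Omega_t}/\pi)^2B_z.$$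
   Context: $\|\cdot\|$ is the norm of $L^2(\mathbb{R}^d)$; $\hat f(\omega)=\int_{\mathbb{R}^d}f(x)e^{-i\omega\cdot x}\,\mathrm{d}x$; $\mathrm{B}(\Omega)=\{f\in L^2(\mathbb{R}^d):\operatorname{supp}(\hat f)\subseteq\Omega\}$ (smooth representatives are used). Write $x=(z,t)\in\mathbb{R}^{d-1}\times\mathbb{R}$; $D_z^\alpha=\partial_{z_1}^{\alpha_1}\cdots\partial_{z_{d-1}}^{\alpha_{d-1}}$ for $\alpha\in\mathbb{N}_0^{d-1}$, $|\alpha|_1=\sum_j\alpha_j$, $\alpha!=\prod_j\alpha_j!$, $z^\alpha=\prod_jz_j^{\alpha_j}$. For a compact set $S$, $m_S=\sup_{\omega\in S}|\omega|_2$ with $|\cdot|_2$ the Euclidean norm; $b>0$ is the smallest constant with $|z|_2\le b|z|_*$ for all $z\in\mathbb{R}^{d-1}$. $\Phi_\Omega(x)=\frac1{(2\pi)^d}\int_\Omega e^{i\omega\cdot x}\,\mathrm{d}\omega$. Voronoi cells: $V_n=\{z\in\mathbb{R}^{d-1}:|z-z_n|_*\le|z-z_l|_*\ \forall l\in I,\ l\ne n\}$, with $I$ countable; they are assumed to form a partition of $\mathbb{R}^{d-1}$ (up to Lebesgue-null sets). When $d=2$, $|\cdot|_*$ is the absolute value on $\mathbb{R}$ (so $b=1$), $I=\mathbb{Z}$, and $z_n<z_{n+1}$ for all $n$. For $j\in\mathbb{N}$, $c_j>0$ is the minimal constant such that $\int_a^{b'}|f|^2\,\mathrm{d}x\le(c_j)^{2j}(b'-a)^{2j}\int_a^{b'}|f^{(j)}|^2\,\mathrm{d}x$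 for all $f\in H^j(a,b')$ (Sobolev space) satisfying either $f(a)=\dots=f^{(j-1)}(a)=0$ or $f(b')=\dots=f^{(j-1)}(b')=0$. For $y\in(0,\infty)$: $R_k(y)=e^y-\sum_{r=0}^k\frac{y^r}{r!}$, $\sigma_d^*(y)=\frac{y+\sqrt{y(d+y)}}{d}$, $h_k(y)=e^yR_k(y)$, $g_{k,d}(y)=(1+2\sigma_d^*(y))^{d/2}\exp(y/\sigma_d^*(y))R_k(y)$; these increase from limit $0$ at $0^+$ to $\infty$, and $H_k,G_{k,d}$ are the inverse functions of $h_k,g_{k,d}$ on $(0,\infty)$. A family $\{\phi_i\}$ in a Hilbert space is a frame with bounds $A,B>0$ if $A\|f\|^2\le\sum_i|\langle f,\phi_i\rangle|^2\le B\|f\|^2$ for all $f$. *)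

theory Defs
  imports "HOL-Analysis.Analysis"
begin

section \<open>Square-integrable functions and the Fourier transform\<close>

definition L2 :: "('a::euclidean_space \<Rightarrow> complex) set" where
  "L2 = {f. f \<in> borel_measurable lborel \<and> integrable lborel (\<lambda>x. (norm (f x))\<^sup>2)}"

definition L2_norm :: "('a::euclidean_space \<Rightarrow> complex) \<Rightarrow> real" where
  "L2_norm f = sqrt (\<integral>x. (norm (f x))\<^sup>2 \<partial>lborel)"

definition L2_inner :: "('a::euclidean_space \<Rightarrow> complex) \<Rightarrow> ('a \<Rightarrow> complex) \<Rightarrow> complex" where
  "L2_inner f g = (\<integral>x. f x * cnj (g x) \<partial>lborel)"

definition fourier :: "('a::euclidean_space \<Rightarrow> complex) \<Rightarrow> 'a \<Rightarrow> complex" where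
  "fourier f \<omega> = (\<integral>x. f x * exp (- \<i> * complex_of_real (\<omega> \<bullet> x)) \<partial>lborel)"

text \<open>The Fourier transform on \<open>L2\<close> is the continuous extension of \<open>fourier\<close> from integrable
  square-integrable functions; as \<open>g\<close> is only determined almost everywhere, it is a relation.\<close>

definition has_fourier_L2 ::
    "('a::euclidean_space \<Rightarrow> complex) \<Rightarrow> ('a \<Rightarrow> complex) \<Rightarrow> bool" where
  "has_fourier_L2 f g \<longleftrightarrow> f \<in> L2 \<and> g \<in> L2 \<and>
     (\<exists>F :: nat \<Rightarrow> 'a \<Rightarrow> complex.
        (\<forall>n. F n \<in> L2 \<and> integrable lborel (F n) \<and> fourier (F n) \<in> L2) \<and>
        (\<lambda>n. L2_norm (\<lambda>x. F n x - f x)) \<longlonglongrightarrow> 0 \<and>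
        (\<lambda>n. L2_norm (\<lambda>\<omega>. fourier (F n) \<omega> - g \<omega>)) \<longlonglongrightarrow> 0)"

definition ess_support :: "('a::euclidean_space \<Rightarrow> complex) \<Rightarrow> 'a set" where
  "ess_support g = - \<Union>{U. open U \<and> (AE x in lborel. x \<in> U \<longrightarrow> g x = 0)}"

section \<open>Partial derivatives and band-limited functions\<close>

definition dir_deriv ::
    "'a::euclidean_space \<Rightarrow> ('a \<Rightarrow> complex) \<Rightarrow> 'a \<Rightarrow> complex" where
  "dir_deriv v f x = vector_derivative (\<lambda>s::real. f (x + s *\<^sub>R v)) (at 0)"

definition smooth :: "('a::euclidean_space \<Rightarrow> complex) \<Rightarrow> bool" where
  "smooth f \<longleftrightarrow> (\<forall>vs. set vs \<subseteq> Basis \<longrightarrow> (\<forall>x. foldr dir_deriv vs f differentiable (at x)))"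

text \<open>Elements are represented by functions rather than equivalence classes: smoothness selects the
  unique smooth representative.\<close>

definition bandlimited :: "'a::euclidean_space set \<Rightarrow> ('a \<Rightarrow> complex) set" where
  "bandlimited \<Omega> = {f. smooth f \<and> f \<in> L2 \<and> (\<exists>g. has_fourier_L2 f g \<and> ess_support g \<subseteq> \<Omega>)}"

definition \<Phi> :: "'a::euclidean_space set \<Rightarrow> 'a \<Rightarrow> complex" where
  "\<Phi> \<Omega> x = complex_of_real (1 / (2 * pi) ^ DIM('a)) *
     (LINT \<omega>:\<Omega>|lborel. exp (\<i> * complex_of_real (\<omega> \<bullet> x)))"

text \<open>The space \<open>\<real>\<^sup>d\<close> is \<open>(real ^ 'n) \<times> real\<close> with \<open>d = CARD('n) + 1\<close>, and multi-indices are
  functions \<open>'n \<Rightarrow> nat\<close>. The order on \<open>'n\<close> only fixes the order of differentiation.\<close>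

definition Dz :: "('n::{finite,linorder} \<Rightarrow> nat) \<Rightarrow>
    ((real, 'n) vec \<times> real \<Rightarrow> complex) \<Rightarrow> (real, 'n) vec \<times> real \<Rightarrow> complex" where
  "Dz \<alpha> f = foldr (\<lambda>j. (dir_deriv (axis j 1, 0)) ^^ \<alpha> j) (sorted_list_of_set UNIV) f"

definition mi_abs :: "('n::finite \<Rightarrow> nat) \<Rightarrow> nat" where
  "mi_abs \<alpha> = (\<Sum>j\<in>UNIV. \<alpha> j)"

definition mi_fact :: "('n::finite \<Rightarrow> nat) \<Rightarrow> real" where
  "mi_fact \<alpha> = (\<Prod>j\<in>UNIV. fact (\<alpha> j))"

definition mi_pow :: "real ^ 'n \<Rightarrow> ('n::finite \<Rightarrow> nat) \<Rightarrow> real" where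
  "mi_pow z \<alpha> = (\<Prod>j\<in>UNIV. (z $ j) ^ \<alpha> j)"

section \<open>Sampling geometry\<close>

definition is_norm :: "('a::real_vector \<Rightarrow> real) \<Rightarrow> bool" where
  "is_norm N \<longleftrightarrow> (\<forall>x. N x = 0 \<longleftrightarrow> x = 0) \<and> (\<forall>c x. N (c *\<^sub>R x) = \<bar>c\<bar> * N x) \<and>
     (\<forall>x y. N (x + y) \<le> N x + N y)"

definition norm_const :: "('a::real_normed_vector \<Rightarrow> real) \<Rightarrow> real" where
  "norm_const N = Inf {b. b > 0 \<and> (\<forall>z. norm z \<le> b * N z)}"

text \<open>Inserting \<open>0\<close> makes the supremum over the empty set \<open>0\<close>, and is harmless otherwise.\<close>

definition max_norm :: "'a::real_normed_vector set \<Rightarrow> real" where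
  "max_norm S = Sup (insert 0 (norm ` S))"

text \<open>Extended reals, so that an unbounded gap has covering radius \<open>\<infinity>\<close>.\<close>

definition covering_radius ::
    "('a::real_vector \<Rightarrow> real) \<Rightarrow> 'i set \<Rightarrow> ('i \<Rightarrow> 'a) \<Rightarrow> ereal" where
  "covering_radius N I z = (SUP x. INF n\<in>I. ereal (N (x - z n)))"

definition voronoi ::
    "('a::real_vector \<Rightarrow> real) \<Rightarrow> 'i set \<Rightarrow> ('i \<Rightarrow> 'a) \<Rightarrow> 'i \<Rightarrow> 'a set" where
  "voronoi N I z n = {x. \<forall>l\<in>I. l \<noteq> n \<longrightarrow> N (x - z n) \<le> N (x - z l)}"

definition ae_partition :: "'i set \<Rightarrow> ('i \<Rightarrow> 'a::euclidean_space set) \<Rightarrow> bool" where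
  "ae_partition I V \<longleftrightarrow> negligible (- (\<Union>n\<in>I. V n)) \<and>
     (\<forall>n\<in>I. \<forall>l\<in>I. n \<noteq> l \<longrightarrow> negligible (V n \<inter> V l))"

definition weight :: "(real ^ 'n \<Rightarrow> real) \<Rightarrow> 'i set \<Rightarrow> ('i \<Rightarrow> real ^ 'n) \<Rightarrow> (int \<Rightarrow> 'i \<Rightarrow> real) \<Rightarrow>
    int \<Rightarrow> 'i \<Rightarrow> ('n::finite \<Rightarrow> nat) \<Rightarrow> real" where
  "weight N I z t m n \<alpha> = (t (m + 1) n - t (m - 1) n) / (2 * mi_fact \<alpha>) *
     (LINT x:voronoi N I z n|lborel. mi_pow (x - z n) (\<lambda>j. 2 * \<alpha> j))"

section \<open>The one-dimensional Poincare-type constants\<close>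

definition L2_on :: "real \<Rightarrow> real \<Rightarrow> (real \<Rightarrow> complex) set" where
  "L2_on a b = {f. set_borel_measurable lborel {a<..<b} f \<and>
     set_integrable lborel {a<..<b} (\<lambda>x. (norm (f x))\<^sup>2)}"

text \<open>Continuously differentiable test functions with compact support in \<open>{a<..<b}\<close>.\<close>

definition weak_deriv_on ::
    "real \<Rightarrow> real \<Rightarrow> (real \<Rightarrow> complex) \<Rightarrow> (real \<Rightarrow> complex) \<Rightarrow> bool" where
  "weak_deriv_on a b f g \<longleftrightarrow>
     (\<forall>\<phi> \<phi>' :: real \<Rightarrow> real.
        (\<forall>x. (\<phi> has_real_derivative \<phi>' x) (at x)) \<and> continuous_on UNIV \<phi>' \<and>
        (\<exists>K. compact K \<and> K \<subseteq> {a<..<b} \<and> (\<forall>x. x \<notin> K \<longrightarrow> \<phi> x = 0)) \<longrightarrow>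
        (LINT x:{a<..<b}|lborel. \<phi>' x *\<^sub>R f x) = - (LINT x:{a<..<b}|lborel. \<phi> x *\<^sub>R g x))"

text \<open>\<open>sobolev_H j a b F\<close>: the function \<open>F 0\<close> lies in the Sobolev space \<open>H\<^sup>j(a,b)\<close>, with weak
  derivatives \<open>F 1, \<dots>, F j\<close>; those of order below \<open>j\<close> are represented by their continuous
  extensions to \<open>{a..b}\<close>, so that they have values at the end points.\<close>

definition sobolev_H :: "nat \<Rightarrow> real \<Rightarrow> real \<Rightarrow> (nat \<Rightarrow> real \<Rightarrow> complex) \<Rightarrow> bool" where
  "sobolev_H j a b F \<longleftrightarrow> (\<forall>i\<le>j. F i \<in> L2_on a b) \<and>
     (\<forall>i<j. weak_deriv_on a b (F i) (F (Suc i)) \<and> continuous_on {a..b} (F i))"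

definition poincare_const :: "nat \<Rightarrow> real" where
  "poincare_const j = Inf {c. c > 0 \<and>
     (\<forall>a b F. a < b \<and> sobolev_H j a b F \<and>
        ((\<forall>i<j. F i a = 0) \<or> (\<forall>i<j. F i b = 0)) \<longrightarrow>
        (LINT x:{a<..<b}|lborel. (norm (F 0 x))\<^sup>2) \<le>
          c ^ (2 * j) * (b - a) ^ (2 * j) * (LINT x:{a<..<b}|lborel. (norm (F j x))\<^sup>2))}"

section \<open>The constants in the density condition\<close>

definition R_rem :: "nat \<Rightarrow> real \<Rightarrow> real" where
  "R_rem k y = exp y - (\<Sum>r\<le>k. y ^ r / fact r)"

definition \<sigma>_star :: "nat \<Rightarrow> real \<Rightarrow> real" where
  "\<sigma>_star d y = (y + sqrt (y * (real d + y))) / real d"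

definition h_fn :: "nat \<Rightarrow> real \<Rightarrow> real" where
  "h_fn k y = exp y * R_rem k y"

text \<open>For \<open>y = 0\<close> both \<open>h_fn\<close> and \<open>g_fn\<close> take the value \<open>0\<close>, which is their limit from the right.\<close>

definition g_fn :: "nat \<Rightarrow> nat \<Rightarrow> real \<Rightarrow> real" where
  "g_fn k d y = (1 + 2 * \<sigma>_star d y) powr (real d / 2) * exp (y / \<sigma>_star d y) * R_rem k y"

definition H_fn :: "nat \<Rightarrow> real \<Rightarrow> real" where
  "H_fn k = the_inv_into {0<..} (h_fn k)"

definition G_fn :: "nat \<Rightarrow> nat \<Rightarrow> real \<Rightarrow> real" where
  "G_fn k d = the_inv_into {0<..} (g_fn k d)"

definition C_const :: "nat \<Rightarrow> nat \<Rightarrow> real" where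
  "C_const k d = (if d = 2 then 1 / poincare_const (k + 1) else max (H_fn k 1) (G_fn k d 1))"

section \<open>Frames\<close>

definition is_frame :: "('a::euclidean_space \<Rightarrow> complex) set \<Rightarrow> 's set \<Rightarrow>
    ('s \<Rightarrow> 'a \<Rightarrow> complex) \<Rightarrow> real \<Rightarrow> real \<Rightarrow> bool" where
  "is_frame X S \<phi> A B \<longleftrightarrow> A > 0 \<and> B > 0 \<and> (\<forall>s\<in>S. \<phi> s \<in> X) \<and>
     (\<forall>f\<in>X. (\<lambda>s. (cmod (L2_inner f (\<phi> s)))\<^sup>2) summable_on S \<and>
        A * (L2_norm f)\<^sup>2 \<le> (\<Sum>\<^sub>\<infinity>s\<in>S. (cmod (L2_inner f (\<phi> s)))\<^sup>2) \<and>
        (\<Sum>\<^sub>\<infinity>s\<in>S. (cmod (L2_inner f (\<phi> s)))\<^sup>2) \<le> B * (L2_norm f)\<^sup>2)"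

end

theory Submission
  imports Defs "HOL-Probability.Characteristic_Functions"
begin

text \<open>
  A band-limited \<open>f\<close> is the inverse Fourier integral of a square-integrable \<open>g\<close> vanishing outside
  \<open>\<Omega>z \<times> \<Omega>t\<close>. Fixing one variable of a partial derivative of \<open>f\<close> gives a band-limited function of
  the other, so by Tonelli a sampling inequality in time for the functions
  \<open>s \<mapsto> D\<^sub>z\<^sup>\<alpha> f (z\<^sub>n, s)\<close> combines with one in space for the functions \<open>f (\<cdot>, s)\<close>.

  Both are perturbation arguments: \<open>\<parallel>f - P\<parallel> \<le> q \<parallel>f\<parallel>\<close> implies \<open>(1 - q) \<parallel>f\<parallel> \<le> \<parallel>P\<parallel> \<le> (1 + q) \<parallel>f\<parallel>\<close>. In
  time, \<open>P\<close> is the step function on the midpoint cells, and the inequalities of Wirtinger (on each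
  half cell) and Bernstein give \<open>q = 2 \<delta>t mt / \<pi>\<close>. In space, \<open>P\<close> is on \<open>V\<^sub>n\<close> the Taylor polynomial of
  degree \<open>k\<close> at \<open>z\<^sub>n\<close>; the weights are the integrals of its squared monomials, and Cauchy-Schwarz with
  \<open>\<Sum>\<^sub>\<alpha> 1 / \<alpha>! \<le> e\<^sup>d\<close> bounds \<open>\<parallel>P\<parallel>\<^sup>2\<close> by the weighted sum. For \<open>d = 2\<close> the Taylor remainder vanishes to
  order \<open>k + 1\<close> at \<open>z\<^sub>n\<close> and is estimated by the Poincare constant and Bernstein's inequality. For \<open>d \<ge> 3\<close> its
  Taylor series is summed, which needs an upper bound for the samples of all derivatives; expanding
  around the sampling points gives \<open>h_fn\<close>, averaging over balls of optimal radius gives \<open>g_fn\<close>.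

  If \<open>mz = 0\<close> or \<open>mt = 0\<close>, then \<open>\<Omega>z \<times> \<Omega>t\<close> is a null set and \<open>f = 0\<close>.
\<close>

section \<open>Square-integrable functions\<close>

text \<open>For d >= 3 the only metric information used about a cell is its radius R, since the
  Voronoi cells of a general norm need not be convex. The Taylor tail is therefore estimated term by
  term, and no term may cost a factor depending on the dimension. Measuring all derivatives of order
  r by one tensor norm, \<open>Qsq\<close>, achieves this: contraction with a vector u costs |u|^r,
  and Bernstein's inequality costs m^r, because the squares of the coordinates of \<omega> add up to
  |\<omega>|^2. In the Cauchy-Schwarz inequality the weights (m R)^r / r! and (R / m)^r / r! are
  balanced so that both factors end up as the same tail in y = m R. The error of the Taylor
  polynomials is then at most K R_k(y), where K bounds sampling at the z_n. Expanding f(z_n) around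
  a variable point of the cell gives K = e^y, whence h. Averaging over balls of radius R / \<sigma>
  gives a bound for each \<sigma> > 0, and \<open>\<sigma>_star\<close> minimises the prefactor of
  g. The frame bounds are the sampling bounds: by Parseval the inner product with a frame element is
  a weighted sampled derivative up to sign.\<close>

lemma integrable_mult_of_squares:
  fixes f g :: "'a \<Rightarrow> real"
  assumes [measurable]: "f \<in> borel_measurable M" "g \<in> borel_measurable M"
    and f: "integrable M (\<lambda>x. (f x)\<^sup>2)" and g: "integrable M (\<lambda>x. (g x)\<^sup>2)"
  shows "integrable M (\<lambda>x. f x * g x)"
proof (rule Bochner_Integration.integrable_bound)
  show "integrable M (\<lambda>x. (f x)\<^sup>2 + (g x)\<^sup>2)" using f g by simp
  have "\<bar>a * b\<bar> \<le> a\<^sup>2 + b\<^sup>2" for a b :: real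
  proof -
    have "0 \<le> (\<bar>a\<bar> - \<bar>b\<bar>)\<^sup>2" "0 \<le> \<bar>a\<bar> * \<bar>b\<bar>" by simp_all
    then show ?thesis unfolding power2_diff abs_mult power2_abs by linarith
  qed
  then show "AE x in M. norm (f x * g x) \<le> norm ((f x)\<^sup>2 + (g x)\<^sup>2)"
    by (intro AE_I2) simp
qed simp

text \<open>The quadratic form \<open>q\<close> in \<open>s\<close> and \<open>t\<close> is
  nonnegative. At \<open>s = ?G\<close>, \<open>t = ?I\<close> this is the claim multiplied by
  \<open>?G\<close>; if \<open>?G = 0\<close>, the form is linear in \<open>t\<close> for
  \<open>s = 1\<close> and would take the value -1 unless \<open>?I = 0\<close>.\<close>

lemma Cauchy_Schwarz_integral:
  fixes f g :: "'a \<Rightarrow> real"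
  assumes [measurable]: "f \<in> borel_measurable M" "g \<in> borel_measurable M"
    and f: "integrable M (\<lambda>x. (f x)\<^sup>2)" and g: "integrable M (\<lambda>x. (g x)\<^sup>2)"
  shows "(\<integral>x. f x * g x \<partial>M)\<^sup>2 \<le> (\<integral>x. (f x)\<^sup>2 \<partial>M) * (\<integral>x. (g x)\<^sup>2 \<partial>M)"
proof -
  let ?F = "\<integral>x. (f x)\<^sup>2 \<partial>M" and ?G = "\<integral>x. (g x)\<^sup>2 \<partial>M" and ?I = "\<integral>x. f x * g x \<partial>M"
  have fg: "integrable M (\<lambda>x. f x * g x)"
    by (rule integrable_mult_of_squares) fact+
  have q: "0 \<le> s\<^sup>2 * ?F - 2 * s * t * ?I + t\<^sup>2 * ?G" for s t
  proof -
    have "0 \<le> (\<integral>x. (s * f x - t * g x)\<^sup>2 \<partial>M)" by simp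
    also have "\<dots> = (\<integral>x. s\<^sup>2 * (f x)\<^sup>2 - 2 * s * t * (f x * g x) + t\<^sup>2 * (g x)\<^sup>2 \<partial>M)"
      by (intro Bochner_Integration.integral_cong) (auto simp: power2_eq_square algebra_simps)
    also have "\<dots> = s\<^sup>2 * ?F - 2 * s * t * ?I + t\<^sup>2 * ?G"
      using f g fg by simp
    finally show ?thesis .
  qed
  show ?thesis
  proof (cases "?G = 0")
    case True
    have "?I = 0"
    proof (rule ccontr)
      assume I: "?I \<noteq> 0"
      have "0 \<le> ?F - 2 * ((?F + 1) / (2 * ?I)) * ?I" using q[of 1 "(?F + 1) / (2 * ?I)"] True by simp
      also have "\<dots> = -1" using I by (simp add: field_simps)
      finally show False by simp
    qed
    then show ?thesis using True by simp
  next
    case False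
    moreover have "?G \<ge> 0" by simp
    ultimately have G: "?G > 0" by linarith
    have "0 \<le> ?G\<^sup>2 * ?F - 2 * ?G * ?I * ?I + ?I\<^sup>2 * ?G" using q[of ?G ?I] by simp
    also have "\<dots> = ?G * (?G * ?F - ?I\<^sup>2)" by (simp add: power2_eq_square algebra_simps)
    finally have "0 \<le> ?G * (?G * ?F - ?I\<^sup>2)" .
    moreover have "0 \<le> y" if "0 < x" "0 \<le> x * y" for x y :: real
      using that by (simp add: zero_le_mult_iff)
    ultimately have "0 \<le> ?G * ?F - ?I\<^sup>2" using G by blast
    then show ?thesis by (simp add: mult.commute)
  qed
qed

lemma norm_integral_mult_le:
  fixes f g :: "'a \<Rightarrow> complex"
  assumes [measurable]: "f \<in> borel_measurable M" "g \<in> borel_measurable M"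
    and f: "integrable M (\<lambda>x. (cmod (f x))\<^sup>2)" and g: "integrable M (\<lambda>x. (cmod (g x))\<^sup>2)"
  shows "integrable M (\<lambda>x. f x * g x)"
    and "(cmod (\<integral>x. f x * g x \<partial>M))\<^sup>2 \<le> (\<integral>x. (cmod (f x))\<^sup>2 \<partial>M) * (\<integral>x. (cmod (g x))\<^sup>2 \<partial>M)"
proof -
  have "integrable M (\<lambda>x. cmod (f x) * cmod (g x))"
    by (rule integrable_mult_of_squares) (use f g in auto)
  then show fg: "integrable M (\<lambda>x. f x * g x)"
    by (rule Bochner_Integration.integrable_bound) (auto simp: norm_mult)
  have "cmod (\<integral>x. f x * g x \<partial>M) \<le> (\<integral>x. cmod (f x) * cmod (g x) \<partial>M)"
    using integral_norm_bound[of M "\<lambda>x. f x * g x"] by (simp add: norm_mult)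
  then have "(cmod (\<integral>x. f x * g x \<partial>M))\<^sup>2 \<le> (\<integral>x. cmod (f x) * cmod (g x) \<partial>M)\<^sup>2"
    by (rule power_mono) simp
  also have "\<dots> \<le> (\<integral>x. (cmod (f x))\<^sup>2 \<partial>M) * (\<integral>x. (cmod (g x))\<^sup>2 \<partial>M)"
    by (rule Cauchy_Schwarz_integral) (use f g in auto)
  finally show "(cmod (\<integral>x. f x * g x \<partial>M))\<^sup>2 \<le> (\<integral>x. (cmod (f x))\<^sup>2 \<partial>M) * (\<integral>x. (cmod (g x))\<^sup>2 \<partial>M)" .
qed

text \<open>The squared norm with values in the extended nonnegative reals, so that Tonelli's
  theorem and limits apply before finiteness is known.\<close>

definition nsq :: "('a::euclidean_space \<Rightarrow> complex) \<Rightarrow> ennreal" where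
  "nsq f = (\<integral>\<^sup>+x. ennreal ((cmod (f x))\<^sup>2) \<partial>lborel)"

lemma L2_measurable: "f \<in> L2 \<Longrightarrow> f \<in> borel_measurable borel"
  by (simp add: L2_def)

lemma L2_integrable: "f \<in> L2 \<Longrightarrow> integrable lborel (\<lambda>x. (cmod (f x))\<^sup>2)"
  by (simp add: L2_def)

lemma L2_iff_nsq: "f \<in> L2 \<longleftrightarrow> f \<in> borel_measurable borel \<and> nsq f < \<infinity>"
  by (auto simp: L2_def nsq_def integrable_iff_bounded)

lemma nsq_eq_integral: "f \<in> L2 \<Longrightarrow> nsq f = ennreal (\<integral>x. (cmod (f x))\<^sup>2 \<partial>lborel)"
  unfolding nsq_def by (rule nn_integral_eq_integral) (auto simp: L2_integrable)

lemma L2_norm_sq: "(L2_norm f)\<^sup>2 = (\<integral>x. (cmod (f x))\<^sup>2 \<partial>lborel)"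
  by (simp add: L2_norm_def)

lemma L2_norm_nonneg: "0 \<le> L2_norm f"
  by (simp add: L2_norm_def)

lemma nsq_eq: "f \<in> L2 \<Longrightarrow> nsq f = ennreal ((L2_norm f)\<^sup>2)"
  by (simp add: nsq_eq_integral L2_norm_sq)

lemma cmod_add_sq_le: "(cmod (a + b))\<^sup>2 \<le> 2 * (cmod a)\<^sup>2 + 2 * (cmod b)\<^sup>2"
proof -
  have "(cmod (a + b))\<^sup>2 \<le> (cmod a + cmod b)\<^sup>2"
    by (rule power_mono) (auto simp: norm_triangle_ineq)
  moreover have "0 \<le> (cmod a - cmod b)\<^sup>2" by simp
  ultimately show ?thesis unfolding power2_diff power2_sum by linarith
qed

lemma nsq_add_le:
  assumes [measurable]: "f \<in> borel_measurable borel" "g \<in> borel_measurable borel"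
  shows "nsq (\<lambda>x. f x + g x) \<le> 2 * nsq f + 2 * nsq g"
proof -
  have "nsq (\<lambda>x. f x + g x) \<le>
      (\<integral>\<^sup>+x. 2 * ennreal ((cmod (f x))\<^sup>2) + 2 * ennreal ((cmod (g x))\<^sup>2) \<partial>lborel)"
    unfolding nsq_def
  proof (rule nn_integral_mono)
    fix x
    have "ennreal ((cmod (f x + g x))\<^sup>2) \<le> ennreal (2 * (cmod (f x))\<^sup>2 + 2 * (cmod (g x))\<^sup>2)"
      by (rule ennreal_leI) (rule cmod_add_sq_le)
    then show "ennreal ((cmod (f x + g x))\<^sup>2) \<le> 2 * ennreal ((cmod (f x))\<^sup>2) + 2 * ennreal ((cmod (g x))\<^sup>2)"
      by (simp add: ennreal_plus ennreal_mult')
  qed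
  also have "\<dots> = 2 * nsq f + 2 * nsq g"
    by (simp add: nsq_def nn_integral_add nn_integral_cmult)
  finally show ?thesis .
qed

lemma nsq_cmult:
  assumes [measurable]: "f \<in> borel_measurable borel"
  shows "nsq (\<lambda>x. c * f x) = ennreal ((cmod c)\<^sup>2) * nsq f"
  by (simp add: nsq_def norm_mult power_mult_distrib ennreal_mult nn_integral_cmult)

lemma L2_cmult: "f \<in> L2 \<Longrightarrow> (\<lambda>x. c * f x) \<in> L2"
  by (auto simp: L2_iff_nsq nsq_cmult ennreal_mult_less_top)

lemma L2_add: "f \<in> L2 \<Longrightarrow> g \<in> L2 \<Longrightarrow> (\<lambda>x. f x + g x) \<in> L2"
  unfolding L2_iff_nsq
proof safe
  assume m: "f \<in> borel_measurable borel" "g \<in> borel_measurable borel" and fin: "nsq f < \<infinity>" "nsq g < \<infinity>"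
  then show "(\<lambda>x. f x + g x) \<in> borel_measurable borel" by simp
  have "nsq (\<lambda>x. f x + g x) \<le> 2 * nsq f + 2 * nsq g" using m by (rule nsq_add_le)
  also have "\<dots> < \<infinity>" using fin by (auto simp: ennreal_mult_less_top)
  finally show "nsq (\<lambda>x. f x + g x) < \<infinity>" .
qed

lemma L2_diff: "f \<in> L2 \<Longrightarrow> g \<in> L2 \<Longrightarrow> (\<lambda>x. f x - g x) \<in> L2"
  using L2_add[of f "\<lambda>x. (-1) * g x"] L2_cmult[of g "-1"] by simp

lemma L2_mono:
  assumes "g \<in> L2" "f \<in> borel_measurable borel" "\<And>x. cmod (f x) \<le> C * cmod (g x)"
  shows "f \<in> L2"
proof -
  have "nsq f \<le> nsq (\<lambda>x. complex_of_real C * g x)"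
    unfolding nsq_def
  proof (intro nn_integral_mono ennreal_leI power_mono)
    fix x
    have "C * cmod (g x) \<le> \<bar>C\<bar> * cmod (g x)" by (intro mult_right_mono) auto
    then show "cmod (f x) \<le> cmod (complex_of_real C * g x)"
      using assms(3)[of x] by (simp add: norm_mult)
  qed simp
  also have "\<dots> < \<infinity>" using L2_cmult[OF assms(1), of "complex_of_real C"] by (simp add: L2_iff_nsq)
  finally show ?thesis using assms(2) by (simp add: L2_iff_nsq)
qed

section \<open>Affine changes of variable and continuity of translation\<close>

lemma lborel_density_scale:
  fixes t :: "'a::euclidean_space"
  assumes c: "c \<noteq> 0"
  shows "lborel = density (distr lborel borel (\<lambda>x. t + c *\<^sub>R x)) (\<lambda>_. ennreal (\<bar>c\<bar>^DIM('a)))"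
  using lborel_affine[OF c, of t] by simp

lemma nn_integral_lborel_affine:
  fixes f :: "'a::euclidean_space \<Rightarrow> ennreal"
  assumes [measurable]: "f \<in> borel_measurable borel" and c: "c \<noteq> 0"
  shows "(\<integral>\<^sup>+x. f x \<partial>lborel) = ennreal (\<bar>c\<bar>^DIM('a)) * (\<integral>\<^sup>+x. f (t + c *\<^sub>R x) \<partial>lborel)"
  by (subst lborel_density_scale[OF c, of t])
     (simp add: nn_integral_density nn_integral_distr nn_integral_cmult)

lemma integrable_lborel_affine:
  fixes f :: "'a::euclidean_space \<Rightarrow> 'b :: {banach, second_countable_topology}"
  assumes f: "integrable lborel f" and c: "c \<noteq> 0"
  shows "integrable lborel (\<lambda>x. f (t + c *\<^sub>R x))"
  using f f[THEN borel_measurable_integrable] c unfolding integrable_iff_bounded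
  by (subst (asm) nn_integral_lborel_affine[where c=c and t=t]) (auto simp: ennreal_mult_less_top)

lemma integral_lborel_affine:
  fixes f :: "'a::euclidean_space \<Rightarrow> 'b :: {banach, second_countable_topology}"
  assumes f[measurable]: "integrable lborel f" and c: "c \<noteq> 0"
  shows "(\<integral>x. f x \<partial>lborel) = (\<bar>c\<bar>^DIM('a)) *\<^sub>R (\<integral>x. f (t + c *\<^sub>R x) \<partial>lborel)"
  using f[THEN borel_measurable_integrable] integrable_lborel_affine[OF f c, of t]
  by (subst lborel_density_scale[OF c, of t]) (simp add: integral_density integral_distr)

lemma nsq_translate:
  assumes "f \<in> borel_measurable borel"
  shows "nsq (\<lambda>x. f (x + u)) = nsq f"
  unfolding nsq_def using assms
  by (subst (2) nn_integral_lborel_affine[where c=1 and t=u]) (auto simp: add.commute)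

lemma L2_translate: "f \<in> L2 \<Longrightarrow> (\<lambda>x. f (x + u)) \<in> L2"
  by (auto simp: L2_iff_nsq nsq_translate)

definition L2_cont :: "('a::euclidean_space \<Rightarrow> complex) \<Rightarrow> bool" where
  "L2_cont f \<longleftrightarrow> f \<in> L2 \<and>
     (\<forall>X. X \<longlonglongrightarrow> 0 \<longrightarrow> (\<lambda>n. nsq (\<lambda>x. f (x + X n) - f x)) \<longlonglongrightarrow> 0)"

lemma L2_cont_add:
  assumes "L2_cont f" "L2_cont g"
  shows "L2_cont (\<lambda>x. f x + g x)"
proof -
  have m[measurable]: "f \<in> borel_measurable borel" "g \<in> borel_measurable borel"
    using assms by (auto simp: L2_cont_def L2_iff_nsq)
  have le: "nsq (\<lambda>x. f (x + u) + g (x + u) - (f x + g x))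
     \<le> 2 * nsq (\<lambda>x. f (x + u) - f x) + 2 * nsq (\<lambda>x. g (x + u) - g x)" for u
    using nsq_add_le[of "\<lambda>x. f (x + u) - f x" "\<lambda>x. g (x + u) - g x"] by (simp add: algebra_simps)
  have "(\<lambda>n. nsq (\<lambda>x. f (x + X n) + g (x + X n) - (f x + g x))) \<longlonglongrightarrow> 0" if "X \<longlonglongrightarrow> 0" for X
  proof (rule tendsto_sandwich[OF _ _ tendsto_const])
    show "(\<lambda>n. 2 * nsq (\<lambda>x. f (x + X n) - f x) + 2 * nsq (\<lambda>x. g (x + X n) - g x)) \<longlonglongrightarrow> 0"
      using tendsto_add[OF ennreal_tendsto_cmult[of 2 "\<lambda>n. nsq (\<lambda>x. f (x + X n) - f x)" 0 sequentially]
          ennreal_tendsto_cmult[of 2 "\<lambda>n. nsq (\<lambda>x. g (x + X n) - g x)" 0 sequentially]] assms that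
      by (auto simp: L2_cont_def)
  qed (auto simp: le)
  then show ?thesis using assms by (auto simp: L2_cont_def L2_add)
qed

lemma L2_cont_cmult:
  assumes "L2_cont f"
  shows "L2_cont (\<lambda>x. c * f x)"
proof -
  have m[measurable]: "f \<in> borel_measurable borel"
    using assms by (auto simp: L2_cont_def L2_iff_nsq)
  have eq: "nsq (\<lambda>x. c * f (x + u) - c * f x) = ennreal ((cmod c)\<^sup>2) * nsq (\<lambda>x. f (x + u) - f x)" for u
    using nsq_cmult[of "\<lambda>x. f (x + u) - f x" c] by (simp add: right_diff_distrib)
  have "(\<lambda>n. nsq (\<lambda>x. c * f (x + X n) - c * f x)) \<longlonglongrightarrow> 0" if "X \<longlonglongrightarrow> 0" for X
    using ennreal_tendsto_cmult[of "ennreal ((cmod c)\<^sup>2)" "\<lambda>n. nsq (\<lambda>x. f (x + X n) - f x)" 0 sequentially] assms that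
    by (auto simp: L2_cont_def eq)
  then show ?thesis using assms by (auto simp: L2_cont_def L2_cmult)
qed

lemma L2_cont_sum:
  "finite S \<Longrightarrow> (\<And>i. i \<in> S \<Longrightarrow> L2_cont (f i)) \<Longrightarrow> L2_cont (\<lambda>x. \<Sum>i\<in>S. f i x)"
proof (induction rule: finite_induct)
  case empty
  then show ?case by (simp add: L2_cont_def L2_iff_nsq nsq_def)
next
  case (insert i S)
  then show ?case by (simp add: L2_cont_add)
qed

lemma L2_cont_limit:
  assumes f: "f \<in> L2" and approx: "\<And>e. e > 0 \<Longrightarrow> \<exists>g. L2_cont g \<and> nsq (\<lambda>x. f x - g x) \<le> ennreal e"
  shows "L2_cont f"
  unfolding L2_cont_def
proof (intro conjI allI impI f)
  fix X :: "nat \<Rightarrow> 'a" assume X: "X \<longlonglongrightarrow> 0"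
  have [measurable]: "f \<in> borel_measurable borel" using f by (rule L2_measurable)
  show "(\<lambda>n. nsq (\<lambda>x. f (x + X n) - f x)) \<longlonglongrightarrow> 0"
  proof (rule tendsto_zero_ennreal)
    fix r :: real assume r: "0 < r"
    \<comment> \<open>Each use of \<open>nsq_add_le\<close> costs a factor 2; with these fractions
      the final sum is 3/4 of \<open>r\<close>.\<close>
    obtain g where g: "L2_cont g" and le: "nsq (\<lambda>x. f x - g x) \<le> ennreal (r / 16)"
      using approx[of "r / 16"] r by auto
    have [measurable]: "g \<in> borel_measurable borel" using g by (auto simp: L2_cont_def L2_measurable)
    have "(\<lambda>n. nsq (\<lambda>x. g (x + X n) - g x)) \<longlonglongrightarrow> 0" using g X by (auto simp: L2_cont_def)
    then have "\<forall>\<^sub>F n in sequentially. nsq (\<lambda>x. g (x + X n) - g x) < ennreal (r / 8)"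
      by (rule order_tendstoD(2)) (use r in simp)
    then show "\<forall>\<^sub>F n in sequentially. nsq (\<lambda>x. f (x + X n) - f x) < ennreal r"
    proof eventually_elim
      case (elim n)
      let ?h = "\<lambda>x. f x - g x"
      have "nsq (\<lambda>x. f (x + X n) - f x) \<le>
          2 * nsq (\<lambda>x. ?h (x + X n) + (-1) * ?h x) + 2 * nsq (\<lambda>x. g (x + X n) - g x)"
        using nsq_add_le[of "\<lambda>x. ?h (x + X n) + (-1) * ?h x" "\<lambda>x. g (x + X n) - g x"] by simp
      also have "nsq (\<lambda>x. ?h (x + X n) + (-1) * ?h x) \<le> 2 * nsq (\<lambda>x. ?h (x + X n)) + 2 * nsq (\<lambda>x. (-1) * ?h x)"
        by (rule nsq_add_le) auto
      also have "nsq (\<lambda>x. (-1) * ?h x) = nsq ?h" by (subst nsq_cmult) auto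
      also have "nsq (\<lambda>x. ?h (x + X n)) = nsq ?h" by (rule nsq_translate) auto
      finally have "nsq (\<lambda>x. f (x + X n) - f x) \<le> 2 * (2 * nsq ?h + 2 * nsq ?h) + 2 * nsq (\<lambda>x. g (x + X n) - g x)"
        by (simp add: add_mono mult_left_mono)
      also have "\<dots> \<le> 2 * (2 * ennreal (r / 16) + 2 * ennreal (r / 16)) + 2 * ennreal (r / 8)"
        using le elim by (intro add_mono mult_left_mono) auto
      also have "\<dots> = ennreal (2 * (2 * (r / 16) + 2 * (r / 16)) + 2 * (r / 8))"
        using r by (simp only: ennreal_mult' ennreal_plus ennreal_numeral zero_le_numeral
          mult_nonneg_nonneg add_nonneg_nonneg divide_nonneg_nonneg less_imp_le)
      also have "\<dots> < ennreal r" using r by (intro ennreal_lessI) auto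
      finally show ?case .
    qed
  qed
qed

text \<open>The points on which the two indicators differ either leave \<open>U\<close> or enter it
  under the translation. For the first kind, openness gives pointwise convergence and
  \<open>indicator U\<close> dominates; the second kind becomes the first, with \<open>- X n\<close>
  in place of \<open>X n\<close>, after a change of variable.\<close>

lemma L2_cont_indicator_open:
  fixes U :: "'a::euclidean_space set"
  assumes U: "open U" and fin: "emeasure lborel U < \<infinity>"
  shows "L2_cont (\<lambda>x. indicator U x)"
  unfolding L2_cont_def
proof (intro conjI allI impI)
  have [measurable]: "U \<in> sets borel" using U by auto
  have "nsq (\<lambda>x. indicator U x) = (\<integral>\<^sup>+x. indicator U x \<partial>lborel)"
    unfolding nsq_def by (intro nn_integral_cong) (auto split: split_indicator)
  then show "(\<lambda>x. indicator U x) \<in> L2"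
    using fin by (simp add: L2_iff_nsq)
  have conv: "(\<lambda>n. \<integral>\<^sup>+x. indicator U x * indicator (-U) (x + X n) \<partial>lborel) \<longlonglongrightarrow> 0"
    if X: "X \<longlonglongrightarrow> 0" for X :: "nat \<Rightarrow> 'a"
  proof -
    have "(\<lambda>n. \<integral>\<^sup>+x. indicator U x * indicator (-U) (x + X n) \<partial>lborel) \<longlonglongrightarrow> (\<integral>\<^sup>+x. 0 \<partial>(lborel :: 'a measure))"
    proof (rule nn_integral_dominated_convergence[where w="indicator U"])
      show "AE x in lborel. (\<lambda>n. indicator U x * indicator (- U) (x + X n) :: ennreal) \<longlonglongrightarrow> 0"
      proof (rule AE_I2)
        fix x
        show "(\<lambda>n. indicator U x * indicator (- U) (x + X n) :: ennreal) \<longlonglongrightarrow> 0"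
        proof (cases "x \<in> U")
          case True
          have "(\<lambda>n. x + X n) \<longlonglongrightarrow> x" using tendsto_add[OF tendsto_const X, of x] by simp
          then have "\<forall>\<^sub>F n in sequentially. x + X n \<in> U"
            using U True by (rule topological_tendstoD)
          then show ?thesis
            by (intro tendsto_eventually) (auto elim!: eventually_mono split: split_indicator)
        qed simp
      qed
    qed (use fin in \<open>auto split: split_indicator simp: nn_integral_indicator\<close>)
    then show ?thesis by simp
  qed
  fix X :: "nat \<Rightarrow> 'a" assume X: "X \<longlonglongrightarrow> 0"
  have "nsq (\<lambda>x. indicator U (x + X n) - indicator U x) =
     (\<integral>\<^sup>+x. indicator U x * indicator (-U) (x + X n) \<partial>lborel) +
     (\<integral>\<^sup>+x. indicator U x * indicator (-U) (x + - X n) \<partial>lborel)" for n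
  proof -
    have "nsq (\<lambda>x. indicator U (x + X n) - indicator U x) =
      (\<integral>\<^sup>+x. indicator U x * indicator (-U) (x + X n) + indicator U (x + X n) * indicator (-U) x \<partial>lborel)"
      unfolding nsq_def by (intro nn_integral_cong) (auto split: split_indicator)
    also have "\<dots> = (\<integral>\<^sup>+x. indicator U x * indicator (-U) (x + X n) \<partial>lborel) +
        (\<integral>\<^sup>+x. indicator U (x + X n) * indicator (-U) x \<partial>lborel)"
      by (intro nn_integral_add) auto
    also have "(\<integral>\<^sup>+x. indicator U (x + X n) * indicator (-U) x \<partial>lborel) =
        (\<integral>\<^sup>+x. indicator U x * indicator (-U) (x + - X n) \<partial>lborel)"
      by (subst (2) nn_integral_lborel_affine[where c=1 and t="X n"]) (auto simp: add.commute)
    finally show ?thesis .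
  qed
  moreover have "(\<lambda>n. - X n) \<longlonglongrightarrow> 0" using tendsto_minus[OF X] by simp
  ultimately show "(\<lambda>n. nsq (\<lambda>x. indicator U (x + X n) - indicator U x)) \<longlonglongrightarrow> 0"
    using tendsto_add[OF conv[OF X] conv[of "\<lambda>n. - X n"]] by simp
qed

lemma L2_cont_indicator:
  fixes A :: "'a::euclidean_space set"
  assumes A[measurable]: "A \<in> sets borel" and fin: "emeasure lborel A < \<infinity>"
  shows "L2_cont (\<lambda>x. indicator A x)"
proof (rule L2_cont_limit)
  have nsq_ind: "nsq (\<lambda>x. indicator B x) = emeasure lborel B" if "B \<in> sets borel" for B :: "'a set"
  proof -
    have "nsq (\<lambda>x. indicator B x) = (\<integral>\<^sup>+x. indicator B x \<partial>lborel)"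
      unfolding nsq_def by (intro nn_integral_cong) (auto split: split_indicator)
    then show ?thesis using that by simp
  qed
  show "(\<lambda>x. indicator A x) \<in> L2" using fin by (simp add: L2_iff_nsq nsq_ind)
  fix e :: real assume e: "e > 0"
  obtain U where U: "open U" "A \<subseteq> U" "emeasure lebesgue (U - A) < ennreal e"
  proof (rule sets_lebesgue_outer_open[OF _ e, of A])
    show "A \<in> sets lebesgue" using A by simp
  qed
  have [measurable]: "U \<in> sets borel" using U(1) by (rule borel_open)
  have UA: "emeasure lborel (U - A) < ennreal e" using U by simp
  have "emeasure lborel U \<le> emeasure lborel A + emeasure lborel (U - A)"
    using emeasure_subadditive[of A lborel "U - A"] U by (simp add: Un_absorb1)
  also have "\<dots> < \<infinity>" using fin UA by (auto intro: order.strict_trans)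
  finally have "L2_cont (\<lambda>x. indicator U x)" using U by (intro L2_cont_indicator_open) auto
  moreover have "nsq (\<lambda>x. indicator A x - indicator U x) = nsq (\<lambda>x. indicator (U - A) x)"
    unfolding nsq_def using U by (intro nn_integral_cong) (auto split: split_indicator)
  then have "nsq (\<lambda>x. indicator A x - indicator U x) \<le> ennreal e"
    using UA by (simp add: nsq_ind)
  ultimately show "\<exists>g. L2_cont g \<and> nsq (\<lambda>x. indicator A x - g x) \<le> ennreal e" by blast
qed

text \<open>Proved for indicators of open sets by dominated convergence, then for indicators by outer
  regularity, and in general by simple approximation.\<close>

lemma L2_cont_L2:
  fixes f :: "'a::euclidean_space \<Rightarrow> complex"
  assumes f: "f \<in> L2"
  shows "L2_cont f"
proof (rule L2_cont_limit[OF f])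
  fix e :: real assume e: "e > 0"
  have fm[measurable]: "f \<in> borel_measurable lborel" using f by (simp add: L2_measurable)
  obtain s where s: "\<And>i::nat. simple_function lborel (s i)"
    and lim: "\<And>x. (\<lambda>i. s i x) \<longlonglongrightarrow> f x" and bd: "\<And>i x. cmod (s i x) \<le> 2 * cmod (f x)"
    using borel_measurable_implies_sequence_metric[OF fm, of 0] by (auto simp: dist_norm)
  have sm[measurable]: "s i \<in> borel_measurable borel" for i
    using borel_measurable_simple_function[OF s[of i]] by simp
  have "(\<lambda>i. nsq (\<lambda>x. f x - s i x)) \<longlonglongrightarrow> (\<integral>\<^sup>+x. 0 \<partial>(lborel :: 'a measure))"
    unfolding nsq_def
  proof (rule nn_integral_dominated_convergence[where w="\<lambda>x. ennreal (9 * (cmod (f x))\<^sup>2)"])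
    have "cmod (f x - s i x) \<le> 3 * cmod (f x)" for i x
      using norm_triangle_ineq4[of "f x" "s i x"] bd[of i x] by linarith
    then have "(cmod (f x - s i x))\<^sup>2 \<le> (3 * cmod (f x))\<^sup>2" for i x
      by (intro power_mono) auto
    then show "AE x in lborel. ennreal ((cmod (f x - s i x))\<^sup>2) \<le> ennreal (9 * (cmod (f x))\<^sup>2)" for i
      by (intro AE_I2 ennreal_leI) (simp add: power_mult_distrib)
    have "nsq f < \<infinity>" using f by (simp add: L2_iff_nsq)
    then show "(\<integral>\<^sup>+x. ennreal (9 * (cmod (f x))\<^sup>2) \<partial>lborel) < \<infinity>"
      by (simp add: ennreal_mult' nn_integral_cmult nsq_def ennreal_mult_less_top)
    have "(\<lambda>i. ennreal ((cmod (f x - s i x))\<^sup>2)) \<longlonglongrightarrow> ennreal ((cmod (f x - f x))\<^sup>2)" for x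
      by (intro tendsto_intros lim)
    then show "AE x in lborel. (\<lambda>i. ennreal ((cmod (f x - s i x))\<^sup>2)) \<longlonglongrightarrow> 0" by simp
  qed auto
  then have "(\<lambda>i. nsq (\<lambda>x. f x - s i x)) \<longlonglongrightarrow> 0" by simp
  then have "\<forall>\<^sub>F i in sequentially. nsq (\<lambda>x. f x - s i x) < ennreal e"
    by (rule order_tendstoD(2)) (use e in simp)
  then obtain i where i: "nsq (\<lambda>x. f x - s i x) < ennreal e"
    by (auto simp: eventually_sequentially)
  have finr: "finite (range (s i))" using s[of i] by (simp add: simple_function_def)
  have rep: "s i x = (\<Sum>y\<in>range (s i). y * indicator (s i -` {y}) x)" for x
  proof -
    have "(\<Sum>y\<in>range (s i). y * indicator (s i -` {y}) x) = (\<Sum>y\<in>range (s i). if y = s i x then y else 0)"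
      by (intro sum.cong) (auto split: split_indicator)
    then show ?thesis using finr by simp
  qed
  have sL2: "s i \<in> L2" by (rule L2_mono[OF f sm bd])
  have "L2_cont (\<lambda>x. y * indicator (s i -` {y}) x)" for y
  \<comment> \<open>The preimage of 0 may have infinite measure; all others have finite measure by
    Chebyshev's inequality.\<close>
  proof (cases "y = 0")
    case True
    then show ?thesis by (simp add: L2_cont_def L2_iff_nsq nsq_def)
  next
    case False
    have m[measurable]: "s i -` {y} \<in> sets borel" using measurable_sets[OF sm[of i], of "{y}"] by simp
    have "ennreal ((cmod y)\<^sup>2) * emeasure lborel (s i -` {y}) =
       (\<integral>\<^sup>+x. ennreal ((cmod y)\<^sup>2) * indicator (s i -` {y}) x \<partial>lborel)"
      by (simp add: nn_integral_cmult)
    also have "\<dots> \<le> nsq (s i)"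
      unfolding nsq_def by (intro nn_integral_mono) (auto split: split_indicator)
    also have "\<dots> < \<infinity>" using sL2 by (simp add: L2_iff_nsq)
    finally have "emeasure lborel (s i -` {y}) < \<infinity>"
      using False by (auto simp: ennreal_mult_less_top)
    then show ?thesis by (intro L2_cont_cmult L2_cont_indicator) auto
  qed
  then have "L2_cont (\<lambda>x. \<Sum>y\<in>range (s i). y * indicator (s i -` {y}) x)"
    by (intro L2_cont_sum finr)
  moreover have "(\<lambda>x. \<Sum>y\<in>range (s i). y * indicator (s i -` {y}) x) = s i"
    by (rule ext) (rule rep[symmetric])
  ultimately have "L2_cont (s i)" by (simp only:)
  then show "\<exists>g. L2_cont g \<and> nsq (\<lambda>x. f x - g x) \<le> ennreal e"
    by (intro exI[of _ "s i"] conjI less_imp_le[OF i])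
qed

section \<open>The Plancherel theorem\<close>

lemma integral_lborel_prod:
  fixes f :: "'a::euclidean_space \<Rightarrow> real \<Rightarrow> complex"
  assumes f: "\<And>b. b \<in> Basis \<Longrightarrow> integrable lborel (f b)"
  shows "integrable lborel (\<lambda>x::'a. \<Prod>b\<in>Basis. f b (x \<bullet> b))"
    and "(\<integral>x. (\<Prod>b\<in>Basis. f b (x \<bullet> b)) \<partial>(lborel :: 'a measure)) = (\<Prod>b\<in>Basis. \<integral>r. f b r \<partial>lborel)"
proof -
  interpret product_sigma_finite "\<lambda>_::'a. lborel :: real measure" ..
  have m[measurable]: "f b \<in> borel_measurable borel" if "b \<in> Basis" for b
    using f[OF that] by auto
  have inner: "(\<Prod>b\<in>Basis. f b ((\<Sum>b'\<in>Basis. h b' *\<^sub>R b') \<bullet> b)) = (\<Prod>b\<in>Basis. f b (h b))" for h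
    by (intro prod.cong) (auto simp: inner_sum_left inner_Basis if_distrib cong: if_cong)
  show "integrable lborel (\<lambda>x::'a. \<Prod>b\<in>Basis. f b (x \<bullet> b))"
    unfolding lborel_eq[where 'a='a] by (subst integrable_distr_eq) (auto simp: inner intro!: product_integrable_prod f)
  show "(\<integral>x. (\<Prod>b\<in>Basis. f b (x \<bullet> b)) \<partial>(lborel :: 'a measure)) = (\<Prod>b\<in>Basis. \<integral>r. f b r \<partial>lborel)"
    unfolding lborel_eq[where 'a='a]
    by (subst integral_distr) (auto simp: inner intro!: product_integral_prod f)
qed

section \<open>The Gaussian and its Fourier transform\<close>

definition gauss :: "'a::euclidean_space \<Rightarrow> real" where
  "gauss x = exp (- (norm x)\<^sup>2 / 2) / sqrt (2 * pi) ^ DIM('a)"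

lemma power2_norm_eq_sum: "(norm (x :: 'a::euclidean_space))\<^sup>2 = (\<Sum>b\<in>Basis. (x \<bullet> b)\<^sup>2)"
  unfolding power2_norm_eq_inner by (subst euclidean_inner) (simp add: power2_eq_square)

lemma gauss_prod: "gauss (x :: 'a::euclidean_space) = (\<Prod>b\<in>Basis. std_normal_density (x \<bullet> b))"
proof -
  have "- (norm x)\<^sup>2 / 2 = (\<Sum>b\<in>Basis. - (x \<bullet> b)\<^sup>2 / 2)"
    by (simp add: power2_norm_eq_sum sum_divide_distrib[symmetric] sum_negf)
  then show ?thesis
    by (simp add: gauss_def std_normal_density_def prod_dividef exp_sum)
qed

lemma gauss_pos: "gauss x > 0"
  by (simp add: gauss_def)

lemma gauss_le_1: "gauss (x::'a::euclidean_space) \<le> 1"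
proof -
  have "exp (- (norm x)\<^sup>2 / 2) \<le> 1" by simp
  also have "1 \<le> sqrt (2 * pi) ^ DIM('a)"
    by (rule one_le_power) (use pi_gt3 in simp)
  finally show ?thesis unfolding gauss_def by (simp add: divide_le_eq)
qed

lemma gauss_measurable[measurable]: "gauss \<in> borel_measurable borel"
  unfolding gauss_def by measurable

lemma integral_gauss_iexp:
  fixes x :: "'a::euclidean_space"
  shows "integrable lborel (\<lambda>v. complex_of_real (gauss v) * exp (\<i> * complex_of_real (v \<bullet> x)))" (is ?A)
    and "(\<integral>v. complex_of_real (gauss v) * exp (\<i> * complex_of_real (v \<bullet> x)) \<partial>lborel) =
      complex_of_real (sqrt (2 * pi) ^ DIM('a) * gauss x)" (is ?B)
proof -
  let ?f = "\<lambda>(b::'a) r. complex_of_real (std_normal_density r) * iexp ((x \<bullet> b) * r)"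
  have int: "integrable lborel (?f b)" for b
    by (rule Bochner_Integration.integrable_bound[OF integrable_std_normal_moment_abs[of 0]])
      (auto simp: norm_mult)
  have val: "(\<integral>r. ?f b r \<partial>lborel) = complex_of_real (exp (- (x \<bullet> b)\<^sup>2 / 2))" for b
  proof -
    have "(\<integral>r. ?f b r \<partial>lborel) = char std_normal_distribution (x \<bullet> b)"
      unfolding char_def by (subst integral_density) (auto simp: scaleR_conv_of_real)
    then show ?thesis by (simp add: char_std_normal_distribution)
  qed
  have eq: "(\<lambda>v. complex_of_real (gauss v) * exp (\<i> * complex_of_real (v \<bullet> x))) = (\<lambda>v. \<Prod>b\<in>Basis. ?f b (v \<bullet> b))"
  proof
    fix v
    have "\<i> * complex_of_real (v \<bullet> x) = (\<Sum>b\<in>Basis. \<i> * complex_of_real ((x \<bullet> b) * (v \<bullet> b)))"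
      by (subst euclidean_inner) (simp add: sum_distrib_left mult.commute)
    then show "complex_of_real (gauss v) * exp (\<i> * complex_of_real (v \<bullet> x)) = (\<Prod>b\<in>Basis. ?f b (v \<bullet> b))"
      by (simp add: gauss_prod prod.distrib exp_sum)
  qed
  show ?A unfolding eq by (rule integral_lborel_prod) (rule int)
  have "(\<integral>v. complex_of_real (gauss v) * exp (\<i> * complex_of_real (v \<bullet> x)) \<partial>lborel) = 
     (\<Prod>b\<in>Basis. complex_of_real (exp (- (x \<bullet> b)\<^sup>2 / 2)))"
    unfolding eq by (subst integral_lborel_prod(2)[OF int]) (simp only: val)
  also have "\<dots> = complex_of_real (exp (\<Sum>b\<in>Basis. - (x \<bullet> b)\<^sup>2 / 2))"
    by (simp add: exp_sum)
  also have "(\<Sum>b\<in>Basis. - (x \<bullet> b)\<^sup>2 / 2) = - (norm x)\<^sup>2 / 2"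
    by (simp add: power2_norm_eq_sum sum_divide_distrib[symmetric] sum_negf)
  finally show ?B by (simp add: gauss_def)
qed

lemma integrable_gauss: "integrable lborel (gauss :: 'a::euclidean_space \<Rightarrow> real)"
  and integral_gauss: "(\<integral>v. gauss v \<partial>(lborel :: 'a::euclidean_space measure)) = 1"
proof -
  have "integrable lborel (\<lambda>v::'a. complex_of_real (gauss v))"
    using integral_gauss_iexp(1)[of "0::'a"] by simp
  then show "integrable lborel (gauss :: 'a \<Rightarrow> real)" by (simp only: complex_of_real_integrable_eq)
  have "complex_of_real (\<integral>v. gauss v \<partial>(lborel :: 'a measure)) = complex_of_real 1"
    using integral_gauss_iexp(2)[of "0::'a"] by (simp add: gauss_def)
  then show "(\<integral>v. gauss v \<partial>(lborel :: 'a measure)) = 1" by (simp only: of_real_eq_iff)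
qed

lemma integral_gauss_scaled_iexp:
  fixes x :: "'a::euclidean_space"
  assumes s: "s > 0"
  shows "(\<integral>v. complex_of_real (gauss (s *\<^sub>R v)) * exp (\<i> * complex_of_real (v \<bullet> x)) \<partial>lborel) =
      complex_of_real ((sqrt (2 * pi) / s) ^ DIM('a) * gauss (x /\<^sub>R s))"
proof -
  let ?f = "\<lambda>v. complex_of_real (gauss v) * exp (\<i> * complex_of_real (v \<bullet> (x /\<^sub>R s)))"
  have "(\<integral>v. ?f v \<partial>lborel) = s ^ DIM('a) *\<^sub>R (\<integral>v. ?f (0 + s *\<^sub>R v) \<partial>lborel)"
    using s integral_lborel_affine[of ?f s 0] integral_gauss_iexp(1)[of "x /\<^sub>R s"] by simp
  also have "(\<integral>v. ?f (0 + s *\<^sub>R v) \<partial>lborel) =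
      (\<integral>v. complex_of_real (gauss (s *\<^sub>R v)) * exp (\<i> * complex_of_real (v \<bullet> x)) \<partial>lborel)" (is "_ = ?J")
  proof -
    have "(s *\<^sub>R v) \<bullet> (x /\<^sub>R s) = v \<bullet> x" for v using s by simp
    then show ?thesis by (simp only: add_0)
  qed
  finally have "complex_of_real (s ^ DIM('a)) * ?J = complex_of_real (sqrt (2 * pi) ^ DIM('a) * gauss (x /\<^sub>R s))"
    by (simp only: integral_gauss_iexp(2) scaleR_conv_of_real)
  moreover have "complex_of_real (s ^ DIM('a)) \<noteq> 0" using s by simp
  moreover have "J = X / y" if "y * J = X" "y \<noteq> 0" for J X y :: complex
    using that by auto
  ultimately have "?J = complex_of_real (sqrt (2 * pi) ^ DIM('a) * gauss (x /\<^sub>R s)) / complex_of_real (s ^ DIM('a))"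
    by blast
  also have "\<dots> = complex_of_real ((sqrt (2 * pi) / s) ^ DIM('a) * gauss (x /\<^sub>R s))"
    by (simp add: power_divide)
  finally show ?thesis .
qed

text \<open>The kernels to come are exponentials of modulus 1 and Gaussians; being bounded, they
  leave the product of two integrable functions integrable.\<close>

lemma fubini_bounded:
  fixes a :: "'a::euclidean_space \<Rightarrow> complex" and b :: "'b::euclidean_space \<Rightarrow> complex"
  assumes a: "integrable lborel a" and b: "integrable lborel b"
    and k[measurable]: "case_prod k \<in> borel_measurable (lborel \<Otimes>\<^sub>M lborel)"
    and bd: "\<And>x y. cmod (k x y) \<le> B"
  shows "integrable (lborel \<Otimes>\<^sub>M lborel) (\<lambda>(x, y). a x * b y * k x y)"
    and "(\<integral>x. a x * (\<integral>y. b y * k x y \<partial>lborel) \<partial>lborel) = (\<integral>y. b y * (\<integral>x. a x * k x y \<partial>lborel) \<partial>lborel)"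
proof -
  have [measurable]: "a \<in> borel_measurable borel" "b \<in> borel_measurable borel"
    using a b by auto
  have B: "0 \<le> B" using bd[of 0 0] norm_ge_zero order_trans by blast
  have int: "integrable lborel (\<lambda>y. b y * k x y)" for x
    by (rule Bochner_Integration.integrable_bound[OF integrable_mult_right[OF integrable_norm[OF b], of B]])
      (use bd B in \<open>auto simp: norm_mult abs_mult mult.commute[of B] intro!: mult_left_mono\<close>)
  show *: "integrable (lborel \<Otimes>\<^sub>M lborel) (\<lambda>(x, y). a x * b y * k x y)"
  proof (rule lborel_pair.Fubini_integrable)
    show "AE x in lborel. integrable lborel (\<lambda>y. case (x, y) of (x, y) \<Rightarrow> a x * b y * k x y)"
      using int by (auto simp: mult.assoc)
    have le: "(\<integral>y. norm (a x * b y * k x y) \<partial>lborel) \<le> norm (a x) * (B * (\<integral>y. norm (b y) \<partial>lborel))" for x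
    proof -
      have "(\<integral>y. norm (a x * b y * k x y) \<partial>lborel) = norm (a x) * (\<integral>y. norm (b y * k x y) \<partial>lborel)"
        by (simp add: norm_mult mult.assoc)
      also have "(\<integral>y. norm (b y * k x y) \<partial>lborel) \<le> (\<integral>y. B * norm (b y) \<partial>lborel)"
        by (intro integral_mono integrable_norm int integrable_mult_right b)
          (use bd in \<open>auto simp: norm_mult mult.commute[of B] intro!: mult_left_mono\<close>)
      finally show ?thesis by (simp add: mult_left_mono)
    qed
    show "integrable lborel (\<lambda>x. \<integral>y. norm (case (x, y) of (x, y) \<Rightarrow> a x * b y * k x y) \<partial>lborel)"
    proof (rule Bochner_Integration.integrable_bound)
      show "integrable lborel (\<lambda>x. norm (a x) * (B * (\<integral>y. norm (b y) \<partial>lborel)))"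
        using a by auto
      show "AE x in lborel. norm (\<integral>y. norm (case (x, y) of (x, y) \<Rightarrow> a x * b y * k x y) \<partial>lborel) \<le>
          norm (norm (a x) * (B * (\<integral>y. norm (b y) \<partial>lborel)))"
        using le B by (auto simp: abs_mult)
    qed simp
  qed simp
  have "(\<integral>x. a x * (\<integral>y. b y * k x y \<partial>lborel) \<partial>lborel) = (\<integral>x. (\<integral>y. a x * b y * k x y \<partial>lborel) \<partial>lborel)"
    by (simp add: mult.assoc)
  also have "\<dots> = (\<integral>y. (\<integral>x. a x * b y * k x y \<partial>lborel) \<partial>lborel)"
    by (rule lborel_pair.Fubini_integral[OF *, symmetric])
  also have "\<dots> = (\<integral>y. (\<integral>x. b y * (a x * k x y) \<partial>lborel) \<partial>lborel)"
    by (simp only: mult.assoc mult.left_commute)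
  finally show "(\<integral>x. a x * (\<integral>y. b y * k x y \<partial>lborel) \<partial>lborel) = (\<integral>y. b y * (\<integral>x. a x * k x y \<partial>lborel) \<partial>lborel)"
    by simp
qed

lemma borel_measurable_cnj[measurable (raw)]:
  "f \<in> borel_measurable M \<Longrightarrow> (\<lambda>x. cnj (f x)) \<in> borel_measurable M"
  by (rule measurable_compose[OF _ borel_measurable_continuous_onI]) (auto intro: continuous_intros)

text \<open>The inverse Fourier integral without its factor \<open>1 / (2 * pi) ^ DIM('a)\<close>;
  that constant reappears in Plancherel's identity and in the passage between \<open>ift\<close> and
  \<open>fourier\<close>.\<close>

definition ift :: "('a::euclidean_space \<Rightarrow> complex) \<Rightarrow> 'a \<Rightarrow> complex" where
  "ift g x = (\<integral>\<omega>. g \<omega> * exp (\<i> * complex_of_real (\<omega> \<bullet> x)) \<partial>lborel)"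

lemma ift_integrable:
  assumes "integrable lborel g"
  shows "integrable lborel (\<lambda>\<omega>. g \<omega> * exp (\<i> * complex_of_real (\<omega> \<bullet> x)))"
  by (rule Bochner_Integration.integrable_bound[OF assms]) (use assms in \<open>auto simp: norm_mult\<close>)

lemma ift_measurable[measurable]:
  assumes [measurable]: "g \<in> borel_measurable borel"
  shows "ift g \<in> borel_measurable borel"
  unfolding ift_def by measurable

lemma norm_ift_le: "integrable lborel g \<Longrightarrow> cmod (ift g x) \<le> (\<integral>\<omega>. cmod (g \<omega>) \<partial>lborel)"
  unfolding ift_def by (rule order_trans[OF integral_norm_bound]) (simp add: norm_mult)

lemma cnj_ift: "cnj (ift g x) = ift (\<lambda>\<omega>. cnj (g \<omega>)) (- x)"
proof -
  have "cnj (ift g x) = (\<integral>\<omega>. cnj (g \<omega> * exp (\<i> * complex_of_real (\<omega> \<bullet> x))) \<partial>lborel)"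
    unfolding ift_def by (rule Bochner_Integration.integral_cnj[symmetric])
  then show ?thesis by (simp add: ift_def exp_cnj)
qed

lemma fourier_eq_ift: "fourier f \<omega> = ift f (- \<omega>)"
  unfolding fourier_def ift_def by (simp add: inner_commute)

text \<open>The weight \<open>gauss (s x)\<close> makes both sides of Plancherel's identity absolutely convergent.\<close>

lemma ift_gauss_weighted:
  fixes g :: "'a::euclidean_space \<Rightarrow> complex"
  assumes g1: "integrable lborel g" and s: "s > 0"
  shows "(\<integral>x. complex_of_real (gauss (s *\<^sub>R x)) * (ift g x * cnj (ift g x)) \<partial>lborel) =
    complex_of_real (sqrt (2 * pi) ^ DIM('a)) *
      (\<integral>\<eta>. cnj (g \<eta>) * (\<integral>v. complex_of_real (gauss v) * g (\<eta> + s *\<^sub>R v) \<partial>lborel) \<partial>lborel)"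
proof -
  have [measurable]: "g \<in> borel_measurable borel" using g1 by auto
  let ?c = "\<lambda>x. complex_of_real (gauss (s *\<^sub>R x))"
  let ?e = "\<lambda>\<omega> x. exp (\<i> * complex_of_real (\<omega> \<bullet> x))"
  have c: "integrable lborel (\<lambda>x::'a. ?c x)"
    unfolding complex_of_real_integrable_eq
    using integrable_lborel_affine[OF integrable_gauss, of s 0] s by simp
  have cg: "integrable lborel (\<lambda>x. ?c x * cnj (ift g x))"
  proof (rule Bochner_Integration.integrable_bound[OF integrable_mult_left[OF integrable_norm[OF c], of "\<integral>\<omega>. cmod (g \<omega>) \<partial>lborel"]])
    show "AE x in lborel. norm (?c x * cnj (ift g x)) \<le> norm (norm (?c x) * (\<integral>\<omega>. cmod (g \<omega>) \<partial>lborel))"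
      using norm_ift_le[OF g1] by (auto simp: norm_mult abs_mult intro!: mult_left_mono)
  qed simp
  have g1': "integrable lborel (\<lambda>\<omega>. cnj (g \<omega>))" using g1 by simp
  \<comment> \<open>Integrating over \<open>x\<close> first leaves the transform of the Gaussian
    weight at the frequency difference \<open>\<omega> - \<eta>\<close>.\<close>
  have inner: "(\<integral>x. (?c x * cnj (ift g x)) * ?e \<omega> x \<partial>lborel) =
      (\<integral>\<eta>. cnj (g \<eta>) * complex_of_real ((sqrt (2 * pi) / s) ^ DIM('a) * gauss ((\<omega> - \<eta>) /\<^sub>R s)) \<partial>lborel)" for \<omega>
  proof -
    have "(\<integral>x. (?c x * cnj (ift g x)) * ?e \<omega> x \<partial>lborel) =
       (\<integral>x. ?c x * (\<integral>\<eta>. cnj (g \<eta>) * ?e (\<omega> - \<eta>) x \<partial>lborel) \<partial>lborel)"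
    proof (intro Bochner_Integration.integral_cong refl)
      fix x
      have "cnj (ift g x) * ?e \<omega> x = (\<integral>\<eta>. cnj (g \<eta>) * ?e \<eta> (- x) * ?e \<omega> x \<partial>lborel)"
        unfolding cnj_ift by (simp add: ift_def)
      also have "\<dots> = (\<integral>\<eta>. cnj (g \<eta>) * ?e (\<omega> - \<eta>) x \<partial>lborel)"
        by (intro Bochner_Integration.integral_cong refl)
          (simp add: mult.assoc inner_diff_left algebra_simps flip: exp_add)
      finally show "(?c x * cnj (ift g x)) * ?e \<omega> x = ?c x * (\<integral>\<eta>. cnj (g \<eta>) * ?e (\<omega> - \<eta>) x \<partial>lborel)"
        by (simp add: mult.assoc)
    qed
    also have "\<dots> = (\<integral>\<eta>. cnj (g \<eta>) * (\<integral>x. ?c x * ?e (\<omega> - \<eta>) x \<partial>lborel) \<partial>lborel)"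
      by (rule fubini_bounded(2)[OF c g1', where B=1]) auto
    also have "(\<lambda>\<eta>. \<integral>x. ?c x * ?e (\<omega> - \<eta>) x \<partial>lborel) =
        (\<lambda>\<eta>. complex_of_real ((sqrt (2 * pi) / s) ^ DIM('a) * gauss ((\<omega> - \<eta>) /\<^sub>R s)))"
      by (rule ext, subst integral_gauss_scaled_iexp[OF s, symmetric]) (simp only: inner_commute)
    finally show ?thesis .
  qed
  have "(\<integral>x. ?c x * (ift g x * cnj (ift g x)) \<partial>lborel) =
     (\<integral>x. (?c x * cnj (ift g x)) * (\<integral>\<omega>. g \<omega> * ?e \<omega> x \<partial>lborel) \<partial>lborel)"
    unfolding ift_def[of g] by (simp only: mult_ac)
  also have "\<dots> = (\<integral>\<omega>. g \<omega> * (\<integral>x. (?c x * cnj (ift g x)) * ?e \<omega> x \<partial>lborel) \<partial>lborel)"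
    by (rule fubini_bounded(2)[OF cg g1, where B=1]) auto
  also have "\<dots> = (\<integral>\<omega>. g \<omega> * (\<integral>\<eta>. cnj (g \<eta>) * complex_of_real ((sqrt (2 * pi) / s) ^ DIM('a) * gauss ((\<omega> - \<eta>) /\<^sub>R s)) \<partial>lborel) \<partial>lborel)"
    by (simp only: inner)
  also have "\<dots> = (\<integral>\<eta>. cnj (g \<eta>) * (\<integral>\<omega>. g \<omega> * complex_of_real ((sqrt (2 * pi) / s) ^ DIM('a) * gauss ((\<omega> - \<eta>) /\<^sub>R s)) \<partial>lborel) \<partial>lborel)"
  proof (rule fubini_bounded(2)[OF g1 g1', where B="(sqrt (2 * pi) / s) ^ DIM('a)"])
    show "cmod (complex_of_real ((sqrt (2 * pi) / s) ^ DIM('a) * gauss ((x - y) /\<^sub>R s))) \<le> (sqrt (2 * pi) / s) ^ DIM('a)" for x y :: 'a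
    proof -
      have "gauss ((x - y) /\<^sub>R s) \<le> 1" by (rule gauss_le_1)
      moreover have "0 \<le> gauss ((x - y) /\<^sub>R s)" using gauss_pos less_imp_le by blast
      moreover have "0 \<le> (sqrt (2 * pi) / s) ^ DIM('a)" using s by simp
      ultimately show ?thesis unfolding norm_of_real
        by (simp only: abs_mult abs_of_nonneg mult_left_le)
    qed
  qed measurable
  \<comment> \<open>Substitution of \<open>\<eta> + s *\<^sub>R v\<close> for
    \<open>\<omega>\<close>: the Jacobian cancels the power of \<open>1 / s\<close>, and the
    concentration of the Gaussian turns into small translations of \<open>g\<close>.\<close>
  also have "\<dots> = (\<integral>\<eta>. cnj (g \<eta>) * (complex_of_real (sqrt (2 * pi) ^ DIM('a)) * (\<integral>v. complex_of_real (gauss v) * g (\<eta> + s *\<^sub>R v) \<partial>lborel)) \<partial>lborel)"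
  proof (intro Bochner_Integration.integral_cong refl arg_cong2[where f="(*)"])
    fix \<eta>
    have int: "integrable lborel (\<lambda>\<omega>. g \<omega> * complex_of_real ((sqrt (2 * pi) / s) ^ DIM('a) * gauss ((\<omega> - \<eta>) /\<^sub>R s)))"
    proof (rule Bochner_Integration.integrable_bound[OF integrable_mult_right[OF integrable_norm[OF g1], of "(sqrt (2 * pi) / s) ^ DIM('a)"]])
      have "cmod (g \<omega>) * ((sqrt (2 * pi) / s) ^ DIM('a) * gauss ((\<omega> - \<eta>) /\<^sub>R s)) \<le> (sqrt (2 * pi) / s) ^ DIM('a) * cmod (g \<omega>)" for \<omega>
      proof -
        have "cmod (g \<omega>) * ((sqrt (2 * pi) / s) ^ DIM('a) * gauss ((\<omega> - \<eta>) /\<^sub>R s)) \<le> cmod (g \<omega>) * ((sqrt (2 * pi) / s) ^ DIM('a) * 1)"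
          using s by (intro mult_left_mono gauss_le_1) auto
        then show ?thesis by (simp add: mult.commute)
      qed
      then show "AE \<omega> in lborel. norm (g \<omega> * complex_of_real ((sqrt (2 * pi) / s) ^ DIM('a) * gauss ((\<omega> - \<eta>) /\<^sub>R s))) \<le> norm ((sqrt (2 * pi) / s) ^ DIM('a) * norm (g \<omega>))"
        unfolding norm_mult norm_of_real using s by (intro AE_I2) (simp add: abs_mult abs_of_nonneg[OF less_imp_le[OF gauss_pos]])
    qed measurable
    show "(\<integral>\<omega>. g \<omega> * complex_of_real ((sqrt (2 * pi) / s) ^ DIM('a) * gauss ((\<omega> - \<eta>) /\<^sub>R s)) \<partial>lborel) =
      complex_of_real (sqrt (2 * pi) ^ DIM('a)) * (\<integral>v. complex_of_real (gauss v) * g (\<eta> + s *\<^sub>R v) \<partial>lborel)"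
    proof -
      have "(\<integral>\<omega>. g \<omega> * complex_of_real ((sqrt (2 * pi) / s) ^ DIM('a) * gauss ((\<omega> - \<eta>) /\<^sub>R s)) \<partial>lborel) =
         s ^ DIM('a) *\<^sub>R (\<integral>v. g (\<eta> + s *\<^sub>R v) * complex_of_real ((sqrt (2 * pi) / s) ^ DIM('a) * gauss v) \<partial>lborel)"
      proof -
        have "(\<eta> + s *\<^sub>R v - \<eta>) /\<^sub>R s = v" for v using s by simp
        then show ?thesis
          using integral_lborel_affine[OF int less_imp_neq[OF s, symmetric], of \<eta>] by (simp only: abs_of_pos[OF s])
      qed
      also have "(\<integral>v. g (\<eta> + s *\<^sub>R v) * complex_of_real ((sqrt (2 * pi) / s) ^ DIM('a) * gauss v) \<partial>lborel) =
         complex_of_real ((sqrt (2 * pi) / s) ^ DIM('a)) * (\<integral>v. complex_of_real (gauss v) * g (\<eta> + s *\<^sub>R v) \<partial>lborel)"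
      proof -
        have "g (\<eta> + s *\<^sub>R v) * complex_of_real ((sqrt (2 * pi) / s) ^ DIM('a) * gauss v) =
          complex_of_real ((sqrt (2 * pi) / s) ^ DIM('a)) * (complex_of_real (gauss v) * g (\<eta> + s *\<^sub>R v))" for v
          unfolding of_real_mult by (simp only: mult_ac)
        then show ?thesis by (simp only: integral_mult_right_zero)
      qed
      finally have "(\<integral>\<omega>. g \<omega> * complex_of_real ((sqrt (2 * pi) / s) ^ DIM('a) * gauss ((\<omega> - \<eta>) /\<^sub>R s)) \<partial>lborel) =
          complex_of_real (s ^ DIM('a) * (sqrt (2 * pi) / s) ^ DIM('a)) * (\<integral>v. complex_of_real (gauss v) * g (\<eta> + s *\<^sub>R v) \<partial>lborel)"
        by (simp only: scaleR_conv_of_real of_real_mult mult.assoc)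
      moreover have "s ^ DIM('a) * (sqrt (2 * pi) / s) ^ DIM('a) = sqrt (2 * pi) ^ DIM('a)"
        using s by (simp add: power_divide)
      ultimately show ?thesis by (simp only:)
    qed
  qed
  also have "\<dots> = complex_of_real (sqrt (2 * pi) ^ DIM('a)) *
      (\<integral>\<eta>. cnj (g \<eta>) * (\<integral>v. complex_of_real (gauss v) * g (\<eta> + s *\<^sub>R v) \<partial>lborel) \<partial>lborel)"
  proof -
    have "cnj (g \<eta>) * (complex_of_real (sqrt (2 * pi) ^ DIM('a)) * J) = complex_of_real (sqrt (2 * pi) ^ DIM('a)) * (cnj (g \<eta>) * J)" for \<eta> J
      by (rule mult.left_commute)
    then show ?thesis by (simp only: integral_mult_right_zero)
  qed
  finally show ?thesis .
qed

text \<open>The autocorrelation of \<open>g\<close> is bounded by its value at the origin and continuous there.\<close>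

lemma Plancherel:
  fixes g :: "'a::euclidean_space \<Rightarrow> complex"
  assumes g1: "integrable lborel g" and g2: "g \<in> L2"
  shows "nsq (ift g) = ennreal ((2 * pi) ^ DIM('a)) * nsq g"
proof -
  have gm[measurable]: "g \<in> borel_measurable borel" using g1 by auto
  let ?E = "\<integral>x. (cmod (g x))\<^sup>2 \<partial>lborel"
  define c where "c = sqrt (2 * pi) ^ DIM('a)"
  have c: "c > 0" by (simp add: c_def)
  have c2: "c * c = (2 * pi) ^ DIM('a)" 
  proof -
    have "c * c = (sqrt (2 * pi) * sqrt (2 * pi)) ^ DIM('a)" by (simp only: c_def power_mult_distrib)
    then show ?thesis by simp
  qed
  define A where "A u = (\<integral>\<eta>. cnj (g \<eta>) * g (\<eta> + u) \<partial>lborel)" for u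
  have sq: "integrable lborel (\<lambda>x. (cmod (g (x + u)))\<^sup>2)" for u
    using L2_integrable[OF L2_translate[OF g2]] .
  have E: "(\<integral>x. (cmod (g (x + u)))\<^sup>2 \<partial>lborel) = ?E" for u
    using integral_lborel_affine[OF L2_integrable[OF g2], of 1 u] by (simp add: add.commute)
  have A_bound: "cmod (A u) \<le> ?E" for u
  proof -
    have "(cmod (A u))\<^sup>2 \<le> ?E * ?E"
      unfolding A_def using norm_integral_mult_le(2)[of "\<lambda>\<eta>. cnj (g \<eta>)" lborel "\<lambda>\<eta>. g (\<eta> + u)"] sq[of u] L2_integrable[OF g2]
      by (simp add: E)
    then have "(cmod (A u))\<^sup>2 \<le> ?E\<^sup>2" by (simp add: power2_eq_square)
    then show ?thesis by (rule power2_le_imp_le) simp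
  qed
  have A0: "A 0 = complex_of_real ?E"
  proof -
    have "cnj z * z = complex_of_real ((cmod z)\<^sup>2)" for z by (simp only: complex_norm_square mult.commute[of "cnj z"])
    then show ?thesis unfolding A_def by (simp only: add_0_right integral_complex_of_real)
  qed
  \<comment> \<open>By Cauchy-Schwarz the autocorrelation inherits the continuity of translations in
    L2.\<close>
  have A_cont: "(\<lambda>n. A (X n)) \<longlonglongrightarrow> A 0" if X: "X \<longlonglongrightarrow> 0" for X
  proof -
    have le: "(cmod (A u - A 0))\<^sup>2 \<le> ?E * enn2real (nsq (\<lambda>x. g (x + u) - g x))" for u
    proof -
      let ?d = "\<lambda>x. g (x + u) - g x"
      have d: "?d \<in> L2" by (intro L2_diff L2_translate g2)
      have "A u - A 0 = (\<integral>\<eta>. cnj (g \<eta>) * g (\<eta> + u) - cnj (g \<eta>) * g (\<eta> + 0) \<partial>lborel)"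
        unfolding A_def
        by (rule Bochner_Integration.integral_diff[symmetric]; rule norm_integral_mult_le(1))
          (use sq L2_integrable[OF g2] in auto)
      also have "\<dots> = (\<integral>\<eta>. cnj (g \<eta>) * ?d \<eta> \<partial>lborel)" by (simp add: right_diff_distrib)
      finally have "(cmod (A u - A 0))\<^sup>2 \<le> ?E * (\<integral>x. (cmod (?d x))\<^sup>2 \<partial>lborel)"
        using norm_integral_mult_le(2)[of "\<lambda>\<eta>. cnj (g \<eta>)" lborel ?d] L2_integrable[OF d] L2_integrable[OF g2] by simp
      then show ?thesis using nsq_eq_integral[OF d] by simp
    qed
    have "(\<lambda>n. nsq (\<lambda>x. g (x + X n) - g x)) \<longlonglongrightarrow> 0"
      using L2_cont_L2[OF g2] X by (simp add: L2_cont_def)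
    then have "(\<lambda>n. enn2real (nsq (\<lambda>x. g (x + X n) - g x))) \<longlonglongrightarrow> enn2real 0"
      by (intro tendsto_enn2real) auto
    then have "(\<lambda>n. ?E * enn2real (nsq (\<lambda>x. g (x + X n) - g x))) \<longlonglongrightarrow> ?E * 0"
      by (intro tendsto_mult tendsto_const) simp
    then have L: "(\<lambda>n. ?E * enn2real (nsq (\<lambda>x. g (x + X n) - g x))) \<longlonglongrightarrow> 0" by simp
    have "(\<lambda>n. (cmod (A (X n) - A 0))\<^sup>2) \<longlonglongrightarrow> 0"
      by (rule tendsto_sandwich[OF _ _ tendsto_const L]; intro always_eventually allI) (simp_all only: zero_le_power2 le)
    then have "(\<lambda>n. sqrt ((cmod (A (X n) - A 0))\<^sup>2)) \<longlonglongrightarrow> sqrt 0"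
      by (rule tendsto_real_sqrt)
    then have "(\<lambda>n. A (X n) - A 0) \<longlonglongrightarrow> 0" by (simp add: tendsto_norm_zero_iff)
    then show ?thesis by (rule LIM_zero_cancel)
  qed
  define s where "s n = 1 / real (Suc n)" for n
  have s: "s n > 0" for n by (simp add: s_def)
  have s0: "s \<longlonglongrightarrow> 0" unfolding s_def by (rule LIMSEQ_Suc[OF lim_1_over_n])
  have weighted: "(\<integral>x. gauss (s n *\<^sub>R x) * (cmod (ift g x))\<^sup>2 \<partial>lborel) = 
      c * Re (\<integral>v. complex_of_real (gauss v) * A (s n *\<^sub>R v) \<partial>lborel)" for n
  proof -
    have int: "integrable (lborel \<Otimes>\<^sub>M lborel) (\<lambda>(v, \<eta>). complex_of_real (gauss v) * (cnj (g \<eta>) * g (\<eta> + s n *\<^sub>R v)))"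
    proof (rule lborel_pair.Fubini_integrable)
      have i: "integrable lborel (\<lambda>\<eta>. cnj (g \<eta>) * g (\<eta> + s n *\<^sub>R v))" for v
        by (rule norm_integral_mult_le(1)) (use sq L2_integrable[OF g2] in auto)
      then show "AE v in lborel. integrable lborel (\<lambda>\<eta>. case (v, \<eta>) of (v, \<eta>) \<Rightarrow> complex_of_real (gauss v) * (cnj (g \<eta>) * g (\<eta> + s n *\<^sub>R v)))"
        by auto
      have le: "(\<integral>\<eta>. norm (cnj (g \<eta>) * g (\<eta> + s n *\<^sub>R v)) \<partial>lborel) \<le> ?E" for v
      proof -
        have "(\<integral>\<eta>. cmod (g \<eta>) * cmod (g (\<eta> + s n *\<^sub>R v)) \<partial>lborel)\<^sup>2 \<le> ?E * ?E"
          using Cauchy_Schwarz_integral[of "\<lambda>\<eta>. cmod (g \<eta>)" lborel "\<lambda>\<eta>. cmod (g (\<eta> + s n *\<^sub>R v))"] sq L2_integrable[OF g2] 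
          by (simp add: E)
        then have "(\<integral>\<eta>. cmod (g \<eta>) * cmod (g (\<eta> + s n *\<^sub>R v)) \<partial>lborel)\<^sup>2 \<le> ?E\<^sup>2" by (simp add: power2_eq_square)
        then show ?thesis unfolding norm_mult complex_mod_cnj by (rule power2_le_imp_le) simp
      qed
      have eq: "(\<integral>\<eta>. norm (complex_of_real (gauss v) * (cnj (g \<eta>) * g (\<eta> + s n *\<^sub>R v))) \<partial>lborel) = 
          gauss v * (\<integral>\<eta>. norm (cnj (g \<eta>) * g (\<eta> + s n *\<^sub>R v)) \<partial>lborel)" for v
        unfolding norm_mult[of "complex_of_real (gauss v)"] norm_of_real abs_of_pos[OF gauss_pos] by (rule integral_mult_right_zero)
      show "integrable lborel (\<lambda>v. \<integral>\<eta>. norm (case (v, \<eta>) of (v, \<eta>) \<Rightarrow> complex_of_real (gauss v) * (cnj (g \<eta>) * g (\<eta> + s n *\<^sub>R v))) \<partial>lborel)"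
      proof (rule Bochner_Integration.integrable_bound[OF integrable_mult_left[OF integrable_gauss, of ?E]])
        show "AE v in lborel. norm (\<integral>\<eta>. norm (case (v, \<eta>) of (v, \<eta>) \<Rightarrow> complex_of_real (gauss v) * (cnj (g \<eta>) * g (\<eta> + s n *\<^sub>R v))) \<partial>lborel)
            \<le> norm (gauss v * ?E)"
          unfolding prod.case eq real_norm_def abs_mult abs_of_pos[OF gauss_pos]
          using le by (intro AE_I2 mult_left_mono less_imp_le[OF gauss_pos]) (simp add: abs_of_nonneg)
      qed measurable
    qed measurable
    have "complex_of_real (\<integral>x. gauss (s n *\<^sub>R x) * (cmod (ift g x))\<^sup>2 \<partial>lborel) =
      (\<integral>x. complex_of_real (gauss (s n *\<^sub>R x)) * (ift g x * cnj (ift g x)) \<partial>lborel)"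
      by (simp only: complex_norm_square[symmetric] of_real_mult[symmetric] integral_complex_of_real)
    also have "\<dots> = complex_of_real c * (\<integral>\<eta>. cnj (g \<eta>) * (\<integral>v. complex_of_real (gauss v) * g (\<eta> + s n *\<^sub>R v) \<partial>lborel) \<partial>lborel)"
      unfolding c_def by (rule ift_gauss_weighted[OF g1 s])
    also have "(\<integral>\<eta>. cnj (g \<eta>) * (\<integral>v. complex_of_real (gauss v) * g (\<eta> + s n *\<^sub>R v) \<partial>lborel) \<partial>lborel) =
       (\<integral>\<eta>. (\<integral>v. complex_of_real (gauss v) * (cnj (g \<eta>) * g (\<eta> + s n *\<^sub>R v)) \<partial>lborel) \<partial>lborel)"
      by (subst mult.left_commute[of "complex_of_real _"], subst integral_mult_right_zero) (rule refl)
    also have "\<dots> = (\<integral>v. (\<integral>\<eta>. complex_of_real (gauss v) * (cnj (g \<eta>) * g (\<eta> + s n *\<^sub>R v)) \<partial>lborel) \<partial>lborel)"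
      by (rule lborel_pair.Fubini_integral[OF int])
    also have "\<dots> = (\<integral>v. complex_of_real (gauss v) * A (s n *\<^sub>R v) \<partial>lborel)"
      unfolding A_def by (simp only: integral_mult_right_zero)
    finally have "Re (complex_of_real (\<integral>x. gauss (s n *\<^sub>R x) * (cmod (ift g x))\<^sup>2 \<partial>lborel)) =
        Re (complex_of_real c * (\<integral>v. complex_of_real (gauss v) * A (s n *\<^sub>R v) \<partial>lborel))"
      by (rule arg_cong)
    then show ?thesis by (simp only: Re_complex_of_real times_complex.sel Im_complex_of_real mult_zero_left diff_zero)
  qed
  have Am[measurable]: "A \<in> borel_measurable borel"
    unfolding A_def by measurable
  \<comment> \<open>On the frequency side dominated convergence applies, with the bound
    \<open>?E\<close> of the autocorrelation times the Gaussian.\<close>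
  have "(\<lambda>n. \<integral>v. complex_of_real (gauss v) * A (s n *\<^sub>R v) \<partial>lborel) \<longlonglongrightarrow> (\<integral>v. complex_of_real (gauss v) * A 0 \<partial>(lborel :: 'a measure))"
  proof (rule integral_dominated_convergence[where w="\<lambda>v. gauss v * ?E"])
    show "integrable lborel (\<lambda>v::'a. gauss v * ?E)" using integrable_gauss[where 'a='a] by simp
    show "AE v in lborel. norm (complex_of_real (gauss v) * A (s n *\<^sub>R v)) \<le> gauss v * ?E" for n
      unfolding norm_mult norm_of_real abs_of_pos[OF gauss_pos]
      by (intro AE_I2 mult_left_mono A_bound less_imp_le[OF gauss_pos])
    have sv: "(\<lambda>n. s n *\<^sub>R v) \<longlonglongrightarrow> 0" for v :: 'a
      using tendsto_scaleR[OF s0 tendsto_const, of v] by simp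
    show "AE v in lborel. (\<lambda>n. complex_of_real (gauss v) * A (s n *\<^sub>R v)) \<longlonglongrightarrow> complex_of_real (gauss v) * A 0"
      by (intro AE_I2 tendsto_mult tendsto_const A_cont sv)
  qed measurable
  also have "(\<integral>v. complex_of_real (gauss v) * A 0 \<partial>(lborel :: 'a measure)) = complex_of_real ?E"
    using integral_gauss[where 'a='a] by (simp only: integral_mult_left_zero integral_complex_of_real of_real_1 A0 mult_1_left)
  finally have "(\<lambda>n. c * Re (\<integral>v. complex_of_real (gauss v) * A (s n *\<^sub>R v) \<partial>lborel)) \<longlonglongrightarrow> c * Re (complex_of_real ?E)"
    by (intro tendsto_mult tendsto_const tendsto_Re)
  then have lim1: "(\<lambda>n. ennreal (\<integral>x. gauss (s n *\<^sub>R x) * (cmod (ift g x))\<^sup>2 \<partial>lborel)) \<longlonglongrightarrow> ennreal (c * ?E)"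
    unfolding weighted by (intro tendsto_ennrealI) simp
  define B where "B = (\<integral>\<omega>. cmod (g \<omega>) \<partial>lborel)"
  have conv: "ennreal (\<integral>x. gauss (s n *\<^sub>R x) * (cmod (ift g x))\<^sup>2 \<partial>lborel) = (\<integral>\<^sup>+x. ennreal (gauss (s n *\<^sub>R x) * (cmod (ift g x))\<^sup>2) \<partial>lborel)" for n
  proof (rule nn_integral_eq_integral[symmetric])
    have "integrable lborel (\<lambda>x::'a. gauss (s n *\<^sub>R x))"
      using integrable_lborel_affine[OF integrable_gauss, of "s n" 0] s[of n] by simp
    then show "integrable lborel (\<lambda>x. gauss (s n *\<^sub>R x) * (cmod (ift g x))\<^sup>2)"
    proof (rule Bochner_Integration.integrable_bound[OF integrable_mult_left[where c="B\<^sup>2"]])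
      show "AE x in lborel. norm (gauss (s n *\<^sub>R x) * (cmod (ift g x))\<^sup>2) \<le> norm (gauss (s n *\<^sub>R x) * B\<^sup>2)"
        using norm_ift_le[OF g1, folded B_def] by (intro AE_I2) (auto simp: abs_mult intro!: mult_left_mono power_mono)
    qed measurable
    show "AE x in lborel. 0 \<le> gauss (s n *\<^sub>R x) * (cmod (ift g x))\<^sup>2"
      by (intro AE_I2 mult_nonneg_nonneg less_imp_le[OF gauss_pos]) simp
  qed
  \<comment> \<open>On the space side the weights increase as \<open>s n\<close> decreases, so
    monotone convergence applies without knowing that \<open>ift g\<close> is
    square-integrable.\<close>
  have "(\<lambda>n. \<integral>\<^sup>+x. ennreal (gauss (s n *\<^sub>R x) * (cmod (ift g x))\<^sup>2) \<partial>lborel) \<longlonglongrightarrow> (\<integral>\<^sup>+x. ennreal (gauss (0::'a) * (cmod (ift g x))\<^sup>2) \<partial>lborel)"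
  proof (rule nn_integral_LIMSEQ)
    have "gauss (s m *\<^sub>R x) \<le> gauss (s n *\<^sub>R x)" if "m \<le> n" for m n and x :: 'a
    proof -
      have "s n \<le> s m" using that by (simp add: s_def frac_le)
      then have "norm (s n *\<^sub>R x) \<le> norm (s m *\<^sub>R x)" using s[of n] s[of m] by (simp add: mult_right_mono)
      then show ?thesis unfolding gauss_def by (intro divide_right_mono) (auto intro: power_mono)
    qed
    then show "incseq (\<lambda>n x. ennreal (gauss (s n *\<^sub>R x) * (cmod (ift g x))\<^sup>2))"
      by (auto simp: incseq_def le_fun_def intro!: ennreal_leI mult_right_mono)
    fix x :: 'a
    have "(\<lambda>n. s n *\<^sub>R x) \<longlonglongrightarrow> 0"
      using tendsto_scaleR[OF s0 tendsto_const, of x] by simp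
    then have "(\<lambda>n. gauss (s n *\<^sub>R x)) \<longlonglongrightarrow> gauss (0::'a)"
      unfolding gauss_def by (intro tendsto_intros) auto
    then show "(\<lambda>n. ennreal (gauss (s n *\<^sub>R x) * (cmod (ift g x))\<^sup>2)) \<longlonglongrightarrow> ennreal (gauss (0::'a) * (cmod (ift g x))\<^sup>2)"
      by (intro tendsto_intros)
  qed measurable
  then have "(\<integral>\<^sup>+x. ennreal (gauss (0::'a) * (cmod (ift g x))\<^sup>2) \<partial>lborel) = ennreal (c * ?E)"
    using lim1 unfolding conv by (rule LIMSEQ_unique)
  \<comment> \<open>The weights tend to \<open>gauss 0 = 1 / c\<close> and not to 1; removing this
    supplies the second factor of \<open>c * c = (2 * pi) ^ DIM('a)\<close>.\<close>
  then have *: "ennreal (1 / c) * nsq (ift g) = ennreal (c * ?E)"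
  proof -
    have g0: "gauss (0::'a) = 1 / c" by (simp add: gauss_def c_def)
    have "ennreal (1 / c) * nsq (ift g) = (\<integral>\<^sup>+x. ennreal (1 / c) * ennreal ((cmod (ift g x))\<^sup>2) \<partial>lborel)"
      unfolding nsq_def by (rule nn_integral_cmult[symmetric]) measurable
    also have "\<dots> = (\<integral>\<^sup>+x. ennreal (gauss (0::'a) * (cmod (ift g x))\<^sup>2) \<partial>lborel)"
      by (intro nn_integral_cong) (simp only: g0 ennreal_mult'' zero_le_power2)
    finally show ?thesis using \<open>_ = ennreal (c * ?E)\<close> by (simp only:)
  qed
  have "nsq (ift g) = ennreal c * (ennreal (1 / c) * nsq (ift g))"
    using c by (simp add: mult.assoc[symmetric] flip: ennreal_mult)
  also have "\<dots> = ennreal ((2 * pi) ^ DIM('a)) * ennreal ?E"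
    unfolding * c2[symmetric] using c by (simp only: ennreal_mult' less_imp_le mult.assoc)
  finally show ?thesis using nsq_eq_integral[OF g2] by simp
qed

section \<open>Polarisation and inversion\<close>

lemma L2_inner_integrable:
  assumes "u \<in> L2" "v \<in> L2"
  shows "integrable lborel (\<lambda>x. u x * cnj (v x))"
  by (rule norm_integral_mult_le(1)) (use assms in \<open>auto simp: L2_def\<close>)

lemma cmod_add_sq: "(cmod (a + b))\<^sup>2 = (cmod a)\<^sup>2 + (cmod b)\<^sup>2 + 2 * Re (a * cnj b)"
  unfolding cmod_power2 by (simp add: power2_eq_square algebra_simps)

lemma L2_norm_add_sq:
  assumes u: "u \<in> L2" and v: "v \<in> L2"
  shows "(L2_norm (\<lambda>x. u x + v x))\<^sup>2 = (L2_norm u)\<^sup>2 + (L2_norm v)\<^sup>2 + 2 * Re (\<integral>x. u x * cnj (v x) \<partial>lborel)"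
proof -
  have i: "integrable lborel (\<lambda>x. Re (u x * cnj (v x)))"
    using L2_inner_integrable[OF u v] by (rule integrable_Re)
  show ?thesis
    unfolding L2_norm_sq cmod_add_sq using i L2_integrable[OF u] L2_integrable[OF v]
    by (simp only: Bochner_Integration.integral_add Bochner_Integration.integrable_add
        integral_mult_right_zero integrable_mult_right integral_Re[OF L2_inner_integrable[OF u v]])
qed

lemma ift_L2:
  assumes "integrable lborel g" "g \<in> L2"
  shows "ift g \<in> L2"
proof -
  have "ift g \<in> borel_measurable borel" using assms by (intro ift_measurable) (simp add: L2_measurable)
  moreover have "nsq (ift g) < \<infinity>" 
    using assms by (simp only: Plancherel) (simp add: L2_iff_nsq ennreal_mult_less_top)
  ultimately show ?thesis by (simp add: L2_iff_nsq)
qed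

lemma L2_norm_ift:
  fixes g :: "'a::euclidean_space \<Rightarrow> complex"
  assumes "integrable lborel g" "g \<in> L2"
  shows "(L2_norm (ift g))\<^sup>2 = (2 * pi) ^ DIM('a) * (L2_norm g)\<^sup>2"
proof -
  have "ennreal ((L2_norm (ift g))\<^sup>2) = ennreal ((2 * pi) ^ DIM('a)) * ennreal ((L2_norm g)\<^sup>2)"
    using Plancherel[OF assms] by (simp only: nsq_eq[OF ift_L2[OF assms]] nsq_eq[OF assms(2)])
  also have "\<dots> = ennreal ((2 * pi) ^ DIM('a) * (L2_norm g)\<^sup>2)"
    by (simp only: ennreal_mult'' zero_le_power2)
  finally show ?thesis by (subst (asm) ennreal_inj) auto
qed

lemma ift_add:
  "integrable lborel g \<Longrightarrow> integrable lborel h \<Longrightarrow> ift (\<lambda>\<omega>. g \<omega> + h \<omega>) x = ift g x + ift h x"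
  unfolding ift_def distrib_right
  by (rule Bochner_Integration.integral_add) (auto intro: ift_integrable)

lemma ift_cmult: "ift (\<lambda>\<omega>. c * g \<omega>) x = c * ift g x"
  unfolding ift_def mult.assoc by (rule integral_mult_right_zero)

lemma ift_sum:
  "finite S \<Longrightarrow> (\<And>i. i \<in> S \<Longrightarrow> integrable lborel (g i)) \<Longrightarrow>
    ift (\<lambda>\<omega>. \<Sum>i\<in>S. g i \<omega>) x = (\<Sum>i\<in>S. ift (g i) x)"
  unfolding ift_def sum_distrib_right
  by (rule Bochner_Integration.integral_sum) (auto intro: ift_integrable)

lemma Plancherel_inner_Re:
  fixes g h :: "'a::euclidean_space \<Rightarrow> complex"
  assumes g: "integrable lborel g" "g \<in> L2" and h: "integrable lborel h" "h \<in> L2"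
  shows "Re (\<integral>x. ift g x * cnj (ift h x) \<partial>lborel) = (2 * pi) ^ DIM('a) * Re (\<integral>\<omega>. g \<omega> * cnj (h \<omega>) \<partial>lborel)"
proof -
  have "(L2_norm (\<lambda>x. ift g x + ift h x))\<^sup>2 = (L2_norm (ift (\<lambda>\<omega>. g \<omega> + h \<omega>)))\<^sup>2"
    using ift_add[OF g(1) h(1)] by presburger
  also have "\<dots> = (2 * pi) ^ DIM('a) * (L2_norm (\<lambda>\<omega>. g \<omega> + h \<omega>))\<^sup>2"
    by (rule L2_norm_ift) (use g h in \<open>auto intro: L2_add\<close>)
  finally show ?thesis
    unfolding L2_norm_add_sq[OF ift_L2[OF g] ift_L2[OF h]] L2_norm_add_sq[OF g(2) h(2)] L2_norm_ift[OF g] L2_norm_ift[OF h]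
    by (simp add: distrib_left)
qed

text \<open>Polarisation of the norm identity yields the real part; the imaginary part is the real
  part for \<open>\<i> * h\<close> in place of \<open>h\<close>.\<close>

lemma Plancherel_inner:
  fixes g h :: "'a::euclidean_space \<Rightarrow> complex"
  assumes g: "integrable lborel g" "g \<in> L2" and h: "integrable lborel h" "h \<in> L2"
  shows "(\<integral>x. ift g x * cnj (ift h x) \<partial>lborel) = complex_of_real ((2 * pi) ^ DIM('a)) * (\<integral>\<omega>. g \<omega> * cnj (h \<omega>) \<partial>lborel)"
proof (rule complex_eqI)
  let ?K = "(2 * pi) ^ DIM('a)"
  have K: "Re (complex_of_real ?K * z) = ?K * Re z" "Im (complex_of_real ?K * z) = ?K * Im z" for z
    by (simp_all only: times_complex.sel Re_complex_of_real Im_complex_of_real mult_zero_left diff_zero add_0_right)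
  show "Re (\<integral>x. ift g x * cnj (ift h x) \<partial>lborel) = Re (complex_of_real ?K * (\<integral>\<omega>. g \<omega> * cnj (h \<omega>) \<partial>lborel))"
    unfolding K by (rule Plancherel_inner_Re[OF g h])
  have i: "a * cnj (\<i> * b) = - \<i> * (a * cnj b)" for a b by simp
  have "Re (\<integral>x. ift g x * cnj (ift (\<lambda>\<omega>. \<i> * h \<omega>) x) \<partial>lborel) = ?K * Re (\<integral>\<omega>. g \<omega> * cnj (\<i> * h \<omega>) \<partial>lborel)"
    by (rule Plancherel_inner_Re[OF g]) (use h in \<open>auto intro: L2_cmult\<close>)
  then have "Re (- \<i> * (\<integral>x. ift g x * cnj (ift h x) \<partial>lborel)) = ?K * Re (- \<i> * (\<integral>\<omega>. g \<omega> * cnj (h \<omega>) \<partial>lborel))"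
    unfolding ift_cmult i integral_mult_right_zero .
  then show "Im (\<integral>x. ift g x * cnj (ift h x) \<partial>lborel) = Im (complex_of_real ?K * (\<integral>\<omega>. g \<omega> * cnj (h \<omega>) \<partial>lborel))"
    unfolding K by simp
qed

lemma nsq_uminus:
  assumes "f \<in> borel_measurable borel"
  shows "nsq (\<lambda>x. f (- x)) = nsq f"
  unfolding nsq_def using assms
  by (subst (2) nn_integral_lborel_affine[where c="-1" and t=0]) auto

lemma fourier_L2:
  fixes F :: "'a::euclidean_space \<Rightarrow> complex"
  assumes F: "integrable lborel F" "F \<in> L2"
  shows "fourier F \<in> L2" and "(L2_norm (fourier F))\<^sup>2 = (2 * pi) ^ DIM('a) * (L2_norm F)\<^sup>2"
proof -
  have eq: "fourier F = (\<lambda>x. ift F (- x))" by (rule ext) (rule fourier_eq_ift)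
  have m: "ift F \<in> borel_measurable borel" using ift_L2[OF F] by (rule L2_measurable)
  then have n: "nsq (fourier F) = nsq (ift F)" unfolding eq by (rule nsq_uminus)
  have "fourier F \<in> borel_measurable borel" unfolding eq using m by measurable
  then show L: "fourier F \<in> L2" using ift_L2[OF F] n by (simp add: L2_iff_nsq)
  have "(L2_norm (fourier F))\<^sup>2 = (L2_norm (ift F))\<^sup>2"
    using n unfolding nsq_eq[OF L] nsq_eq[OF ift_L2[OF F]] by (subst (asm) ennreal_inj) auto
  then show "(L2_norm (fourier F))\<^sup>2 = (2 * pi) ^ DIM('a) * (L2_norm F)\<^sup>2"
    by (simp only: L2_norm_ift[OF F])
qed

text \<open>The inversion formula in \<open>L2\<close> is hidden in this identity: both norms are expanded, the squares
  are matched by Plancherel and the mixed terms by Fubini.\<close>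

lemma L2_norm_diff_inverse:
  fixes F g :: "'a::euclidean_space \<Rightarrow> complex"
  assumes F: "integrable lborel F" "F \<in> L2" and g: "integrable lborel g" "g \<in> L2"
  defines "K \<equiv> (2 * pi) ^ DIM('a)"
  shows "(L2_norm (\<lambda>\<omega>. fourier F \<omega> - complex_of_real K * g \<omega>))\<^sup>2 = K * (L2_norm (\<lambda>x. F x - ift g x))\<^sup>2"
proof -
  have K: "K > 0" by (simp add: K_def)
  note fL = fourier_L2[OF F, folded K_def] and iL = ift_L2[OF g] and iN = L2_norm_ift[OF g, folded K_def]
  have norm_c: "(L2_norm (\<lambda>x. c * u x))\<^sup>2 = (cmod c)\<^sup>2 * (L2_norm u)\<^sup>2" for c and u :: "'a \<Rightarrow> complex"
    unfolding L2_norm_sq norm_mult power_mult_distrib by (rule integral_mult_right_zero)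
  have cross: "(\<integral>x. F x * cnj (ift g x) \<partial>lborel) = (\<integral>\<omega>. fourier F \<omega> * cnj (g \<omega>) \<partial>lborel)"
  proof -
    have "(\<integral>x. F x * cnj (ift g x) \<partial>lborel) = (\<integral>x. F x * (\<integral>\<omega>. cnj (g \<omega>) * exp (\<i> * complex_of_real (\<omega> \<bullet> - x)) \<partial>lborel) \<partial>lborel)"
      unfolding cnj_ift unfolding ift_def ..
    also have "\<dots> = (\<integral>\<omega>. cnj (g \<omega>) * (\<integral>x. F x * exp (\<i> * complex_of_real (\<omega> \<bullet> - x)) \<partial>lborel) \<partial>lborel)"
      by (rule fubini_bounded(2)[where B=1]) (use F g in auto)
    also have "\<dots> = (\<integral>\<omega>. fourier F \<omega> * cnj (g \<omega>) \<partial>lborel)"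
      unfolding fourier_def by (intro Bochner_Integration.integral_cong refl) (simp add: mult.commute)
    finally show ?thesis .
  qed
  have "(L2_norm (\<lambda>\<omega>. fourier F \<omega> + (- complex_of_real K) * g \<omega>))\<^sup>2 =
      K * (L2_norm F)\<^sup>2 + K\<^sup>2 * (L2_norm g)\<^sup>2 + 2 * Re (\<integral>\<omega>. fourier F \<omega> * cnj ((- complex_of_real K) * g \<omega>) \<partial>lborel)"
    unfolding L2_norm_add_sq[OF fL(1) L2_cmult[OF g(2)]] fL(2) norm_c using K by simp
  also have "(\<integral>\<omega>. fourier F \<omega> * cnj ((- complex_of_real K) * g \<omega>) \<partial>lborel) = (- complex_of_real K) * (\<integral>\<omega>. fourier F \<omega> * cnj (g \<omega>) \<partial>lborel)"
    by (subst integral_mult_right_zero[symmetric]) (intro Bochner_Integration.integral_cong refl, simp)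
  finally have 1: "(L2_norm (\<lambda>\<omega>. fourier F \<omega> - complex_of_real K * g \<omega>))\<^sup>2 =
      K * (L2_norm F)\<^sup>2 + K\<^sup>2 * (L2_norm g)\<^sup>2 - 2 * K * Re (\<integral>\<omega>. fourier F \<omega> * cnj (g \<omega>) \<partial>lborel)"
    by simp
  have "(L2_norm (\<lambda>x. F x + (- 1) * ift g x))\<^sup>2 =
      (L2_norm F)\<^sup>2 + K * (L2_norm g)\<^sup>2 + 2 * Re (\<integral>x. F x * cnj ((- 1) * ift g x) \<partial>lborel)"
    unfolding L2_norm_add_sq[OF F(2) L2_cmult[OF iL]] norm_c iN by simp
  also have "(\<integral>x. F x * cnj ((- 1) * ift g x) \<partial>lborel) = - (\<integral>x. F x * cnj (ift g x) \<partial>lborel)"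
    by simp
  finally have "(L2_norm (\<lambda>x. F x - ift g x))\<^sup>2 =
      (L2_norm F)\<^sup>2 + K * (L2_norm g)\<^sup>2 - 2 * Re (\<integral>x. F x * cnj (ift g x) \<partial>lborel)" by simp
  then show ?thesis unfolding 1 cross by (simp add: power2_eq_square right_diff_distrib distrib_left)
qed

section \<open>Band-limited functions as Fourier integrals\<close>

text \<open>The possible spectra. They vanish everywhere outside \<open>A\<close>, not just almost
  everywhere, so that a multiplier needs to be controlled on \<open>A\<close> only and estimates
  hold pointwise.\<close>

definition PW :: "'a::euclidean_space set \<Rightarrow> ('a \<Rightarrow> complex) set" where
  "PW A = {g \<in> L2. \<forall>\<omega>. \<omega> \<notin> A \<longrightarrow> g \<omega> = 0}"

lemma PW_L2: "g \<in> PW A \<Longrightarrow> g \<in> L2"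
  by (simp add: PW_def)

lemma PW_measurable: "g \<in> PW A \<Longrightarrow> g \<in> borel_measurable borel"
  by (simp add: PW_def L2_measurable)

lemma bounded_obtain_cball:
  fixes A :: "'a::real_normed_vector set"
  assumes "bounded A"
  obtains r where "A \<subseteq> cball 0 r"
proof -
  obtain r where "\<forall>x\<in>A. norm x \<le> r" using assms bounded_iff by blast
  then have "A \<subseteq> cball 0 r" by auto
  then show ?thesis by (rule that)
qed

text \<open>On a bounded set square-integrability implies integrability, because x \<le> x^2 +
  1.\<close>

lemma PW_integrable:
  assumes "bounded A" and g: "g \<in> PW A"
  shows "integrable lborel g"
proof -
  obtain r where r: "A \<subseteq> cball 0 r" using bounded_obtain_cball[OF assms(1)] .
  have "integrable lborel (\<lambda>\<omega>. (cmod (g \<omega>))\<^sup>2 + indicator (cball 0 r) \<omega>)"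
    using L2_integrable[OF PW_L2[OF g]] emeasure_lborel_cball_finite[of 0 r]
    by (intro Bochner_Integration.integrable_add integrable_real_indicator) simp_all
  then show ?thesis
  proof (rule Bochner_Integration.integrable_bound)
    have le: "x \<le> x\<^sup>2 + 1" for x :: real
    proof -
      have "0 \<le> x\<^sup>2 - 2 * x + 1" using zero_le_power2[of "x - 1"] by (simp add: power2_diff)
      then show ?thesis using zero_le_power2[of x] by linarith
    qed
    show "AE \<omega> in lborel. norm (g \<omega>) \<le> norm ((cmod (g \<omega>))\<^sup>2 + indicator (cball 0 r) \<omega>)"
    proof (rule AE_I2)
      fix \<omega>
      show "norm (g \<omega>) \<le> norm ((cmod (g \<omega>))\<^sup>2 + indicator (cball 0 r) \<omega>)"
        using g r le[of "cmod (g \<omega>)"] by (cases "\<omega> \<in> A") (auto simp: PW_def)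
    qed
  qed (use g in \<open>simp add: PW_measurable\<close>)
qed

lemma PW_mult:
  assumes g: "g \<in> PW A" and k: "k \<in> borel_measurable borel" and bd: "\<And>\<omega>. \<omega> \<in> A \<Longrightarrow> cmod (k \<omega>) \<le> C"
  shows "(\<lambda>\<omega>. k \<omega> * g \<omega>) \<in> PW A"
proof -
  have "cmod (k \<omega> * g \<omega>) \<le> C * cmod (g \<omega>)" for \<omega>
    using bd g by (cases "\<omega> \<in> A") (auto simp: norm_mult PW_def intro: mult_right_mono)
  then have "(\<lambda>\<omega>. k \<omega> * g \<omega>) \<in> L2"
    using k PW_measurable[OF g] by (intro L2_mono[OF PW_L2[OF g]]) measurable
  then show ?thesis using g by (auto simp: PW_def)
qed

section \<open>Derivatives as multipliers of the spectrum\<close>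

lemma PW_inner_mult:
  assumes A: "bounded A" and g: "g \<in> PW A"
  shows "(\<lambda>\<omega>. \<i> * complex_of_real (\<omega> \<bullet> v) * g \<omega>) \<in> PW A"
proof -
  obtain r where r: "A \<subseteq> cball 0 r" using bounded_obtain_cball[OF A] .
  have "cmod (\<i> * complex_of_real (\<omega> \<bullet> v)) \<le> r * norm v" if "\<omega> \<in> A" for \<omega>
  proof -
    have "\<bar>\<omega> \<bullet> v\<bar> \<le> norm \<omega> * norm v" by (rule Cauchy_Schwarz_ineq2)
    also have "\<dots> \<le> r * norm v" using r that by (intro mult_right_mono) auto
    finally show ?thesis by (simp add: norm_mult)
  qed
  then show ?thesis by (intro PW_mult[OF g]) auto
qed

text \<open>On a bounded spectrum the estimate |exp(i s) - 1 - i s| \<le> s^2 / 2 makes the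
  remainder O(|h|^2), uniformly in \<open>x\<close>.\<close>

lemma ift_has_derivative:
  assumes A: "bounded A" and g: "g \<in> PW A"
  shows "(ift g has_derivative (\<lambda>h. ift (\<lambda>\<omega>. \<i> * complex_of_real (\<omega> \<bullet> h) * g \<omega>) x)) (at x)"
proof -
  note int = PW_integrable[OF A g]
  note int' = PW_integrable[OF A PW_inner_mult[OF A g]]
  obtain r where r: "A \<subseteq> cball 0 r" using bounded_obtain_cball[OF A] .
  define B where "B = (\<integral>\<omega>. cmod (g \<omega>) \<partial>lborel) * r\<^sup>2 / 2"
  have B: "B \<ge> 0" by (simp add: B_def)
  have lin: "bounded_linear (\<lambda>h. ift (\<lambda>\<omega>. \<i> * complex_of_real (\<omega> \<bullet> h) * g \<omega>) x)"
  proof (rule bounded_linear_intro)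
    fix h k
    show "ift (\<lambda>\<omega>. \<i> * complex_of_real (\<omega> \<bullet> (h + k)) * g \<omega>) x =
      ift (\<lambda>\<omega>. \<i> * complex_of_real (\<omega> \<bullet> h) * g \<omega>) x + ift (\<lambda>\<omega>. \<i> * complex_of_real (\<omega> \<bullet> k) * g \<omega>) x"
      by (subst ift_add[symmetric, OF int' int']) (simp add: inner_add_right distrib_left distrib_right)
  next
    fix c h
    show "ift (\<lambda>\<omega>. \<i> * complex_of_real (\<omega> \<bullet> (c *\<^sub>R h)) * g \<omega>) x = c *\<^sub>R ift (\<lambda>\<omega>. \<i> * complex_of_real (\<omega> \<bullet> h) * g \<omega>) x"
      by (simp add: scaleR_conv_of_real mult_ac flip: ift_cmult)
  next
    fix h
    have "cmod (ift (\<lambda>\<omega>. \<i> * complex_of_real (\<omega> \<bullet> h) * g \<omega>) x) \<le> (\<integral>\<omega>. cmod (\<i> * complex_of_real (\<omega> \<bullet> h) * g \<omega>) \<partial>lborel)"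
      by (rule norm_ift_le[OF int'])
    also have "\<dots> \<le> (\<integral>\<omega>. norm h * r * cmod (g \<omega>) \<partial>lborel)"
    proof (rule integral_mono)
      show "integrable lborel (\<lambda>\<omega>. cmod (\<i> * complex_of_real (\<omega> \<bullet> h) * g \<omega>))" using int' by (rule integrable_norm)
      show "integrable lborel (\<lambda>\<omega>. norm h * r * cmod (g \<omega>))" using int by simp
      fix \<omega>
      show "cmod (\<i> * complex_of_real (\<omega> \<bullet> h) * g \<omega>) \<le> norm h * r * cmod (g \<omega>)"
      proof (cases "\<omega> \<in> A")
        case True
        have "\<bar>\<omega> \<bullet> h\<bar> \<le> norm \<omega> * norm h" by (rule Cauchy_Schwarz_ineq2)
        also have "\<dots> \<le> r * norm h" using r True by (intro mult_right_mono) auto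
        finally have "\<bar>\<omega> \<bullet> h\<bar> * cmod (g \<omega>) \<le> (r * norm h) * cmod (g \<omega>)" by (rule mult_right_mono) simp
        then show ?thesis by (simp add: norm_mult mult_ac)
      qed (use g in \<open>auto simp: PW_def\<close>)
    qed
    finally show "norm (ift (\<lambda>\<omega>. \<i> * complex_of_real (\<omega> \<bullet> h) * g \<omega>) x) \<le> norm h * (r * (\<integral>\<omega>. cmod (g \<omega>) \<partial>lborel))"
      by (simp add: mult.assoc)
  qed
  have est: "cmod (ift g (x + h) - ift g x - ift (\<lambda>\<omega>. \<i> * complex_of_real (\<omega> \<bullet> h) * g \<omega>) x) \<le> B * (norm h)\<^sup>2" for h
  proof -
    let ?e = "\<lambda>\<omega>. exp (\<i> * complex_of_real (\<omega> \<bullet> x))"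
    let ?R = "\<lambda>\<omega>. exp (\<i> * complex_of_real (\<omega> \<bullet> h)) - 1 - \<i> * complex_of_real (\<omega> \<bullet> h)"
    have "ift g (x + h) - ift g x - ift (\<lambda>\<omega>. \<i> * complex_of_real (\<omega> \<bullet> h) * g \<omega>) x =
      (\<integral>\<omega>. g \<omega> * exp (\<i> * complex_of_real (\<omega> \<bullet> (x + h))) - g \<omega> * ?e \<omega> - \<i> * complex_of_real (\<omega> \<bullet> h) * g \<omega> * ?e \<omega> \<partial>lborel)"
      unfolding ift_def
      by (simp only: Bochner_Integration.integral_diff Bochner_Integration.integrable_diff ift_integrable[OF int] ift_integrable[OF int'])
    also have "\<dots> = (\<integral>\<omega>. ?R \<omega> * (g \<omega> * ?e \<omega>) \<partial>lborel)"
      by (intro Bochner_Integration.integral_cong refl) (simp add: inner_add_right distrib_left exp_add algebra_simps)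
    finally have "cmod (ift g (x + h) - ift g x - ift (\<lambda>\<omega>. \<i> * complex_of_real (\<omega> \<bullet> h) * g \<omega>) x) =
       cmod (\<integral>\<omega>. ?R \<omega> * (g \<omega> * ?e \<omega>) \<partial>lborel)" by (simp only:)
    also have "\<dots> \<le> (\<integral>\<omega>. cmod (?R \<omega> * (g \<omega> * ?e \<omega>)) \<partial>lborel)" by (rule integral_norm_bound)
    also have "\<dots> \<le> (\<integral>\<omega>. cmod (g \<omega>) * (r\<^sup>2 / 2 * (norm h)\<^sup>2) \<partial>lborel)"
    proof (rule integral_mono')
      show "integrable lborel (\<lambda>\<omega>. cmod (g \<omega>) * (r\<^sup>2 / 2 * (norm h)\<^sup>2))" using int by simp
      fix \<omega>
      show "cmod (?R \<omega> * (g \<omega> * ?e \<omega>)) \<le> cmod (g \<omega>) * (r\<^sup>2 / 2 * (norm h)\<^sup>2)"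
      proof (cases "\<omega> \<in> A")
        case True
        have "cmod (?R \<omega>) \<le> (\<omega> \<bullet> h)\<^sup>2 / 2"
          using iexp_approx1[of "\<omega> \<bullet> h" 1] by (simp add: diff_diff_eq power2_eq_square)
        also have "(\<omega> \<bullet> h)\<^sup>2 \<le> (r * norm h)\<^sup>2"
        proof (rule abs_le_square_iff[THEN iffD1])
          have "\<bar>\<omega> \<bullet> h\<bar> \<le> norm \<omega> * norm h" by (rule Cauchy_Schwarz_ineq2)
          also have "\<dots> \<le> r * norm h" using r True by (intro mult_right_mono) auto
          finally show "\<bar>\<omega> \<bullet> h\<bar> \<le> \<bar>r * norm h\<bar>" by linarith
        qed
        finally have "cmod (?R \<omega>) \<le> r\<^sup>2 / 2 * (norm h)\<^sup>2" by (simp add: power_mult_distrib)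
        then have "cmod (g \<omega>) * cmod (?R \<omega>) \<le> cmod (g \<omega>) * (r\<^sup>2 / 2 * (norm h)\<^sup>2)" by (intro mult_left_mono) auto
        then show ?thesis by (simp add: norm_mult mult.commute)
      qed (use g in \<open>auto simp: PW_def\<close>)
    qed simp
    also have "\<dots> = B * (norm h)\<^sup>2" by (simp add: B_def)
    finally show ?thesis .
  qed
  show ?thesis
    unfolding has_derivative_at
  proof (intro conjI lin)
    have "(\<lambda>h. B * norm h) \<midarrow>(0::'a)\<rightarrow> B * norm (0::'a)" by (intro tendsto_intros)
    then have "(\<lambda>h. B * norm h) \<midarrow>(0::'a)\<rightarrow> 0" by simp
    then show "(\<lambda>h. norm (ift g (x + h) - ift g x - ift (\<lambda>\<omega>. \<i> * complex_of_real (\<omega> \<bullet> h) * g \<omega>) x) / norm h) \<midarrow>0\<rightarrow> 0"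
    proof (rule tendsto_sandwich[OF _ _ tendsto_const, rotated 2])
      show "\<forall>\<^sub>F h in at 0. norm (ift g (x + h) - ift g x - ift (\<lambda>\<omega>. \<i> * complex_of_real (\<omega> \<bullet> h) * g \<omega>) x) / norm h \<le> B * norm h"
      proof (rule always_eventually, rule allI)
        fix h :: 'a
        show "norm (ift g (x + h) - ift g x - ift (\<lambda>\<omega>. \<i> * complex_of_real (\<omega> \<bullet> h) * g \<omega>) x) / norm h \<le> B * norm h"
          using est[of h] B by (cases "h = 0") (auto simp: pos_divide_le_eq power2_eq_square mult.assoc)
      qed
    qed (auto intro!: always_eventually)
  qed
qed

lemma ift_continuous: "bounded A \<Longrightarrow> g \<in> PW A \<Longrightarrow> continuous_on S (ift g)"
  by (intro continuous_at_imp_continuous_on ballI has_derivative_continuous[OF ift_has_derivative])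

lemma dir_deriv_ift:
  assumes A: "bounded A" and g: "g \<in> PW A"
  shows "dir_deriv v (ift g) = ift (\<lambda>\<omega>. \<i> * complex_of_real (\<omega> \<bullet> v) * g \<omega>)"
proof
  fix x
  let ?D = "\<lambda>h. ift (\<lambda>\<omega>. \<i> * complex_of_real (\<omega> \<bullet> h) * g \<omega>) x"
  have "((\<lambda>s::real. x + s *\<^sub>R v) has_derivative (\<lambda>s. s *\<^sub>R v)) (at 0)"
    by (auto intro!: derivative_eq_intros)
  moreover have "(ift g has_derivative ?D) (at (x + 0 *\<^sub>R v))"
    using ift_has_derivative[OF A g] by simp
  ultimately have "((\<lambda>s::real. ift g (x + s *\<^sub>R v)) has_derivative (\<lambda>s. ?D (s *\<^sub>R v))) (at 0)"
    by (rule has_derivative_compose)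
  moreover have "?D (s *\<^sub>R v) = s *\<^sub>R ?D v" for s
    by (simp add: scaleR_conv_of_real mult_ac flip: ift_cmult)
  ultimately have "((\<lambda>s::real. ift g (x + s *\<^sub>R v)) has_vector_derivative ?D v) (at 0)"
    by (simp add: has_vector_derivative_def)
  then show "dir_deriv v (ift g) x = ?D v"
    unfolding dir_deriv_def by (rule vector_derivative_at)
qed

lemma foldr_dir_deriv_ift:
  assumes A: "bounded A" and g: "g \<in> PW A"
  shows "\<exists>h \<in> PW A. foldr dir_deriv vs (ift g) = ift h"
proof (induction vs)
  case Nil
  then show ?case using g by auto
next
  case (Cons v vs)
  then obtain h where "h \<in> PW A" "foldr dir_deriv vs (ift g) = ift h" by blast
  then show ?case using PW_inner_mult[OF A] dir_deriv_ift[OF A] by auto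
qed

lemma smooth_ift:
  assumes A: "bounded A" and g: "g \<in> PW A"
  shows "smooth (ift g)"
  unfolding smooth_def
proof (intro allI impI)
  fix vs :: "'a list" and x
  obtain h where "h \<in> PW A" "foldr dir_deriv vs (ift g) = ift h"
    using foldr_dir_deriv_ift[OF A g] by blast
  then show "foldr dir_deriv vs (ift g) differentiable at x"
    using ift_has_derivative[OF A] by (auto simp: differentiable_def)
qed

text \<open>The complement of the essential support is a union of possibly uncountably many open
  sets; Lindelof's theorem leaves countably many null sets.\<close>

lemma AE_outside_ess_support: "AE x in lborel. x \<notin> ess_support g \<longrightarrow> g x = 0"
proof -
  let ?F = "{U. open U \<and> (AE x in lborel. x \<in> U \<longrightarrow> g x = 0)}"
  obtain F' where F': "F' \<subseteq> ?F" "countable F'" "\<Union>F' = \<Union>?F"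
    using Lindelof[of ?F] by blast
  have "AE x in lborel. \<forall>U\<in>F'. x \<in> U \<longrightarrow> g x = 0"
    using F' by (subst AE_ball_countable) auto
  moreover have "x \<notin> ess_support g \<longleftrightarrow> (\<exists>U\<in>F'. x \<in> U)" for x
    using F'(3) unfolding ess_support_def by auto
  ultimately show ?thesis by (auto elim!: eventually_mono)
qed

lemma L2_norm_triangle_zero:
  assumes u: "u \<in> L2" and F: "\<And>n. F n \<in> L2" and v: "v \<in> L2"
    and lim: "(\<lambda>n. L2_norm (\<lambda>x. F n x - u x)) \<longlonglongrightarrow> 0" "(\<lambda>n. L2_norm (\<lambda>x. F n x - v x)) \<longlonglongrightarrow> 0"
  shows "AE x in lborel. u x = v x"
proof -
  have "nsq (\<lambda>x. u x - v x) \<le> 2 * ennreal ((L2_norm (\<lambda>x. F n x - v x))\<^sup>2) + 2 * ennreal ((L2_norm (\<lambda>x. F n x - u x))\<^sup>2)" for n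
  proof -
    let ?a = "\<lambda>x. F n x - v x" and ?b = "\<lambda>x. F n x - u x"
    have ab: "?a \<in> L2" "?b \<in> L2" using u F v by (auto intro: L2_diff)
    have "nsq (\<lambda>x. u x - v x) = nsq (\<lambda>x. ?a x + (-1) * ?b x)" by simp
    also have "\<dots> \<le> 2 * nsq ?a + 2 * nsq (\<lambda>x. (-1) * ?b x)"
      using ab by (intro nsq_add_le L2_measurable L2_cmult) auto
    also have "nsq (\<lambda>x. (-1) * ?b x) = nsq ?b"
      using ab by (subst nsq_cmult) (auto simp: L2_measurable)
    finally show ?thesis by (simp only: nsq_eq[OF ab(1)] nsq_eq[OF ab(2)])
  qed
  moreover have "(\<lambda>n. 2 * ennreal ((L2_norm (\<lambda>x. F n x - v x))\<^sup>2) + 2 * ennreal ((L2_norm (\<lambda>x. F n x - u x))\<^sup>2)) \<longlonglongrightarrow>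
      2 * ennreal (0\<^sup>2) + 2 * ennreal (0\<^sup>2)"
    by (intro tendsto_add ennreal_tendsto_cmult tendsto_ennrealI tendsto_power lim) auto
  ultimately have "nsq (\<lambda>x. u x - v x) \<le> 2 * ennreal (0\<^sup>2) + 2 * ennreal (0\<^sup>2)"
    by (intro LIMSEQ_le_const) auto
  then have "nsq (\<lambda>x. u x - v x) = 0" by simp
  then have "AE x in lborel. ennreal ((cmod (u x - v x))\<^sup>2) = 0"
    unfolding nsq_def using L2_measurable[OF u] L2_measurable[OF v] by (subst (asm) nn_integral_0_iff_AE) auto
  then show ?thesis by (auto elim!: eventually_mono)
qed

text \<open>The transforms of the approximants \<open>F n\<close> converge to \<open>g0\<close>, so
  \<open>L2_norm_diff_inverse\<close> makes \<open>F n\<close> converge to \<open>ift g\<close> as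
  well as to \<open>f\<close>. Thus \<open>f\<close> and \<open>ift g\<close> agree almost
  everywhere, and everywhere since both are continuous. Cutting \<open>g0\<close> off outside
  \<open>\<Omega>\<close> changes it on a null set only.\<close>

lemma bandlimited_obtain_PW:
  assumes \<Omega>: "compact \<Omega>" and f: "f \<in> bandlimited \<Omega>"
  obtains g where "g \<in> PW \<Omega>" "f = ift g"
proof -
  define K where "K = (2 * pi) ^ DIM('a)"
  have K: "K > 0" by (simp add: K_def)
  obtain g0 where sm: "smooth f" and fL: "f \<in> L2" and hf: "has_fourier_L2 f g0" and supp: "ess_support g0 \<subseteq> \<Omega>"
    using f by (auto simp: bandlimited_def)
  have [measurable]: "\<Omega> \<in> sets borel" using \<Omega> by (simp add: borel_compact)
  have g0: "g0 \<in> L2" using hf by (simp add: has_fourier_L2_def)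
  define g1 where "g1 \<omega> = indicator \<Omega> \<omega> * g0 \<omega>" for \<omega>
  have g1m: "g1 \<in> borel_measurable borel" unfolding g1_def using L2_measurable[OF g0] by measurable
  have g1L: "g1 \<in> L2" by (rule L2_mono[OF g0 g1m, of 1]) (auto simp: g1_def split: split_indicator)
  define g where "g \<omega> = complex_of_real (1 / K) * g1 \<omega>" for \<omega>
  have gP: "g \<in> PW \<Omega>" 
  proof -
    have "g \<in> L2" unfolding g_def[abs_def] by (rule L2_cmult[OF g1L])
    then show ?thesis by (auto simp: PW_def g_def g1_def)
  qed
  have gi: "integrable lborel g" by (rule PW_integrable[OF compact_imp_bounded[OF \<Omega>] gP])
  note gL = PW_L2[OF gP]
  have Kg: "complex_of_real K * g \<omega> = g1 \<omega>" for \<omega>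
    unfolding g_def using K by (simp add: mult.assoc[symmetric] flip: of_real_mult)
  have AEg: "AE \<omega> in lborel. g1 \<omega> = g0 \<omega>"
    using AE_outside_ess_support[of g0] supp by (auto simp: g1_def elim!: eventually_mono split: split_indicator)
  obtain F where F: "\<And>n. F n \<in> L2" "\<And>n. integrable lborel (F n)"
    and lim: "(\<lambda>n. L2_norm (\<lambda>x. F n x - f x)) \<longlonglongrightarrow> 0" "(\<lambda>n. L2_norm (\<lambda>\<omega>. fourier (F n) \<omega> - g0 \<omega>)) \<longlonglongrightarrow> 0"
    using hf unfolding has_fourier_L2_def by blast
  have "L2_norm (\<lambda>\<omega>. fourier (F n) \<omega> - g0 \<omega>) = sqrt K * L2_norm (\<lambda>x. F n x - ift g x)" for n
  proof -
    have "L2_norm (\<lambda>\<omega>. fourier (F n) \<omega> - g0 \<omega>) = L2_norm (\<lambda>\<omega>. fourier (F n) \<omega> - g1 \<omega>)"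
      unfolding L2_norm_def
    proof (intro arg_cong[where f=sqrt] Bochner_Integration.integral_cong_AE)
      show "AE \<omega> in lborel. (cmod (fourier (F n) \<omega> - g0 \<omega>))\<^sup>2 = (cmod (fourier (F n) \<omega> - g1 \<omega>))\<^sup>2"
        using AEg by (auto elim!: eventually_mono)
    qed (use L2_measurable[OF fourier_L2(1)[OF F(2) F(1)]] L2_measurable[OF g0] g1m in measurable)
    also have "\<dots> = sqrt (K * (L2_norm (\<lambda>x. F n x - ift g x))\<^sup>2)"
      using L2_norm_diff_inverse[OF F(2)[of n] F(1)[of n] gi gL, folded K_def]
      unfolding Kg using L2_norm_nonneg by (metis real_sqrt_unique)
    also have "\<dots> = sqrt K * L2_norm (\<lambda>x. F n x - ift g x)"
      by (simp add: real_sqrt_mult L2_norm_nonneg)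
    finally show ?thesis .
  qed
  then have "(\<lambda>n. sqrt K * L2_norm (\<lambda>x. F n x - ift g x) / sqrt K) \<longlonglongrightarrow> 0 / sqrt K"
    using lim(2) K by (intro tendsto_divide tendsto_const) auto
  then have "(\<lambda>n. L2_norm (\<lambda>x. F n x - ift g x)) \<longlonglongrightarrow> 0" using K by simp
  then have AE: "AE x in lborel. f x = ift g x"
    using L2_norm_triangle_zero[OF fL F(1) ift_L2[OF gi gL] lim(1)] by blast
  have "continuous_on UNIV f"
  proof (intro continuous_at_imp_continuous_on ballI)
    fix x
    have "f differentiable (at x)" using sm unfolding smooth_def by (metis empty_set foldr_Nil id_apply empty_subsetI)
    then show "isCont f x" by (rule differentiable_imp_continuous_within)
  qed
  moreover have "continuous_on UNIV (ift g)"
    by (rule ift_continuous[OF compact_imp_bounded[OF \<Omega>] gP])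
  ultimately have "closed {x. f x = ift g x}" by (rule closed_Collect_eq)
  then have "x \<in> {x. f x = ift g x}" for x
    by (rule mem_closed_if_AE_lebesgue) (use AE in \<open>auto intro!: AE_completion\<close>)
  then have "f = ift g" by auto
  with gP show ?thesis by (rule that)
qed

text \<open>The approximants demanded by \<open>has_fourier_L2\<close> are the truncations of
  \<open>ift g\<close> to balls; \<open>L2_norm_diff_inverse\<close> carries their convergence over
  to the transforms.\<close>

lemma ift_bandlimited:
  fixes g :: "'a::euclidean_space \<Rightarrow> complex"
  assumes \<Omega>: "compact \<Omega>" and g: "g \<in> PW \<Omega>"
  shows "ift g \<in> bandlimited \<Omega>"
proof -
  define K where "K = (2 * pi) ^ DIM('a)"
  have K: "K > 0" by (simp add: K_def)
  note b = compact_imp_bounded[OF \<Omega>]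
  note gi = PW_integrable[OF b g] and gL = PW_L2[OF g]
  let ?f = "ift g"
  have fL: "?f \<in> L2" by (rule ift_L2[OF gi gL])
  have fm[measurable]: "?f \<in> borel_measurable borel" using fL by (rule L2_measurable)
  define F where "F n x = indicator (cball 0 (real n)) x * ?f x" for n :: nat and x :: 'a
  have Fm[measurable]: "F n \<in> borel_measurable borel" for n
    unfolding F_def using fm by (intro borel_measurable_times borel_measurable_indicator) auto
  have FL: "F n \<in> L2" for n
    by (rule L2_mono[OF fL Fm, of _ 1]) (auto simp: F_def split: split_indicator)
  have "F n \<in> PW (cball 0 (real n))" for n
    using FL by (auto simp: PW_def F_def)
  then have Fi: "integrable lborel (F n)" for n
    by (rule PW_integrable[rotated]) simp
  have lim: "(\<lambda>n. L2_norm (\<lambda>x. F n x - ?f x)) \<longlonglongrightarrow> 0"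
  proof -
    have "(\<lambda>n. \<integral>x. (cmod (F n x - ?f x))\<^sup>2 \<partial>lborel) \<longlonglongrightarrow> (\<integral>x. 0 \<partial>(lborel :: 'a measure))"
    proof (rule integral_dominated_convergence[where w="\<lambda>x. (cmod (?f x))\<^sup>2"])
      show "AE x in lborel. (\<lambda>n. (cmod (F n x - ?f x))\<^sup>2) \<longlonglongrightarrow> 0"
      proof (rule AE_I2)
        fix x :: 'a
        obtain N :: nat where N: "norm x \<le> real N" using real_arch_simple by blast
        have "\<forall>\<^sub>F n in sequentially. (cmod (F n x - ?f x))\<^sup>2 = 0"
          using eventually_ge_at_top[of N]
        proof eventually_elim
          case (elim n)
          then have "norm x \<le> real n" using N by simp
          then show ?case by (simp add: F_def)
        qed
        then show "(\<lambda>n. (cmod (F n x - ?f x))\<^sup>2) \<longlonglongrightarrow> 0" by (rule tendsto_eventually)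
      qed
      show "AE x in lborel. norm ((cmod (F n x - ?f x))\<^sup>2) \<le> (cmod (?f x))\<^sup>2" for n
        by (rule AE_I2) (auto simp: F_def split: split_indicator)
    qed (use L2_integrable[OF fL] in auto)
    then have "(\<lambda>n. sqrt (\<integral>x. (cmod (F n x - ?f x))\<^sup>2 \<partial>lborel)) \<longlonglongrightarrow> sqrt 0"
      by (intro tendsto_real_sqrt) simp
    then show ?thesis by (simp add: L2_norm_def)
  qed
  have "L2_norm (\<lambda>\<omega>. fourier (F n) \<omega> - complex_of_real K * g \<omega>) = sqrt K * L2_norm (\<lambda>x. F n x - ?f x)" for n
  proof -
    have "L2_norm (\<lambda>\<omega>. fourier (F n) \<omega> - complex_of_real K * g \<omega>) = sqrt (K * (L2_norm (\<lambda>x. F n x - ?f x))\<^sup>2)"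
      using L2_norm_diff_inverse[OF Fi[of n] FL[of n] gi gL, folded K_def] L2_norm_nonneg by (metis real_sqrt_unique)
    then show ?thesis by (simp add: real_sqrt_mult L2_norm_nonneg)
  qed
  moreover have "(\<lambda>n. sqrt K * L2_norm (\<lambda>x. F n x - ?f x)) \<longlonglongrightarrow> sqrt K * 0"
    by (intro tendsto_mult tendsto_const lim)
  ultimately have lim2: "(\<lambda>n. L2_norm (\<lambda>\<omega>. fourier (F n) \<omega> - complex_of_real K * g \<omega>)) \<longlonglongrightarrow> 0" by simp
  have "has_fourier_L2 ?f (\<lambda>\<omega>. complex_of_real K * g \<omega>)"
    unfolding has_fourier_L2_def
    using fL L2_cmult[OF gL] FL Fi fourier_L2(1)[OF Fi FL] lim lim2 by blast
  moreover have "open (- \<Omega>)" using \<Omega> compact_imp_closed by blast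
  then have "- \<Omega> \<subseteq> - ess_support (\<lambda>\<omega>. complex_of_real K * g \<omega>)"
    using g unfolding ess_support_def by (auto simp: PW_def intro!: exI[of _ "- \<Omega>"])
  ultimately show ?thesis
    using smooth_ift[OF b g] fL unfolding bandlimited_def by blast
qed

section \<open>Partial derivatives and the frame elements\<close>

lemma PW_mult_continuous:
  assumes A: "bounded A" and g: "g \<in> PW A" and k: "continuous_on UNIV k"
  shows "(\<lambda>\<omega>. k \<omega> * g \<omega>) \<in> PW A"
proof -
  obtain r where r: "A \<subseteq> cball 0 r" using bounded_obtain_cball[OF A] .
  have "compact (k ` cball 0 r)"
    by (rule compact_continuous_image[OF continuous_on_subset[OF k]]) auto
  then obtain C where C: "\<forall>y\<in>k ` cball 0 r. norm y \<le> C"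
    using compact_imp_bounded bounded_iff by blast
  show ?thesis
  proof (rule PW_mult[OF g])
    show "k \<in> borel_measurable borel" using k by (rule borel_measurable_continuous_onI)
    show "cmod (k \<omega>) \<le> C" if "\<omega> \<in> A" for \<omega> using C r that by auto
  qed
qed

lemma funpow_dir_deriv_ift:
  assumes A: "bounded A" and g: "g \<in> PW A"
  shows "((dir_deriv v) ^^ n) (ift g) = ift (\<lambda>\<omega>. (\<i> * complex_of_real (\<omega> \<bullet> v)) ^ n * g \<omega>)"
proof (induction n)
  case (Suc n)
  have "(\<lambda>\<omega>. (\<i> * complex_of_real (\<omega> \<bullet> v)) ^ n * g \<omega>) \<in> PW A"
    by (intro PW_mult_continuous[OF A g] continuous_intros)
  from dir_deriv_ift[OF A this] show ?case by (simp add: Suc.IH mult.assoc)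
qed simp

text \<open>The Fourier multiplier of \<open>Dz \<alpha>\<close>.\<close>

definition zfac :: "('n::finite \<Rightarrow> nat) \<Rightarrow> real ^ 'n \<Rightarrow> complex" where
  "zfac \<alpha> w = (\<Prod>j\<in>UNIV. (\<i> * complex_of_real (w $ j)) ^ \<alpha> j)"

lemma continuous_on_zfac: "continuous_on S (zfac \<alpha>)"
  unfolding zfac_def by (intro continuous_intros)

lemma Dz_ift:
  fixes A :: "((real, 'n::{finite,linorder}) vec \<times> real) set"
  assumes A: "bounded A" and g: "g \<in> PW A"
  shows "Dz \<alpha> (ift g) = ift (\<lambda>\<omega>. zfac \<alpha> (fst \<omega>) * g \<omega>)"
proof -
  have *: "foldr (\<lambda>j. (dir_deriv (axis j 1, 0)) ^^ \<alpha> j) js (ift g) =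
      ift (\<lambda>\<omega>. (\<Prod>j\<leftarrow>js. (\<i> * complex_of_real (fst \<omega> $ j)) ^ \<alpha> j) * g \<omega>)" for js
  proof (induction js)
    case (Cons j js)
    have "continuous_on UNIV (\<lambda>\<omega>::(real, 'n) vec \<times> real. \<Prod>j\<leftarrow>js. (\<i> * complex_of_real (fst \<omega> $ j)) ^ \<alpha> j)"
      by (induction js) (auto intro!: continuous_intros)
    then have "(\<lambda>\<omega>. (\<Prod>j\<leftarrow>js. (\<i> * complex_of_real (fst \<omega> $ j)) ^ \<alpha> j) * g \<omega>) \<in> PW A"
      by (rule PW_mult_continuous[OF A g])
    from funpow_dir_deriv_ift[OF A this] show ?case
      by (simp add: Cons.IH inner_prod_def inner_axis mult.assoc)
  qed simp
  have "(\<Prod>j\<leftarrow>sorted_list_of_set UNIV. (\<i> * complex_of_real (w $ j)) ^ \<alpha> j) = zfac \<alpha> w" for w :: "(real, 'n) vec"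
    unfolding zfac_def by (subst prod.distinct_set_conv_list[symmetric]) auto
  then show ?thesis unfolding Dz_def * by simp
qed

lemma ift_translate: "ift g (x - a) = ift (\<lambda>\<omega>. exp (- (\<i> * complex_of_real (\<omega> \<bullet> a))) * g \<omega>) x"
  unfolding ift_def
  by (intro Bochner_Integration.integral_cong refl)
    (simp add: inner_diff_right right_diff_distrib exp_diff exp_minus field_simps)

text \<open>The spectrum of the translated derivative of \<open>\<Phi> \<Omega>\<close> is the
  multiplier \<open>zfac \<alpha>\<close> times a phase on \<open>\<Omega>\<close>. Parseval's
  identity turns the inner product into the inverse integral of \<open>zfac \<alpha>\<close> times
  the spectrum of \<open>f\<close> at \<open>a\<close>; conjugating the multiplier only changes its
  sign.\<close>

lemma frame_element:
  fixes \<Omega> :: "((real, 'n::{finite,linorder}) vec \<times> real) set" and c :: real and a \<alpha>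
  assumes \<Omega>: "compact \<Omega>"
  defines "\<phi> \<equiv> \<lambda>x. complex_of_real c * Dz \<alpha> (\<Phi> \<Omega>) (x - a)"
  shows "\<phi> \<in> bandlimited \<Omega>"
    and "f \<in> bandlimited \<Omega> \<Longrightarrow> cmod (L2_inner f \<phi>) = \<bar>c\<bar> * cmod (Dz \<alpha> f a)"
proof -
  define K where "K = (2 * pi) ^ DIM((real, 'n) vec \<times> real)"
  have K: "K > 0" by (simp add: K_def)
  note b = compact_imp_bounded[OF \<Omega>]
  have [measurable]: "\<Omega> \<in> sets borel" using \<Omega> by (rule borel_compact)
  define u where "u \<omega> = complex_of_real (1 / K) * indicator \<Omega> \<omega>" for \<omega> :: "(real, 'n) vec \<times> real"
  have "nsq (\<lambda>\<omega>. indicator \<Omega> \<omega> :: complex) = (\<integral>\<^sup>+\<omega>. indicator \<Omega> \<omega> \<partial>lborel)"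
    unfolding nsq_def by (intro nn_integral_cong) (auto split: split_indicator)
  then have "(\<lambda>\<omega>. indicator \<Omega> \<omega> :: complex) \<in> L2"
    using emeasure_compact_finite[OF \<Omega>] by (simp add: L2_iff_nsq)
  then have "u \<in> L2" unfolding u_def[abs_def] by (rule L2_cmult)
  then have uP: "u \<in> PW \<Omega>" by (auto simp: PW_def u_def)
  have "\<Phi> \<Omega> = ift u"
  proof
    fix x
    have "\<Phi> \<Omega> x = complex_of_real (1 / K) * ift (indicator \<Omega>) x"
      unfolding \<Phi>_def K_def ift_def set_lebesgue_integral_def
      by (intro arg_cong2[where f="(*)"] refl Bochner_Integration.integral_cong) (simp split: split_indicator)
    then show "\<Phi> \<Omega> x = ift u x" unfolding u_def[abs_def] ift_cmult .
  qed
  then have D\<Phi>: "Dz \<alpha> (\<Phi> \<Omega>) = ift (\<lambda>\<omega>. zfac \<alpha> (fst \<omega>) * u \<omega>)"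
    using Dz_ift[OF b uP] by simp
  define h where "h \<omega> = (complex_of_real c * exp (- (\<i> * complex_of_real (\<omega> \<bullet> a))) * zfac \<alpha> (fst \<omega>)) * u \<omega>" for \<omega>
  have hP: "h \<in> PW \<Omega>"
    unfolding h_def[abs_def]
    by (intro PW_mult_continuous[OF b uP] continuous_intros continuous_on_compose2[OF continuous_on_zfac[of UNIV]]) auto
  have \<phi>: "\<phi> = ift h"
    unfolding \<phi>_def D\<Phi> ift_translate h_def[abs_def] by (simp add: mult.assoc flip: ift_cmult)
  show "\<phi> \<in> bandlimited \<Omega>" unfolding \<phi> by (rule ift_bandlimited[OF \<Omega> hP])
  assume "f \<in> bandlimited \<Omega>"
  from bandlimited_obtain_PW[OF \<Omega> this] obtain g where g: "g \<in> PW \<Omega>" and f: "f = ift g" by blast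
  define s :: complex where "s = (\<Prod>j\<in>UNIV. (- 1) ^ \<alpha> j)"
  have s: "cmod s = 1" by (simp add: s_def prod_norm[symmetric] norm_power)
  have cz: "cnj (zfac \<alpha> w) = s * zfac \<alpha> w" for w
    unfolding zfac_def s_def by (simp add: prod.distrib[symmetric] power_mult_distrib[symmetric])
  have "L2_inner f \<phi> = complex_of_real K * (\<integral>\<omega>. g \<omega> * cnj (h \<omega>) \<partial>lborel)"
    unfolding L2_inner_def f \<phi> K_def
    by (rule Plancherel_inner) (use g hP PW_L2 PW_integrable[OF b] in auto)
  also have "(\<integral>\<omega>. g \<omega> * cnj (h \<omega>) \<partial>lborel) =
    (\<integral>\<omega>. (complex_of_real (1 / K) * (complex_of_real c * s)) * (zfac \<alpha> (fst \<omega>) * g \<omega> * exp (\<i> * complex_of_real (\<omega> \<bullet> a))) \<partial>lborel)"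
  proof (intro Bochner_Integration.integral_cong refl)
    fix \<omega>
    show "g \<omega> * cnj (h \<omega>) =
      (complex_of_real (1 / K) * (complex_of_real c * s)) * (zfac \<alpha> (fst \<omega>) * g \<omega> * exp (\<i> * complex_of_real (\<omega> \<bullet> a)))"
    proof (cases "\<omega> \<in> \<Omega>")
      case True
      then show ?thesis by (simp add: h_def u_def cz exp_cnj mult_ac)
    next
      case False
      then have "g \<omega> = 0" using g unfolding PW_def by blast
      then show ?thesis using False by (simp add: h_def u_def)
    qed
  qed
  also have "\<dots> = (complex_of_real (1 / K) * (complex_of_real c * s)) * Dz \<alpha> f a"
    unfolding f Dz_ift[OF b g] ift_def by (rule integral_mult_right_zero)
  finally have "L2_inner f \<phi> = complex_of_real c * s * Dz \<alpha> f a" using K by simp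
  then show "cmod (L2_inner f \<phi>) = \<bar>c\<bar> * cmod (Dz \<alpha> f a)" by (simp add: norm_mult s)
qed

section \<open>Freezing one of two variables\<close>

lemma nsq_pair:
  fixes f :: "'a::euclidean_space \<times> 'b::euclidean_space \<Rightarrow> complex"
  assumes [measurable]: "f \<in> borel_measurable borel"
  shows "nsq f = (\<integral>\<^sup>+y. nsq (\<lambda>x. f (x, y)) \<partial>lborel)" and "nsq f = (\<integral>\<^sup>+x. nsq (\<lambda>y. f (x, y)) \<partial>lborel)"
proof -
  have m: "(\<lambda>p. ennreal ((cmod (f p))\<^sup>2)) \<in> borel_measurable (lborel \<Otimes>\<^sub>M lborel)"
    using assms by (simp add: lborel_prod)
  show "nsq f = (\<integral>\<^sup>+y. nsq (\<lambda>x. f (x, y)) \<partial>lborel)"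
    unfolding nsq_def lborel_prod[symmetric] by (rule lborel_pair.nn_integral_snd[OF m, symmetric])
  show "nsq f = (\<integral>\<^sup>+x. nsq (\<lambda>y. f (x, y)) \<partial>lborel)"
    unfolding nsq_def lborel_prod[symmetric] by (rule lborel.nn_integral_fst[OF m, symmetric])
qed

lemma PW_swap:
  fixes g :: "'a::euclidean_space \<times> 'b::euclidean_space \<Rightarrow> complex"
  assumes g: "g \<in> PW (A \<times> B)"
  shows "(\<lambda>p. g (snd p, fst p)) \<in> PW (B \<times> A)"
proof -
  have gm[measurable]: "g \<in> borel_measurable borel" using g by (rule PW_measurable)
  have m: "(\<lambda>p::'b \<times> 'a. g (snd p, fst p)) \<in> borel_measurable borel"
  proof (rule measurable_compose[OF _ gm])
    show "(\<lambda>p::'b \<times> 'a. (snd p, fst p)) \<in> borel \<rightarrow>\<^sub>M borel"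
      by (intro borel_measurable_continuous_onI continuous_intros)
  qed
  have "nsq (\<lambda>p. g (snd p, fst p)) = nsq g"
    by (subst nsq_pair(1)[OF m], subst nsq_pair(2)[OF gm]) simp
  then show ?thesis using g m by (auto simp: PW_def L2_iff_nsq)
qed

text \<open>Cauchy-Schwarz in \<open>x\<close> for almost every \<open>y\<close>, followed by
  integration over \<open>y\<close>. A continuous \<open>k\<close> need not be square-integrable, so
  it is first cut off to a ball containing \<open>A\<close>, which leaves the integrals
  unchanged.\<close>

lemma PW_partial:
  fixes g :: "'a::euclidean_space \<times> 'b::euclidean_space \<Rightarrow> complex"
  assumes A: "bounded A" and B: "bounded B" and g: "g \<in> PW (A \<times> B)" and k: "continuous_on UNIV k"
  shows "(\<lambda>y. \<integral>x. k x * g (x, y) \<partial>lborel) \<in> PW B"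
proof -
  obtain r where r: "A \<subseteq> cball 0 r" using bounded_obtain_cball[OF A] .
  have gm[measurable]: "g \<in> borel_measurable borel" using g by (rule PW_measurable)
  have km[measurable]: "k \<in> borel_measurable borel" using k by (rule borel_measurable_continuous_onI)
  have gm2[measurable]: "g \<in> borel_measurable (borel \<Otimes>\<^sub>M borel)" using gm by (simp add: borel_prod)
  have m: "(\<lambda>y. \<integral>x. k x * g (x, y) \<partial>lborel) \<in> borel_measurable borel"
    by measurable
  define k' where "k' x = indicator (cball 0 r) x * k x" for x
  have k'm[measurable]: "k' \<in> borel_measurable borel" unfolding k'_def using km by (intro borel_measurable_times borel_measurable_indicator) auto
  have "compact (k ` cball 0 r)"
    by (rule compact_continuous_image[OF continuous_on_subset[OF k]]) auto
  then obtain C where C: "\<forall>y\<in>k ` cball 0 r. norm y \<le> C"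
    using compact_imp_bounded bounded_iff by blast
  have k'2: "integrable lborel (\<lambda>x. (cmod (k' x))\<^sup>2)"
  proof (rule Bochner_Integration.integrable_bound)
    show "integrable lborel (\<lambda>x::'a. C\<^sup>2 * indicator (cball 0 r) x)"
      using emeasure_lborel_cball_finite[of "0::'a" r]
      by (intro integrable_mult_right integrable_real_indicator) simp_all
    show "AE x in lborel. norm ((cmod (k' x))\<^sup>2) \<le> norm (C\<^sup>2 * indicator (cball 0 r) x)"
      using C by (intro AE_I2) (auto simp: k'_def split: split_indicator intro!: power_mono)
  qed measurable
  have eq: "(\<integral>x. k x * g (x, y) \<partial>lborel) = (\<integral>x. k' x * g (x, y) \<partial>lborel)" for y
  proof (intro Bochner_Integration.integral_cong refl)
    fix x show "k x * g (x, y) = k' x * g (x, y)"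
      using g r by (cases "x \<in> A") (auto simp: PW_def k'_def)
  qed
  define D where "D = (\<integral>x. (cmod (k' x))\<^sup>2 \<partial>lborel)"
  have D: "D \<ge> 0" by (simp add: D_def)
  have "nsq g < \<infinity>" using PW_L2[OF g] by (simp add: L2_iff_nsq)
  then have "(\<integral>\<^sup>+y. nsq (\<lambda>x. g (x, y)) \<partial>lborel) \<noteq> \<infinity>" by (simp add: nsq_pair(1)[OF gm])
  then have AE: "AE y in lborel. nsq (\<lambda>x. g (x, y)) \<noteq> \<infinity>"
    by (rule nn_integral_PInf_AE[rotated]) (simp add: nsq_def)
  have "nsq (\<lambda>y. \<integral>x. k x * g (x, y) \<partial>lborel) \<le> (\<integral>\<^sup>+y. ennreal D * nsq (\<lambda>x. g (x, y)) \<partial>lborel)"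
    unfolding nsq_def[of "\<lambda>y. \<integral>x. k x * g (x, y) \<partial>lborel"]
  proof (rule nn_integral_mono_AE, use AE in eventually_elim)
    case (elim y)
    have sm: "(\<lambda>x. g (x, y)) \<in> borel_measurable borel" by measurable
    then have L: "(\<lambda>x. g (x, y)) \<in> L2" using elim by (auto simp: L2_iff_nsq less_top[symmetric])
    have "(cmod (\<integral>x. k' x * g (x, y) \<partial>lborel))\<^sup>2 \<le> D * (\<integral>x. (cmod (g (x, y)))\<^sup>2 \<partial>lborel)"
      unfolding D_def by (rule norm_integral_mult_le(2)) (use k'2 L2_integrable[OF L] sm in auto)
    then show ?case unfolding eq nsq_eq_integral[OF L] using D by (simp add: ennreal_leI flip: ennreal_mult)
  qed
  also have "\<dots> = ennreal D * nsq g"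
    unfolding nsq_pair(1)[OF gm] by (rule nn_integral_cmult) (simp add: nsq_def)
  also have "\<dots> < \<infinity>" using \<open>nsq g < \<infinity>\<close> by (simp add: ennreal_mult_less_top)
  finally have "(\<lambda>y. \<integral>x. k x * g (x, y) \<partial>lborel) \<in> L2" using m by (simp add: L2_iff_nsq)
  moreover have "(\<integral>x. k x * g (x, y) \<partial>lborel) = 0" if "y \<notin> B" for y
    using g that by (simp add: PW_def)
  ultimately show ?thesis by (auto simp: PW_def)
qed

text \<open>By Fubini a multiplier in the first variable and the evaluation at \<open>a\<close> can
  be absorbed into a spectrum for the second variable; \<open>PW_partial\<close> shows that it is
  band-limited again.\<close>

lemma ift_partial:
  fixes g :: "'a::euclidean_space \<times> 'b::euclidean_space \<Rightarrow> complex"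
  assumes A: "bounded A" and B: "bounded B" and g: "g \<in> PW (A \<times> B)" and k: "continuous_on UNIV k"
  shows "ift (\<lambda>p. k (fst p) * g p) (a, b) = ift (\<lambda>y. \<integral>x. (k x * exp (\<i> * complex_of_real (x \<bullet> a))) * g (x, y) \<partial>lborel) b"
proof -
  let ?E = "\<lambda>p. exp (\<i> * complex_of_real (p \<bullet> (a, b)))"
  have AB: "bounded (A \<times> B)" using A B by (rule bounded_Times)
  have "continuous_on UNIV (\<lambda>p::'a \<times> 'b. k (fst p))"
    by (rule continuous_on_compose2[OF k]) (auto intro: continuous_intros)
  then have "(\<lambda>p. k (fst p) * g p) \<in> PW (A \<times> B)" by (rule PW_mult_continuous[OF AB g])
  then have "integrable lborel (\<lambda>p. k (fst p) * g p * ?E p)"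
    by (intro ift_integrable PW_integrable[OF AB])
  then have int: "integrable (lborel \<Otimes>\<^sub>M lborel) (case_prod (\<lambda>x y. k x * g (x, y) * ?E (x, y)))"
    by (simp only: lborel_prod split_def prod.collapse)
  have "ift (\<lambda>p. k (fst p) * g p) (a, b) = (\<integral>p. case_prod (\<lambda>x y. k x * g (x, y) * ?E (x, y)) p \<partial>(lborel \<Otimes>\<^sub>M lborel))"
    unfolding ift_def lborel_prod by (simp only: split_def prod.collapse)
  also have "\<dots> = (\<integral>y. (\<integral>x. k x * g (x, y) * ?E (x, y) \<partial>lborel) \<partial>lborel)"
    by (rule lborel_pair.integral_snd[OF int, symmetric])
  also have "\<dots> = (\<integral>y. (\<integral>x. ((k x * exp (\<i> * complex_of_real (x \<bullet> a))) * g (x, y)) * exp (\<i> * complex_of_real (y \<bullet> b)) \<partial>lborel) \<partial>lborel)"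
    by (simp add: inner_prod_def distrib_left exp_add mult_ac)
  also have "\<dots> = ift (\<lambda>y. \<integral>x. (k x * exp (\<i> * complex_of_real (x \<bullet> a))) * g (x, y) \<partial>lborel) b"
    unfolding ift_def integral_mult_left_zero ..
  finally show ?thesis .
qed

lemma ift_swap:
  fixes g :: "'a::euclidean_space \<times> 'b::euclidean_space \<Rightarrow> complex"
  assumes g: "integrable lborel g"
  shows "ift g (a, b) = ift (\<lambda>p. g (snd p, fst p)) (b, a)"
proof -
  let ?h = "\<lambda>p. g p * exp (\<i> * complex_of_real (p \<bullet> (a, b)))"
  have "integrable (lborel \<Otimes>\<^sub>M lborel) ?h"
    using ift_integrable[OF g, of "(a, b)"] by (simp add: lborel_prod)
  then have "(\<integral>(x, y). ?h (y, x) \<partial>(lborel \<Otimes>\<^sub>M lborel)) = integral\<^sup>L (lborel \<Otimes>\<^sub>M lborel) ?h"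
    by (intro lborel_pair.integral_product_swap) auto
  then show ?thesis
    unfolding ift_def lborel_prod by (simp add: split_def inner_prod_def add.commute)
qed

section \<open>Multi-indices and the multinomial theorem\<close>

lemma finite_multiindex: "finite {\<alpha> :: 'n::finite \<Rightarrow> nat. mi_abs \<alpha> \<le> k}"
proof (rule finite_subset)
  show "{\<alpha> :: 'n \<Rightarrow> nat. mi_abs \<alpha> \<le> k} \<subseteq> PiE UNIV (\<lambda>_. {..k})"
  proof (clarsimp simp: mi_abs_def PiE_iff)
    fix \<alpha> :: "'n \<Rightarrow> nat" and j assume "sum \<alpha> UNIV \<le> k"
    moreover have "\<alpha> j \<le> sum \<alpha> UNIV" by (rule member_le_sum) auto
    ultimately show "\<alpha> j \<le> k" by linarith
  qed
  show "finite (PiE UNIV (\<lambda>_::'n. {..k}))" by (intro finite_PiE) auto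
qed

text \<open>Dividing by factorials turns the binomial theorem into a plain convolution. It separates
  the exponent \<open>i\<close> of a new index \<open>a\<close>, and \<open>(i, \<alpha>)\<close>
  corresponds to \<open>\<alpha>(a := i)\<close>.\<close>

lemma multinomial_set:
  fixes x :: "'n::finite \<Rightarrow> 'a::field_char_0"
  assumes "finite J"
  shows "(\<Sum>j\<in>J. x j) ^ r / fact r =
    (\<Sum>\<alpha> | (\<forall>j. j \<notin> J \<longrightarrow> \<alpha> j = 0) \<and> sum \<alpha> J = r. \<Prod>j\<in>J. x j ^ \<alpha> j / fact (\<alpha> j))"
  using assms
proof (induction J arbitrary: r rule: finite_induct)
  case empty
  have "{\<alpha> :: 'n \<Rightarrow> nat. \<forall>j. \<alpha> j = 0} = {\<lambda>_. 0}" by auto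
  then show ?case by (cases r) auto
next
  case (insert a J)
  let ?S = "\<lambda>J r. {\<alpha> :: 'n \<Rightarrow> nat. (\<forall>j. j \<notin> J \<longrightarrow> \<alpha> j = 0) \<and> sum \<alpha> J = r}"
  let ?t = "\<lambda>J \<alpha>. \<Prod>j\<in>J. x j ^ \<alpha> j / fact (\<alpha> j)"
  have fin: "finite (?S J r)" if "finite J" for J r
  proof (rule finite_subset[OF _ finite_multiindex[of r]])
    show "?S J r \<subseteq> {\<alpha>. mi_abs \<alpha> \<le> r}"
    proof (clarsimp simp: mi_abs_def)
      fix \<alpha> :: "'n \<Rightarrow> nat" assume "\<forall>j. j \<notin> J \<longrightarrow> \<alpha> j = 0"
      then have "sum \<alpha> UNIV = sum \<alpha> J" using that by (intro sum.mono_neutral_right) auto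
      then show "sum \<alpha> UNIV \<le> sum \<alpha> J" by simp
    qed
  qed
  have "(\<Sum>j\<in>insert a J. x j) ^ r / fact r = (\<Sum>i\<le>r. (x a ^ i / fact i) * ((\<Sum>j\<in>J. x j) ^ (r - i) / fact (r - i)))"
    using insert.hyps by (simp add: binomial_ring sum_divide_distrib binomial_fact)
  also have "\<dots> = (\<Sum>i\<le>r. \<Sum>\<alpha>\<in>?S J (r - i). (x a ^ i / fact i) * ?t J \<alpha>)"
    unfolding insert.IH sum_distrib_left ..
  also have "\<dots> = (\<Sum>(i, \<alpha>)\<in>(SIGMA i:{..r}. ?S J (r - i)). (x a ^ i / fact i) * ?t J \<alpha>)"
    by (rule sum.Sigma) (use fin insert.hyps in auto)
  also have "\<dots> = (\<Sum>\<alpha>\<in>?S (insert a J) r. ?t (insert a J) \<alpha>)"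
  proof (rule sum.reindex_bij_witness[where j="\<lambda>(i, \<alpha>). \<alpha>(a := i)" and i="\<lambda>\<alpha>. (\<alpha> a, \<alpha>(a := 0))"])
    fix p assume p: "p \<in> (SIGMA i:{..r}. ?S J (r - i))"
    obtain i \<alpha> where p': "p = (i, \<alpha>)" by fastforce
    have \<alpha>a: "\<alpha> a = 0" using p p' insert.hyps by auto
    have same: "sum (\<alpha>(a := i)) J = sum \<alpha> J" "?t J (\<alpha>(a := i)) = ?t J \<alpha>"
      using insert.hyps by (auto intro!: sum.cong prod.cong)
    show "(\<lambda>\<alpha>. (\<alpha> a, \<alpha>(a := 0))) ((\<lambda>(i, \<alpha>). \<alpha>(a := i)) p) = p" using \<alpha>a p' by auto
    show "(\<lambda>(i, \<alpha>). \<alpha>(a := i)) p \<in> ?S (insert a J) r"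
      using p p' insert.hyps same(1) by auto
    show "?t (insert a J) ((\<lambda>(i, \<alpha>). \<alpha>(a := i)) p) = (case p of (i, \<alpha>) \<Rightarrow> (x a ^ i / fact i) * ?t J \<alpha>)"
      using p' insert.hyps same(2) by (simp del: prod_dividef)
  next
    fix \<alpha> assume \<alpha>: "\<alpha> \<in> ?S (insert a J) r"
    have "sum (\<alpha>(a := 0)) J = sum \<alpha> J" using insert.hyps by (auto intro!: sum.cong)
    moreover have "\<alpha> a + sum \<alpha> J = r" using \<alpha> insert.hyps by simp
    ultimately show "(\<alpha> a, \<alpha>(a := 0)) \<in> (SIGMA i:{..r}. ?S J (r - i))" using \<alpha> by auto
    show "(\<lambda>(i, \<alpha>). \<alpha>(a := i)) (\<alpha> a, \<alpha>(a := 0)) = \<alpha>" by simp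
  qed
  finally show ?case .
qed

lemma multinomial:
  fixes x :: "'n::finite \<Rightarrow> 'a::field_char_0"
  shows "(\<Sum>\<alpha> | mi_abs \<alpha> = r. \<Prod>j\<in>UNIV. x j ^ \<alpha> j / fact (\<alpha> j)) = (\<Sum>j\<in>UNIV. x j) ^ r / fact r"
  using multinomial_set[of UNIV x r] by (simp add: mi_abs_def)

lemma sum_multiindex_le:
  fixes x :: "'n::finite \<Rightarrow> 'a::field_char_0"
  shows "(\<Sum>\<alpha> | mi_abs \<alpha> \<le> k. \<Prod>j\<in>UNIV. x j ^ \<alpha> j / fact (\<alpha> j)) = (\<Sum>r\<le>k. (\<Sum>j\<in>UNIV. x j) ^ r / fact r)"
proof -
  have "(\<Sum>r\<le>k. (\<Sum>j\<in>UNIV. x j) ^ r / fact r) = (\<Sum>r\<le>k. \<Sum>\<alpha> | \<alpha> \<in> {\<alpha>. mi_abs \<alpha> \<le> k} \<and> mi_abs \<alpha> = r. \<Prod>j\<in>UNIV. x j ^ \<alpha> j / fact (\<alpha> j))"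
    unfolding multinomial[symmetric] by (intro sum.cong refl) auto
  also have "\<dots> = (\<Sum>\<alpha> | mi_abs \<alpha> \<le> k. \<Prod>j\<in>UNIV. x j ^ \<alpha> j / fact (\<alpha> j))"
    by (rule sum.group) (auto simp: finite_multiindex)
  finally show ?thesis ..
qed

section \<open>The inequalities of Wirtinger and Poincare\<close>

lemma nn_integral_Icc:
  fixes \<phi> :: "real \<Rightarrow> real"
  assumes c: "continuous_on {a..b} \<phi>" and nn: "\<And>x. 0 \<le> \<phi> x"
  shows "(\<integral>\<^sup>+x. ennreal (\<phi> x) * indicator {a..b} x \<partial>lborel) = ennreal (integral {a..b} \<phi>)"
proof -
  have si: "set_integrable lborel {a..b} \<phi>"
    unfolding set_integrable_def by (rule borel_integrable_compact[OF _ c]) simp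
  have "(\<integral>\<^sup>+x. ennreal (\<phi> x) * indicator {a..b} x \<partial>lborel) = (\<integral>\<^sup>+x. ennreal (indicator {a..b} x *\<^sub>R \<phi> x) \<partial>lborel)"
    by (intro nn_integral_cong) (auto split: split_indicator)
  also have "\<dots> = ennreal (\<integral>x. indicator {a..b} x *\<^sub>R \<phi> x \<partial>lborel)"
    by (rule nn_integral_eq_integral) (use si nn in \<open>auto simp: set_integrable_def\<close>)
  also have "(\<integral>x. indicator {a..b} x *\<^sub>R \<phi> x \<partial>lborel) = integral {a..b} \<phi>"
    using set_borel_integral_eq_integral(2)[OF si] by (simp add: set_lebesgue_integral_def)
  finally show ?thesis .
qed

lemma nn_integral_Icc_split:
  fixes \<phi> :: "real \<Rightarrow> ennreal"
  assumes m[measurable]: "\<phi> \<in> borel_measurable borel" and pz: "p \<le> z" "z \<le> q"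
  shows "(\<integral>\<^sup>+x. \<phi> x * indicator {p..q} x \<partial>lborel) =
    (\<integral>\<^sup>+x. \<phi> x * indicator {p..z} x \<partial>lborel) + (\<integral>\<^sup>+x. \<phi> x * indicator {z..q} x \<partial>lborel)"
proof -
  have "(\<integral>\<^sup>+x. \<phi> x * indicator {p..q} x \<partial>lborel) = (\<integral>\<^sup>+x. \<phi> x * indicator {p..z} x + \<phi> x * indicator {z..q} x \<partial>lborel)"
  proof (rule nn_integral_cong_AE)
    show "AE x in lborel. \<phi> x * indicator {p..q} x = \<phi> x * indicator {p..z} x + \<phi> x * indicator {z..q} x"
      using AE_lborel_singleton[of z] by eventually_elim (use pz in \<open>auto split: split_indicator\<close>)
  qed
  also have "\<dots> = (\<integral>\<^sup>+x. \<phi> x * indicator {p..z} x \<partial>lborel) + (\<integral>\<^sup>+x. \<phi> x * indicator {z..q} x \<partial>lborel)"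
    by (rule nn_integral_add) measurable
  finally show ?thesis .
qed

text \<open>The function \<open>\<Psi>\<close> below has derivative \<open>norm (f' - c cot (c (x - a)) f) ^ 2\<close>.\<close>

lemma wirtinger_left:
  fixes f f' :: "real \<Rightarrow> complex"
  assumes ab: "a < b" and der: "\<And>x. (f has_vector_derivative f' x) (at x)"
    and cont: "continuous_on UNIV f'" and f0: "f a = 0"
  shows "integral {a..b} (\<lambda>x. (cmod (f x))\<^sup>2) \<le> (2 * (b - a) / pi)\<^sup>2 * integral {a..b} (\<lambda>x. (cmod (f' x))\<^sup>2)"
proof -
  \<comment> \<open>With this \<open>c\<close>, \<open>cot (c * (b - a))\<close> vanishes, so the
    boundary term of \<open>\<Psi>\<close> at \<open>b\<close> disappears.\<close>
  define c where "c = pi / (2 * (b - a))"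
  have c: "c > 0" using ab by (simp add: c_def)
  have cb: "c * (b - a) = pi / 2" unfolding c_def using ab by (simp add: divide_simps)
  have fc: "continuous_on UNIV f"
    using der has_vector_derivative_continuous by (blast intro: continuous_at_imp_continuous_on)
  define u where "u x = f x \<bullet> f x" for x
  have u: "u x = (cmod (f x))\<^sup>2" for x by (simp add: u_def power2_norm_eq_inner)
  have du: "(u has_real_derivative 2 * (f x \<bullet> f' x)) (at x)" for x
  proof -
    have "(f has_derivative (\<lambda>h. h *\<^sub>R f' x)) (at x)" using der[of x] by (simp add: has_vector_derivative_def)
    from has_derivative_inner[OF this this]
    have "((\<lambda>x. f x \<bullet> f x) has_derivative (\<lambda>h. f x \<bullet> (h *\<^sub>R f' x) + (h *\<^sub>R f' x) \<bullet> f x)) (at x)" .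
    moreover have "(\<lambda>h. f x \<bullet> (h *\<^sub>R f' x) + (h *\<^sub>R f' x) \<bullet> f x) = (*) (2 * (f x \<bullet> f' x))"
      by (rule ext) (simp add: inner_commute[of "f' x"])
    ultimately show ?thesis unfolding has_field_derivative_def u_def[abs_def] by simp
  qed
  define G where "G x = (cmod (f' x))\<^sup>2 - c\<^sup>2 * u x" for x
  have uc: "continuous_on S u" for S unfolding u_def using continuous_on_subset[OF fc] by (auto intro!: continuous_intros)
  have Gc: "continuous_on S G" for S unfolding G_def
    using continuous_on_subset[OF cont] uc by (auto intro!: continuous_intros)
  define \<phi> where "\<phi> x = c * cot (c * (x - a)) * u x" for x
  define \<Psi> where "\<Psi> x = integral {a..x} G - \<phi> x" for x
  have sin_pos: "sin (c * (x - a)) > 0" if "a < x" "x \<le> b" for x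
  proof (rule sin_gt_zero)
    show "0 < c * (x - a)" using that c by simp
    have "c * (x - a) \<le> c * (b - a)" using that c by (intro mult_left_mono) auto
    then show "c * (x - a) < pi" using cb pi_gt_zero by linarith
  qed
  have d\<phi>: "(\<phi> has_real_derivative (c * (- c / (sin (c * (x - a)))\<^sup>2) * u x + c * cot (c * (x - a)) * (2 * (f x \<bullet> f' x)))) (at x)"
    if "a < x" "x \<le> b" for x
  proof -
    have s: "sin (c * (x - a)) \<noteq> 0" using sin_pos[OF that] by simp
    have "((\<lambda>x. c * (x - a)) has_real_derivative c) (at x)" by (auto intro!: derivative_eq_intros)
    from DERIV_chain2[OF DERIV_cot[OF s] this]
    have "((\<lambda>x. cot (c * (x - a))) has_real_derivative - c / (sin (c * (x - a)))\<^sup>2) (at x)"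
      by (simp add: divide_inverse mult.commute)
    from DERIV_mult[OF DERIV_cmult[OF this, of c] du[of x]]
    show ?thesis unfolding \<phi>_def[abs_def] by (simp add: algebra_simps)
  qed
  have "\<Psi> a \<le> \<Psi> b"
  proof (rule DERIV_nonneg_imp_increasing_open[of a b \<Psi>])
    show "a \<le> b" using ab by simp
    fix x assume x: "a < x" "x < b"
    define s where "s = sin (c * (x - a))"
    define k where "k = c * cot (c * (x - a))"
    have s: "s > 0" using sin_pos x unfolding s_def by simp
    \<comment> \<open>1 / sin^2 = 1 + cot^2: this completes the square in the derivative of
      \<open>\<Psi>\<close>.\<close>
    have k2: "c\<^sup>2 / s\<^sup>2 = c\<^sup>2 + k\<^sup>2"
      using s unfolding k_def cot_def s_def[symmetric]
      by (simp add: field_simps power2_eq_square cos_squared_eq[unfolded power2_eq_square] s_def)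
    have "((\<lambda>x. integral {a..x} G) has_real_derivative G x) (at x within {a..b})"
      by (rule integral_has_real_derivative[OF Gc]) (use x in auto)
    then have "((\<lambda>x. integral {a..x} G) has_real_derivative G x) (at x)"
      using x by (simp add: at_within_Icc_at)
    from DERIV_diff[OF this d\<phi>[of x]] x
    have "(\<Psi> has_real_derivative G x - (c * (- c / s\<^sup>2) * u x + k * (2 * (f x \<bullet> f' x)))) (at x)"
      unfolding \<Psi>_def[abs_def] s_def k_def by simp
    moreover have "G x - (c * (- c / s\<^sup>2) * u x + k * (2 * (f x \<bullet> f' x))) = (norm (f' x - k *\<^sub>R f x))\<^sup>2"
    proof -
      have "G x - (c * (- c / s\<^sup>2) * u x + k * (2 * (f x \<bullet> f' x))) =
        (cmod (f' x))\<^sup>2 - c\<^sup>2 * u x + (c\<^sup>2 / s\<^sup>2) * u x - 2 * k * (f x \<bullet> f' x)"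
        unfolding G_def by (simp add: power2_eq_square)
      also have "\<dots> = (cmod (f' x))\<^sup>2 + k\<^sup>2 * u x - 2 * k * (f x \<bullet> f' x)"
        unfolding k2 by (simp add: algebra_simps)
      also have "\<dots> = (norm (f' x - k *\<^sub>R f x))\<^sup>2"
      proof -
        have "f' x \<bullet> f x = f x \<bullet> f' x" by (rule inner_commute)
        then show ?thesis unfolding u_def power2_norm_eq_inner
          by (simp add: inner_diff_left inner_diff_right power2_eq_square algebra_simps)
      qed
      finally show ?thesis .
    qed
    ultimately show "\<exists>y. DERIV \<Psi> x :> y \<and> y \<ge> 0" by (metis zero_le_power2)
  next
    have "continuous_on {a..b} (\<lambda>x. integral {a..x} G)"
      by (rule indefinite_integral_continuous_1) (rule integrable_continuous_real[OF Gc])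
    moreover have "continuous_on {a..b} \<phi>"
      unfolding continuous_on_eq_continuous_within
    proof
      fix x assume x: "x \<in> {a..b}"
      show "continuous (at x within {a..b}) \<phi>"
      proof (cases "x = a")
        case False
        then have "isCont \<phi> x" using x by (intro DERIV_isCont[OF d\<phi>]) auto
        then show ?thesis by (rule continuous_at_imp_continuous_at_within)
      next
        case True
        \<comment> \<open>The cotangent has a simple pole at \<open>a\<close>, but
          \<open>u = |f|^2\<close> has a zero there with vanishing derivative, so that
          \<open>\<phi>\<close> is continuous with value 0.\<close>
        have l1: "((\<lambda>x. (u x - u a) / (x - a)) \<longlongrightarrow> 0) (at a)"
          using du[of a] f0 by (simp add: has_field_derivative_iff)
        have "((\<lambda>x. sin (c * (x - a))) has_real_derivative c) (at a)"
          by (auto intro!: derivative_eq_intros)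
        then have l2: "((\<lambda>x. sin (c * (x - a)) / (x - a)) \<longlongrightarrow> c) (at a)"
          by (simp add: has_field_derivative_iff)
        have l3: "((\<lambda>x. c * cos (c * (x - a))) \<longlongrightarrow> c * cos (c * (a - a))) (at a)"
          by (intro tendsto_intros)
        have "((\<lambda>x. c * cos (c * (x - a)) * ((u x - u a) / (x - a)) / (sin (c * (x - a)) / (x - a)))
            \<longlongrightarrow> c * cos (c * (a - a)) * 0 / c) (at a)"
          by (rule tendsto_divide[OF tendsto_mult[OF l3 l1] l2]) (use c in simp)
        then have l4: "((\<lambda>x. c * cos (c * (x - a)) * ((u x - u a) / (x - a)) / (sin (c * (x - a)) / (x - a))) \<longlongrightarrow> 0) (at a)"
          by simp
        have "\<forall>\<^sub>F x in at a. c * cos (c * (x - a)) * ((u x - u a) / (x - a)) / (sin (c * (x - a)) / (x - a)) = \<phi> x"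
          by (auto simp: eventually_at_filter \<phi>_def cot_def u_def f0 intro!: always_eventually)
        then have "(\<phi> \<longlongrightarrow> 0) (at a)"
          by (rule Lim_transform_eventually[OF l4])
        then have "isCont \<phi> a" by (simp add: isCont_def \<phi>_def u_def f0)
        then show ?thesis unfolding True by (rule continuous_at_imp_continuous_at_within)
      qed
    qed
    ultimately show "continuous_on {a..b} \<Psi>" unfolding \<Psi>_def by (rule continuous_on_diff)
  qed
  moreover have "\<Psi> a = 0" by (simp add: \<Psi>_def \<phi>_def u_def f0)
  moreover have "\<Psi> b = integral {a..b} G" by (simp add: \<Psi>_def \<phi>_def cb cot_def)
  moreover have "integral {a..b} G = integral {a..b} (\<lambda>x. (cmod (f' x))\<^sup>2) - c\<^sup>2 * integral {a..b} u"
  proof -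
    have "(\<lambda>x. (cmod (f' x))\<^sup>2) integrable_on {a..b}"
      by (intro integrable_continuous_real continuous_intros continuous_on_subset[OF cont]) auto
    moreover have "(\<lambda>x. c\<^sup>2 * u x) integrable_on {a..b}"
      by (intro integrable_continuous_real continuous_intros uc)
    ultimately show ?thesis
      unfolding G_def by (simp add: Henstock_Kurzweil_Integration.integral_diff)
  qed
  ultimately have "c\<^sup>2 * integral {a..b} u \<le> integral {a..b} (\<lambda>x. (cmod (f' x))\<^sup>2)" by linarith
  then have "integral {a..b} u \<le> (1 / c)\<^sup>2 * integral {a..b} (\<lambda>x. (cmod (f' x))\<^sup>2)"
    using c by (simp add: field_simps)
  moreover have "1 / c = 2 * (b - a) / pi" by (simp add: c_def)
  ultimately show ?thesis by (simp only: u[abs_def])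
qed

text \<open>The zero at the right end point is reduced to the left one by reflection. The bound uses
  \<open>\<delta>\<close> instead of the length, so that one constant serves all cells.\<close>

lemma wirtinger_nn:
  fixes f f' :: "real \<Rightarrow> complex"
  assumes der: "\<And>x. (f has_vector_derivative f' x) (at x)"
    and cont: "continuous_on UNIV f'" and ab: "a \<le> b" and len: "b - a \<le> \<delta>"
  shows "(\<integral>\<^sup>+x. ennreal ((cmod (f x - f a))\<^sup>2) * indicator {a..b} x \<partial>lborel)
      \<le> ennreal ((2 * \<delta> / pi)\<^sup>2) * (\<integral>\<^sup>+x. ennreal ((cmod (f' x))\<^sup>2) * indicator {a..b} x \<partial>lborel)" (is ?left)
    and "(\<integral>\<^sup>+x. ennreal ((cmod (f x - f b))\<^sup>2) * indicator {a..b} x \<partial>lborel)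
      \<le> ennreal ((2 * \<delta> / pi)\<^sup>2) * (\<integral>\<^sup>+x. ennreal ((cmod (f' x))\<^sup>2) * indicator {a..b} x \<partial>lborel)" (is ?right)
proof -
  have fc: "continuous_on UNIV f"
    using der has_vector_derivative_continuous by (blast intro: continuous_at_imp_continuous_on)
  note c' = continuous_on_subset[OF cont subset_UNIV] and fc' = continuous_on_subset[OF fc subset_UNIV]
  have step: "ennreal (integral {a..b} (\<lambda>x. (cmod (f x - w))\<^sup>2)) \<le> ennreal ((2 * \<delta> / pi)\<^sup>2) * ennreal (integral {a..b} (\<lambda>x. (cmod (f' x))\<^sup>2))"
    if "a < b" "integral {a..b} (\<lambda>x. (cmod (f x - w))\<^sup>2) \<le> (2 * (b - a) / pi)\<^sup>2 * integral {a..b} (\<lambda>x. (cmod (f' x))\<^sup>2)" for w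
  proof -
    have n: "0 \<le> integral {a..b} (\<lambda>x. (cmod (f' x))\<^sup>2)"
      by (intro Henstock_Kurzweil_Integration.integral_nonneg integrable_continuous_real continuous_intros c') auto
    have "(2 * (b - a) / pi)\<^sup>2 \<le> (2 * \<delta> / pi)\<^sup>2"
      using ab len by (intro power_mono divide_right_mono) auto
    then have "integral {a..b} (\<lambda>x. (cmod (f x - w))\<^sup>2) \<le> (2 * \<delta> / pi)\<^sup>2 * integral {a..b} (\<lambda>x. (cmod (f' x))\<^sup>2)"
      using that(2) mult_right_mono[OF _ n] by (meson order_trans)
    then show ?thesis using n by (simp add: ennreal_leI flip: ennreal_mult)
  qed
  have nn: "(\<integral>\<^sup>+x. ennreal ((cmod (f x - w))\<^sup>2) * indicator {a..b} x \<partial>lborel) = ennreal (integral {a..b} (\<lambda>x. (cmod (f x - w))\<^sup>2))" for w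
    by (intro nn_integral_Icc continuous_intros fc') auto
  have nn': "(\<integral>\<^sup>+x. ennreal ((cmod (f' x))\<^sup>2) * indicator {a..b} x \<partial>lborel) = ennreal (integral {a..b} (\<lambda>x. (cmod (f' x))\<^sup>2))"
    by (intro nn_integral_Icc continuous_intros c') auto
  show ?left
  proof (cases "a = b")
    case False
    then have "a < b" using ab by simp
    moreover have "((\<lambda>x. f x - f a) has_vector_derivative f' x) (at x)" for x
      using has_vector_derivative_diff[OF der has_vector_derivative_const] by simp
    ultimately show ?thesis unfolding nn nn' by (intro step wirtinger_left[OF _ _ cont]) auto
  next
    case True
    then show ?thesis unfolding nn nn' by simp
  qed
  show ?right
  proof (cases "a = b")
    case False
    then have "a < b" using ab by simp
    let ?g = "\<lambda>x. f (- x) - f b" and ?g' = "\<lambda>x. - f' (- x)"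
    have "(?g has_vector_derivative ?g' x) (at x)" for x
    proof -
      have "((\<lambda>x. - x :: real) has_vector_derivative (-1)) (at x)" by (auto intro!: derivative_eq_intros)
      from vector_diff_chain_at[OF this der]
      have "(f \<circ> uminus has_vector_derivative (-1) *\<^sub>R f' (- x)) (at x)" .
      from has_vector_derivative_diff[OF this has_vector_derivative_const[of "f b"]]
      show ?thesis by (simp add: o_def)
    qed
    moreover have "continuous_on UNIV ?g'"
      by (intro continuous_intros continuous_on_compose2[OF cont]) auto
    ultimately have "integral {-b..-a} (\<lambda>x. (cmod (?g x))\<^sup>2) \<le> (2 * (- a - (- b)) / pi)\<^sup>2 * integral {-b..-a} (\<lambda>x. (cmod (?g' x))\<^sup>2)"
      using \<open>a < b\<close> by (intro wirtinger_left) auto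
    moreover have "integral {-b..-a} (\<lambda>x. (cmod (?g x))\<^sup>2) = integral {a..b} (\<lambda>x. (cmod (f x - f b))\<^sup>2)"
      by (rule Henstock_Kurzweil_Integration.integral_reflect_real)
    moreover have "integral {-b..-a} (\<lambda>x. (cmod (?g' x))\<^sup>2) = integral {a..b} (\<lambda>x. (cmod (f' x))\<^sup>2)"
      unfolding norm_minus_cancel by (rule Henstock_Kurzweil_Integration.integral_reflect_real)
    ultimately show ?thesis unfolding nn nn' using \<open>a < b\<close> by (intro step) auto
  next
    case True
    then show ?thesis unfolding nn nn' by simp
  qed
qed

text \<open>The constant 2 / pi belongs to a zero at an end point, so the cell is cut at its
  sampling point.\<close>

lemma wirtinger_cell:
  fixes f f' :: "real \<Rightarrow> complex"
  assumes der: "\<And>x. (f has_vector_derivative f' x) (at x)"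
    and cont: "continuous_on UNIV f'" and z: "p \<le> z" "z \<le> q" "z - p \<le> \<delta>" "q - z \<le> \<delta>"
  shows "(\<integral>\<^sup>+x. ennreal ((cmod (f x - f z))\<^sup>2) * indicator {p..q} x \<partial>lborel)
      \<le> ennreal ((2 * \<delta> / pi)\<^sup>2) * (\<integral>\<^sup>+x. ennreal ((cmod (f' x))\<^sup>2) * indicator {p..q} x \<partial>lborel)"
proof -
  have fc: "continuous_on UNIV f"
    using der has_vector_derivative_continuous by (blast intro: continuous_at_imp_continuous_on)
  have [measurable]: "f \<in> borel_measurable borel" "f' \<in> borel_measurable borel"
    using fc cont by (auto intro: borel_measurable_continuous_onI)
  show ?thesis
    by (subst (1 2) nn_integral_Icc_split[OF _ z(1,2)])
      (auto simp: distrib_left intro!: add_mono wirtinger_nn[OF der cont] z)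
qed

section \<open>Weak derivatives and the Poincare constant\<close>

definition ramp :: "real \<Rightarrow> real" where
  "ramp r = 2 * ((max 0 r)\<^sup>2 - 2 * (max 0 (r - 1 / 2))\<^sup>2 + (max 0 (r - 1))\<^sup>2)"

text \<open>A hat of mass 1 on [0, 1], with antiderivative \<open>ramp\<close>. Test functions of
  \<open>weak_deriv_on\<close> are continuously differentiable, which is why the step
  \<open>ramp\<close> is quadratic and not linear; combining squares of \<open>max\<close> reduces
  its differentiation to a single function.\<close>

definition ramp' :: "real \<Rightarrow> real" where
  "ramp' r = 4 * (max 0 r - 2 * max 0 (r - 1 / 2) + max 0 (r - 1))"

lemma ramp_eq:
  "ramp r = (if r \<le> 0 then 0 else if r \<le> 1 / 2 then 2 * r\<^sup>2 else if r \<le> 1 then 1 - 2 * (1 - r)\<^sup>2 else 1)"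
  unfolding ramp_def by (auto simp: max_def power2_eq_square algebra_simps)

lemma ramp_bounds: "0 \<le> ramp r" "ramp r \<le> 1" "r \<le> 0 \<Longrightarrow> ramp r = 0" "r \<ge> 1 \<Longrightarrow> ramp r = 1"
proof -
  have 1: "2 * r\<^sup>2 \<le> 1" if "0 < r" "r \<le> 1 / 2"
  proof -
    have "r\<^sup>2 \<le> (1 / 2)\<^sup>2" using that by (intro power_mono) auto
    then show ?thesis by (simp add: power2_eq_square)
  qed
  have 2: "2 * (1 - r)\<^sup>2 \<le> 1" if "1 / 2 < r" "r \<le> 1"
  proof -
    have "(1 - r)\<^sup>2 \<le> (1 / 2)\<^sup>2" using that by (intro power_mono) auto
    then show ?thesis by (simp add: power2_eq_square)
  qed
  show "0 \<le> ramp r" "ramp r \<le> 1" using 1 2 by (auto simp: ramp_eq)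
  show "r \<le> 0 \<Longrightarrow> ramp r = 0" by (simp add: ramp_eq)
  show "r \<ge> 1 \<Longrightarrow> ramp r = 1" by (auto simp: ramp_eq)
qed

lemma ramp'_bounds: "0 \<le> ramp' r" "r \<notin> {0..1} \<Longrightarrow> ramp' r = 0"
  unfolding ramp'_def by (auto simp: max_def)

lemma continuous_on_ramp': "continuous_on S ramp'"
  unfolding ramp'_def by (intro continuous_intros)

lemma has_derivative_max0_sq: "((\<lambda>r. (max 0 r)\<^sup>2) has_real_derivative 2 * max 0 r) (at (r::real))"
proof -
  consider "r < 0" | "r > 0" | "r = 0" by linarith
  then show ?thesis
  proof cases
    case 1
    have "((\<lambda>r. (max 0 r)\<^sup>2) has_real_derivative 0) (at r)"
      by (rule has_field_derivative_transform_within_open[OF DERIV_const[of 0], of "{..<0}"]) (use 1 in auto)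
    then show ?thesis using 1 by simp
  next
    case 2
    have "((\<lambda>r. r\<^sup>2) has_real_derivative 2 * r) (at r)" by (auto intro!: derivative_eq_intros)
    then have "((\<lambda>r. (max 0 r)\<^sup>2) has_real_derivative 2 * r) (at r)"
      by (rule has_field_derivative_transform_within_open[of _ _ _ "{0<..}"]) (use 2 in auto)
    then show ?thesis using 2 by simp
  next
    case 3
    have "((\<lambda>h::real. max 0 h) \<longlongrightarrow> max 0 0) (at 0)" by (intro tendsto_intros)
    then have "((\<lambda>h::real. max 0 h) \<longlongrightarrow> 0) (at 0)" by simp
    then have "((\<lambda>h::real. (max 0 h)\<^sup>2 / h) \<longlongrightarrow> 0) (at 0)"
      by (rule Lim_transform_eventually) (auto simp: eventually_at_filter max_def power2_eq_square intro!: always_eventually)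
    then show ?thesis using 3 by (simp add: has_field_derivative_iff)
  qed
qed

lemma ramp_deriv: "(ramp has_real_derivative ramp' r) (at r)"
proof -
  have *: "((\<lambda>r. (max 0 (r - c))\<^sup>2) has_real_derivative 2 * max 0 (r - c)) (at r)" for c :: real
  proof -
    have "((\<lambda>r. r - c) has_real_derivative 1) (at r)" by (auto intro!: derivative_eq_intros)
    from DERIV_chain2[OF has_derivative_max0_sq[of "r - c"] this] show ?thesis by simp
  qed
  show ?thesis unfolding ramp_def[abs_def] ramp'_def
    by (rule derivative_eq_intros * has_derivative_max0_sq refl)+ (simp add: algebra_simps)
qed

lemma set_integrable_continuous_Icc:
  fixes f :: "real \<Rightarrow> 'b::{banach, second_countable_topology}"
  assumes "continuous_on {a..b} f"
  shows "set_integrable lborel {a..b} f" and "set_integrable lborel {a<..<b} f"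
proof -
  show *: "set_integrable lborel {a..b} f"
    unfolding set_integrable_def by (rule borel_integrable_compact[OF _ assms]) simp
  show "set_integrable lborel {a<..<b} f"
    by (rule set_integrable_subset[OF *]) auto
qed

lemma set_integral_open_Icc:
  fixes f :: "real \<Rightarrow> 'b::{banach, second_countable_topology}"
  assumes "f \<in> borel_measurable borel \<or> continuous_on {a..b} f"
  shows "(LINT x:{a<..<b}|lborel. f x) = (LINT x:{a..b}|lborel. f x)"
  unfolding set_lebesgue_integral_def
proof (rule Bochner_Integration.integral_cong_AE)
  have m: "(\<lambda>x. indicator {a..b} x *\<^sub>R f x) \<in> borel_measurable lborel"
    using assms
  proof
    assume "continuous_on {a..b} f"
    then show ?thesis using borel_integrable_compact[of "{a..b}" f] by auto
  qed simp
  then show "(\<lambda>x. indicator {a..b} x *\<^sub>R f x) \<in> borel_measurable lborel" .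
  have "(\<lambda>x. indicator {a<..<b} x *\<^sub>R (indicator {a..b} x *\<^sub>R f x)) \<in> borel_measurable lborel"
    using m by measurable
  moreover have "(\<lambda>x. indicator {a<..<b} x *\<^sub>R (indicator {a..b} x *\<^sub>R f x)) = (\<lambda>x. indicator {a<..<b} x *\<^sub>R f x)"
    by (rule ext) (simp split: split_indicator)
  ultimately show "(\<lambda>x. indicator {a<..<b} x *\<^sub>R f x) \<in> borel_measurable lborel" by simp
  show "AE x in lborel. indicator {a<..<b} x *\<^sub>R f x = indicator {a..b} x *\<^sub>R f x"
    using AE_lborel_singleton[of a] AE_lborel_singleton[of b]
    by eventually_elim (auto split: split_indicator)
qed

text \<open>The bumps \<open>n ramp' (n (s - x))\<close> form an approximate identity at \<open>x\<close> from the right.\<close>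

lemma ramp'_approx_identity:
  fixes f :: "real \<Rightarrow> complex"
  assumes f: "continuous_on {a..b} f" and x: "a < x" "x < b"
  shows "(\<lambda>n. LINT s:{a<..<b}|lborel. (real n * ramp' (real n * (s - x))) *\<^sub>R f s) \<longlonglongrightarrow> f x"
proof (rule LIMSEQ_I)
  fix e :: real assume e: "e > 0"
  have "continuous (at x within {a..b}) f" using f x by (simp add: continuous_on_eq_continuous_within)
  then obtain d where d: "d > 0" "\<And>s. s \<in> {a..b} \<Longrightarrow> dist s x < d \<Longrightarrow> dist (f s) (f x) < e / 2"
    unfolding continuous_within_eps_delta using e by (meson half_gt_zero)
  obtain N :: nat where N: "N > 0" "1 / real N < min d (b - x)"
    using d(1) x by (metis nat_approx_posE zero_less_Suc diff_gt_0_iff_gt min_less_iff_conj)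
  show "\<exists>N. \<forall>n\<ge>N. norm ((LINT s:{a<..<b}|lborel. (real n * ramp' (real n * (s - x))) *\<^sub>R f s) - f x) < e"
  proof (intro exI allI impI)
    fix n assume n: "n \<ge> N"
    have n0: "real n > 0" using n N by simp
    have "1 / real n \<le> 1 / real N" using n N by (intro divide_left_mono) auto
    then have n1: "1 / real n < d" "1 / real n < b - x" using N by auto
    define w where "w s = real n * ramp' (real n * (s - x))" for s
    have wc: "continuous_on {a..b} w" unfolding w_def[abs_def]
      by (intro continuous_intros continuous_on_compose2[OF continuous_on_ramp'[of UNIV]]) auto
    have w0: "0 \<le> w s" for s using ramp'_bounds(1) by (simp add: w_def)
    have w_out: "w s = 0" if "s \<notin> {x..x + 1 / real n}" for s
    proof -
      have "real n * (s - x) \<notin> {0..1}"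
      proof
        assume "real n * (s - x) \<in> {0..1}"
        then have "0 \<le> s - x" "s - x \<le> 1 / real n" using n0 by (auto simp: zero_le_mult_iff field_simps)
        then show False using that by auto
      qed
      then show ?thesis using ramp'_bounds(2) by (simp add: w_def)
    qed
    have w1: "(LINT s:{a<..<b}|lborel. w s) = 1"
    proof -
      have "((\<lambda>s. ramp (real n * (s - x))) has_vector_derivative w s) (at s within {a..b})" for s
      proof -
        have "((\<lambda>s. real n * (s - x)) has_real_derivative real n) (at s)" by (auto intro!: derivative_eq_intros)
        from DERIV_chain2[OF ramp_deriv this]
        show ?thesis unfolding w_def by (auto simp: has_real_derivative_iff_has_vector_derivative[symmetric] mult.commute intro: has_field_derivative_at_within)
      qed
      then have "(\<integral>s. indicator {a..b} s *\<^sub>R w s \<partial>lborel) = ramp (real n * (b - x)) - ramp (real n * (a - x))"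
        using x by (intro integral_FTC_Icc wc) auto
      moreover have "real n * (b - x) \<ge> 1" using n1(2) n0 by (simp add: field_simps)
      moreover have "real n * (a - x) \<le> 0" using x by (simp add: mult_le_0_iff)
      moreover have "(LINT s:{a<..<b}|lborel. w s) = (LINT s:{a..b}|lborel. w s)"
        using wc by (intro set_integral_open_Icc) simp
      ultimately show ?thesis unfolding set_lebesgue_integral_def by (simp only: ramp_bounds diff_zero)
    qed
    have iwf: "set_integrable lborel {a<..<b} (\<lambda>s. w s *\<^sub>R f s)"
      by (intro set_integrable_continuous_Icc continuous_intros wc f)
    have iw: "set_integrable lborel {a<..<b} w" by (intro set_integrable_continuous_Icc wc)
    have iwx: "set_integrable lborel {a<..<b} (\<lambda>s. w s *\<^sub>R f x)"
      by (intro set_integrable_continuous_Icc continuous_intros wc)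
    have "f x = (LINT s:{a<..<b}|lborel. w s *\<^sub>R f x)"
    proof -
      have "(LINT s:{a<..<b}|lborel. w s *\<^sub>R f x) = (LINT s:{a<..<b}|lborel. w s) *\<^sub>R f x"
        using iw unfolding set_lebesgue_integral_def set_integrable_def
        by (subst integral_scaleR_left[symmetric]) auto
      then show ?thesis using w1 by simp
    qed
    then have "(LINT s:{a<..<b}|lborel. w s *\<^sub>R f s) - f x = (LINT s:{a<..<b}|lborel. w s *\<^sub>R f s - w s *\<^sub>R f x)"
      using iwf iwx by (subst set_integral_diff) auto
    also have "norm \<dots> \<le> (LINT s:{a<..<b}|lborel. norm (w s *\<^sub>R f s - w s *\<^sub>R f x))"
      by (rule set_integral_norm_bound) (rule set_integral_diff(1)[OF iwf iwx])
    also have "\<dots> \<le> (LINT s:{a<..<b}|lborel. w s * (e / 2))"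
    proof (rule set_integral_mono)
      show "set_integrable lborel {a<..<b} (\<lambda>s. norm (w s *\<^sub>R f s - w s *\<^sub>R f x))"
        by (rule set_integrable_norm) (rule set_integral_diff(1)[OF iwf iwx])
      show "set_integrable lborel {a<..<b} (\<lambda>s. w s * (e / 2))" using iw by (rule set_integrable_mult_left[rotated])
      fix s assume s: "s \<in> {a<..<b}"
      show "norm (w s *\<^sub>R f s - w s *\<^sub>R f x) \<le> w s * (e / 2)"
      proof (cases "s \<in> {x..x + 1 / real n}")
        case True
        then have "dist (f s) (f x) < e / 2" using s n1(1) by (intro d(2)) (auto simp: dist_real_def)
        moreover have "norm (w s *\<^sub>R f s - w s *\<^sub>R f x) = w s * norm (f s - f x)"
          using w0[of s] by (simp add: scaleR_diff_right[symmetric] abs_of_nonneg del: scaleR_diff_right)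
        moreover have "w s * norm (f s - f x) \<le> w s * (e / 2)" if "norm (f s - f x) < e / 2"
          using w0[of s] that by (intro mult_left_mono) auto
        ultimately show ?thesis by (simp only: dist_norm)
      next
        case False
        then show ?thesis using w_out[of s] by simp
      qed
    qed
    also have "\<dots> = e / 2" using w1 by simp
    also have "\<dots> < e" using e by simp
    finally show "norm ((LINT s:{a<..<b}|lborel. (real n * ramp' (real n * (s - x))) *\<^sub>R f s) - f x) < e"
      unfolding w_def .
  qed
qed

text \<open>The weak derivative is tested with a smoothed indicator of {x..y}. Its derivative is a
  difference of two approximate identities, which converge to \<open>f x - f y\<close>, and
  Cauchy-Schwarz on its support bounds the other side. The end points of the interval follow by
  continuity.\<close>

lemma weak_deriv_increment:
  fixes f g :: "real \<Rightarrow> complex"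
  assumes f: "continuous_on {a..b} f" and g: "g \<in> L2_on a b" and wd: "weak_deriv_on a b f g"
    and xy: "x \<in> {a..b}" "y \<in> {a..b}"
  shows "(cmod (f y - f x))\<^sup>2 \<le> \<bar>y - x\<bar> * (LINT s:{a<..<b}|lborel. (cmod (g s))\<^sup>2)"
proof -
  define G where "G = (LINT s:{a<..<b}|lborel. (cmod (g s))\<^sup>2)"
  have interior: "(cmod (f y - f x))\<^sup>2 \<le> (y - x) * G" if xy: "a < x" "x < y" "y < b" for x y
  proof -
    define \<phi> where "\<phi> n s = ramp (real n * (s - x)) - ramp (real n * (s - y))" for n :: nat and s
    define \<phi>' where "\<phi>' n s = real n * ramp' (real n * (s - x)) - real n * ramp' (real n * (s - y))" for n :: nat and s
    have d\<phi>: "(\<phi> n has_real_derivative \<phi>' n s) (at s)" for n s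
    proof -
      have *: "((\<lambda>s. ramp (real n * (s - v))) has_real_derivative real n * ramp' (real n * (s - v))) (at s)" for v
      proof -
        have "((\<lambda>s. real n * (s - v)) has_real_derivative real n) (at s)" by (auto intro!: derivative_eq_intros)
        from DERIV_chain2[OF ramp_deriv this] show ?thesis by (simp add: mult.commute)
      qed
      show ?thesis unfolding \<phi>_def[abs_def] \<phi>'_def by (intro DERIV_diff *)
    qed
    have c\<phi>': "continuous_on S (\<phi>' n)" for S n
      unfolding \<phi>'_def[abs_def]
      by (intro continuous_intros continuous_on_compose2[OF continuous_on_ramp'[of UNIV]]) auto
    have c\<phi>: "continuous_on S (\<phi> n)" for S n
      using d\<phi> DERIV_isCont by (blast intro: continuous_at_imp_continuous_on)
    have [measurable]: "\<phi> n \<in> borel_measurable borel" for n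
      by (rule borel_measurable_continuous_onI) (rule c\<phi>)
    have lim: "(\<lambda>n. LINT s:{a<..<b}|lborel. \<phi>' n s *\<^sub>R f s) \<longlonglongrightarrow> f x - f y"
    proof -
      have "(LINT s:{a<..<b}|lborel. \<phi>' n s *\<^sub>R f s) = (LINT s:{a<..<b}|lborel. (real n * ramp' (real n * (s - x))) *\<^sub>R f s)
         - (LINT s:{a<..<b}|lborel. (real n * ramp' (real n * (s - y))) *\<^sub>R f s)" for n
      proof -
        have i: "set_integrable lborel {a<..<b} (\<lambda>s. (real n * ramp' (real n * (s - v))) *\<^sub>R f s)" for v
          by (intro set_integrable_continuous_Icc continuous_intros f continuous_on_compose2[OF continuous_on_ramp'[of UNIV]]) auto
        show ?thesis unfolding \<phi>'_def scaleR_diff_left by (rule set_integral_diff(2)[OF i i])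
      qed
      then show ?thesis using xy by (auto intro!: tendsto_diff ramp'_approx_identity f)
    qed
    have ev: "\<forall>\<^sub>F n in sequentially. (cmod (LINT s:{a<..<b}|lborel. \<phi>' n s *\<^sub>R f s))\<^sup>2 \<le> (y - x + 1 / real n) * G"
    proof -
      \<comment> \<open>The support of \<open>\<phi> n\<close> overshoots \<open>y\<close> by
        \<open>1 / real n\<close>; for \<open>n \<ge> N\<close> it is still a compact subset of
        \<open>{a<..<b}\<close>.\<close>
      obtain N :: nat where N: "N > 0" "1 / real N < b - y"
        using xy by (metis nat_approx_posE zero_less_Suc diff_gt_0_iff_gt)
      show ?thesis
        using eventually_ge_at_top[of N]
      proof eventually_elim
        case (elim n)
        have n0: "real n > 0" using elim N by simp
        have "1 / real n \<le> 1 / real N" using elim N by (intro divide_left_mono) auto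
        then have n1: "1 / real n < b - y" using N by auto
        have out: "\<phi> n s = 0" if "s \<notin> {x..y + 1 / real n}" for s
        proof (cases "s < x")
          case True
          then have "real n * (s - x) \<le> 0" "real n * (s - y) \<le> 0" using xy by (auto simp: mult_le_0_iff)
          then show ?thesis by (simp add: \<phi>_def ramp_bounds)
        next
          case False
          then have s: "s - y > 1 / real n" "s - x > 1 / real n" using that xy by auto
          then have "real n * (s - y) \<ge> 1" "real n * (s - x) \<ge> 1"
            using n0 by (auto simp: divide_less_eq mult.commute)
          then show ?thesis by (simp add: \<phi>_def ramp_bounds)
        qed
        have "\<bar>\<phi> n s\<bar> \<le> 1" for s
          using ramp_bounds(1,2)[of "real n * (s - x)"] ramp_bounds(1,2)[of "real n * (s - y)"]
          unfolding \<phi>_def by linarith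
        then have sq: "(\<phi> n s)\<^sup>2 \<le> indicator {x..y + 1 / real n} s" for s
          using out[of s] by (auto simp: abs_square_le_1 split: split_indicator)
        have "(LINT s:{a<..<b}|lborel. \<phi>' n s *\<^sub>R f s) = - (LINT s:{a<..<b}|lborel. \<phi> n s *\<^sub>R g s)"
        proof (rule wd[unfolded weak_deriv_on_def, rule_format], intro conjI allI)
          show "\<exists>K. compact K \<and> K \<subseteq> {a<..<b} \<and> (\<forall>x. x \<notin> K \<longrightarrow> \<phi> n x = 0)"
            by (rule exI[of _ "{x..y + 1 / real n}"]) (use xy n1 out in auto)
        qed (use d\<phi> c\<phi>' in auto)
        then have "(cmod (LINT s:{a<..<b}|lborel. \<phi>' n s *\<^sub>R f s))\<^sup>2 = (cmod (LINT s:{a<..<b}|lborel. \<phi> n s *\<^sub>R g s))\<^sup>2"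
          by simp
        also have "(LINT s:{a<..<b}|lborel. \<phi> n s *\<^sub>R g s) =
            (\<integral>s. complex_of_real (\<phi> n s) * (indicator {a<..<b} s *\<^sub>R g s) \<partial>lborel)"
          unfolding set_lebesgue_integral_def
          by (intro Bochner_Integration.integral_cong refl) (simp add: scaleR_conv_of_real mult.left_commute)
        also have "(cmod (\<integral>s. complex_of_real (\<phi> n s) * (indicator {a<..<b} s *\<^sub>R g s) \<partial>lborel))\<^sup>2 \<le>
            (\<integral>s. (cmod (complex_of_real (\<phi> n s)))\<^sup>2 \<partial>lborel) * (\<integral>s. (cmod (indicator {a<..<b} s *\<^sub>R g s))\<^sup>2 \<partial>lborel)"
        proof (rule norm_integral_mult_le(2))
          show m: "(\<lambda>s. complex_of_real (\<phi> n s)) \<in> borel_measurable lborel"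
            using c\<phi>[of UNIV n] by (auto intro!: borel_measurable_continuous_onI continuous_intros)
          show "(\<lambda>s. indicator {a<..<b} s *\<^sub>R g s) \<in> borel_measurable lborel"
            using g by (simp add: L2_on_def set_borel_measurable_def)
          show "integrable lborel (\<lambda>s. (cmod (complex_of_real (\<phi> n s)))\<^sup>2)"
          proof (rule Bochner_Integration.integrable_bound[of _ "indicator {x..y + 1 / real n} :: real \<Rightarrow> real"])
            show "AE s in lborel. norm ((cmod (complex_of_real (\<phi> n s)))\<^sup>2) \<le> norm (indicat_real {x..y + 1 / real n} s)"
              using sq by (intro AE_I2) simp
          qed (auto intro!: integrable_real_indicator simp: emeasure_lborel_Icc_eq)
          have "integrable lborel (\<lambda>s. indicator {a<..<b} s *\<^sub>R (cmod (g s))\<^sup>2)"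
            using g by (simp add: L2_on_def set_integrable_def)
          moreover have "(\<lambda>s. indicator {a<..<b} s *\<^sub>R (cmod (g s))\<^sup>2) = (\<lambda>s. (cmod (indicator {a<..<b} s *\<^sub>R g s))\<^sup>2)"
            by (rule ext) (simp split: split_indicator)
          ultimately show "integrable lborel (\<lambda>s. (cmod (indicator {a<..<b} s *\<^sub>R g s))\<^sup>2)" by (simp only:)
        qed
        also have "(\<integral>s. (cmod (indicator {a<..<b} s *\<^sub>R g s))\<^sup>2 \<partial>lborel) = G"
          unfolding G_def set_lebesgue_integral_def
          by (intro Bochner_Integration.integral_cong refl) (simp split: split_indicator)
        also have "(\<integral>s. (cmod (complex_of_real (\<phi> n s)))\<^sup>2 \<partial>lborel) * G \<le> (y - x + 1 / real n) * G"
        proof (rule mult_right_mono)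
          have "(\<integral>s. (cmod (complex_of_real (\<phi> n s)))\<^sup>2 \<partial>lborel) \<le> (\<integral>s. indicator {x..y + 1 / real n} s \<partial>lborel)"
            by (rule integral_mono') (use sq in \<open>auto intro!: integrable_real_indicator simp: emeasure_lborel_Icc_eq\<close>)
          also have "\<dots> = y - x + 1 / real n"
          proof -
            have "x \<le> y + 1 / real n" using xy n0 by (intro add_increasing2) auto
            then show ?thesis by simp
          qed
          finally show "(\<integral>s. (cmod (complex_of_real (\<phi> n s)))\<^sup>2 \<partial>lborel) \<le> y - x + 1 / real n" .
          show "0 \<le> G" unfolding G_def set_lebesgue_integral_def by (intro Bochner_Integration.integral_nonneg) simp
        qed
        finally show ?case .
      qed
    qed
    have "(\<lambda>n. (cmod (LINT s:{a<..<b}|lborel. \<phi>' n s *\<^sub>R f s))\<^sup>2) \<longlonglongrightarrow> (cmod (f x - f y))\<^sup>2"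
      by (intro tendsto_intros lim)
    moreover have "(\<lambda>n. (y - x + 1 / real n) * G) \<longlonglongrightarrow> (y - x + 0) * G"
      by (intro tendsto_intros lim_1_over_n)
    ultimately have "(cmod (f x - f y))\<^sup>2 \<le> (y - x + 0) * G"
      using ev by (intro tendsto_le[OF sequentially_bot])
    then show ?thesis by (simp add: norm_minus_commute)
  qed
  have closed: "(cmod (f y - f x))\<^sup>2 \<le> (y - x) * G" if xy: "x \<in> {a..b}" "y \<in> {a..b}" "x < y" for x y
  proof -
    \<comment> \<open>Points moving from the interior to \<open>x\<close> and \<open>y\<close>; the
      summand 3 keeps \<open>X n < Y n\<close> already for \<open>n = 0\<close>.\<close>
    define r where "r n = (y - x) / real (n + 3)" for n :: nat
    define X where "X n = x + r n" for n
    define Y where "Y n = y - r n" for n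
    have l0: "r \<longlonglongrightarrow> 0"
      using LIMSEQ_ignore_initial_segment[OF lim_const_over_n[of "y - x"], of 3] unfolding r_def[abs_def] by simp
    have lX: "X \<longlonglongrightarrow> x" using tendsto_add[OF tendsto_const l0, of x] unfolding X_def[abs_def] by simp
    have lY: "Y \<longlonglongrightarrow> y" using tendsto_diff[OF tendsto_const l0, of y] unfolding Y_def[abs_def] by simp
    have small: "0 < r n" "2 * r n < y - x" for n
    proof -
      show "0 < r n" using xy by (simp add: r_def)
      have "r n \<le> (y - x) / 3" unfolding r_def using xy by (intro divide_left_mono) auto
      then show "2 * r n < y - x" using xy by (simp add: field_simps)
    qed
    have XY: "a < X n" "X n < Y n" "Y n < b" for n
      using small[of n] xy unfolding X_def Y_def by auto
    have ev: "\<forall>\<^sub>F n in sequentially. X n \<in> {a..b}" "\<forall>\<^sub>F n in sequentially. Y n \<in> {a..b}"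
    proof -
      have "X n \<in> {a..b}" "Y n \<in> {a..b}" for n using XY[of n] by auto
      then show "\<forall>\<^sub>F n in sequentially. X n \<in> {a..b}" "\<forall>\<^sub>F n in sequentially. Y n \<in> {a..b}"
        by (simp_all only: eventually_True)
    qed
    have le: "(cmod (f (Y n) - f (X n)))\<^sup>2 \<le> (Y n - X n) * G" for n
      by (rule interior) (use XY in auto)
    have fX: "(\<lambda>n. f (X n)) \<longlonglongrightarrow> f x" and fY: "(\<lambda>n. f (Y n)) \<longlonglongrightarrow> f y"
      using continuous_on_tendsto_compose[OF f lX xy(1) ev(1)] continuous_on_tendsto_compose[OF f lY xy(2) ev(2)] .
    show ?thesis
    proof (rule LIMSEQ_le)
      show "(\<lambda>n. (cmod (f (Y n) - f (X n)))\<^sup>2) \<longlonglongrightarrow> (cmod (f y - f x))\<^sup>2" by (intro tendsto_intros fX fY)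
      show "(\<lambda>n. (Y n - X n) * G) \<longlonglongrightarrow> (y - x) * G" by (intro tendsto_intros lX lY)
      show "\<exists>N. \<forall>n\<ge>N. (cmod (f (Y n) - f (X n)))\<^sup>2 \<le> (Y n - X n) * G" using le by blast
    qed
  qed
  consider "x < y" | "x = y" | "y < x" by linarith
  then show ?thesis
    using closed[OF xy] closed[OF xy(2,1)] by cases (auto simp: G_def norm_minus_commute)
qed

text \<open>A crude bound with constant 1: each derivative loses a factor
  \<open>(b - a)\<^sup>2\<close> by integrating the pointwise increment estimate. It serves to show
  that the set defining \<open>poincare_const\<close> is nonempty.\<close>

lemma sobolev_poincare:
  assumes "a < b" and "sobolev_H j a b F" and v: "v \<in> {a..b}" and "\<forall>i<j. F i v = 0"
  shows "(LINT x:{a<..<b}|lborel. (cmod (F 0 x))\<^sup>2) \<le> (b - a) ^ (2 * j) * (LINT x:{a<..<b}|lborel. (cmod (F j x))\<^sup>2)"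
  using assms(2,4)
proof (induction j arbitrary: F)
  case (Suc j)
  let ?G = "\<lambda>i. LINT x:{a<..<b}|lborel. (cmod (F i x))\<^sup>2"
  have G0: "0 \<le> ?G i" for i unfolding set_lebesgue_integral_def by (intro Bochner_Integration.integral_nonneg) simp
  have "sobolev_H j a b (\<lambda>i. F (Suc i))" using Suc.prems by (auto simp: sobolev_H_def)
  from Suc.IH[OF this] Suc.prems have 1: "?G 1 \<le> (b - a) ^ (2 * j) * ?G (Suc j)" by auto
  have c: "continuous_on {a..b} (F 0)" and L: "F 1 \<in> L2_on a b" "F 0 \<in> L2_on a b" and w: "weak_deriv_on a b (F 0) (F 1)"
    using Suc.prems by (auto simp: sobolev_H_def)
  have F0: "F 0 v = 0" using Suc.prems by simp
  have pt: "(cmod (F 0 x))\<^sup>2 \<le> (b - a) * ?G 1" if "x \<in> {a<..<b}" for x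
  proof -
    have "(cmod (F 0 x))\<^sup>2 \<le> \<bar>x - v\<bar> * ?G 1"
      using weak_deriv_increment[OF c L(1) w v, of x] that F0 by simp
    also have "\<dots> \<le> (b - a) * ?G 1" using that v by (intro mult_right_mono G0) auto
    finally show ?thesis .
  qed
  have "?G 0 \<le> (LINT x:{a<..<b}|lborel. (b - a) * ?G 1)"
  proof (rule set_integral_mono)
    show "set_integrable lborel {a<..<b} (\<lambda>x. (cmod (F 0 x))\<^sup>2)" using L by (simp add: L2_on_def)
    show "set_integrable lborel {a<..<b} (\<lambda>x. (b - a) * ?G 1)"
      by (intro set_integrable_continuous_Icc continuous_intros)
  qed (rule pt)
  also have "\<dots> = (b - a)\<^sup>2 * ?G 1"
    using \<open>a < b\<close> by (simp add: set_lebesgue_integral_def power2_eq_square)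
  also have "\<dots> \<le> (b - a)\<^sup>2 * ((b - a) ^ (2 * j) * ?G (Suc j))"
    by (intro mult_left_mono 1) simp
  also have "\<dots> = (b - a) ^ (2 * Suc j) * ?G (Suc j)" by (simp add: power_add[symmetric] mult.assoc[symmetric])
  finally show ?case .
qed simp

text \<open>An infimum of reals is meaningful only for a nonempty set bounded below, hence
  \<open>1 \<in> P\<close>. That the infimum itself is admissible follows by letting admissible
  constants tend to it.\<close>

lemma poincare_const_nonneg: "0 \<le> poincare_const j"
  and poincare_const_ineq: "a < b \<Longrightarrow> sobolev_H j a b F \<Longrightarrow> (\<forall>i<j. F i a = 0) \<or> (\<forall>i<j. F i b = 0) \<Longrightarrow>
    (LINT x:{a<..<b}|lborel. (cmod (F 0 x))\<^sup>2) \<le>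
      poincare_const j ^ (2 * j) * (b - a) ^ (2 * j) * (LINT x:{a<..<b}|lborel. (cmod (F j x))\<^sup>2)"
proof -
  define P where "P = {c. c > 0 \<and>
     (\<forall>a b F. a < b \<and> sobolev_H j a b F \<and>
        ((\<forall>i<j. F i a = 0) \<or> (\<forall>i<j. F i b = 0)) \<longrightarrow>
        (LINT x:{a<..<b}|lborel. (norm (F 0 x))\<^sup>2) \<le>
          c ^ (2 * j) * (b - a) ^ (2 * j) * (LINT x:{a<..<b}|lborel. (norm (F j x))\<^sup>2))}"
  have P: "poincare_const j = Inf P" by (simp add: poincare_const_def P_def)
  have "1 \<in> P"
    unfolding P_def
  proof (intro CollectI conjI allI impI)
    fix a b :: real and F
    assume "a < b \<and> sobolev_H j a b F \<and> ((\<forall>i<j. F i a = 0) \<or> (\<forall>i<j. F i b = 0))"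
    then have ab: "a < b" and F: "sobolev_H j a b F" and v: "(\<forall>i<j. F i a = 0) \<or> (\<forall>i<j. F i b = 0)"
      by auto
    from v have "\<exists>v\<in>{a..b}. \<forall>i<j. F i v = 0" using ab by force
    then show "(LINT x:{a<..<b}|lborel. (norm (F 0 x))\<^sup>2) \<le>
        1 ^ (2 * j) * (b - a) ^ (2 * j) * (LINT x:{a<..<b}|lborel. (norm (F j x))\<^sup>2)"
      using sobolev_poincare[OF ab F] by auto
  qed simp
  then have ne: "P \<noteq> {}" by blast
  have bdd: "bdd_below P" by (rule bdd_belowI[of _ 0]) (auto simp: P_def)
  show nn: "0 \<le> poincare_const j"
    unfolding P by (rule cInf_greatest[OF ne]) (auto simp: P_def)
  assume ab: "a < b" and F: "sobolev_H j a b F" and v: "(\<forall>i<j. F i a = 0) \<or> (\<forall>i<j. F i b = 0)"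
  let ?L = "LINT x:{a<..<b}|lborel. (cmod (F 0 x))\<^sup>2" and ?R = "LINT x:{a<..<b}|lborel. (cmod (F j x))\<^sup>2"
  have R: "0 \<le> ?R" unfolding set_lebesgue_integral_def by (intro Bochner_Integration.integral_nonneg) simp
  let ?c = "\<lambda>n. poincare_const j + 1 / real n"
  have le: "?L \<le> ?c n ^ (2 * j) * (b - a) ^ (2 * j) * ?R" if "n > 0" for n
  proof -
    have "Inf P < ?c n" using that by (simp add: P)
    then obtain c where c: "c \<in> P" "c < ?c n" using cInf_less_iff[OF ne bdd] by blast
    then have "?L \<le> c ^ (2 * j) * (b - a) ^ (2 * j) * ?R" using ab F v unfolding P_def by blast
    also have "\<dots> \<le> ?c n ^ (2 * j) * (b - a) ^ (2 * j) * ?R"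
      using c ab R by (intro mult_right_mono power_mono) (auto simp: P_def)
    finally show ?thesis .
  qed
  have "(\<lambda>n. ?c n ^ (2 * j) * (b - a) ^ (2 * j) * ?R) \<longlonglongrightarrow> (poincare_const j + 0) ^ (2 * j) * (b - a) ^ (2 * j) * ?R"
    by (intro tendsto_intros lim_1_over_n)
  then have "?L \<le> (poincare_const j + 0) ^ (2 * j) * (b - a) ^ (2 * j) * ?R"
    by (rule LIMSEQ_le_const) (use le in \<open>auto intro!: exI[of _ 1]\<close>)
  then show "?L \<le> poincare_const j ^ (2 * j) * (b - a) ^ (2 * j) * ?R" by simp
qed

text \<open>Integration by parts; a test function with compact support in the open interval vanishes
  at both end points.\<close>

lemma sobolev_H_smooth:
  assumes der: "\<And>i x. (D i has_vector_derivative D (Suc i) x) (at x)" and ab: "a < b"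
  shows "sobolev_H j a b D"
proof -
  have c: "continuous_on S (D i)" for i S
    using der has_vector_derivative_continuous by (blast intro: continuous_at_imp_continuous_on)
  have L: "D i \<in> L2_on a b" for i
  proof -
    have "D i \<in> borel_measurable borel" using c by (rule borel_measurable_continuous_onI)
    then show ?thesis unfolding L2_on_def
      by (auto simp: set_borel_measurable_def intro!: set_integrable_continuous_Icc continuous_intros c)
  qed
  have "weak_deriv_on a b (D i) (D (Suc i))" for i
    unfolding weak_deriv_on_def
  proof (intro allI impI, elim conjE exE)
    fix \<phi> \<phi>' :: "real \<Rightarrow> real" and K
    assume \<phi>: "\<forall>x. (\<phi> has_real_derivative \<phi>' x) (at x)" "continuous_on UNIV \<phi>'"
      and K: "compact K" "K \<subseteq> {a<..<b}" "\<forall>x. x \<notin> K \<longrightarrow> \<phi> x = 0"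
    have c\<phi>: "continuous_on S \<phi>" for S
      using \<phi>(1) DERIV_isCont by (blast intro: continuous_at_imp_continuous_on)
    note c\<phi>' = continuous_on_subset[OF \<phi>(2) subset_UNIV]
    have z: "\<phi> a = 0" "\<phi> b = 0" using K by auto
    have d: "((\<lambda>x. \<phi> x *\<^sub>R D i x) has_vector_derivative \<phi> x *\<^sub>R D (Suc i) x + \<phi>' x *\<^sub>R D i x) (at x within {a..b})" for x
      using has_vector_derivative_scaleR[OF \<phi>(1)[rule_format] der] by (rule has_vector_derivative_at_within)
    have "(\<integral>x. indicator {a..b} x *\<^sub>R (\<phi> x *\<^sub>R D (Suc i) x + \<phi>' x *\<^sub>R D i x) \<partial>lborel) = \<phi> b *\<^sub>R D i b - \<phi> a *\<^sub>R D i a"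
      using ab d by (intro integral_FTC_Icc continuous_intros c c\<phi> c\<phi>') auto
    then have "(LINT x:{a..b}|lborel. \<phi> x *\<^sub>R D (Suc i) x + \<phi>' x *\<^sub>R D i x) = 0"
      using z by (simp add: set_lebesgue_integral_def)
    moreover have "(LINT x:{a<..<b}|lborel. \<phi> x *\<^sub>R D (Suc i) x + \<phi>' x *\<^sub>R D i x) = (LINT x:{a..b}|lborel. \<phi> x *\<^sub>R D (Suc i) x + \<phi>' x *\<^sub>R D i x)"
      by (intro set_integral_open_Icc disjI2 continuous_intros c c\<phi> c\<phi>')
    moreover have "(LINT x:{a<..<b}|lborel. \<phi> x *\<^sub>R D (Suc i) x + \<phi>' x *\<^sub>R D i x) =
      (LINT x:{a<..<b}|lborel. \<phi> x *\<^sub>R D (Suc i) x) + (LINT x:{a<..<b}|lborel. \<phi>' x *\<^sub>R D i x)"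
      by (intro set_integral_add set_integrable_continuous_Icc continuous_intros c c\<phi> c\<phi>')
    ultimately show "(LINT x:{a<..<b}|lborel. \<phi>' x *\<^sub>R D i x) = - (LINT x:{a<..<b}|lborel. \<phi> x *\<^sub>R D (Suc i) x)"
      by (simp add: eq_neg_iff_add_eq_0 add.commute)
  qed
  then show ?thesis unfolding sobolev_H_def using c L by auto
qed

text \<open>\<open>poincare_const\<close> refers to zeros at one end point, so the inequality is
  applied on either side of \<open>z\<close>, in both cases with the length bounded by
  \<open>\<delta>\<close>.\<close>

lemma poincare_cell:
  fixes D :: "nat \<Rightarrow> real \<Rightarrow> complex"
  assumes der: "\<And>i x. (D i has_vector_derivative D (Suc i) x) (at x)" and zero: "\<And>i. i < j \<Longrightarrow> D i z = 0"
    and z: "p \<le> z" "z \<le> q" "z - p \<le> \<delta>" "q - z \<le> \<delta>"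
  shows "(\<integral>\<^sup>+x. ennreal ((cmod (D 0 x))\<^sup>2) * indicator {p..q} x \<partial>lborel)
      \<le> ennreal ((poincare_const j * \<delta>) ^ (2 * j)) * (\<integral>\<^sup>+x. ennreal ((cmod (D j x))\<^sup>2) * indicator {p..q} x \<partial>lborel)"
proof -
  have c: "continuous_on S (D i)" for i S
    using der has_vector_derivative_continuous by (blast intro: continuous_at_imp_continuous_on)
  have [measurable]: "D i \<in> borel_measurable borel" for i using c by (rule borel_measurable_continuous_onI)
  have side: "(\<integral>\<^sup>+x. ennreal ((cmod (D 0 x))\<^sup>2) * indicator {a..b} x \<partial>lborel)
      \<le> ennreal ((poincare_const j * \<delta>) ^ (2 * j)) * (\<integral>\<^sup>+x. ennreal ((cmod (D j x))\<^sup>2) * indicator {a..b} x \<partial>lborel)"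
    if ab: "a \<le> b" "b - a \<le> \<delta>" "a = z \<or> b = z" for a b
  proof -
    have nn: "(\<integral>\<^sup>+x. ennreal ((cmod (D i x))\<^sup>2) * indicator {a..b} x \<partial>lborel) = ennreal (LINT x:{a<..<b}|lborel. (cmod (D i x))\<^sup>2)" for i
    proof -
      have "(\<integral>\<^sup>+x. ennreal ((cmod (D i x))\<^sup>2) * indicator {a..b} x \<partial>lborel) = ennreal (integral {a..b} (\<lambda>x. (cmod (D i x))\<^sup>2))"
        by (intro nn_integral_Icc continuous_intros c) auto
      also have "integral {a..b} (\<lambda>x. (cmod (D i x))\<^sup>2) = (LINT x:{a..b}|lborel. (cmod (D i x))\<^sup>2)"
        by (rule set_borel_integral_eq_integral(2)[symmetric]) (intro set_integrable_continuous_Icc continuous_intros c)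
      also have "\<dots> = (LINT x:{a<..<b}|lborel. (cmod (D i x))\<^sup>2)"
        by (intro set_integral_open_Icc[symmetric] disjI2 continuous_intros c)
      finally show ?thesis .
    qed
    let ?R = "LINT x:{a<..<b}|lborel. (cmod (D j x))\<^sup>2"
    have R: "0 \<le> ?R" unfolding set_lebesgue_integral_def by (intro Bochner_Integration.integral_nonneg) simp
    show ?thesis
    proof (cases "a = b")
      case False
      then have "a < b" using ab by simp
      then have "(LINT x:{a<..<b}|lborel. (cmod (D 0 x))\<^sup>2) \<le> poincare_const j ^ (2 * j) * (b - a) ^ (2 * j) * ?R"
        using ab zero by (intro poincare_const_ineq sobolev_H_smooth der) auto
      also have "\<dots> \<le> poincare_const j ^ (2 * j) * \<delta> ^ (2 * j) * ?R"
        using ab R by (intro mult_right_mono mult_left_mono power_mono) (auto simp: poincare_const_nonneg)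
      also have "\<dots> = (poincare_const j * \<delta>) ^ (2 * j) * ?R" by (simp only: power_mult_distrib)
      finally show ?thesis unfolding nn by (simp only: ennreal_leI ennreal_mult''[OF R, symmetric])
    next
      case True
      have "{b..b} = {b}" by auto
      then show ?thesis using True by simp
    qed
  qed
  show ?thesis
    by (subst (1 2) nn_integral_Icc_split[OF _ z(1,2)])
      (auto simp: distrib_left intro!: add_mono side z)
qed

section \<open>The density constants\<close>

lemma R_rem_sums: "(\<lambda>r. y ^ (r + Suc k) / fact (r + Suc k)) sums R_rem k y"
proof -
  have "(\<lambda>r. y ^ r / fact r) sums exp y"
    using exp_converges[of y] by (simp add: divide_inverse mult.commute)
  from sums_split_initial_segment[OF this, of "Suc k"]
  show ?thesis by (simp add: R_rem_def lessThan_Suc_atMost)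
qed

lemma R_rem_0: "R_rem k 0 = 0"
  using sums_unique2[OF R_rem_sums[of 0 k], of 0] by simp

lemma R_rem_strict_mono:
  assumes "0 \<le> x" "x < y"
  shows "R_rem k x < R_rem k y"
proof -
  have s: "(\<lambda>r. y ^ (r + Suc k) / fact (r + Suc k) - x ^ (r + Suc k) / fact (r + Suc k)) sums (R_rem k y - R_rem k x)"
    by (rule sums_diff[OF R_rem_sums R_rem_sums])
  have pos: "0 < y ^ (r + Suc k) / fact (r + Suc k) - x ^ (r + Suc k) / fact (r + Suc k)" for r
  proof -
    have "x ^ (r + Suc k) < y ^ (r + Suc k)" using assms by (intro power_strict_mono) auto
    then show ?thesis by (simp only: diff_gt_0_iff_gt divide_strict_right_mono fact_gt_zero)
  qed
  have "0 < R_rem k y - R_rem k x"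
    using suminf_pos[OF sums_summable[OF s] pos] sums_unique[OF s] by simp
  then show ?thesis by simp
qed

lemma R_rem_nonneg: "0 \<le> y \<Longrightarrow> 0 \<le> R_rem k y"
  using R_rem_strict_mono[of 0 y k] by (cases "y = 0") (auto simp: R_rem_0)

lemma R_rem_unbounded: "\<exists>y>0. 1 < R_rem k y"
proof (intro exI conjI)
  define f where "f = (fact (Suc k) :: real)"
  define y where "y = f + 1"
  have f: "f > 0" unfolding f_def by (rule fact_gt_zero)
  then show "0 < y" by (simp add: y_def)
  have y1: "1 \<le> y" using f by (simp add: y_def)
  have "(\<Sum>r<1. y ^ (r + Suc k) / fact (r + Suc k)) \<le> (\<Sum>r. y ^ (r + Suc k) / fact (r + Suc k))"
    using y1 by (intro sum_le_suminf sums_summable[OF R_rem_sums]) auto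
  also have "\<dots> = R_rem k y" by (rule sums_unique[OF R_rem_sums, symmetric])
  finally have "y ^ Suc k / f \<le> R_rem k y" by (simp add: f_def)
  moreover have "1 < y ^ Suc k / f"
  proof -
    have "y ^ 1 \<le> y ^ Suc k" by (rule power_increasing[OF _ y1]) simp
    then have "f < y ^ Suc k" by (simp add: y_def)
    then show ?thesis using f by simp
  qed
  ultimately show "1 < R_rem k y" by linarith
qed

lemma continuous_on_R_rem: "continuous_on S (R_rem k)"
  unfolding R_rem_def[abs_def] by (intro continuous_intros) auto

lemma h_fn_small: "e > 0 \<Longrightarrow> \<exists>y>0. h_fn k y < e"
proof -
  assume e: "e > 0"
  have "continuous_on UNIV (h_fn k)"
    unfolding h_fn_def[abs_def] by (intro continuous_intros continuous_on_R_rem)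
  then have "isCont (h_fn k) 0" by (simp add: continuous_on_eq_continuous_at)
  moreover have "h_fn k 0 = 0" by (simp add: h_fn_def R_rem_0)
  ultimately have "(h_fn k \<longlongrightarrow> 0) (at 0)" by (simp add: isCont_def)
  then have "(h_fn k \<longlongrightarrow> 0) (at_right 0)" by (rule tendsto_mono[OF at_le[OF subset_UNIV]])
  then have "\<forall>\<^sub>F y in at_right 0. h_fn k y < e" using e by (rule order_tendstoD)
  then have "\<forall>\<^sub>F y in at_right (0::real). h_fn k y < e \<and> y > 0"
    using eventually_at_right_less by (rule eventually_conj)
  then show ?thesis using eventually_happens'[OF trivial_limit_at_right_real] by blast
qed

text \<open>\<open>the_inv_into\<close> is a definite description, which says nothing unless the
  value 1 is attained exactly once; the intermediate value theorem and strict monotonicity provide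
  this.\<close>

lemma the_inv_into_gt:
  fixes \<phi> :: "real \<Rightarrow> real"
  assumes mono: "\<And>x y. 0 < x \<Longrightarrow> x < y \<Longrightarrow> \<phi> x < \<phi> y" and cont: "continuous_on {0<..} \<phi>"
    and low: "\<exists>y>0. \<phi> y < 1" and high: "\<exists>y>0. 1 < \<phi> y"
    and y: "0 < y" "y < the_inv_into {0<..} \<phi> 1"
  shows "\<phi> y < 1"
proof -
  obtain a b where ab: "0 < a" "\<phi> a < 1" "0 < b" "1 < \<phi> b" using low high by blast
  have "a < b" using mono[OF ab(3)] ab by (metis less_asym less_trans linorder_neqE_linordered_idom)
  then obtain x where x: "a \<le> x" "x \<le> b" "\<phi> x = 1"
  proof -
    have "{a..b} \<subseteq> {0<..}" using ab by auto
    from IVT'[of \<phi> a 1 b, OF _ _ _ continuous_on_subset[OF cont this]] show ?thesis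
      using that ab \<open>a < b\<close> by auto
  qed
  have inj: "inj_on \<phi> {0<..}"
    by (rule inj_onI) (metis mono greaterThan_iff less_irrefl linorder_neqE_linordered_idom)
  have "the_inv_into {0<..} \<phi> 1 = x" using the_inv_into_f_eq[OF inj x(3)] x ab by simp
  then show ?thesis using mono[OF y(1), of x] y x by simp
qed

lemma h_fn_lt_1:
  assumes "0 < y" "y < H_fn k 1"
  shows "h_fn k y < 1"
proof (rule the_inv_into_gt[where \<phi>="h_fn k"])
  show "h_fn k x < h_fn k y" if "0 < x" "x < y" for x y
    unfolding h_fn_def using that R_rem_strict_mono[of x y k] R_rem_nonneg[of x k]
    by (intro mult_strict_mono) auto
  show "continuous_on {0<..} (h_fn k)"
    unfolding h_fn_def[abs_def] by (intro continuous_intros continuous_on_R_rem)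
  show "\<exists>y>0. h_fn k y < 1" by (rule h_fn_small) simp
  obtain w where w: "w > 0" "1 < R_rem k w" using R_rem_unbounded by blast
  have "1 * R_rem k w \<le> h_fn k w" unfolding h_fn_def using w by (intro mult_right_mono) auto
  then show "\<exists>y>0. 1 < h_fn k y" using w by (intro exI[of _ w]) auto
  show "y < the_inv_into {0<..} (h_fn k) 1" using assms(2) by (simp add: H_fn_def)
qed fact

lemma \<sigma>_star_pos: "d > 0 \<Longrightarrow> y > 0 \<Longrightarrow> \<sigma>_star d y > 0"
  unfolding \<sigma>_star_def by (intro divide_pos_pos add_pos_nonneg) auto

text \<open>The equation of stationary points of (d / 2) ln(1 + 2 \<sigma>) + y / \<sigma>, the
  logarithm of the prefactor in \<open>g_fn\<close>, as a function of \<sigma>.\<close>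

lemma \<sigma>_star_eq:
  assumes d: "d > 0" and y: "y > 0"
  shows "y * (1 + 2 * \<sigma>_star d y) = real d * (\<sigma>_star d y)\<^sup>2"
proof -
  define q where "q = sqrt (y * (real d + y))"
  have q: "q\<^sup>2 = y * (real d + y)" unfolding q_def using y by simp
  have s: "\<sigma>_star d y = (y + q) / real d" by (simp add: \<sigma>_star_def q_def)
  have "real d * (real d * (\<sigma>_star d y)\<^sup>2) = (y + q)\<^sup>2"
    unfolding s using d by (simp add: power_divide power2_eq_square)
  also have "\<dots> = y * (real d + 2 * (y + q))" unfolding power2_sum q by (simp add: power2_eq_square algebra_simps)
  also have "\<dots> = real d * (y * (1 + 2 * \<sigma>_star d y))" unfolding s using d by (simp add: field_simps)
  finally show ?thesis using d by simp
qed

text \<open>The elementary bound \<open>ln x \<ge> 1 - 1 / x\<close> reduces the minimality of \<open>\<sigma>_star\<close> to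
  \<open>d (\<sigma> - \<sigma>_star)\<^sup>2 \<ge> 0\<close>.\<close>

lemma \<sigma>_star_minimal:
  assumes d: "d > 0" and y: "y > 0" and s: "\<sigma> > 0"
  shows "(1 + 2 * \<sigma>_star d y) powr (real d / 2) * exp (y / \<sigma>_star d y) \<le> (1 + 2 * \<sigma>) powr (real d / 2) * exp (y / \<sigma>)"
proof -
  define \<tau> where "\<tau> = \<sigma>_star d y"
  have t: "\<tau> > 0" unfolding \<tau>_def by (rule \<sigma>_star_pos[OF d y])
  have yt: "y = real d * \<tau>\<^sup>2 / (1 + 2 * \<tau>)"
    using \<sigma>_star_eq[OF d y] t unfolding \<tau>_def[symmetric] by (simp add: field_simps)
  have pos: "1 + 2 * \<sigma> > 0" "1 + 2 * \<tau> > 0" using s t by auto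
  have "ln ((1 + 2 * \<tau>) / (1 + 2 * \<sigma>)) \<le> (1 + 2 * \<tau>) / (1 + 2 * \<sigma>) - 1"
    using pos by (intro ln_le_minus_one) simp
  also have "\<dots> = 2 * (\<tau> - \<sigma>) / (1 + 2 * \<sigma>)" using pos by (simp add: field_simps)
  finally have l: "ln (1 + 2 * \<tau>) - ln (1 + 2 * \<sigma>) \<le> 2 * (\<tau> - \<sigma>) / (1 + 2 * \<sigma>)"
    using pos by (simp add: ln_div)
  have "real d / 2 * (ln (1 + 2 * \<tau>) - ln (1 + 2 * \<sigma>)) + y / \<tau> - y / \<sigma> \<le>
     real d / 2 * (2 * (\<tau> - \<sigma>) / (1 + 2 * \<sigma>)) + y / \<tau> - y / \<sigma>"
    using mult_left_mono[OF l, of "real d / 2"] by simp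
  also have "\<dots> = - real d * (\<sigma> - \<tau>)\<^sup>2 / (\<sigma> * (1 + 2 * \<sigma>) * (1 + 2 * \<tau>))"
    unfolding yt using s t pos by (simp add: divide_simps power2_eq_square) (simp add: algebra_simps)
  also have "\<dots> \<le> 0" using s pos by (intro divide_nonpos_nonneg) auto
  finally have "real d / 2 * ln (1 + 2 * \<tau>) + y / \<tau> \<le> real d / 2 * ln (1 + 2 * \<sigma>) + y / \<sigma>"
    by (simp add: algebra_simps)
  then have "exp (real d / 2 * ln (1 + 2 * \<tau>) + y / \<tau>) \<le> exp (real d / 2 * ln (1 + 2 * \<sigma>) + y / \<sigma>)" by simp
  then show ?thesis using pos unfolding \<tau>_def[symmetric] by (simp add: powr_def exp_add)
qed

lemma g_fn_lt_1:
  assumes d: "d > 0" and y: "0 < y" "y < G_fn k d 1"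
  shows "g_fn k d y < 1"
proof (rule the_inv_into_gt[where \<phi>="g_fn k d"])
  let ?K = "\<lambda>\<sigma> y. (1 + 2 * \<sigma>) powr (real d / 2) * exp (y / \<sigma>)"
  have g: "g_fn k d y = ?K (\<sigma>_star d y) y * R_rem k y" for y by (simp add: g_fn_def)
  have K1: "1 \<le> ?K (\<sigma>_star d y) y" if "y > 0" for y
  proof -
    have "1 * 1 \<le> ?K (\<sigma>_star d y) y"
      using \<sigma>_star_pos[OF d that] that by (intro mult_mono ge_one_powr_ge_zero) auto
    then show ?thesis by simp
  qed
  \<comment> \<open>Minimality replaces differentiation of \<open>\<sigma>_star\<close>: the
    prefactor at \<open>x\<close> grows when the optimal parameter of \<open>y\<close> is inserted,
    and for a fixed parameter it is monotone in the argument.\<close>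
  show "g_fn k d x < g_fn k d y" if xy: "0 < x" "x < y" for x y
  proof -
    have y: "0 < y" using xy by simp
    have "?K (\<sigma>_star d x) x \<le> ?K (\<sigma>_star d y) x" by (rule \<sigma>_star_minimal[OF d xy(1) \<sigma>_star_pos[OF d y]])
    also have "\<dots> \<le> ?K (\<sigma>_star d y) y" using xy \<sigma>_star_pos[OF d y] by (intro mult_left_mono) (auto intro: divide_right_mono)
    finally have "g_fn k d x \<le> ?K (\<sigma>_star d y) y * R_rem k x"
      unfolding g using R_rem_nonneg[of x k] xy by (intro mult_right_mono) auto
    also have "\<dots> < ?K (\<sigma>_star d y) y * R_rem k y"
    proof (rule mult_strict_left_mono)
      show "R_rem k x < R_rem k y" using xy by (intro R_rem_strict_mono) auto
      show "0 < ?K (\<sigma>_star d y) y" using K1[OF y] by (rule less_le_trans[OF zero_less_one])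
    qed
    finally show ?thesis unfolding g .
  qed
  show "continuous_on {0<..} (g_fn k d)"
  proof -
    have "continuous_on {0<..} (\<sigma>_star d)" unfolding \<sigma>_star_def[abs_def] by (intro continuous_intros) (use d in auto)
    moreover have "\<sigma>_star d y \<noteq> 0" "1 + 2 * \<sigma>_star d y \<noteq> 0" if "y \<in> {0<..}" for y using \<sigma>_star_pos[OF d, of y] that by auto
    ultimately show ?thesis unfolding g_fn_def[abs_def] by (intro continuous_intros continuous_on_R_rem) auto
  qed
  show "\<exists>y>0. g_fn k d y < 1"
  proof -
    \<comment> \<open>The parameter 1 in place of \<open>\<sigma>_star\<close> bounds
      \<open>g_fn\<close> by \<open>3 powr (real d / 2)\<close> times \<open>h_fn\<close>, whose
      smallness near 0 is known.\<close>
    obtain y where y: "y > 0" "h_fn k y < 1 / 3 powr (real d / 2)" using h_fn_small[of "1 / 3 powr (real d / 2)" k] by auto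
    have "g_fn k d y \<le> ?K 1 y * R_rem k y"
      unfolding g using \<sigma>_star_minimal[OF d y(1), of 1] R_rem_nonneg[of y k] y by (intro mult_right_mono) auto
    also have "\<dots> = 3 powr (real d / 2) * h_fn k y" by (simp add: h_fn_def)
    also have "\<dots> < 1" using y(2) by (simp add: field_simps)
    finally show ?thesis using y by blast
  qed
  obtain w where w: "w > 0" "1 < R_rem k w" using R_rem_unbounded by blast
  have "1 * R_rem k w \<le> g_fn k d w" unfolding g using w K1[OF w(1)] by (intro mult_right_mono) auto
  then show "\<exists>y>0. 1 < g_fn k d y" using w by (intro exI[of _ w]) auto
  show "y < the_inv_into {0<..} (g_fn k d) 1" using assms(3) by (simp add: G_fn_def)
qed fact

lemma min_h_g_lt_1:
  assumes "d > 0" "0 \<le> y" "y = 0 \<or> y < max (H_fn k 1) (G_fn k d 1)"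
  shows "min (h_fn k y) (g_fn k d y) < 1"
proof (cases "y = 0")
  case True
  then show ?thesis by (simp add: h_fn_def R_rem_0)
next
  case False
  then show ?thesis using assms h_fn_lt_1[of y k] g_fn_lt_1[of d y k] by (auto simp: min_less_iff_disj less_max_iff_disj)
qed

section \<open>Voronoi and midpoint cells\<close>

lemma is_norm_nonneg: "is_norm N \<Longrightarrow> 0 \<le> N x"
proof -
  assume N: "is_norm N"
  have "N (x + (-1) *\<^sub>R x) \<le> N x + N ((-1) *\<^sub>R x)" using N unfolding is_norm_def by blast
  moreover have "N ((-1) *\<^sub>R x) = \<bar>-1\<bar> * N x" using N unfolding is_norm_def by blast
  moreover have "N 0 = 0" using N unfolding is_norm_def by blast
  ultimately show ?thesis by simp
qed

text \<open>A norm is convex, and convex functions on a finite-dimensional space are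
  continuous.\<close>

lemma is_norm_continuous:
  fixes N :: "'a::euclidean_space \<Rightarrow> real"
  assumes N: "is_norm N"
  shows "continuous_on S N"
proof -
  have "convex_on UNIV N"
  proof (rule convex_onI)
    fix t :: real and x y :: 'a assume t: "0 < t" "t < 1"
    have "N ((1 - t) *\<^sub>R x + t *\<^sub>R y) \<le> N ((1 - t) *\<^sub>R x) + N (t *\<^sub>R y)" using N unfolding is_norm_def by blast
    also have "N ((1 - t) *\<^sub>R x) = \<bar>1 - t\<bar> * N x" using N unfolding is_norm_def by blast
    also have "N (t *\<^sub>R y) = \<bar>t\<bar> * N y" using N unfolding is_norm_def by blast
    finally show "N ((1 - t) *\<^sub>R x + t *\<^sub>R y) \<le> (1 - t) * N x + t * N y" using t by simp
  qed simp
  then have "continuous_on UNIV N" by (rule convex_on_continuous[OF open_UNIV])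
  then show ?thesis by (rule continuous_on_subset) simp
qed

text \<open>Compactness of the unit sphere gives some admissible constant. The infimum is admissible
  too, because for each \<open>x \<noteq> 0\<close> the quotient \<open>norm x / N x\<close> is a
  lower bound of the admissible ones.\<close>

lemma norm_le_norm_const:
  fixes N :: "'a::euclidean_space \<Rightarrow> real"
  assumes N: "is_norm N"
  shows "norm x \<le> norm_const N * N x" and "0 < norm_const N"
proof -
  let ?B = "{b. b > 0 \<and> (\<forall>z. norm z \<le> b * N z)}"
  have N0: "N 0 = 0" using N unfolding is_norm_def by blast
  have pos: "0 < N z" if "z \<noteq> 0" for z
    using is_norm_nonneg[OF N, of z] N that unfolding is_norm_def by (metis less_eq_real_def)
  have "\<exists>x0\<in>sphere (0::'a) 1. \<forall>x\<in>sphere 0 1. N x0 \<le> N x"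
    by (rule continuous_attains_inf) (use is_norm_continuous[OF N] in auto)
  then obtain x0 :: 'a where x0: "norm x0 = 1" "\<And>x. norm x = 1 \<Longrightarrow> N x0 \<le> N x" by auto
  have "x0 \<noteq> 0" using x0 by auto
  then have m: "N x0 > 0" by (rule pos)
  have "norm z \<le> (1 / N x0) * N z" for z
  proof (cases "z = 0")
    case False
    have "N x0 \<le> N ((1 / norm z) *\<^sub>R z)" using False by (intro x0) simp
    also have "\<dots> = \<bar>1 / norm z\<bar> * N z" using N unfolding is_norm_def by blast
    finally show ?thesis using False m by (simp add: field_simps)
  qed (simp add: N0)
  then have "1 / N x0 \<in> ?B" using m by simp
  then have ne: "?B \<noteq> {}" by blast
  show le: "norm x \<le> norm_const N * N x" for x
  proof (cases "x = 0")
    case False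
    have "norm x / N x \<le> Inf ?B"
      by (rule cInf_greatest[OF ne]) (use pos[OF False] in \<open>auto simp: pos_divide_le_eq\<close>)
    then show ?thesis using pos[OF False] by (simp add: norm_const_def pos_divide_le_eq)
  qed (simp add: N0)
  obtain e :: 'a where e: "e \<in> Basis" using nonempty_Basis by blast
  then have "0 < norm_const N * N e" using le[of e] by simp
  then show "0 < norm_const N" using is_norm_nonneg[OF N, of e] by (auto simp: zero_less_mult_iff)
qed

lemma norm_const_eq_1:
  fixes N :: "'a::euclidean_space \<Rightarrow> real"
  assumes "\<And>x. N x = norm x"
  shows "norm_const N = 1"
proof -
  obtain e :: 'a where e: "e \<in> Basis" using nonempty_Basis by blast
  have "{b. b > 0 \<and> (\<forall>z. norm z \<le> b * N z)} = {1..}"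
  proof (intro equalityI subsetI)
    fix b :: real assume "b \<in> {b. b > 0 \<and> (\<forall>z. norm z \<le> b * N z)}"
    then have "norm e \<le> b * norm e" by (auto simp: assms)
    then show "b \<in> {1..}" using e by simp
  next
    fix b :: real assume b: "b \<in> {1..}"
    have "norm z \<le> b * norm z" for z :: 'a using mult_right_mono[of 1 b "norm z"] b by simp
    then show "b \<in> {b. b > 0 \<and> (\<forall>z. norm z \<le> b * N z)}" using b by (auto simp: assms)
  qed
  then show ?thesis by (simp add: norm_const_def)
qed

lemma closed_voronoi:
  fixes N :: "'a::euclidean_space \<Rightarrow> real"
  assumes N: "is_norm N"
  shows "closed (voronoi N I z n)"
proof -
  have c: "continuous_on UNIV (\<lambda>x. N (x - a))" for a
    by (rule continuous_on_compose2[OF is_norm_continuous[OF N, of UNIV]]) (auto intro: continuous_intros)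
  have "voronoi N I z n = (\<Inter>l\<in>I - {n}. {x. N (x - z n) \<le> N (x - z l)})"
    by (auto simp: voronoi_def)
  then show ?thesis by (auto intro!: closed_INT closed_Collect_le c)
qed

lemma voronoi_radius:
  assumes "n \<in> I" "x \<in> voronoi N I z n"
  shows "ereal (N (x - z n)) \<le> covering_radius N I z"
proof -
  have "ereal (N (x - z n)) \<le> (INF l\<in>I. ereal (N (x - z l)))"
    using assms by (intro INF_greatest) (auto simp: voronoi_def)
  also have "\<dots> \<le> covering_radius N I z" unfolding covering_radius_def by (rule SUP_upper) simp
  finally show ?thesis .
qed

lemma negligible_borel_null_sets:
  assumes "negligible S" "S \<in> sets borel"
  shows "S \<in> null_sets lborel"
  using assms by (auto simp: negligible_iff_null_sets null_sets_def)

text \<open>Countability of \<open>I\<close> makes the counting measure sigma-finite and reduces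
  joint measurability to that of each \<open>f n\<close>.\<close>

lemma nn_integral_count_space_swap:
  assumes I: "countable I" and f: "\<And>n. n \<in> I \<Longrightarrow> f n \<in> borel_measurable M" and M: "sigma_finite_measure M"
  shows "(\<integral>\<^sup>+n. \<integral>\<^sup>+x. f n x \<partial>M \<partial>count_space I) = (\<integral>\<^sup>+x. \<integral>\<^sup>+n. f n x \<partial>count_space I \<partial>M)"
    and "(\<lambda>x. \<integral>\<^sup>+n. f n x \<partial>count_space I) \<in> borel_measurable M"
proof -
  interpret M: sigma_finite_measure M by fact
  interpret C: sigma_finite_measure "count_space I" by (rule sigma_finite_measure_count_space_countable[OF I])
  interpret P: pair_sigma_finite "count_space I" M ..
  have m: "(\<lambda>p. f (fst p) (snd p)) \<in> borel_measurable (count_space I \<Otimes>\<^sub>M M)"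
    by (rule measurable_pair_measure_countable1[OF I]) (use f in simp)
  have m': "(\<lambda>p. f (snd p) (fst p)) \<in> borel_measurable (M \<Otimes>\<^sub>M count_space I)"
    using measurable_compose[OF measurable_pair_swap' m] by (simp add: split_def)
  show "(\<lambda>x. \<integral>\<^sup>+n. f n x \<partial>count_space I) \<in> borel_measurable M"
    using C.borel_measurable_nn_integral_fst[OF m'] by simp
  show "(\<integral>\<^sup>+n. \<integral>\<^sup>+x. f n x \<partial>M \<partial>count_space I) = (\<integral>\<^sup>+x. \<integral>\<^sup>+n. f n x \<partial>count_space I \<partial>M)"
    using P.Fubini[OF m] by simp
qed

lemma nn_integral_ae_partition:
  fixes V :: "'i \<Rightarrow> 'a::euclidean_space set"
  assumes I: "countable I" and V: "\<And>n. n \<in> I \<Longrightarrow> V n \<in> sets borel" and part: "ae_partition I V"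
    and m: "\<phi> \<in> borel_measurable borel"
  shows "(\<integral>\<^sup>+x. \<phi> x \<partial>lborel) = (\<integral>\<^sup>+n. \<integral>\<^sup>+x. \<phi> x * indicator (V n) x \<partial>lborel \<partial>count_space I)"
proof -
  have U: "AE x in lborel. \<exists>n\<in>I. x \<in> V n"
  proof -
    have "(\<Union>n\<in>I. V n) \<in> sets borel" using I V by (rule sets.countable_UN'')
    then have "- (\<Union>n\<in>I. V n) \<in> sets borel" by (auto simp: Compl_eq_Diff_UNIV)
    then have "- (\<Union>n\<in>I. V n) \<in> null_sets lborel"
      using part by (intro negligible_borel_null_sets) (auto simp: ae_partition_def)
    from AE_not_in[OF this] show ?thesis by (auto elim!: eventually_mono)
  qed
  have D: "AE x in lborel. \<forall>n\<in>I. \<forall>l\<in>I. n \<noteq> l \<longrightarrow> \<not> (x \<in> V n \<and> x \<in> V l)"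
  proof (subst AE_ball_countable[OF I], intro ballI, subst AE_ball_countable[OF I], intro ballI)
    fix n l assume nl: "n \<in> I" "l \<in> I"
    show "AE x in lborel. n \<noteq> l \<longrightarrow> \<not> (x \<in> V n \<and> x \<in> V l)"
    proof (cases "n = l")
      case False
      then have "V n \<inter> V l \<in> null_sets lborel"
        using part V nl by (intro negligible_borel_null_sets) (auto simp: ae_partition_def)
      from AE_not_in[OF this] show ?thesis by (auto elim!: eventually_mono)
    qed simp
  qed
  have "(\<integral>\<^sup>+x. \<phi> x \<partial>lborel) = (\<integral>\<^sup>+x. \<integral>\<^sup>+n. \<phi> x * indicator (V n) x \<partial>count_space I \<partial>lborel)"
  proof (rule nn_integral_cong_AE, use U D in eventually_elim)
    case (elim x)
    then obtain n where n: "n \<in> I" "x \<in> V n" by blast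
    have "(\<integral>\<^sup>+l. \<phi> x * indicator (V l) x \<partial>count_space I) = (\<integral>\<^sup>+l. \<phi> x * indicator {n} l \<partial>count_space I)"
      using elim n by (intro nn_integral_cong) (auto split: split_indicator)
    also have "\<dots> = \<phi> x" using n by (subst nn_integral_cmult_indicator) (auto simp: one_ennreal_def[symmetric])
    finally show ?case ..
  qed
  also have "\<dots> = (\<integral>\<^sup>+n. \<integral>\<^sup>+x. \<phi> x * indicator (V n) x \<partial>lborel \<partial>count_space I)"
    by (rule nn_integral_count_space_swap(1)[symmetric, OF I]) (use m V in \<open>auto intro!: lborel.sigma_finite_measure_axioms\<close>)
  finally show ?thesis .
qed

text \<open>The Voronoi cell of \<open>t m\<close> on the line as an explicit interval; its length
  is the time factor of \<open>weight\<close>.\<close>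

definition time_cell :: "(int \<Rightarrow> real) \<Rightarrow> int \<Rightarrow> real set" where
  "time_cell t m = {(t (m - 1) + t m) / 2 .. (t m + t (m + 1)) / 2}"

lemma strict_mono_int:
  fixes t :: "int \<Rightarrow> real"
  assumes "\<And>m. t m < t (m + 1)"
  shows "m < l \<Longrightarrow> t m < t l"
proof (induction l rule: int_gr_induct)
  case base
  then show ?case using assms by simp
next
  case (step i)
  then show ?case using assms[of i] by simp
qed

lemma time_cells:
  fixes t :: "int \<Rightarrow> real"
  assumes mono: "\<And>m. t m < t (m + 1)" and cov: "covering_radius (\<lambda>s. \<bar>s\<bar>) UNIV t \<le> ereal \<delta>"
  shows "t (m + 1) - t m \<le> 2 * \<delta>" and "ae_partition UNIV (time_cell t)"
proof -
  note sm = strict_mono_int[of t, OF mono]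
  have le: "t m \<le> t l" if "m \<le> l" for m l using sm[of m l] that by (cases "m = l") auto
  have near: "\<exists>m. \<bar>x - t m\<bar> < \<delta> + e" if "e > 0" for x e
  proof -
    have "(INF m. ereal \<bar>x - t m\<bar>) \<le> ereal \<delta>"
      using cov unfolding covering_radius_def by (meson SUP_upper order_trans UNIV_I)
    also have "\<dots> < ereal (\<delta> + e)" using that by simp
    finally show ?thesis by (auto simp: INF_less_iff)
  qed
  show gap: "t (m + 1) - t m \<le> 2 * \<delta>" for m
  proof (rule field_le_epsilon)
    fix e :: real assume e: "e > 0"
    \<comment> \<open>At the midpoint of a gap every sampling time is at least half the gap
      away.\<close>
    define c where "c = (t m + t (m + 1)) / 2"
    have c: "2 * c = t m + t (m + 1)" by (simp add: c_def)
    obtain l where l: "\<bar>c - t l\<bar> < \<delta> + e / 2" using near[of "e / 2"] e by auto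
    have "t l \<le> t m \<or> t (m + 1) \<le> t l" using le[of l m] le[of "m + 1" l] by linarith
    then show "t (m + 1) - t m \<le> 2 * \<delta> + e" using l c by linarith
  qed
  have cover: "\<exists>m. x \<in> time_cell t m" for x
  proof -
    \<comment> \<open>Testing the covering radius beyond \<open>\<delta>\<close> to the left and to
      the right of \<open>x\<close> yields sampling times on both sides; in particular the sequence
      has no finite limits.\<close>
    obtain m1 where "\<bar>(x - \<delta> - 1) - t m1\<bar> < \<delta> + 1" using near[of 1] by auto
    then have m1: "t m1 \<le> x" by linarith
    obtain m2 where "\<bar>(x + \<delta> + 1) - t m2\<bar> < \<delta> + 1" using near[of 1] by auto
    then have m2: "x < t m2" by linarith
    have "m1 < m2" using m1 m2 le[of m2 m1] by linarith
    have fin: "finite {m. m1 \<le> m \<and> t m \<le> x}"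
    proof (rule finite_subset)
      show "{m. m1 \<le> m \<and> t m \<le> x} \<subseteq> {m1..m2}"
      proof
        fix m assume "m \<in> {m. m1 \<le> m \<and> t m \<le> x}"
        then show "m \<in> {m1..m2}" using m2 le[of m2 m] by (cases "m \<le> m2") auto
      qed
    qed simp
    define m where "m = Max {m. m1 \<le> m \<and> t m \<le> x}"
    have "m \<in> {m. m1 \<le> m \<and> t m \<le> x}" unfolding m_def using fin m1 by (intro Max_in) auto
    then have m: "m1 \<le> m" "t m \<le> x" by auto
    have "\<not> t (m + 1) \<le> x"
    proof
      assume "t (m + 1) \<le> x"
      then have "m + 1 \<le> m" using m Max_ge[OF fin, of "m + 1"] unfolding m_def[symmetric] by auto
      then show False by simp
    qed
    then have x: "t m \<le> x" "x \<le> t (m + 1)" using m by auto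
    show ?thesis
    proof (cases "x \<le> (t m + t (m + 1)) / 2")
      case True
      then show ?thesis using x mono[of "m - 1"] by (intro exI[of _ m]) (auto simp: time_cell_def field_simps)
    next
      case False
      then show ?thesis using x mono[of "m + 1"] by (intro exI[of _ "m + 1"]) (auto simp: time_cell_def field_simps)
    qed
  qed
  have disj: "negligible (time_cell t m \<inter> time_cell t l)" if "m < l" for m l
  proof (rule negligible_subset)
    show "negligible {(t m + t (m + 1)) / 2}" by simp
    have "t m \<le> t (l - 1)" "t (m + 1) \<le> t l" using le that by auto
    then show "time_cell t m \<inter> time_cell t l \<subseteq> {(t m + t (m + 1)) / 2}"
      unfolding time_cell_def by (auto simp: field_simps)
  qed
  show "ae_partition UNIV (time_cell t)"
    unfolding ae_partition_def
  proof (intro conjI ballI impI)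
    have "- (\<Union>m. time_cell t m) = {}" using cover by auto
    then show "negligible (- (\<Union>m. time_cell t m))" by simp
    fix m l :: int assume "m \<noteq> l"
    then show "negligible (time_cell t m \<inter> time_cell t l)"
      using disj[of m l] disj[of l m] by (cases "m < l") (auto simp: Int_commute)
  qed
qed

section \<open>Bernstein inequalities and Taylor expansion\<close>

lemma nsq_ift_PW:
  fixes g :: "'a::euclidean_space \<Rightarrow> complex"
  shows "bounded A \<Longrightarrow> g \<in> PW A \<Longrightarrow> nsq (ift g) = ennreal ((2 * pi) ^ DIM('a)) * nsq g"
  by (intro Plancherel PW_integrable PW_L2)

text \<open>Cauchy-Schwarz for the partial sums, then the limit. The sum of the \<open>q r\<close>
  may be infinite at this stage and is therefore taken in the extended reals.\<close>

lemma weighted_Cauchy_Schwarz_sums: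
  fixes t :: "nat \<Rightarrow> complex" and w q :: "nat \<Rightarrow> real"
  assumes t: "t sums S" and w: "w sums \<rho>" and w0: "\<And>r. 0 \<le> w r" and q0: "\<And>r. 0 \<le> q r"
    and le: "\<And>r. (cmod (t r))\<^sup>2 \<le> w r * q r"
  shows "ennreal ((cmod S)\<^sup>2) \<le> ennreal \<rho> * (\<Sum>r. ennreal (q r))"
proof -
  have \<rho>: "0 \<le> \<rho>" using sums_le[OF w0 sums_zero w] .
  have part: "ennreal ((cmod (\<Sum>r<N. t r))\<^sup>2) \<le> ennreal \<rho> * (\<Sum>r. ennreal (q r))" for N
  proof -
    have "cmod (\<Sum>r<N. t r) \<le> (\<Sum>r<N. sqrt (w r) * sqrt (q r))"
    proof (rule order_trans[OF norm_sum], rule sum_mono)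
      fix r
      have "cmod (t r) = sqrt ((cmod (t r))\<^sup>2)" by simp
      also have "\<dots> \<le> sqrt (w r * q r)" using le by (rule real_sqrt_le_mono)
      finally show "cmod (t r) \<le> sqrt (w r) * sqrt (q r)" by (simp add: real_sqrt_mult)
    qed
    then have "(cmod (\<Sum>r<N. t r))\<^sup>2 \<le> (\<Sum>r<N. sqrt (w r) * sqrt (q r))\<^sup>2" by (rule power_mono) simp
    also have "\<dots> \<le> (\<Sum>r<N. (sqrt (w r))\<^sup>2) * (\<Sum>r<N. (sqrt (q r))\<^sup>2)" by (rule Cauchy_Schwarz_ineq_sum)
    also have "\<dots> = (\<Sum>r<N. w r) * (\<Sum>r<N. q r)" using w0 q0 by simp
    also have "\<dots> \<le> \<rho> * (\<Sum>r<N. q r)"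
      using sum_le_suminf[OF sums_summable[OF w], of "{..<N}"] sums_unique[OF w] w0 q0
      by (intro mult_right_mono sum_nonneg) auto
    finally have "ennreal ((cmod (\<Sum>r<N. t r))\<^sup>2) \<le> ennreal (\<rho> * (\<Sum>r<N. q r))" by (rule ennreal_leI)
    also have "\<dots> = ennreal \<rho> * (\<Sum>r<N. ennreal (q r))"
      using \<rho> q0 by (simp add: ennreal_mult sum_nonneg)
    also have "\<dots> \<le> ennreal \<rho> * (\<Sum>r. ennreal (q r))"
      by (intro mult_left_mono sum_le_suminf) auto
    finally show ?thesis .
  qed
  have "(\<lambda>N. ennreal ((cmod (\<Sum>r<N. t r))\<^sup>2)) \<longlonglongrightarrow> ennreal ((cmod S)\<^sup>2)"
    using t unfolding sums_def by (intro tendsto_intros)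
  then show ?thesis by (rule LIMSEQ_le_const2) (use part in blast)
qed

text \<open>The exponential series in \<open>\<omega> \<bullet> u\<close> is integrated term by
  term; on the bounded set \<open>A\<close> it is dominated by an exponential series independent of
  \<open>\<omega>\<close>.\<close>

lemma ift_taylor:
  fixes g :: "'a::euclidean_space \<Rightarrow> complex"
  assumes A: "bounded A" and g: "g \<in> PW A"
  shows "(\<lambda>r. ift (\<lambda>\<omega>. (\<i> * complex_of_real (\<omega> \<bullet> u)) ^ r * g \<omega>) x / fact r) sums ift g (x + u)"
proof -
  obtain c where c: "A \<subseteq> cball 0 c" using bounded_obtain_cball[OF A] .
  define y where "y = \<bar>c\<bar> * norm u"
  note int = PW_integrable[OF A g]
  let ?f = "\<lambda>r \<omega>. ((\<i> * complex_of_real (\<omega> \<bullet> u)) ^ r / fact r) * (g \<omega> * exp (\<i> * complex_of_real (\<omega> \<bullet> x)))"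
  have P: "(\<lambda>\<omega>. (\<i> * complex_of_real (\<omega> \<bullet> u)) ^ r / fact r * g \<omega>) \<in> PW A" for r
    by (intro PW_mult_continuous[OF A g] continuous_intros) auto
  have i: "integrable lborel (?f r)" for r
    using ift_integrable[OF PW_integrable[OF A P]] by (simp add: mult.assoc)
  have nb: "cmod (?f r \<omega>) \<le> y ^ r / fact r * cmod (g \<omega>)" for r \<omega>
  proof (cases "\<omega> \<in> A")
    case True
    have "\<bar>\<omega> \<bullet> u\<bar> \<le> norm \<omega> * norm u" by (rule Cauchy_Schwarz_ineq2)
    also have "\<dots> \<le> y" unfolding y_def using c True by (intro mult_right_mono) auto
    finally have "\<bar>\<omega> \<bullet> u\<bar> ^ r \<le> y ^ r" by (intro power_mono) auto
    then have "\<bar>\<omega> \<bullet> u\<bar> ^ r / fact r * cmod (g \<omega>) \<le> y ^ r / fact r * cmod (g \<omega>)"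
      by (intro mult_right_mono divide_right_mono) auto
    then show ?thesis by (simp add: norm_mult norm_divide norm_power)
  qed (use g in \<open>auto simp: PW_def\<close>)
  have "(\<lambda>r. integral\<^sup>L lborel (?f r)) sums (\<integral>\<omega>. (\<Sum>r. ?f r \<omega>) \<partial>lborel)"
  proof (rule sums_integral[OF i])
    have sy: "summable (\<lambda>r. y ^ r / fact r)"
      using summable_exp[of y] by (simp add: divide_inverse mult.commute)
    show "AE \<omega> in lborel. summable (\<lambda>r. norm (?f r \<omega>))"
    proof (rule AE_I2)
      fix \<omega>
      show "summable (\<lambda>r. norm (?f r \<omega>))"
        by (rule summable_comparison_test'[OF summable_mult2[OF sy, of "cmod (g \<omega>)"]]) (use nb in auto)
    qed
    show "summable (\<lambda>r. \<integral>\<omega>. norm (?f r \<omega>) \<partial>lborel)"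
    proof (rule summable_comparison_test'[OF summable_mult2[OF sy, of "\<integral>\<omega>. cmod (g \<omega>) \<partial>lborel"]])
      fix r
      have "(\<integral>\<omega>. norm (?f r \<omega>) \<partial>lborel) \<le> (\<integral>\<omega>. y ^ r / fact r * cmod (g \<omega>) \<partial>lborel)"
        by (intro integral_mono integrable_norm i integrable_mult_right int nb)
      then show "norm (\<integral>\<omega>. norm (?f r \<omega>) \<partial>lborel) \<le> y ^ r / fact r * (\<integral>\<omega>. cmod (g \<omega>) \<partial>lborel)"
        by simp
    qed
  qed
  also have "(\<integral>\<omega>. (\<Sum>r. ?f r \<omega>) \<partial>lborel) = ift g (x + u)"
    unfolding ift_def
  proof (intro Bochner_Integration.integral_cong refl)
    fix \<omega>
    have "(\<lambda>r. (\<i> * complex_of_real (\<omega> \<bullet> u)) ^ r / fact r) sums exp (\<i> * complex_of_real (\<omega> \<bullet> u))"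
      using exp_converges[of "\<i> * complex_of_real (\<omega> \<bullet> u)"] by (simp add: scaleR_conv_of_real divide_inverse mult.commute)
    from sums_mult2[OF this, of "g \<omega> * exp (\<i> * complex_of_real (\<omega> \<bullet> x))"]
    show "(\<Sum>r. ?f r \<omega>) = g \<omega> * exp (\<i> * complex_of_real (\<omega> \<bullet> (x + u)))"
      by (simp add: sums_iff inner_add_right distrib_left exp_add mult_ac)
  qed
  also have "(\<lambda>r. integral\<^sup>L lborel (?f r)) = (\<lambda>r. ift (\<lambda>\<omega>. (\<i> * complex_of_real (\<omega> \<bullet> u)) ^ r * g \<omega>) x / fact r)"
    unfolding ift_def by (rule ext) (simp add: mult.assoc flip: integral_divide_zero)
  finally show ?thesis .
qed

text \<open>\<open>Qsq r g x\<close> is the squared Euclidean norm of the tensor of all partial derivatives of order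
  \<open>r\<close> of \<open>ift g\<close> at \<open>x\<close>.\<close>

primrec Qsq :: "nat \<Rightarrow> ('a::euclidean_space \<Rightarrow> complex) \<Rightarrow> 'a \<Rightarrow> real" where
  "Qsq 0 g x = (cmod (ift g x))\<^sup>2"
| "Qsq (Suc r) g x = (\<Sum>b\<in>Basis. Qsq r (\<lambda>\<omega>. complex_of_real (\<omega> \<bullet> b) * g \<omega>) x)"

lemma Qsq_nonneg: "0 \<le> Qsq r g x"
  by (induction r arbitrary: g) (auto intro: sum_nonneg)

lemma PW_mult_inner: "bounded A \<Longrightarrow> g \<in> PW A \<Longrightarrow> (\<lambda>\<omega>. complex_of_real (\<omega> \<bullet> b) * g \<omega>) \<in> PW A"
  by (intro PW_mult_continuous continuous_intros)

lemma Qsq_measurable: "g \<in> borel_measurable borel \<Longrightarrow> Qsq r g \<in> borel_measurable borel"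
proof (induction r arbitrary: g)
  case 0
  then have "ift g \<in> borel_measurable borel" by (rule ift_measurable)
  then show ?case by simp
next
  case (Suc r)
  have "Qsq r (\<lambda>\<omega>. complex_of_real (\<omega> \<bullet> b) * g \<omega>) \<in> borel_measurable borel" for b
    using Suc.prems by (intro Suc.IH) measurable
  then show ?case by simp
qed

text \<open>A directional derivative of order \<open>r\<close> is the contraction of the derivative
  tensor with \<open>r\<close> copies of \<open>u\<close>; Cauchy-Schwarz in one slot at a time
  costs \<open>(norm u)\<^sup>2\<close> per slot.\<close>

lemma Qsq_bound:
  fixes g :: "'a::euclidean_space \<Rightarrow> complex"
  assumes A: "bounded A" and g: "g \<in> PW A"
  shows "(cmod (ift (\<lambda>\<omega>. complex_of_real (\<omega> \<bullet> u) ^ r * g \<omega>) x))\<^sup>2 \<le> norm u ^ (2 * r) * Qsq r g x"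
  using g
proof (induction r arbitrary: g)
  case (Suc r)
  let ?g = "\<lambda>b \<omega>. complex_of_real (\<omega> \<bullet> b) * g \<omega>"
  let ?t = "\<lambda>b. ift (\<lambda>\<omega>. complex_of_real (\<omega> \<bullet> u) ^ r * ?g b \<omega>) x"
  have P: "(\<lambda>\<omega>. complex_of_real (\<omega> \<bullet> u) ^ r * ?g b \<omega>) \<in> PW A" for b
    by (intro PW_mult_continuous[OF A PW_mult_inner[OF A Suc.prems]] continuous_intros)
  have "ift (\<lambda>\<omega>. complex_of_real (\<omega> \<bullet> u) ^ Suc r * g \<omega>) x =
      ift (\<lambda>\<omega>. \<Sum>b\<in>Basis. complex_of_real (u \<bullet> b) * (complex_of_real (\<omega> \<bullet> u) ^ r * ?g b \<omega>)) x"
  proof -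
    have "complex_of_real (\<omega> \<bullet> u) ^ Suc r * g \<omega> =
        (\<Sum>b\<in>Basis. complex_of_real (u \<bullet> b) * (complex_of_real (\<omega> \<bullet> u) ^ r * ?g b \<omega>))" for \<omega>
    proof -
      have "complex_of_real (\<omega> \<bullet> u) = (\<Sum>b\<in>Basis. complex_of_real (u \<bullet> b) * complex_of_real (\<omega> \<bullet> b))"
        by (subst euclidean_inner) (simp add: mult.commute)
      then have "complex_of_real (\<omega> \<bullet> u) ^ Suc r * g \<omega> =
        (\<Sum>b\<in>Basis. complex_of_real (u \<bullet> b) * complex_of_real (\<omega> \<bullet> b)) * (complex_of_real (\<omega> \<bullet> u) ^ r * g \<omega>)"
        by (simp only: power_Suc mult.assoc)
      then show ?thesis by (simp only: sum_distrib_right) (simp only: mult_ac)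
    qed
    then show ?thesis by (simp only:)
  qed
  also have "\<dots> = (\<Sum>b\<in>Basis. complex_of_real (u \<bullet> b) * ?t b)"
    by (subst ift_sum) (auto intro!: integrable_mult_right PW_integrable[OF A P] simp: ift_cmult)
  finally have "cmod (ift (\<lambda>\<omega>. complex_of_real (\<omega> \<bullet> u) ^ Suc r * g \<omega>) x) \<le> (\<Sum>b\<in>Basis. \<bar>u \<bullet> b\<bar> * cmod (?t b))"
    using norm_sum[of "\<lambda>b. complex_of_real (u \<bullet> b) * ?t b" Basis] by (simp only: norm_mult norm_of_real)
  then have "(cmod (ift (\<lambda>\<omega>. complex_of_real (\<omega> \<bullet> u) ^ Suc r * g \<omega>) x))\<^sup>2 \<le> (\<Sum>b\<in>Basis. \<bar>u \<bullet> b\<bar> * cmod (?t b))\<^sup>2"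
    by (rule power_mono) simp
  also have "\<dots> \<le> (\<Sum>b\<in>Basis. \<bar>u \<bullet> b\<bar>\<^sup>2) * (\<Sum>b\<in>Basis. (cmod (?t b))\<^sup>2)" by (rule Cauchy_Schwarz_ineq_sum)
  also have "(\<Sum>b\<in>Basis. \<bar>u \<bullet> b\<bar>\<^sup>2) = (norm u)\<^sup>2" by (simp add: power2_norm_eq_sum)
  also have "(norm u)\<^sup>2 * (\<Sum>b\<in>Basis. (cmod (?t b))\<^sup>2) \<le> (norm u)\<^sup>2 * (\<Sum>b\<in>Basis. norm u ^ (2 * r) * Qsq r (?g b) x)"
    by (intro mult_left_mono sum_mono Suc.IH PW_mult_inner[OF A Suc.prems]) simp
  also have "\<dots> = norm u ^ (2 * Suc r) * Qsq (Suc r) g x"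
    by (simp add: sum_distrib_left[symmetric] mult.assoc[symmetric] power_add[symmetric])
  finally show ?case .
qed simp

lemma nsq_mult_le:
  assumes g: "g \<in> PW A" and k: "k \<in> borel_measurable borel" and C: "\<And>\<omega>. \<omega> \<in> A \<Longrightarrow> (cmod (k \<omega>))\<^sup>2 \<le> C"
  shows "nsq (\<lambda>\<omega>. k \<omega> * g \<omega>) \<le> ennreal C * nsq g"
proof -
  have "nsq (\<lambda>\<omega>. k \<omega> * g \<omega>) \<le> (\<integral>\<^sup>+\<omega>. ennreal C * ennreal ((cmod (g \<omega>))\<^sup>2) \<partial>lborel)"
    unfolding nsq_def
  proof (rule nn_integral_mono)
    fix \<omega>
    show "ennreal ((cmod (k \<omega> * g \<omega>))\<^sup>2) \<le> ennreal C * ennreal ((cmod (g \<omega>))\<^sup>2)"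
    proof (cases "\<omega> \<in> A")
      case True
      then have "(cmod (k \<omega> * g \<omega>))\<^sup>2 \<le> C * (cmod (g \<omega>))\<^sup>2"
        using C by (simp add: norm_mult power_mult_distrib mult_right_mono)
      then show ?thesis by (simp only: ennreal_leI ennreal_mult''[OF zero_le_power2, symmetric])
    qed (use g in \<open>auto simp: PW_def\<close>)
  qed
  also have "\<dots> = ennreal C * nsq g"
    unfolding nsq_def using PW_measurable[OF g] by (intro nn_integral_cmult) measurable
  finally show ?thesis .
qed

lemma nsq_ift_mult_le:
  assumes A: "bounded A" and g: "g \<in> PW A" and k: "continuous_on UNIV k" and C: "\<And>\<omega>. \<omega> \<in> A \<Longrightarrow> (cmod (k \<omega>))\<^sup>2 \<le> C"
  shows "nsq (ift (\<lambda>\<omega>. k \<omega> * g \<omega>)) \<le> ennreal C * nsq (ift g)"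
  unfolding nsq_ift_PW[OF A g] nsq_ift_PW[OF A PW_mult_continuous[OF A g k]]
  using nsq_mult_le[OF g borel_measurable_continuous_onI[OF k] C]
  by (simp add: mult.left_commute[of "ennreal C"] mult_left_mono)

text \<open>Bernstein's inequality for the whole gradient. By Plancherel the squares of the
  coordinates of \<open>\<omega>\<close> are added before they are estimated, which avoids a factor
  for the dimension.\<close>

lemma sum_nsq_inner_le:
  fixes g :: "'a::euclidean_space \<Rightarrow> complex"
  assumes A: "bounded A" and g: "g \<in> PW A" and m: "\<And>\<omega>. \<omega> \<in> A \<Longrightarrow> norm \<omega> \<le> m"
  shows "(\<Sum>b\<in>Basis. nsq (ift (\<lambda>\<omega>. complex_of_real (\<omega> \<bullet> b) * g \<omega>))) \<le> ennreal (m\<^sup>2) * nsq (ift g)"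
proof -
  have gm[measurable]: "g \<in> borel_measurable borel" using g by (rule PW_measurable)
  have "(\<Sum>b\<in>Basis. nsq (\<lambda>\<omega>. complex_of_real (\<omega> \<bullet> b) * g \<omega>)) = (\<integral>\<^sup>+\<omega>. (\<Sum>b\<in>Basis. ennreal ((cmod (complex_of_real (\<omega> \<bullet> b) * g \<omega>))\<^sup>2)) \<partial>lborel)"
    unfolding nsq_def by (rule nn_integral_sum[symmetric]) measurable
  also have "\<dots> = nsq (\<lambda>\<omega>. complex_of_real (norm \<omega>) * g \<omega>)"
    unfolding nsq_def
  proof (intro nn_integral_cong)
    fix \<omega>
    have "(\<Sum>b\<in>Basis. ennreal ((cmod (complex_of_real (\<omega> \<bullet> b) * g \<omega>))\<^sup>2)) = ennreal (\<Sum>b\<in>Basis. (cmod (complex_of_real (\<omega> \<bullet> b) * g \<omega>))\<^sup>2)"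
      by (rule sum_ennreal) simp
    also have "(\<Sum>b\<in>Basis. (cmod (complex_of_real (\<omega> \<bullet> b) * g \<omega>))\<^sup>2) = (cmod (complex_of_real (norm \<omega>) * g \<omega>))\<^sup>2"
      by (simp add: norm_mult power_mult_distrib power2_norm_eq_sum sum_distrib_right)
    finally show "(\<Sum>b\<in>Basis. ennreal ((cmod (complex_of_real (\<omega> \<bullet> b) * g \<omega>))\<^sup>2)) = ennreal ((cmod (complex_of_real (norm \<omega>) * g \<omega>))\<^sup>2)" .
  qed
  also have "\<dots> \<le> ennreal (m\<^sup>2) * nsq g"
    by (rule nsq_mult_le[OF g]) (use m in \<open>auto intro: power_mono\<close>)
  finally have "(\<Sum>b\<in>Basis. nsq (\<lambda>\<omega>. complex_of_real (\<omega> \<bullet> b) * g \<omega>)) \<le> ennreal (m\<^sup>2) * nsq g" .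
  then have "ennreal ((2 * pi) ^ DIM('a)) * (\<Sum>b\<in>Basis. nsq (\<lambda>\<omega>. complex_of_real (\<omega> \<bullet> b) * g \<omega>)) \<le>
    ennreal ((2 * pi) ^ DIM('a)) * (ennreal (m\<^sup>2) * nsq g)" by (rule mult_left_mono) simp
  then show ?thesis
    unfolding nsq_ift_PW[OF A g] nsq_ift_PW[OF A PW_mult_inner[OF A g]]
    by (simp only: sum_distrib_left[symmetric] mult.left_commute[of "ennreal (m\<^sup>2)"])
qed

text \<open>A sampling measure is a measure \<open>M\<close> together with the sampling points \<open>p\<close>; both Lebesgue
  measure (with \<open>p = id\<close>) and weighted point evaluations occur below.\<close>

lemma nn_integral_Qsq_le:
  fixes g :: "'a::euclidean_space \<Rightarrow> complex"
  assumes A: "bounded A" and p[measurable]: "p \<in> M \<rightarrow>\<^sub>M borel"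
    and samp: "\<And>g. g \<in> PW A \<Longrightarrow> (\<integral>\<^sup>+i. ennreal ((cmod (ift g (p i)))\<^sup>2) \<partial>M) \<le> B * nsq (ift g)"
    and m: "\<And>\<omega>. \<omega> \<in> A \<Longrightarrow> norm \<omega> \<le> m" and g: "g \<in> PW A"
  shows "(\<integral>\<^sup>+i. ennreal (Qsq r g (p i)) \<partial>M) \<le> ennreal (m ^ (2 * r)) * (B * nsq (ift g))"
  using g
proof (induction r arbitrary: g)
  case 0
  then show ?case using samp by simp
next
  case (Suc r)
  let ?g = "\<lambda>b \<omega>. complex_of_real (\<omega> \<bullet> b) * g \<omega>"
  note P = PW_mult_inner[OF A Suc.prems]
  have "(\<integral>\<^sup>+i. ennreal (Qsq (Suc r) g (p i)) \<partial>M) = (\<Sum>b\<in>Basis. \<integral>\<^sup>+i. ennreal (Qsq r (?g b) (p i)) \<partial>M)"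
  proof -
    have "(\<integral>\<^sup>+i. ennreal (Qsq (Suc r) g (p i)) \<partial>M) = (\<integral>\<^sup>+i. (\<Sum>b\<in>Basis. ennreal (Qsq r (?g b) (p i))) \<partial>M)"
      by (simp add: sum_ennreal Qsq_nonneg)
    also have "\<dots> = (\<Sum>b\<in>Basis. \<integral>\<^sup>+i. ennreal (Qsq r (?g b) (p i)) \<partial>M)"
    proof (rule nn_integral_sum)
      fix b
      have "Qsq r (?g b) \<in> borel_measurable borel" by (rule Qsq_measurable) (rule PW_measurable[OF P])
      then show "(\<lambda>i. ennreal (Qsq r (?g b) (p i))) \<in> borel_measurable M" by measurable
    qed
    finally show ?thesis .
  qed
  also have "\<dots> \<le> (\<Sum>b\<in>Basis. ennreal (m ^ (2 * r)) * (B * nsq (ift (?g b))))"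
    by (intro sum_mono Suc.IH P)
  also have "\<dots> = ennreal (m ^ (2 * r)) * (B * (\<Sum>b\<in>Basis. nsq (ift (?g b))))"
    by (simp only: sum_distrib_left)
  also have "\<dots> \<le> ennreal (m ^ (2 * r)) * (B * (ennreal (m\<^sup>2) * nsq (ift g)))"
    by (intro mult_left_mono sum_nsq_inner_le[OF A Suc.prems m]) auto
  also have "\<dots> = ennreal (m ^ (2 * r)) * ennreal (m\<^sup>2) * (B * nsq (ift g))" by (simp only: mult_ac)
  also have "ennreal (m ^ (2 * r)) * ennreal (m\<^sup>2) = ennreal (m ^ (2 * Suc r))"
    by (simp add: power_mult power2_eq_square mult_ac flip: ennreal_mult)
  finally show ?case .
qed

section \<open>Tails of the Taylor series\<close>

definition tail :: "nat \<Rightarrow> real \<Rightarrow> real" where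
  "tail s y = (\<Sum>r. y ^ (r + s) / fact (r + s))"

lemma tail_sums: "(\<lambda>r. y ^ (r + s) / fact (r + s)) sums tail s y"
proof -
  have "summable (\<lambda>r. y ^ r / fact r)"
    using summable_exp[of y] by (simp add: divide_inverse mult.commute)
  then have "summable (\<lambda>r. y ^ (r + s) / fact (r + s))" by (rule summable_ignore_initial_segment)
  then show ?thesis unfolding tail_def by (rule summable_sums)
qed

lemma tail_0: "tail 0 y = exp y"
  unfolding tail_def exp_def by (simp add: divide_inverse mult.commute)

lemma tail_Suc: "tail (Suc k) y = R_rem k y"
  unfolding tail_def by (rule sums_unique[OF R_rem_sums, symmetric])

lemma tail_nonneg: "0 \<le> y \<Longrightarrow> 0 \<le> tail s y"
  unfolding tail_def by (rule suminf_nonneg[OF sums_summable[OF tail_sums]]) simp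

text \<open>The second Cauchy-Schwarz factor of a Taylor tail. For \<open>c = R / m\<close>,
  Bernstein's factor \<open>m ^ (2 * r)\<close> turns its weights into those of the exponential
  series at \<open>m * R\<close>, which is also the first factor.\<close>

definition Esum :: "nat \<Rightarrow> real \<Rightarrow> ('a::euclidean_space \<Rightarrow> complex) \<Rightarrow> 'a \<Rightarrow> ennreal" where
  "Esum s c g x = (\<Sum>r. ennreal (c ^ (r + s) / fact (r + s) * Qsq (r + s) g x))"

lemma Esum_measurable: "g \<in> borel_measurable borel \<Longrightarrow> Esum s c g \<in> borel_measurable borel"
  unfolding Esum_def[abs_def] using Qsq_measurable[of g] by measurable

text \<open>The factor \<open>R ^ (2 * r)\<close> from the contraction bound is split as
  \<open>(m * R) ^ r\<close> times \<open>(R / m) ^ r\<close>, and the two factorials are shared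
  between the two sums. The starting index \<open>s = 0\<close> bounds the value itself,
  \<open>s = Suc k\<close> the Taylor remainder.\<close>

lemma taylor_tail_le:
  fixes g :: "'a::euclidean_space \<Rightarrow> complex"
  assumes A: "bounded A" and g: "g \<in> PW A" and m: "m > 0" and u: "norm u \<le> R"
  shows "ennreal ((cmod (ift g (x + u) - (\<Sum>r<s. ift (\<lambda>\<omega>. (\<i> * complex_of_real (\<omega> \<bullet> u)) ^ r * g \<omega>) x / fact r)))\<^sup>2)
    \<le> ennreal (tail s (m * R)) * Esum s (R / m) g x"
proof -
  have R: "0 \<le> R" using u norm_ge_zero order_trans by blast
  let ?T = "\<lambda>r. ift (\<lambda>\<omega>. (\<i> * complex_of_real (\<omega> \<bullet> u)) ^ r * g \<omega>) x"
  have le: "(cmod (?T r / fact r))\<^sup>2 \<le> ((m * R) ^ r / fact r) * ((R / m) ^ r / fact r * Qsq r g x)" for r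
  proof -
    have "?T r = \<i> ^ r * ift (\<lambda>\<omega>. complex_of_real (\<omega> \<bullet> u) ^ r * g \<omega>) x"
      by (simp add: power_mult_distrib mult.assoc flip: ift_cmult)
    then have "(cmod (?T r))\<^sup>2 = (cmod (ift (\<lambda>\<omega>. complex_of_real (\<omega> \<bullet> u) ^ r * g \<omega>) x))\<^sup>2"
      by (simp add: norm_mult norm_power)
    also have "\<dots> \<le> norm u ^ (2 * r) * Qsq r g x" by (rule Qsq_bound[OF A g])
    also have "\<dots> \<le> R ^ (2 * r) * Qsq r g x"
      using u by (intro mult_right_mono power_mono Qsq_nonneg) auto
    also have "R ^ (2 * r) = (m * R) ^ r * (R / m) ^ r"
      using m by (simp add: power_mult_distrib[symmetric] power_mult power2_eq_square)
    finally have "(cmod (?T r))\<^sup>2 / (fact r)\<^sup>2 \<le> (m * R) ^ r * (R / m) ^ r * Qsq r g x / (fact r)\<^sup>2"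
      by (rule divide_right_mono) simp
    then show ?thesis by (simp add: norm_divide power_divide power2_eq_square mult_ac)
  qed
  have "(\<lambda>r. ?T (r + s) / fact (r + s)) sums (ift g (x + u) - (\<Sum>r<s. ?T r / fact r))"
    by (rule sums_split_initial_segment[OF ift_taylor[OF A g]])
  moreover have "0 \<le> (m * R) ^ (r + s) / fact (r + s)" for r using m R by simp
  moreover have "0 \<le> (R / m) ^ (r + s) / fact (r + s) * Qsq (r + s) g x" for r
    using m R Qsq_nonneg by (intro mult_nonneg_nonneg) auto
  ultimately show ?thesis
    unfolding Esum_def by (rule weighted_Cauchy_Schwarz_sums[OF _ tail_sums[of "m * R" s] _ _ le])
qed

lemma nn_integral_Esum_le:
  fixes g :: "'a::euclidean_space \<Rightarrow> complex"
  assumes A: "bounded A" and p[measurable]: "p \<in> M \<rightarrow>\<^sub>M borel"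
    and samp: "\<And>g. g \<in> PW A \<Longrightarrow> (\<integral>\<^sup>+i. ennreal ((cmod (ift g (p i)))\<^sup>2) \<partial>M) \<le> B * nsq (ift g)"
    and m: "\<And>\<omega>. \<omega> \<in> A \<Longrightarrow> norm \<omega> \<le> m" and m0: "m > 0" and R: "0 \<le> R" and g: "g \<in> PW A"
  shows "(\<integral>\<^sup>+i. Esum s (R / m) g (p i) \<partial>M) \<le> ennreal (tail s (m * R)) * (B * nsq (ift g))"
proof -
  have gm: "g \<in> borel_measurable borel" using g by (rule PW_measurable)
  have [measurable]: "Qsq r g \<in> borel_measurable borel" for r by (rule Qsq_measurable[OF gm])
  have c: "0 \<le> (R / m) ^ r / fact r" for r using R m0 by simp
  have "(\<integral>\<^sup>+i. Esum s (R / m) g (p i) \<partial>M) = (\<Sum>r. \<integral>\<^sup>+i. ennreal ((R / m) ^ (r + s) / fact (r + s) * Qsq (r + s) g (p i)) \<partial>M)"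
    unfolding Esum_def by (rule nn_integral_suminf) measurable
  also have "\<dots> \<le> (\<Sum>r. ennreal ((m * R) ^ (r + s) / fact (r + s)) * (B * nsq (ift g)))"
  proof (rule suminf_le)
    fix r
    let ?r = "r + s"
    have "(\<integral>\<^sup>+i. ennreal ((R / m) ^ ?r / fact ?r * Qsq ?r g (p i)) \<partial>M) = ennreal ((R / m) ^ ?r / fact ?r) * (\<integral>\<^sup>+i. ennreal (Qsq ?r g (p i)) \<partial>M)"
      by (subst nn_integral_cmult[symmetric]) (measurable, simp only: ennreal_mult'[OF c])
    also have "\<dots> \<le> ennreal ((R / m) ^ ?r / fact ?r) * (ennreal (m ^ (2 * ?r)) * (B * nsq (ift g)))"
      by (intro mult_left_mono nn_integral_Qsq_le[OF A p samp m g]) auto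
    also have "\<dots> = ennreal ((R / m) ^ ?r / fact ?r * m ^ (2 * ?r)) * (B * nsq (ift g))"
      using c[of ?r] by (simp only: mult.assoc[symmetric] ennreal_mult')
    also have "(R / m) ^ ?r / fact ?r * m ^ (2 * ?r) = (m * R) ^ ?r / fact ?r"
    proof -
      have "(R / m) ^ ?r * m ^ (2 * ?r) = (R / m * m\<^sup>2) ^ ?r" by (simp only: power_mult power_mult_distrib)
      also have "R / m * m\<^sup>2 = m * R" using m0 by (simp add: power2_eq_square)
      finally show ?thesis by (simp only: times_divide_eq_left)
    qed
    finally show "(\<integral>\<^sup>+i. ennreal ((R / m) ^ ?r / fact ?r * Qsq ?r g (p i)) \<partial>M) \<le> ennreal ((m * R) ^ ?r / fact ?r) * (B * nsq (ift g))" .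
  qed auto
  also have "\<dots> = (\<Sum>r. ennreal ((m * R) ^ (r + s) / fact (r + s))) * (B * nsq (ift g))"
    by (rule ennreal_suminf_multc)
  also have "(\<Sum>r. ennreal ((m * R) ^ (r + s) / fact (r + s))) = ennreal (tail s (m * R))"
  proof -
    have "0 \<le> (m * R) ^ (r + s) / fact (r + s)" for r using m0 R by simp
    from suminf_ennreal_eq[OF this tail_sums] show ?thesis .
  qed
  finally show ?thesis .
qed

lemma nn_integral_Esum_lborel_le:
  fixes g :: "'a::euclidean_space \<Rightarrow> complex"
  assumes "bounded A" "\<And>\<omega>. \<omega> \<in> A \<Longrightarrow> norm \<omega> \<le> m" "m > 0" "0 \<le> R" "g \<in> PW A"
  shows "(\<integral>\<^sup>+x. Esum s (R / m) g x \<partial>lborel) \<le> ennreal (tail s (m * R)) * nsq (ift g)"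
  using nn_integral_Esum_le[of A "\<lambda>x. x" lborel 1 m R g s] assms by (simp add: nsq_def)

section \<open>Sampling on cells\<close>

text \<open>An abstract family of cells, instantiated both by the Voronoi cells in space and by the
  midpoint cells in time; \<open>R\<close> is the radius in the Euclidean norm, the one in which the
  spectrum is measured.\<close>

locale cells =
  fixes I :: "'i set" and V :: "'i \<Rightarrow> 'a::euclidean_space set" and z :: "'i \<Rightarrow> 'a" and R :: real
  assumes I: "countable I" and V: "\<And>n. n \<in> I \<Longrightarrow> V n \<in> sets borel" and part: "ae_partition I V"
    and rad: "\<And>n x. n \<in> I \<Longrightarrow> x \<in> V n \<Longrightarrow> norm (x - z n) \<le> R" and R: "0 \<le> R"
begin

text \<open>The integral of a function given separately on every cell. Keeping the cell index as an
  argument avoids choosing values on overlaps; an integrand independent of the index gives the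
  Lebesgue integral, and one constant on each cell a sum weighted with the cell volumes.\<close>

definition cellint :: "('i \<Rightarrow> 'a \<Rightarrow> ennreal) \<Rightarrow> ennreal" where
  "cellint \<phi> = (\<integral>\<^sup>+n. \<integral>\<^sup>+x. \<phi> n x * indicator (V n) x \<partial>lborel \<partial>count_space I)"

lemma cellint_const: "\<phi> \<in> borel_measurable borel \<Longrightarrow> cellint (\<lambda>n. \<phi>) = (\<integral>\<^sup>+x. \<phi> x \<partial>lborel)"
  unfolding cellint_def by (rule nn_integral_ae_partition[OF I V part, symmetric])

lemma cellint_mono: "(\<And>n x. n \<in> I \<Longrightarrow> x \<in> V n \<Longrightarrow> \<phi> n x \<le> \<psi> n x) \<Longrightarrow> cellint \<phi> \<le> cellint \<psi>"
  unfolding cellint_def by (intro nn_integral_mono) (auto split: split_indicator)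

lemma cellint_add:
  assumes "\<And>n. n \<in> I \<Longrightarrow> \<phi> n \<in> borel_measurable borel" "\<And>n. n \<in> I \<Longrightarrow> \<psi> n \<in> borel_measurable borel"
  shows "cellint (\<lambda>n x. \<phi> n x + \<psi> n x) = cellint \<phi> + cellint \<psi>"
proof -
  have "cellint (\<lambda>n x. \<phi> n x + \<psi> n x) = (\<integral>\<^sup>+n. (\<integral>\<^sup>+x. \<phi> n x * indicator (V n) x \<partial>lborel) + (\<integral>\<^sup>+x. \<psi> n x * indicator (V n) x \<partial>lborel) \<partial>count_space I)"
    unfolding cellint_def
  proof (rule nn_integral_cong)
    fix n assume "n \<in> space (count_space I)"
    then have n: "n \<in> I" by simp
    show "(\<integral>\<^sup>+x. (\<phi> n x + \<psi> n x) * indicator (V n) x \<partial>lborel) = (\<integral>\<^sup>+x. \<phi> n x * indicator (V n) x \<partial>lborel) + (\<integral>\<^sup>+x. \<psi> n x * indicator (V n) x \<partial>lborel)"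
      unfolding distrib_right using assms[OF n] V[OF n] by (intro nn_integral_add) auto
  qed
  also have "\<dots> = cellint \<phi> + cellint \<psi>"
    unfolding cellint_def by (rule nn_integral_add) auto
  finally show ?thesis .
qed

lemma cellint_cmult:
  assumes "\<And>n. n \<in> I \<Longrightarrow> \<phi> n \<in> borel_measurable borel"
  shows "cellint (\<lambda>n x. c * \<phi> n x) = c * cellint \<phi>"
proof -
  have "cellint (\<lambda>n x. c * \<phi> n x) = (\<integral>\<^sup>+n. c * (\<integral>\<^sup>+x. \<phi> n x * indicator (V n) x \<partial>lborel) \<partial>count_space I)"
    unfolding cellint_def
  proof (rule nn_integral_cong)
    fix n assume "n \<in> space (count_space I)"
    then have n: "n \<in> I" by simp
    show "(\<integral>\<^sup>+x. c * \<phi> n x * indicator (V n) x \<partial>lborel) = c * (\<integral>\<^sup>+x. \<phi> n x * indicator (V n) x \<partial>lborel)"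
      unfolding mult.assoc using assms[OF n] V[OF n] by (intro nn_integral_cmult) auto
  qed
  also have "\<dots> = c * cellint \<phi>"
    unfolding cellint_def by (rule nn_integral_cmult) simp
  finally show ?thesis .
qed

lemma cellint_points: "cellint (\<lambda>n x. \<phi> n) = (\<integral>\<^sup>+n. \<phi> n * emeasure lborel (V n) \<partial>count_space I)"
  unfolding cellint_def using V by (intro nn_integral_cong) (simp add: nn_integral_cmult_indicator)

text \<open>Convexity of the square gives \<open>\<bar>a + b\<bar>\<^sup>2 \<le> \<bar>a\<bar>\<^sup>2 / (1 - \<lambda>) + \<bar>b\<bar>\<^sup>2 / \<lambda>\<close>, which is
  optimal for \<open>\<lambda> = q\<close>; this replaces Minkowski's inequality.\<close>

lemma perturbation:
  assumes f: "f \<in> L2" and P: "\<And>n. n \<in> I \<Longrightarrow> P n \<in> borel_measurable borel" and q: "0 \<le> q"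
    and close: "cellint (\<lambda>n x. ennreal ((cmod (f x - P n x))\<^sup>2)) \<le> ennreal (q\<^sup>2) * nsq f"
  shows "cellint (\<lambda>n x. ennreal ((cmod (P n x))\<^sup>2)) \<le> ennreal ((1 + q)\<^sup>2) * nsq f"
    and "q < 1 \<Longrightarrow> ennreal ((1 - q)\<^sup>2) * nsq f \<le> cellint (\<lambda>n x. ennreal ((cmod (P n x))\<^sup>2))"
proof -
  have fm[measurable]: "f \<in> borel_measurable borel" using f by (rule L2_measurable)
  define X where "X = (L2_norm f)\<^sup>2"
  have X0: "0 \<le> X" by (simp add: X_def)
  have X: "nsq f = ennreal X" unfolding X_def by (rule nsq_eq[OF f])
  let ?Y = "cellint (\<lambda>n x. ennreal ((cmod (P n x))\<^sup>2))"
  let ?Z = "cellint (\<lambda>n x. ennreal ((cmod (f x - P n x))\<^sup>2))"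
  have cf: "cellint (\<lambda>n x. ennreal ((cmod (f x))\<^sup>2)) = ennreal X"
    by (subst cellint_const) (auto simp: nsq_def[symmetric] X)
  have mP: "(\<lambda>x. ennreal ((cmod (P n x))\<^sup>2)) \<in> borel_measurable borel" if "n \<in> I" for n using P[OF that] by measurable
  have mD: "(\<lambda>x. ennreal ((cmod (f x - P n x))\<^sup>2)) \<in> borel_measurable borel" if "n \<in> I" for n using P[OF that] by measurable
  have conv: "(cmod (a + b))\<^sup>2 \<le> 1 / (1 - l) * (cmod a)\<^sup>2 + 1 / l * (cmod b)\<^sup>2" if l: "0 < l" "l < 1" for a b :: complex and l
  proof -
    have "(cmod (a + b))\<^sup>2 \<le> (cmod a + cmod b)\<^sup>2" by (intro power_mono norm_triangle_ineq) simp
    also have "\<dots> \<le> 1 / (1 - l) * (cmod a)\<^sup>2 + 1 / l * (cmod b)\<^sup>2"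
    proof -
      have "1 / (1 - l) * (cmod a)\<^sup>2 + 1 / l * (cmod b)\<^sup>2 - (cmod a + cmod b)\<^sup>2 = (l * cmod a - (1 - l) * cmod b)\<^sup>2 / (l * (1 - l))"
        using l by (simp add: divide_simps power2_eq_square) (simp add: algebra_simps)
      also have "\<dots> \<ge> 0" using l by (intro divide_nonneg_nonneg) auto
      finally show ?thesis by simp
    qed
    finally show ?thesis .
  qed
  have conv2: "(cmod (a - b))\<^sup>2 \<le> (1 + l) * (cmod a)\<^sup>2 + (1 + 1 / l) * (cmod b)\<^sup>2" if l: "0 < l" for a b :: complex and l
  proof -
    have "(cmod (a - b))\<^sup>2 \<le> (cmod a + cmod b)\<^sup>2" by (intro power_mono norm_triangle_ineq4) simp
    also have "\<dots> \<le> (1 + l) * (cmod a)\<^sup>2 + (1 + 1 / l) * (cmod b)\<^sup>2"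
    proof -
      have "(1 + l) * (cmod a)\<^sup>2 + (1 + 1 / l) * (cmod b)\<^sup>2 - (cmod a + cmod b)\<^sup>2 = (l * cmod a - cmod b)\<^sup>2 / l"
        using l by (simp add: divide_simps power2_eq_square) (simp add: algebra_simps)
      also have "\<dots> \<ge> 0" using l by (intro divide_nonneg_nonneg) auto
      finally show ?thesis by simp
    qed
    finally show ?thesis .
  qed
  have comb: "cellint (\<lambda>n x. ennreal (a * (cmod (u n x))\<^sup>2 + c * (cmod (v n x))\<^sup>2)) =
      ennreal a * cellint (\<lambda>n x. ennreal ((cmod (u n x))\<^sup>2)) + ennreal c * cellint (\<lambda>n x. ennreal ((cmod (v n x))\<^sup>2))"
    if "0 \<le> a" "0 \<le> c" "\<And>n. n \<in> I \<Longrightarrow> u n \<in> borel_measurable borel" "\<And>n. n \<in> I \<Longrightarrow> v n \<in> borel_measurable borel" for a c and u v :: "'i \<Rightarrow> 'a \<Rightarrow> complex"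
  proof -
    have mu: "(\<lambda>x. ennreal ((cmod (u n x))\<^sup>2)) \<in> borel_measurable borel" if "n \<in> I" for n using \<open>n \<in> I \<Longrightarrow> u n \<in> _\<close>[OF that] by measurable
    have mv: "(\<lambda>x. ennreal ((cmod (v n x))\<^sup>2)) \<in> borel_measurable borel" if "n \<in> I" for n using \<open>n \<in> I \<Longrightarrow> v n \<in> _\<close>[OF that] by measurable
    have "cellint (\<lambda>n x. ennreal (a * (cmod (u n x))\<^sup>2 + c * (cmod (v n x))\<^sup>2)) =
        cellint (\<lambda>n x. ennreal a * ennreal ((cmod (u n x))\<^sup>2) + ennreal c * ennreal ((cmod (v n x))\<^sup>2))"
      using that(1,2) by (simp add: ennreal_mult)
    also have "\<dots> = cellint (\<lambda>n x. ennreal a * ennreal ((cmod (u n x))\<^sup>2)) + cellint (\<lambda>n x. ennreal c * ennreal ((cmod (v n x))\<^sup>2))"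
      using mu mv by (intro cellint_add borel_measurable_times) auto
    finally show ?thesis by (simp only: cellint_cmult[OF mu] cellint_cmult[OF mv])
  qed
  \<comment> \<open>Proved for parameters strictly above \<open>q\<close>, so that
    \<open>1 / l\<close> makes sense also for \<open>q = 0\<close>; the bound for \<open>q\<close>
    is the limit.\<close>
  have up: "?Y \<le> ennreal ((1 + l)\<^sup>2 * X)" if l: "q < l" for l
  proof -
    have l0: "0 < l" using q l by linarith
    have Z: "?Z \<le> ennreal (l\<^sup>2 * X)"
    proof -
      have "?Z \<le> ennreal (q\<^sup>2 * X)" using close X0 by (simp add: X flip: ennreal_mult)
      also have "\<dots> \<le> ennreal (l\<^sup>2 * X)" using l q X0 by (intro ennreal_leI mult_right_mono power_mono) auto
      finally show ?thesis .
    qed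
    have "?Y \<le> cellint (\<lambda>n x. ennreal ((1 + l) * (cmod (f x))\<^sup>2 + (1 + 1 / l) * (cmod (f x - P n x))\<^sup>2))"
    proof (intro cellint_mono ennreal_leI)
      fix n x show "(cmod (P n x))\<^sup>2 \<le> (1 + l) * (cmod (f x))\<^sup>2 + (1 + 1 / l) * (cmod (f x - P n x))\<^sup>2"
        using conv2[OF l0, of "f x" "f x - P n x"] by simp
    qed
    also have "\<dots> = ennreal (1 + l) * ennreal X + ennreal (1 + 1 / l) * ?Z"
      using l0 P by (subst comb) (auto simp: cf)
    also have "\<dots> \<le> ennreal (1 + l) * ennreal X + ennreal (1 + 1 / l) * ennreal (l\<^sup>2 * X)"
      using Z by (intro add_mono mult_left_mono) auto
    also have "\<dots> = ennreal ((1 + l) * X + (1 + 1 / l) * (l\<^sup>2 * X))"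
      using l0 X0 by (simp flip: ennreal_mult ennreal_plus)
    also have "(1 + l) * X + (1 + 1 / l) * (l\<^sup>2 * X) = (1 + l)\<^sup>2 * X"
      using l0 by (simp add: field_simps power2_eq_square)
    finally show ?thesis .
  qed
  have seq: "(\<lambda>n. q + (1 - q) / real (Suc n)) \<longlonglongrightarrow> q"
    using tendsto_add[OF tendsto_const LIMSEQ_Suc[OF lim_const_over_n[of "1 - q"]], of q] by simp
  have seq': "(\<lambda>n. q + 1 / real (Suc n)) \<longlonglongrightarrow> q"
    using tendsto_add[OF tendsto_const LIMSEQ_Suc[OF lim_1_over_n], of q] by simp
  have "?Y \<le> ennreal ((1 + q)\<^sup>2 * X)"
  proof (rule LIMSEQ_le_const)
    show "(\<lambda>n. ennreal ((1 + (q + 1 / real (Suc n)))\<^sup>2 * X)) \<longlonglongrightarrow> ennreal ((1 + q)\<^sup>2 * X)"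
      by (intro tendsto_intros seq')
    show "\<exists>N. \<forall>n\<ge>N. ?Y \<le> ennreal ((1 + (q + 1 / real (Suc n)))\<^sup>2 * X)"
      by (intro exI[of _ 0] allI impI up) simp
  qed
  then show "?Y \<le> ennreal ((1 + q)\<^sup>2) * nsq f" using X0 by (simp add: X flip: ennreal_mult)
  assume q1: "q < 1"
  have low: "ennreal ((1 - l)\<^sup>2 * X) \<le> ?Y" if l: "q < l" "l < 1" for l
  proof (cases "?Y = top")
    case False
    then obtain Y where Y: "?Y = ennreal Y" "0 \<le> Y" by (cases ?Y) auto
    have l0: "0 < l" using q l by linarith
    have Z: "?Z \<le> ennreal (l\<^sup>2 * X)"
    proof -
      have "?Z \<le> ennreal (q\<^sup>2 * X)" using close X0 by (simp add: X flip: ennreal_mult)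
      also have "\<dots> \<le> ennreal (l\<^sup>2 * X)" using l q X0 by (intro ennreal_leI mult_right_mono power_mono) auto
      finally show ?thesis .
    qed
    have "ennreal X \<le> cellint (\<lambda>n x. ennreal (1 / (1 - l) * (cmod (P n x))\<^sup>2 + 1 / l * (cmod (f x - P n x))\<^sup>2))"
      unfolding cf[symmetric]
    proof (intro cellint_mono ennreal_leI)
      fix n x show "(cmod (f x))\<^sup>2 \<le> 1 / (1 - l) * (cmod (P n x))\<^sup>2 + 1 / l * (cmod (f x - P n x))\<^sup>2"
        using conv[OF l0 l(2), of "P n x" "f x - P n x"] by simp
    qed
    also have "\<dots> = ennreal (1 / (1 - l)) * ?Y + ennreal (1 / l) * ?Z"
      using l l0 P by (subst comb) auto
    also have "\<dots> \<le> ennreal (1 / (1 - l)) * ennreal Y + ennreal (1 / l) * ennreal (l\<^sup>2 * X)"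
      using Z Y by (intro add_mono mult_left_mono) auto
    also have "\<dots> = ennreal (1 / (1 - l) * Y + 1 / l * (l\<^sup>2 * X))"
      using l l0 X0 Y by (simp flip: ennreal_mult ennreal_plus)
    finally have "X \<le> 1 / (1 - l) * Y + 1 / l * (l\<^sup>2 * X)"
      using l l0 X0 Y by (subst (asm) ennreal_le_iff) auto
    then have "(1 - l) * X \<le> 1 / (1 - l) * Y" using l0 by (simp add: power2_eq_square algebra_simps)
    then have "(1 - l)\<^sup>2 * X \<le> Y" using l by (simp add: field_simps power2_eq_square)
    then show ?thesis unfolding Y by (rule ennreal_leI)
  qed simp
  have "ennreal ((1 - q)\<^sup>2 * X) \<le> ?Y"
  proof (rule LIMSEQ_le_const2)
    show "(\<lambda>n. ennreal ((1 - (q + (1 - q) / real (Suc n)))\<^sup>2 * X)) \<longlonglongrightarrow> ennreal ((1 - q)\<^sup>2 * X)"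
      by (intro tendsto_intros seq)
    show "\<exists>N. \<forall>n\<ge>N. ennreal ((1 - (q + (1 - q) / real (Suc n)))\<^sup>2 * X) \<le> ?Y"
    \<comment> \<open>The index starts at 1, because for \<open>n = 0\<close> the parameter would be
      1.\<close>
    proof (intro exI[of _ 1] allI impI low)
      fix n :: nat assume "n \<ge> 1"
      then have "(1 - q) / real (Suc n) < (1 - q) / 1" using q1 by (intro divide_strict_left_mono) auto
      then show "q + (1 - q) / real (Suc n) < 1" by simp
    qed (use q1 in simp)
  qed
  then show "ennreal ((1 - q)\<^sup>2) * nsq f \<le> ?Y" using X0 by (simp add: X flip: ennreal_mult)
qed

end

section \<open>Sampling and Taylor approximation on general cells\<close>

context cells
begin

text \<open>The value at \<open>z n\<close> is expanded around the variable point \<open>x\<close>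
  of the cell, so that the bound no longer depends on \<open>n\<close> and the cells add up to a
  Lebesgue integral. Both Cauchy-Schwarz factors contribute the full exponential series.\<close>

lemma sampling_exp:
  assumes A: "bounded A" and m: "\<And>\<omega>. \<omega> \<in> A \<Longrightarrow> norm \<omega> \<le> m" and m0: "m > 0" and g: "g \<in> PW A"
  shows "cellint (\<lambda>n x. ennreal ((cmod (ift g (z n)))\<^sup>2)) \<le> ennreal ((exp (m * R))\<^sup>2) * nsq (ift g)"
proof -
  have Em: "Esum 0 (R / m) g \<in> borel_measurable borel" by (rule Esum_measurable[OF PW_measurable[OF g]])
  have "cellint (\<lambda>n x. ennreal ((cmod (ift g (z n)))\<^sup>2)) \<le> cellint (\<lambda>n x. ennreal (exp (m * R)) * Esum 0 (R / m) g x)"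
  proof (rule cellint_mono)
    fix n x assume "n \<in> I" "x \<in> V n"
    then have "norm (z n - x) \<le> R" using rad by (simp add: norm_minus_commute)
    from taylor_tail_le[OF A g m0 this, where x=x and s=0]
    show "ennreal ((cmod (ift g (z n)))\<^sup>2) \<le> ennreal (exp (m * R)) * Esum 0 (R / m) g x" by (simp add: tail_0)
  qed
  also have "\<dots> = (\<integral>\<^sup>+x. ennreal (exp (m * R)) * Esum 0 (R / m) g x \<partial>lborel)"
    by (rule cellint_const) (use Em in measurable)
  also have "\<dots> = ennreal (exp (m * R)) * (\<integral>\<^sup>+x. Esum 0 (R / m) g x \<partial>lborel)"
    using Em by (intro nn_integral_cmult) simp
  also have "\<dots> \<le> ennreal (exp (m * R)) * (ennreal (tail 0 (m * R)) * nsq (ift g))"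
    by (intro mult_left_mono nn_integral_Esum_lborel_le[OF A m m0 R g]) auto
  also have "\<dots> = ennreal ((exp (m * R))\<^sup>2) * nsq (ift g)"
    by (simp add: tail_0 power2_eq_square ennreal_mult mult.assoc)
  finally show ?thesis .
qed

text \<open>Averaging over balls of radius \<open>\<epsilon>\<close> instead of over the cells themselves.\<close>

lemma sampling_ball:
  assumes A: "bounded A" and m: "\<And>\<omega>. \<omega> \<in> A \<Longrightarrow> norm \<omega> \<le> m" and m0: "m > 0" and g: "g \<in> PW A" and e: "\<epsilon> > 0"
  shows "cellint (\<lambda>n x. ennreal ((cmod (ift g (z n)))\<^sup>2)) \<le> ennreal (((\<epsilon> + R) / \<epsilon>) ^ DIM('a) * (exp (m * \<epsilon>))\<^sup>2) * nsq (ift g)"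
proof -
  define v where "v = unit_ball_vol (real DIM('a))"
  have v: "v > 0" unfolding v_def by (rule unit_ball_vol_pos) simp
  define E where "E x = ennreal (exp (m * \<epsilon>)) * Esum 0 (\<epsilon> / m) g x" for x
  have Em[measurable]: "E \<in> borel_measurable borel"
    unfolding E_def[abs_def] using Esum_measurable[OF PW_measurable[OF g]] by measurable
  define \<phi> where "\<phi> n = ennreal ((cmod (ift g (z n)))\<^sup>2)" for n
  have [measurable]: "(indicator (cball c \<rho>) :: 'a \<Rightarrow> ennreal) \<in> borel_measurable borel" for c \<rho>
    by (rule borel_measurable_indicator) simp
  have ball_e: "emeasure lborel (cball (c :: 'a) \<rho>) = ennreal (v * \<rho> ^ DIM('a))" if "\<rho> \<ge> 0" for c \<rho>
    unfolding v_def by (rule emeasure_cball[OF that])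
  define S where "S = (\<integral>\<^sup>+n. \<phi> n * emeasure lborel (V n) \<partial>count_space I)"
  have pt: "\<phi> n * ennreal (v * \<epsilon> ^ DIM('a)) \<le> (\<integral>\<^sup>+x. E x * indicator (cball (z n) \<epsilon>) x \<partial>lborel)" for n
  proof -
    have "\<phi> n * ennreal (v * \<epsilon> ^ DIM('a)) = (\<integral>\<^sup>+x. \<phi> n * indicator (cball (z n) \<epsilon>) x \<partial>lborel)"
      using e by (simp add: nn_integral_cmult_indicator ball_e)
    also have "\<dots> \<le> (\<integral>\<^sup>+x. E x * indicator (cball (z n) \<epsilon>) x \<partial>lborel)"
    proof (rule nn_integral_mono)
      fix x
      show "\<phi> n * indicator (cball (z n) \<epsilon>) x \<le> E x * indicator (cball (z n) \<epsilon>) x"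
      proof (cases "x \<in> cball (z n) \<epsilon>")
        case True
        then have "norm (z n - x) \<le> \<epsilon>" by (simp add: dist_norm)
        from taylor_tail_le[OF A g m0 this, where x=x and s=0]
        have "\<phi> n \<le> E x" by (simp add: tail_0 \<phi>_def E_def)
        then show ?thesis by (rule mult_right_mono) simp
      qed simp
    qed
    finally show ?thesis .
  qed
  \<comment> \<open>The cells of all sampling points within \<open>\<epsilon>\<close> of
    \<open>x\<close> lie in the ball of radius \<open>\<epsilon> + R\<close> around \<open>x\<close>
    and overlap in null sets only, so its volume bounds their total volume.\<close>
  have mult: "(\<integral>\<^sup>+n. emeasure lborel (V n) * indicator (cball (z n) \<epsilon>) x \<partial>count_space I) \<le> ennreal (v * (\<epsilon> + R) ^ DIM('a))" for x
  proof -
    have "(\<integral>\<^sup>+n. emeasure lborel (V n) * indicator (cball (z n) \<epsilon>) x \<partial>count_space I) = cellint (\<lambda>n w. indicator (cball (z n) \<epsilon>) x)"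
      unfolding cellint_points by (simp add: mult.commute)
    also have "\<dots> \<le> cellint (\<lambda>n w. indicator (cball x (\<epsilon> + R)) w)"
    proof (rule cellint_mono)
      fix n w assume "n \<in> I" "w \<in> V n"
      then have "norm (w - z n) \<le> R" by (rule rad)
      moreover have "dist x w \<le> \<epsilon> + R" if "dist (z n) x \<le> \<epsilon>" "norm (w - z n) \<le> R"
        using that dist_triangle[of x w "z n"] by (simp add: dist_norm norm_minus_commute)
      ultimately show "indicator (cball (z n) \<epsilon>) x \<le> (indicator (cball x (\<epsilon> + R)) w :: ennreal)"
        by (auto split: split_indicator)
    qed
    also have "\<dots> = ennreal (v * (\<epsilon> + R) ^ DIM('a))"
      using e R by (subst cellint_const) (auto simp: ball_e)
    finally show ?thesis .
  qed
  have "ennreal (v * \<epsilon> ^ DIM('a)) * S = (\<integral>\<^sup>+n. emeasure lborel (V n) * (\<phi> n * ennreal (v * \<epsilon> ^ DIM('a))) \<partial>count_space I)"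
    unfolding S_def by (subst nn_integral_cmult[symmetric]) (auto simp: mult_ac)
  also have "\<dots> \<le> (\<integral>\<^sup>+n. emeasure lborel (V n) * (\<integral>\<^sup>+x. E x * indicator (cball (z n) \<epsilon>) x \<partial>lborel) \<partial>count_space I)"
    by (intro nn_integral_mono mult_left_mono pt) simp
  also have "\<dots> = (\<integral>\<^sup>+n. \<integral>\<^sup>+x. emeasure lborel (V n) * (E x * indicator (cball (z n) \<epsilon>) x) \<partial>lborel \<partial>count_space I)"
    by (intro nn_integral_cong nn_integral_cmult[symmetric]) simp
  also have "\<dots> = (\<integral>\<^sup>+x. \<integral>\<^sup>+n. emeasure lborel (V n) * (E x * indicator (cball (z n) \<epsilon>) x) \<partial>count_space I \<partial>lborel)"
    by (rule nn_integral_count_space_swap(1)[OF I]) (auto intro: lborel.sigma_finite_measure_axioms)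
  also have "\<dots> = (\<integral>\<^sup>+x. E x * (\<integral>\<^sup>+n. emeasure lborel (V n) * indicator (cball (z n) \<epsilon>) x \<partial>count_space I) \<partial>lborel)"
    by (intro nn_integral_cong, subst nn_integral_cmult[symmetric]) (auto simp: mult_ac)
  also have "\<dots> \<le> (\<integral>\<^sup>+x. E x * ennreal (v * (\<epsilon> + R) ^ DIM('a)) \<partial>lborel)"
    by (intro nn_integral_mono mult_left_mono mult) simp
  also have "\<dots> = (\<integral>\<^sup>+x. E x \<partial>lborel) * ennreal (v * (\<epsilon> + R) ^ DIM('a))"
    by (rule nn_integral_multc) simp
  also have "(\<integral>\<^sup>+x. E x \<partial>lborel) = ennreal (exp (m * \<epsilon>)) * (\<integral>\<^sup>+x. Esum 0 (\<epsilon> / m) g x \<partial>lborel)"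
    unfolding E_def using Esum_measurable[OF PW_measurable[OF g]] by (intro nn_integral_cmult) simp
  also have "\<dots> * ennreal (v * (\<epsilon> + R) ^ DIM('a)) \<le> ennreal (exp (m * \<epsilon>)) * (ennreal (tail 0 (m * \<epsilon>)) * nsq (ift g)) * ennreal (v * (\<epsilon> + R) ^ DIM('a))"
    using e by (intro mult_right_mono mult_left_mono nn_integral_Esum_lborel_le[OF A m m0 _ g]) auto
  finally have le: "ennreal (v * \<epsilon> ^ DIM('a)) * S \<le> ennreal (exp (m * \<epsilon>)) * (ennreal (exp (m * \<epsilon>)) * nsq (ift g)) * ennreal (v * (\<epsilon> + R) ^ DIM('a))"
    by (simp only: tail_0)
  have "S = ennreal (1 / (v * \<epsilon> ^ DIM('a))) * (ennreal (v * \<epsilon> ^ DIM('a)) * S)"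
    using v e by (simp add: mult.assoc[symmetric] flip: ennreal_mult)
  also have "\<dots> \<le> ennreal (1 / (v * \<epsilon> ^ DIM('a))) * (ennreal (exp (m * \<epsilon>)) * (ennreal (exp (m * \<epsilon>)) * nsq (ift g)) * ennreal (v * (\<epsilon> + R) ^ DIM('a)))"
    by (intro mult_left_mono le) simp
  also have "\<dots> = (ennreal (1 / (v * \<epsilon> ^ DIM('a))) * ennreal (exp (m * \<epsilon>)) * ennreal (exp (m * \<epsilon>)) * ennreal (v * (\<epsilon> + R) ^ DIM('a))) * nsq (ift g)"
    by (simp only: mult_ac)
  also have "ennreal (1 / (v * \<epsilon> ^ DIM('a))) * ennreal (exp (m * \<epsilon>)) * ennreal (exp (m * \<epsilon>)) * ennreal (v * (\<epsilon> + R) ^ DIM('a)) =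
      ennreal (1 / (v * \<epsilon> ^ DIM('a)) * exp (m * \<epsilon>) * exp (m * \<epsilon>) * (v * (\<epsilon> + R) ^ DIM('a)))"
  proof -
    have "0 \<le> v * (\<epsilon> + R) ^ DIM('a)" using v e R by simp
    then show ?thesis by (simp only: ennreal_mult'' exp_ge_zero)
  qed
  also have "1 / (v * \<epsilon> ^ DIM('a)) * exp (m * \<epsilon>) * exp (m * \<epsilon>) * (v * (\<epsilon> + R) ^ DIM('a)) = ((\<epsilon> + R) / \<epsilon>) ^ DIM('a) * (exp (m * \<epsilon>))\<^sup>2"
    using v by (simp add: power_divide power2_eq_square)
  finally show ?thesis unfolding cellint_points S_def \<phi>_def .
qed

text \<open>The Taylor polynomial at \<open>z n\<close> of degree less than \<open>s\<close>,
  written with directional derivatives, as in the Taylor series itself; it is rewritten in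
  multi-indices only for the comparison with the weights.\<close>

definition tpoly :: "nat \<Rightarrow> ('a \<Rightarrow> complex) \<Rightarrow> 'i \<Rightarrow> 'a \<Rightarrow> complex" where
  "tpoly s g n x = (\<Sum>r<s. ift (\<lambda>\<omega>. (\<i> * complex_of_real (\<omega> \<bullet> (x - z n))) ^ r * g \<omega>) (z n) / fact r)"

lemma tpoly_measurable:
  assumes [measurable]: "g \<in> borel_measurable borel"
  shows "tpoly s g n \<in> borel_measurable borel"
  unfolding tpoly_def[abs_def] ift_def by measurable

text \<open>Here the expansion is around \<open>z n\<close>, and the derivatives sampled there are
  controlled by applying \<open>samp\<close> to each of them. The tail enters once from either
  Cauchy-Schwarz factor, hence its square.\<close>

lemma tpoly_close:
  assumes A: "bounded A" and m: "\<And>\<omega>. \<omega> \<in> A \<Longrightarrow> norm \<omega> \<le> m" and m0: "m > 0" and g: "g \<in> PW A" and K: "0 \<le> K"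
    and samp: "\<And>g. g \<in> PW A \<Longrightarrow> cellint (\<lambda>n x. ennreal ((cmod (ift g (z n)))\<^sup>2)) \<le> ennreal (K\<^sup>2) * nsq (ift g)"
  shows "cellint (\<lambda>n x. ennreal ((cmod (ift g x - tpoly (Suc k) g n x))\<^sup>2)) \<le> ennreal ((K * R_rem k (m * R))\<^sup>2) * nsq (ift g)"
proof -
  \<comment> \<open>Point evaluations weighted with the cell volumes, as the sampling measure for
    \<open>nn_integral_Esum_le\<close>.\<close>
  define M where "M = density (count_space I) (\<lambda>n. emeasure lborel (V n))"
  have Mint: "(\<integral>\<^sup>+n. \<phi> n \<partial>M) = cellint (\<lambda>n x. \<phi> n)" for \<phi>
    unfolding M_def cellint_points by (subst nn_integral_density) (auto simp: mult.commute)
  have zm: "z \<in> M \<rightarrow>\<^sub>M borel" by (simp add: M_def)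
  let ?t = "tail (Suc k) (m * R)"
  have t0: "0 \<le> ?t" using m0 R by (intro tail_nonneg) simp
  have "cellint (\<lambda>n x. ennreal ((cmod (ift g x - tpoly (Suc k) g n x))\<^sup>2)) \<le> cellint (\<lambda>n x. ennreal ?t * Esum (Suc k) (R / m) g (z n))"
  proof (rule cellint_mono)
    fix n x assume "n \<in> I" "x \<in> V n"
    then have "norm (x - z n) \<le> R" by (rule rad)
    from taylor_tail_le[OF A g m0 this, where x="z n" and s="Suc k"]
    show "ennreal ((cmod (ift g x - tpoly (Suc k) g n x))\<^sup>2) \<le> ennreal ?t * Esum (Suc k) (R / m) g (z n)"
      by (simp add: tpoly_def)
  qed
  also have "\<dots> = ennreal ?t * cellint (\<lambda>n x. Esum (Suc k) (R / m) g (z n))" by (rule cellint_cmult) simp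
  also have "cellint (\<lambda>n x. Esum (Suc k) (R / m) g (z n)) = (\<integral>\<^sup>+n. Esum (Suc k) (R / m) g (z n) \<partial>M)" by (rule Mint[symmetric])
  also have "\<dots> \<le> ennreal ?t * (ennreal (K\<^sup>2) * nsq (ift g))"
    by (rule nn_integral_Esum_le[OF A zm _ m m0 R g]) (use samp Mint in auto)
  finally have "cellint (\<lambda>n x. ennreal ((cmod (ift g x - tpoly (Suc k) g n x))\<^sup>2)) \<le> ennreal ?t * (ennreal ?t * (ennreal (K\<^sup>2) * nsq (ift g)))"
    by (simp add: mult_left_mono)
  also have "\<dots> = ennreal ((K * ?t)\<^sup>2) * nsq (ift g)"
    using t0 K by (simp add: power_mult_distrib power2_eq_square ennreal_mult mult_ac)
  finally show ?thesis by (simp only: tail_Suc)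
qed

end

section \<open>Cells in one dimension\<close>

lemma lborel_DIM1:
  fixes e :: "'a::euclidean_space"
  assumes e: "Basis = {e}"
  shows "(lborel :: 'a measure) = distr lborel borel (\<lambda>r::real. r *\<^sub>R e)"
proof (rule lborel_eqI)
  fix l u :: 'a assume "\<And>b. b \<in> Basis \<Longrightarrow> l \<bullet> b \<le> u \<bullet> b"
  then have le: "l \<bullet> e \<le> u \<bullet> e" using e by auto
  have "e \<in> Basis" unfolding e by simp
  then have ee: "e \<bullet> e = 1" by (rule inner_same_Basis)
  have "(\<lambda>r::real. r *\<^sub>R e) -` box l u = {l \<bullet> e<..<u \<bullet> e}"
    by (auto simp: box_def e ee)
  then show "emeasure (distr lborel borel (\<lambda>r::real. r *\<^sub>R e)) (box l u) = (\<Prod>b\<in>Basis. (u - l) \<bullet> b)"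
    using le by (subst emeasure_distr) (auto simp: e inner_diff_left)
qed simp

lemma ift_line_deriv:
  fixes g :: "'a::euclidean_space \<Rightarrow> complex"
  assumes A: "bounded A" and g: "g \<in> PW A"
  shows "((\<lambda>r. ift g (r *\<^sub>R e)) has_vector_derivative ift (\<lambda>\<omega>. \<i> * complex_of_real (\<omega> \<bullet> e) * g \<omega>) (r *\<^sub>R e)) (at r)"
proof -
  let ?D = "\<lambda>h. ift (\<lambda>\<omega>. \<i> * complex_of_real (\<omega> \<bullet> h) * g \<omega>) (r *\<^sub>R e)"
  have "((\<lambda>s::real. s *\<^sub>R e) has_derivative (\<lambda>s. s *\<^sub>R e)) (at r)"
    by (auto intro!: derivative_eq_intros)
  from has_derivative_compose[OF this ift_has_derivative[OF A g]]
  have "((\<lambda>s. ift g (s *\<^sub>R e)) has_derivative (\<lambda>s. ?D (s *\<^sub>R e))) (at r)" .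
  moreover have "?D (s *\<^sub>R e) = s *\<^sub>R ?D e" for s
    by (simp add: scaleR_conv_of_real mult_ac flip: ift_cmult)
  ultimately show ?thesis by (simp add: has_vector_derivative_def)
qed

text \<open>The space is one-dimensional but not necessarily the type \<open>real\<close>: the
  locale serves the time axis with \<open>e = 1\<close> as well as \<open>real ^ 'n\<close> with a
  single coordinate.\<close>

locale interval_cells = cells I V z R
  for I :: "'i set" and V :: "'i \<Rightarrow> 'a::euclidean_space set" and z R +
  fixes e :: 'a
  assumes e: "Basis = {e}" and closed: "\<And>n. n \<in> I \<Longrightarrow> closed (V n)" and convex: "\<And>n. n \<in> I \<Longrightarrow> convex (V n)"
    and center: "\<And>n. n \<in> I \<Longrightarrow> z n \<in> V n"
begin

lemma norm_e: "norm e = 1"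
proof (rule norm_Basis)
  show "e \<in> Basis" unfolding e by simp
qed

lemma repr: "(x \<bullet> e) *\<^sub>R e = x"
  using euclidean_representation[of x] by (simp add: e)

lemma cell_interval:
  assumes n: "n \<in> I"
  obtains p q where "\<And>r. r *\<^sub>R e \<in> V n \<longleftrightarrow> r \<in> {p..q}" "p \<le> z n \<bullet> e" "z n \<bullet> e \<le> q" "z n \<bullet> e - p \<le> R" "q - z n \<bullet> e \<le> R"
proof -
  let ?U = "{r. r *\<^sub>R e \<in> V n}"
  have U: "?U = (\<lambda>r. r *\<^sub>R e) -` V n" by auto
  have zU: "z n \<bullet> e \<in> ?U" using center[OF n] by (simp add: repr)
  have sub: "\<bar>r - z n \<bullet> e\<bar> \<le> R" if "r \<in> ?U" for r
  proof -
    have "norm (r *\<^sub>R e - z n) \<le> R" using that rad[OF n] by simp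
    moreover have "r *\<^sub>R e - z n = (r - z n \<bullet> e) *\<^sub>R e" using repr[of "z n"] by (simp add: scaleR_diff_left)
    ultimately show ?thesis by (simp add: norm_e)
  qed
  have "closed ?U" unfolding U by (rule closed_vimage[OF closed[OF n]]) (intro continuous_intros)
  moreover have "bounded ?U"
    by (rule bounded_subset[OF bounded_cball[of "z n \<bullet> e" R]]) (use sub in \<open>auto simp: dist_real_def abs_minus_commute\<close>)
  ultimately have "compact ?U" by (simp add: compact_eq_bounded_closed)
  moreover have "convex ?U"
  proof (rule convexI)
    fix a b u v :: real assume "a \<in> ?U" "b \<in> ?U" "0 \<le> u" "0 \<le> v" "u + v = 1"
    then have "u *\<^sub>R (a *\<^sub>R e) + v *\<^sub>R (b *\<^sub>R e) \<in> V n" using convex[OF n] by (intro convexD) auto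
    then show "u *\<^sub>R a + v *\<^sub>R b \<in> ?U" by (simp add: scaleR_add_left)
  qed
  then have "connected ?U" by (rule convex_connected)
  ultimately obtain p q where pq: "?U = {p..q}" using connected_compact_interval_1[of ?U] by (auto simp: cbox_interval)
  then have "r *\<^sub>R e \<in> V n \<longleftrightarrow> r \<in> {p..q}" for r by blast
  moreover have z: "p \<le> z n \<bullet> e" "z n \<bullet> e \<le> q" using zU pq by auto
  moreover have "p \<in> ?U" "q \<in> ?U" using pq z by auto
  ultimately show ?thesis using sub[of p] sub[of q] that by (smt (verit))
qed

lemma cell_integral:
  assumes \<phi>: "\<phi> \<in> borel_measurable borel" and n: "n \<in> I" and pq: "\<And>r. r *\<^sub>R e \<in> V n \<longleftrightarrow> r \<in> {p..q}"
  shows "(\<integral>\<^sup>+x. \<phi> x * indicator (V n) x \<partial>lborel) = (\<integral>\<^sup>+r. \<phi> (r *\<^sub>R e) * indicator {p..q} r \<partial>lborel)"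
proof -
  have "(\<integral>\<^sup>+x. \<phi> x * indicator (V n) x \<partial>lborel) = (\<integral>\<^sup>+r. \<phi> (r *\<^sub>R e) * indicator (V n) (r *\<^sub>R e) \<partial>lborel)"
    unfolding lborel_DIM1[OF e] using \<phi> V[OF n] by (intro nn_integral_distr) auto
  also have "\<dots> = (\<integral>\<^sup>+r. \<phi> (r *\<^sub>R e) * indicator {p..q} r \<partial>lborel)"
    using pq by (intro nn_integral_cong) (auto split: split_indicator)
  finally show ?thesis .
qed

text \<open>An inequality on every interval around the sampling point, with the same constant, adds
  up over the cells; this is how the one-dimensional inequalities of Wirtinger and Poincare become
  global.\<close>

lemma cellint_local_le:
  assumes \<phi>: "\<And>n. n \<in> I \<Longrightarrow> \<phi> n \<in> borel_measurable borel" and \<psi>: "\<psi> \<in> borel_measurable borel"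
    and le: "\<And>n p q. n \<in> I \<Longrightarrow> p \<le> z n \<bullet> e \<Longrightarrow> z n \<bullet> e \<le> q \<Longrightarrow> z n \<bullet> e - p \<le> R \<Longrightarrow> q - z n \<bullet> e \<le> R \<Longrightarrow>
      (\<integral>\<^sup>+r. \<phi> n (r *\<^sub>R e) * indicator {p..q} r \<partial>lborel) \<le> C * (\<integral>\<^sup>+r. \<psi> (r *\<^sub>R e) * indicator {p..q} r \<partial>lborel)"
  shows "cellint \<phi> \<le> C * (\<integral>\<^sup>+x. \<psi> x \<partial>lborel)"
proof -
  have "cellint \<phi> \<le> (\<integral>\<^sup>+n. C * (\<integral>\<^sup>+x. \<psi> x * indicator (V n) x \<partial>lborel) \<partial>count_space I)"
    unfolding cellint_def
  proof (rule nn_integral_mono)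
    fix n assume "n \<in> space (count_space I)"
    then have n: "n \<in> I" by simp
    obtain p q where pq: "\<And>r. r *\<^sub>R e \<in> V n \<longleftrightarrow> r \<in> {p..q}" "p \<le> z n \<bullet> e" "z n \<bullet> e \<le> q" "z n \<bullet> e - p \<le> R" "q - z n \<bullet> e \<le> R"
      using cell_interval[OF n] by blast
    show "(\<integral>\<^sup>+x. \<phi> n x * indicator (V n) x \<partial>lborel) \<le> C * (\<integral>\<^sup>+x. \<psi> x * indicator (V n) x \<partial>lborel)"
      unfolding cell_integral[OF \<phi>[OF n] n pq(1)] cell_integral[OF \<psi> n pq(1)] by (rule le[OF n pq(2-)])
  qed
  also have "\<dots> = C * (\<integral>\<^sup>+n. \<integral>\<^sup>+x. \<psi> x * indicator (V n) x \<partial>lborel \<partial>count_space I)"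
    by (rule nn_integral_cmult) simp
  also have "(\<integral>\<^sup>+n. \<integral>\<^sup>+x. \<psi> x * indicator (V n) x \<partial>lborel \<partial>count_space I) = (\<integral>\<^sup>+x. \<psi> x \<partial>lborel)"
    using cellint_const[OF \<psi>] unfolding cellint_def .
  finally show ?thesis .
qed

lemma nsq_ift_deriv_le:
  assumes A: "bounded A" and m: "\<And>\<omega>. \<omega> \<in> A \<Longrightarrow> norm \<omega> \<le> m" and g: "g \<in> PW A"
  shows "nsq (ift (\<lambda>\<omega>. (\<i> * complex_of_real (\<omega> \<bullet> e)) ^ j * g \<omega>)) \<le> ennreal (m ^ (2 * j)) * nsq (ift g)"
proof (rule nsq_ift_mult_le[OF A g])
  fix \<omega> assume "\<omega> \<in> A"
  then have "\<bar>\<omega> \<bullet> e\<bar> \<le> m" using Cauchy_Schwarz_ineq2[of \<omega> e] m[of \<omega>] by (simp add: norm_e)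
  then have "\<bar>\<omega> \<bullet> e\<bar> ^ (2 * j) \<le> m ^ (2 * j)" by (intro power_mono) auto
  then show "(cmod ((\<i> * complex_of_real (\<omega> \<bullet> e)) ^ j))\<^sup>2 \<le> m ^ (2 * j)"
    by (simp add: norm_mult norm_power power_mult mult.commute flip: power_mult)
qed (intro continuous_intros)

lemma wirtinger_cells:
  assumes A: "bounded A" and m: "\<And>\<omega>. \<omega> \<in> A \<Longrightarrow> norm \<omega> \<le> m" and g: "g \<in> PW A"
  shows "cellint (\<lambda>n x. ennreal ((cmod (ift g x - ift g (z n)))\<^sup>2)) \<le> ennreal ((2 * R * m / pi)\<^sup>2) * nsq (ift g)"
proof -
  let ?g' = "\<lambda>\<omega>. \<i> * complex_of_real (\<omega> \<bullet> e) * g \<omega>"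
  have g': "?g' \<in> PW A" by (rule PW_inner_mult[OF A g])
  have [measurable]: "ift g \<in> borel_measurable borel" "ift ?g' \<in> borel_measurable borel"
    by (rule ift_measurable[OF PW_measurable[OF g]], rule ift_measurable[OF PW_measurable[OF g']])
  have "cellint (\<lambda>n x. ennreal ((cmod (ift g x - ift g (z n)))\<^sup>2)) \<le> ennreal ((2 * R / pi)\<^sup>2) * (\<integral>\<^sup>+x. ennreal ((cmod (ift ?g' x))\<^sup>2) \<partial>lborel)"
  proof (rule cellint_local_le)
    fix n p q assume pq: "p \<le> z n \<bullet> e" "z n \<bullet> e \<le> q" "z n \<bullet> e - p \<le> R" "q - z n \<bullet> e \<le> R"
    have c: "continuous_on UNIV (\<lambda>r. ift ?g' (r *\<^sub>R e))"
      by (rule continuous_on_compose2[OF ift_continuous[OF A g', of UNIV]]) (auto intro: continuous_intros)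
    show "(\<integral>\<^sup>+r. ennreal ((cmod (ift g (r *\<^sub>R e) - ift g (z n)))\<^sup>2) * indicator {p..q} r \<partial>lborel) \<le>
      ennreal ((2 * R / pi)\<^sup>2) * (\<integral>\<^sup>+r. ennreal ((cmod (ift ?g' (r *\<^sub>R e)))\<^sup>2) * indicator {p..q} r \<partial>lborel)"
      using wirtinger_cell[OF ift_line_deriv[OF A g] c pq] by (simp only: repr)
  qed measurable
  also have "\<dots> \<le> ennreal ((2 * R / pi)\<^sup>2) * (ennreal (m\<^sup>2) * nsq (ift g))"
    using nsq_ift_deriv_le[OF A m g, of 1] by (intro mult_left_mono) (auto simp: nsq_def)
  also have "\<dots> = ennreal ((2 * R * m / pi)\<^sup>2) * nsq (ift g)"
    by (simp add: mult.assoc[symmetric] power_mult_distrib power_divide flip: ennreal_mult)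
  finally show ?thesis .
qed

lemma poincare_cells:
  assumes A: "bounded A" and m: "\<And>\<omega>. \<omega> \<in> A \<Longrightarrow> norm \<omega> \<le> m" and m0: "0 \<le> m" and g: "g \<in> PW A"
  shows "cellint (\<lambda>n x. ennreal ((cmod (ift g x - tpoly (Suc k) g n x))\<^sup>2)) \<le>
    ennreal (((m * poincare_const (Suc k) * R) ^ Suc k)\<^sup>2) * nsq (ift g)"
proof -
  let ?g = "\<lambda>i \<omega>. (\<i> * complex_of_real (\<omega> \<bullet> e)) ^ i * g \<omega>"
  have P: "?g i \<in> PW A" for i by (intro PW_mult_continuous[OF A g] continuous_intros)
  have [measurable]: "ift (?g i) \<in> borel_measurable borel" for i
    by (rule ift_measurable[OF PW_measurable[OF P]])
  have [measurable]: "ift g \<in> borel_measurable borel" "tpoly (Suc k) g n \<in> borel_measurable borel" for n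
    by (rule ift_measurable[OF PW_measurable[OF g]], rule tpoly_measurable[OF PW_measurable[OF g]])
  have "cellint (\<lambda>n x. ennreal ((cmod (ift g x - tpoly (Suc k) g n x))\<^sup>2)) \<le>
     ennreal ((poincare_const (Suc k) * R) ^ (2 * Suc k)) * (\<integral>\<^sup>+x. ennreal ((cmod (ift (?g (Suc k)) x))\<^sup>2) \<partial>lborel)"
  proof (rule cellint_local_le)
    fix n p q assume pq: "p \<le> z n \<bullet> e" "z n \<bullet> e \<le> q" "z n \<bullet> e - p \<le> R" "q - z n \<bullet> e \<le> R"
    let ?\<zeta> = "z n \<bullet> e"
    define a where "a l = ift (?g l) (z n)" for l
    \<comment> \<open>The \<open>i\<close>-th derivative of the Taylor remainder along the line. All
      of order up to \<open>k\<close> vanish at the sampling point; for order \<open>Suc k\<close>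
      the sum is empty and the derivative of \<open>ift g\<close> remains.\<close>
    define D where "D i r = ift (?g i) (r *\<^sub>R e) - (\<Sum>l\<in>{i..k}. ((r - ?\<zeta>) ^ (l - i) / fact (l - i)) *\<^sub>R a l)" for i r
    have mono_deriv: "((\<lambda>r. (r - ?\<zeta>) ^ j / fact j) has_real_derivative (if j = 0 then 0 else (r - ?\<zeta>) ^ (j - 1) / fact (j - 1))) (at r)" for j r
    proof (cases j)
      case (Suc i)
      have "((\<lambda>r. (r - ?\<zeta>) ^ Suc i) has_real_derivative real (Suc i) * (r - ?\<zeta>) ^ i) (at r)"
        by (auto intro!: derivative_eq_intros simp del: power_Suc of_nat_Suc)
      from DERIV_cdivide[OF this, of "fact (Suc i)"] show ?thesis using Suc by (simp add: field_simps del: of_nat_Suc)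
    qed simp
    have der: "(D i has_vector_derivative D (Suc i) r) (at r)" for i r
    proof -
      have 1: "((\<lambda>r. ift (?g i) (r *\<^sub>R e)) has_vector_derivative ift (?g (Suc i)) (r *\<^sub>R e)) (at r)"
        using ift_line_deriv[OF A P[of i], of e r] by (simp add: mult.assoc)
      have 2: "((\<lambda>r. \<Sum>l\<in>{i..k}. ((r - ?\<zeta>) ^ (l - i) / fact (l - i)) *\<^sub>R a l) has_vector_derivative
          (\<Sum>l\<in>{i..k}. (if l - i = 0 then 0 else (r - ?\<zeta>) ^ (l - i - 1) / fact (l - i - 1)) *\<^sub>R a l)) (at r)"
      proof (rule has_vector_derivative_sum)
        fix l
        from has_vector_derivative_scaleR[OF mono_deriv[of "l - i" r] has_vector_derivative_const[of "a l"]]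
        show "((\<lambda>r. ((r - ?\<zeta>) ^ (l - i) / fact (l - i)) *\<^sub>R a l) has_vector_derivative
          (if l - i = 0 then 0 else (r - ?\<zeta>) ^ (l - i - 1) / fact (l - i - 1)) *\<^sub>R a l) (at r)" by simp
      qed
      have 3: "(\<Sum>l\<in>{i..k}. (if l - i = 0 then 0 else (r - ?\<zeta>) ^ (l - i - 1) / fact (l - i - 1)) *\<^sub>R a l) =
          (\<Sum>l\<in>{Suc i..k}. ((r - ?\<zeta>) ^ (l - Suc i) / fact (l - Suc i)) *\<^sub>R a l)"
        by (rule sum.mono_neutral_cong_right) auto
      show ?thesis unfolding D_def[abs_def] 3[symmetric] by (rule has_vector_derivative_diff[OF 1 2])
    qed
    have zero: "D i ?\<zeta> = 0" if "i < Suc k" for i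
    proof -
      have "(\<Sum>l\<in>{i..k}. ((?\<zeta> - ?\<zeta>) ^ (l - i) / fact (l - i)) *\<^sub>R a l) = (\<Sum>l\<in>{i..k}. if l = i then a i else 0)"
        by (intro sum.cong) auto
      also have "\<dots> = a i" using that by simp
      finally show ?thesis by (simp add: D_def a_def repr)
    qed
    have D0: "D 0 r = ift g (r *\<^sub>R e) - tpoly (Suc k) g n (r *\<^sub>R e)" for r
    proof -
      have "tpoly (Suc k) g n (r *\<^sub>R e) = (\<Sum>l\<in>{0..k}. ((r - ?\<zeta>) ^ l / fact l) *\<^sub>R a l)"
        unfolding tpoly_def atLeast0AtMost lessThan_Suc_atMost
      proof (intro sum.cong refl)
        fix l
        have "\<omega> \<bullet> (r *\<^sub>R e - z n) = (r - ?\<zeta>) * (\<omega> \<bullet> e)" for \<omega>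
          by (subst repr[of "z n", symmetric]) (simp add: inner_diff_right left_diff_distrib)
        then have "ift (\<lambda>\<omega>. (\<i> * complex_of_real (\<omega> \<bullet> (r *\<^sub>R e - z n))) ^ l * g \<omega>) (z n) = complex_of_real ((r - ?\<zeta>) ^ l) * a l"
          unfolding a_def by (simp add: power_mult_distrib mult_ac flip: ift_cmult)
        then show "ift (\<lambda>\<omega>. (\<i> * complex_of_real (\<omega> \<bullet> (r *\<^sub>R e - z n))) ^ l * g \<omega>) (z n) / fact l = ((r - ?\<zeta>) ^ l / fact l) *\<^sub>R a l"
          by (simp add: scaleR_conv_of_real)
      qed
      then show ?thesis by (simp add: D_def)
    qed
    have Dk: "D (Suc k) r = ift (?g (Suc k)) (r *\<^sub>R e)" for r by (simp add: D_def)
    from poincare_cell[where D=D and j="Suc k", OF der zero pq]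
    show "(\<integral>\<^sup>+r. ennreal ((cmod (ift g (r *\<^sub>R e) - tpoly (Suc k) g n (r *\<^sub>R e)))\<^sup>2) * indicator {p..q} r \<partial>lborel) \<le>
      ennreal ((poincare_const (Suc k) * R) ^ (2 * Suc k)) * (\<integral>\<^sup>+r. ennreal ((cmod (ift (?g (Suc k)) (r *\<^sub>R e)))\<^sup>2) * indicator {p..q} r \<partial>lborel)"
      unfolding D0 Dk by simp
  qed measurable
  also have "\<dots> \<le> ennreal ((poincare_const (Suc k) * R) ^ (2 * Suc k)) * (ennreal (m ^ (2 * Suc k)) * nsq (ift g))"
    unfolding nsq_def[symmetric] by (intro mult_left_mono nsq_ift_deriv_le[OF A m g]) auto
  also have "\<dots> = ennreal ((poincare_const (Suc k) * R) ^ (2 * Suc k) * m ^ (2 * Suc k)) * nsq (ift g)"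
    by (subst ennreal_mult'') (auto simp: m0 mult.assoc)
  also have "(poincare_const (Suc k) * R) ^ (2 * Suc k) * m ^ (2 * Suc k) = ((m * poincare_const (Suc k) * R) ^ Suc k)\<^sup>2"
    by (simp only: power_mult_distrib[symmetric] power_mult[symmetric] mult_ac)
  finally show ?thesis .
qed

lemma sampling_wirtinger:
  assumes A: "bounded A" and m: "\<And>\<omega>. \<omega> \<in> A \<Longrightarrow> norm \<omega> \<le> m" and m0: "0 \<le> m" and g: "g \<in> PW A"
  shows "cellint (\<lambda>n x. ennreal ((cmod (ift g (z n)))\<^sup>2)) \<le> ennreal ((1 + 2 * R * m / pi)\<^sup>2) * nsq (ift g)"
    and "2 * R * m / pi < 1 \<Longrightarrow> ennreal ((1 - 2 * R * m / pi)\<^sup>2) * nsq (ift g) \<le> cellint (\<lambda>n x. ennreal ((cmod (ift g (z n)))\<^sup>2))"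
proof -
  have f: "ift g \<in> L2" by (rule ift_L2[OF PW_integrable[OF A g] PW_L2[OF g]])
  have q: "0 \<le> 2 * R * m / pi" using R m0 by simp
  note * = perturbation[OF f _ q, of "\<lambda>n x. ift g (z n)", OF _ wirtinger_cells[OF A m g]]
  show "cellint (\<lambda>n x. ennreal ((cmod (ift g (z n)))\<^sup>2)) \<le> ennreal ((1 + 2 * R * m / pi)\<^sup>2) * nsq (ift g)"
    by (rule *(1)) auto
  show "2 * R * m / pi < 1 \<Longrightarrow> ennreal ((1 - 2 * R * m / pi)\<^sup>2) * nsq (ift g) \<le> cellint (\<lambda>n x. ennreal ((cmod (ift g (z n)))\<^sup>2))"
    by (rule *(2)) auto
qed

end

section \<open>Weighted samples of partial derivatives\<close>

lemma mi_pow_double: "mi_pow u (\<lambda>j. 2 * \<alpha> j) = (mi_pow u \<alpha>)\<^sup>2"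
  unfolding mi_pow_def by (simp add: prod_power_distrib power_mult[symmetric] mult.commute)

lemma mi_pow_sq_le: "(mi_pow u \<alpha>)\<^sup>2 \<le> norm u ^ (2 * mi_abs \<alpha>)"
proof -
  have "\<bar>mi_pow u \<alpha>\<bar> = (\<Prod>j\<in>UNIV. \<bar>u $ j\<bar> ^ \<alpha> j)"
    unfolding mi_pow_def by (simp add: abs_prod power_abs)
  also have "\<dots> \<le> (\<Prod>j\<in>UNIV. norm u ^ \<alpha> j)"
    by (intro prod_mono conjI power_mono component_le_norm_cart) auto
  also have "\<dots> = norm u ^ mi_abs \<alpha>" unfolding mi_abs_def by (rule power_sum[symmetric])
  finally have "\<bar>mi_pow u \<alpha>\<bar>\<^sup>2 \<le> (norm u ^ mi_abs \<alpha>)\<^sup>2" by (rule power_mono) simp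
  then show ?thesis by (simp add: power_mult[symmetric] mult.commute)
qed

lemma mi_fact_pos: "0 < mi_fact \<alpha>"
  unfolding mi_fact_def by (intro prod_pos) simp

lemma continuous_on_mi_pow: "continuous_on S (\<lambda>x. mi_pow (x - a) \<alpha>)"
  unfolding mi_pow_def by (intro continuous_intros)

lemma mi_prod_divide: "(\<Prod>j\<in>UNIV. (y j :: 'a::field_char_0) ^ \<alpha> j / fact (\<alpha> j)) = (\<Prod>j\<in>UNIV. y j ^ \<alpha> j) / (\<Prod>j\<in>UNIV. fact (\<alpha> j))"
  by (rule prod_dividef)

lemma sum_inverse_mi_fact_le: "(\<Sum>\<alpha> | mi_abs (\<alpha> :: 'n::finite \<Rightarrow> nat) \<le> k. 1 / mi_fact \<alpha>) \<le> exp (real CARD('n))"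
proof -
  have "(\<Sum>\<alpha> | mi_abs (\<alpha> :: 'n \<Rightarrow> nat) \<le> k. 1 / mi_fact \<alpha>) = (\<Sum>r\<le>k. real CARD('n) ^ r / fact r)"
    using sum_multiindex_le[of "\<lambda>j::'n. 1 :: real" k] by (simp add: mi_fact_def prod_dividef)
  also have "\<dots> \<le> exp (real CARD('n))"
    using R_rem_nonneg[of "real CARD('n)" k] by (simp add: R_rem_def)
  finally show ?thesis .
qed

locale mcells = cells I V z R
  for I :: "'i set" and V :: "'i \<Rightarrow> (real, 'n::finite) vec set" and z R
begin

text \<open>The spatial factor of \<open>weight\<close>.\<close>

definition cweight :: "'i \<Rightarrow> ('n \<Rightarrow> nat) \<Rightarrow> real" where
  "cweight n \<alpha> = (LINT x:V n|lborel. mi_pow (x - z n) (\<lambda>j. 2 * \<alpha> j)) / mi_fact \<alpha>"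

lemma cweight_nonneg: "0 \<le> cweight n \<alpha>"
  unfolding cweight_def set_lebesgue_integral_def mi_pow_double
  by (intro divide_nonneg_pos mi_fact_pos Bochner_Integration.integral_nonneg) simp

lemma ennreal_cweight:
  assumes n: "n \<in> I"
  shows "ennreal (cweight n \<alpha>) = (\<integral>\<^sup>+x. ennreal ((mi_pow (x - z n) \<alpha>)\<^sup>2 / mi_fact \<alpha>) * indicator (V n) x \<partial>lborel)"
proof -
  have m[measurable]: "(\<lambda>x. mi_pow (x - z n) \<alpha>) \<in> borel_measurable borel"
    by (rule borel_measurable_continuous_onI[OF continuous_on_mi_pow])
  have Vm[measurable]: "V n \<in> sets borel" by (rule V[OF n])
  have Vb: "V n \<subseteq> cball (z n) R" using rad[OF n] by (auto simp: dist_norm norm_minus_commute)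
  have fin: "emeasure lborel (V n) < \<infinity>"
    using emeasure_mono[OF Vb, of lborel] emeasure_lborel_cball_finite[of "z n" R] by (simp add: order_le_less_trans)
  have int: "integrable lborel (\<lambda>x. indicator (V n) x * (mi_pow (x - z n) \<alpha>)\<^sup>2)"
  proof (rule Bochner_Integration.integrable_bound)
    show "integrable lborel (\<lambda>x. R ^ (2 * mi_abs \<alpha>) * indicator (V n) x :: real)"
      using fin by (intro integrable_mult_right integrable_real_indicator) auto
    show "AE x in lborel. norm (indicator (V n) x * (mi_pow (x - z n) \<alpha>)\<^sup>2) \<le> norm (R ^ (2 * mi_abs \<alpha>) * indicator (V n) x :: real)"
    proof (rule AE_I2)
      fix x
      show "norm (indicator (V n) x * (mi_pow (x - z n) \<alpha>)\<^sup>2) \<le> norm (R ^ (2 * mi_abs \<alpha>) * indicator (V n) x :: real)"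
      proof (cases "x \<in> V n")
        case True
        then have "norm (x - z n) ^ (2 * mi_abs \<alpha>) \<le> R ^ (2 * mi_abs \<alpha>)" using rad[OF n] by (intro power_mono) auto
        then show ?thesis using mi_pow_sq_le[of "x - z n" \<alpha>] True R by simp
      qed simp
    qed
  qed measurable
  have "ennreal (cweight n \<alpha>) = ennreal (\<integral>x. indicator (V n) x * (mi_pow (x - z n) \<alpha>)\<^sup>2 / mi_fact \<alpha> \<partial>lborel)"
    unfolding cweight_def set_lebesgue_integral_def mi_pow_double by simp
  also have "\<dots> = (\<integral>\<^sup>+x. ennreal (indicator (V n) x * (mi_pow (x - z n) \<alpha>)\<^sup>2 / mi_fact \<alpha>) \<partial>lborel)"
    using int mi_fact_pos[of \<alpha>] by (intro nn_integral_eq_integral[symmetric]) (auto intro!: AE_I2 divide_nonneg_pos)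
  also have "\<dots> = (\<integral>\<^sup>+x. ennreal ((mi_pow (x - z n) \<alpha>)\<^sup>2 / mi_fact \<alpha>) * indicator (V n) x \<partial>lborel)"
    by (intro nn_integral_cong) (auto split: split_indicator)
  finally show ?thesis .
qed

definition deriv_at :: "((real, 'n) vec \<Rightarrow> complex) \<Rightarrow> ('n \<Rightarrow> nat) \<Rightarrow> 'i \<Rightarrow> complex" where
  "deriv_at g \<alpha> n = ift (\<lambda>\<omega>. zfac \<alpha> \<omega> * g \<omega>) (z n)"

definition wsum :: "nat \<Rightarrow> ((real, 'n) vec \<Rightarrow> complex) \<Rightarrow> ennreal" where
  "wsum k g = (\<integral>\<^sup>+n. (\<Sum>\<alpha> | mi_abs \<alpha> \<le> k. ennreal (cweight n \<alpha>) * ennreal ((cmod (deriv_at g \<alpha> n))\<^sup>2)) \<partial>count_space I)"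

text \<open>The weights are written as the integrals they come from, so that the weighted sum can be
  compared with Taylor polynomials pointwise on each cell.\<close>

lemma wsum_eq_cellint:
  "wsum k g = cellint (\<lambda>n x. \<Sum>\<alpha> | mi_abs \<alpha> \<le> k. ennreal ((mi_pow (x - z n) \<alpha>)\<^sup>2 / mi_fact \<alpha>) * ennreal ((cmod (deriv_at g \<alpha> n))\<^sup>2))"
  unfolding wsum_def cellint_def
proof (rule nn_integral_cong)
  fix n assume "n \<in> space (count_space I)"
  then have n: "n \<in> I" by simp
  have [measurable]: "(\<lambda>x. mi_pow (x - z n) \<alpha>) \<in> borel_measurable borel" for \<alpha>
    by (rule borel_measurable_continuous_onI[OF continuous_on_mi_pow])
  have [measurable]: "V n \<in> sets borel" by (rule V[OF n])
  have "(\<integral>\<^sup>+x. (\<Sum>\<alpha> | mi_abs \<alpha> \<le> k. ennreal ((mi_pow (x - z n) \<alpha>)\<^sup>2 / mi_fact \<alpha>) * ennreal ((cmod (deriv_at g \<alpha> n))\<^sup>2)) * indicator (V n) x \<partial>lborel)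
    = (\<integral>\<^sup>+x. (\<Sum>\<alpha> | mi_abs \<alpha> \<le> k. ennreal ((cmod (deriv_at g \<alpha> n))\<^sup>2) * (ennreal ((mi_pow (x - z n) \<alpha>)\<^sup>2 / mi_fact \<alpha>) * indicator (V n) x)) \<partial>lborel)"
  proof (intro nn_integral_cong)
    fix x
    show "(\<Sum>\<alpha> | mi_abs \<alpha> \<le> k. ennreal ((mi_pow (x - z n) \<alpha>)\<^sup>2 / mi_fact \<alpha>) * ennreal ((cmod (deriv_at g \<alpha> n))\<^sup>2)) * indicator (V n) x
      = (\<Sum>\<alpha> | mi_abs \<alpha> \<le> k. ennreal ((cmod (deriv_at g \<alpha> n))\<^sup>2) * (ennreal ((mi_pow (x - z n) \<alpha>)\<^sup>2 / mi_fact \<alpha>) * indicator (V n) x))"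
      unfolding sum_distrib_right by (intro sum.cong refl) (simp only: mult_ac)
  qed
  also have "\<dots> = (\<Sum>\<alpha> | mi_abs \<alpha> \<le> k. \<integral>\<^sup>+x. ennreal ((cmod (deriv_at g \<alpha> n))\<^sup>2) * (ennreal ((mi_pow (x - z n) \<alpha>)\<^sup>2 / mi_fact \<alpha>) * indicator (V n) x) \<partial>lborel)"
    by (rule nn_integral_sum) measurable
  also have "\<dots> = (\<Sum>\<alpha> | mi_abs \<alpha> \<le> k. ennreal ((cmod (deriv_at g \<alpha> n))\<^sup>2) * ennreal (cweight n \<alpha>))"
    unfolding ennreal_cweight[OF n] by (intro sum.cong refl nn_integral_cmult) measurable
  finally show "(\<Sum>\<alpha> | mi_abs \<alpha> \<le> k. ennreal (cweight n \<alpha>) * ennreal ((cmod (deriv_at g \<alpha> n))\<^sup>2)) =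
    (\<integral>\<^sup>+x. (\<Sum>\<alpha> | mi_abs \<alpha> \<le> k. ennreal ((mi_pow (x - z n) \<alpha>)\<^sup>2 / mi_fact \<alpha>) * ennreal ((cmod (deriv_at g \<alpha> n))\<^sup>2)) * indicator (V n) x \<partial>lborel)"
    by (simp only: mult.commute)
qed

text \<open>The multinomial theorem is applied to the multipliers under the integral, where partial
  derivatives are commuting scalar factors.\<close>

lemma tpoly_multiindex:
  assumes A: "bounded A" and g: "g \<in> PW A"
  shows "tpoly (Suc k) g n x = (\<Sum>\<alpha> | mi_abs \<alpha> \<le> k. complex_of_real (mi_pow (x - z n) \<alpha> / mi_fact \<alpha>) * deriv_at g \<alpha> n)"
proof -
  let ?u = "x - z n"
  have P1: "(\<lambda>\<omega>. (\<i> * complex_of_real (\<omega> \<bullet> ?u)) ^ r / fact r * g \<omega>) \<in> PW A" for r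
    by (intro PW_mult_continuous[OF A g] continuous_intros) auto
  have P2: "(\<lambda>\<omega>. zfac \<alpha> \<omega> * g \<omega>) \<in> PW A" for \<alpha>
    by (intro PW_mult_continuous[OF A g] continuous_on_zfac)
  have pt: "(\<Sum>r<Suc k. (\<i> * complex_of_real (\<omega> \<bullet> ?u)) ^ r / fact r * g \<omega>) =
      (\<Sum>\<alpha> | mi_abs \<alpha> \<le> k. complex_of_real (mi_pow ?u \<alpha> / mi_fact \<alpha>) * (zfac \<alpha> \<omega> * g \<omega>))" for \<omega>
  proof -
    have "\<i> * complex_of_real (\<omega> \<bullet> ?u) = (\<Sum>j\<in>UNIV. \<i> * complex_of_real (\<omega> $ j) * complex_of_real (?u $ j))"
      by (simp add: inner_vec_def sum_distrib_left mult.assoc)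
    then have "(\<Sum>r\<le>k. (\<i> * complex_of_real (\<omega> \<bullet> ?u)) ^ r / fact r) =
      (\<Sum>\<alpha> | mi_abs \<alpha> \<le> k. \<Prod>j\<in>UNIV. (\<i> * complex_of_real (\<omega> $ j) * complex_of_real (?u $ j)) ^ \<alpha> j / fact (\<alpha> j))"
      by (simp only: sum_multiindex_le)
    also have "\<dots> = (\<Sum>\<alpha> | mi_abs \<alpha> \<le> k. complex_of_real (mi_pow ?u \<alpha> / mi_fact \<alpha>) * zfac \<alpha> \<omega>)"
    proof (intro sum.cong refl)
      fix \<alpha> :: "'n \<Rightarrow> nat"
      have "(\<Prod>j\<in>UNIV. (\<i> * complex_of_real (\<omega> $ j) * complex_of_real (?u $ j)) ^ \<alpha> j / fact (\<alpha> j)) =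
        zfac \<alpha> \<omega> * (\<Prod>j\<in>UNIV. complex_of_real (?u $ j) ^ \<alpha> j) / (\<Prod>j\<in>UNIV. fact (\<alpha> j))"
        unfolding mi_prod_divide zfac_def by (simp only: power_mult_distrib prod.distrib)
      then show "(\<Prod>j\<in>UNIV. (\<i> * complex_of_real (\<omega> $ j) * complex_of_real (?u $ j)) ^ \<alpha> j / fact (\<alpha> j)) =
        complex_of_real (mi_pow ?u \<alpha> / mi_fact \<alpha>) * zfac \<alpha> \<omega>"
        by (simp add: mi_pow_def mi_fact_def mult.commute)
    qed
    finally show ?thesis
      unfolding sum_distrib_right[symmetric] lessThan_Suc_atMost by (simp add: sum_distrib_right mult.assoc)
  qed
  have "tpoly (Suc k) g n x = (\<Sum>r<Suc k. ift (\<lambda>\<omega>. (\<i> * complex_of_real (\<omega> \<bullet> ?u)) ^ r / fact r * g \<omega>) (z n))"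
    unfolding tpoly_def
  proof (intro sum.cong refl)
    fix r
    have "ift (\<lambda>\<omega>. (\<i> * complex_of_real (\<omega> \<bullet> ?u)) ^ r / fact r * g \<omega>) (z n) =
      ift (\<lambda>\<omega>. (1 / fact r) * ((\<i> * complex_of_real (\<omega> \<bullet> ?u)) ^ r * g \<omega>)) (z n)" by simp
    then show "ift (\<lambda>\<omega>. (\<i> * complex_of_real (\<omega> \<bullet> ?u)) ^ r * g \<omega>) (z n) / fact r = ift (\<lambda>\<omega>. (\<i> * complex_of_real (\<omega> \<bullet> ?u)) ^ r / fact r * g \<omega>) (z n)"
      by (simp only: ift_cmult) simp
  qed
  also have "\<dots> = ift (\<lambda>\<omega>. \<Sum>r<Suc k. (\<i> * complex_of_real (\<omega> \<bullet> ?u)) ^ r / fact r * g \<omega>) (z n)"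
    by (rule ift_sum[symmetric]) (rule finite_lessThan, rule PW_integrable[OF A P1])
  also have "\<dots> = ift (\<lambda>\<omega>. \<Sum>\<alpha> | mi_abs \<alpha> \<le> k. complex_of_real (mi_pow ?u \<alpha> / mi_fact \<alpha>) * (zfac \<alpha> \<omega> * g \<omega>)) (z n)"
    by (simp only: pt)
  also have "\<dots> = (\<Sum>\<alpha> | mi_abs \<alpha> \<le> k. complex_of_real (mi_pow ?u \<alpha> / mi_fact \<alpha>) * deriv_at g \<alpha> n)"
    unfolding deriv_at_def ift_cmult[symmetric]
    by (rule ift_sum[OF finite_multiindex]) (intro integrable_mult_right PW_integrable[OF A P2])
  finally show ?thesis .
qed

text \<open>The factor 1 / \<alpha>! is split into two square roots: one remains with the monomial
  and forms the weight, the squares of the other sum to at most the exponential of the spatial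
  dimension.\<close>

lemma tpoly_sq_le:
  assumes A: "bounded A" and g: "g \<in> PW A"
  shows "(cmod (tpoly (Suc k) g n x))\<^sup>2 \<le> exp (real CARD('n)) *
    (\<Sum>\<alpha> | mi_abs \<alpha> \<le> k. (mi_pow (x - z n) \<alpha>)\<^sup>2 / mi_fact \<alpha> * (cmod (deriv_at g \<alpha> n))\<^sup>2)"
proof -
  let ?F = "{\<alpha> :: 'n \<Rightarrow> nat. mi_abs \<alpha> \<le> k}" and ?u = "x - z n"
  let ?a = "\<lambda>\<alpha>. 1 / sqrt (mi_fact \<alpha>)" and ?c = "\<lambda>\<alpha>. \<bar>mi_pow ?u \<alpha>\<bar> / sqrt (mi_fact \<alpha>) * cmod (deriv_at g \<alpha> n)"
  have f0: "0 \<le> mi_fact \<alpha>" for \<alpha> :: "'n \<Rightarrow> nat" using mi_fact_pos[of \<alpha>] by simp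
  have "cmod (tpoly (Suc k) g n x) \<le> (\<Sum>\<alpha>\<in>?F. ?a \<alpha> * ?c \<alpha>)"
    unfolding tpoly_multiindex[OF A g]
  proof (rule order_trans[OF norm_sum], rule sum_mono)
    fix \<alpha> :: "'n \<Rightarrow> nat"
    have "sqrt (mi_fact \<alpha>) * sqrt (mi_fact \<alpha>) = mi_fact \<alpha>" using mi_fact_pos[of \<alpha>] by simp
    then show "cmod (complex_of_real (mi_pow ?u \<alpha> / mi_fact \<alpha>) * deriv_at g \<alpha> n) \<le> ?a \<alpha> * ?c \<alpha>"
      using mi_fact_pos[of \<alpha>] by (simp add: norm_mult norm_divide abs_divide)
  qed
  then have "(cmod (tpoly (Suc k) g n x))\<^sup>2 \<le> (\<Sum>\<alpha>\<in>?F. ?a \<alpha> * ?c \<alpha>)\<^sup>2" by (rule power_mono) simp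
  also have "\<dots> \<le> (\<Sum>\<alpha>\<in>?F. (?a \<alpha>)\<^sup>2) * (\<Sum>\<alpha>\<in>?F. (?c \<alpha>)\<^sup>2)" by (rule Cauchy_Schwarz_ineq_sum)
  also have "(\<Sum>\<alpha>\<in>?F. (?a \<alpha>)\<^sup>2) = (\<Sum>\<alpha>\<in>?F. 1 / mi_fact \<alpha>)"
    using f0 by (simp add: power_divide)
  also have "(\<Sum>\<alpha>\<in>?F. (?c \<alpha>)\<^sup>2) = (\<Sum>\<alpha>\<in>?F. (mi_pow ?u \<alpha>)\<^sup>2 / mi_fact \<alpha> * (cmod (deriv_at g \<alpha> n))\<^sup>2)"
    using f0 by (simp add: power_divide power_mult_distrib)
  also have "(\<Sum>\<alpha>\<in>?F. 1 / mi_fact \<alpha>) * (\<Sum>\<alpha>\<in>?F. (mi_pow ?u \<alpha>)\<^sup>2 / mi_fact \<alpha> * (cmod (deriv_at g \<alpha> n))\<^sup>2) \<le>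
      exp (real CARD('n)) * (\<Sum>\<alpha>\<in>?F. (mi_pow ?u \<alpha>)\<^sup>2 / mi_fact \<alpha> * (cmod (deriv_at g \<alpha> n))\<^sup>2)"
    using f0 by (intro mult_right_mono sum_inverse_mi_fact_le sum_nonneg) auto
  finally show ?thesis .
qed

lemma wsum_lower:
  assumes A: "bounded A" and g: "g \<in> PW A" and q: "0 \<le> q" "q < 1"
    and close: "cellint (\<lambda>n x. ennreal ((cmod (ift g x - tpoly (Suc k) g n x))\<^sup>2)) \<le> ennreal (q\<^sup>2) * nsq (ift g)"
  shows "ennreal (exp (- real CARD('n)) * (1 - q)\<^sup>2) * nsq (ift g) \<le> wsum k g"
proof -
  let ?p = "real CARD('n)"
  have f: "ift g \<in> L2" by (rule ift_L2[OF PW_integrable[OF A g] PW_L2[OF g]])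
  let ?T = "\<lambda>n x. \<Sum>\<alpha> | mi_abs \<alpha> \<le> k. ennreal ((mi_pow (x - z n) \<alpha>)\<^sup>2 / mi_fact \<alpha>) * ennreal ((cmod (deriv_at g \<alpha> n))\<^sup>2)"
  have m: "(\<lambda>x. mi_pow (x - z n) \<alpha>) \<in> borel_measurable borel" for n \<alpha>
    by (rule borel_measurable_continuous_onI[OF continuous_on_mi_pow])
  have "ennreal ((1 - q)\<^sup>2) * nsq (ift g) \<le> cellint (\<lambda>n x. ennreal ((cmod (tpoly (Suc k) g n x))\<^sup>2))"
    by (rule perturbation(2)[OF f _ q(1) close q(2)]) (rule tpoly_measurable[OF PW_measurable[OF g]])
  also have "\<dots> \<le> cellint (\<lambda>n x. ennreal (exp ?p) * ?T n x)"
  proof (rule cellint_mono)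
    fix n x
    have nn: "0 \<le> (mi_pow (x - z n) \<alpha>)\<^sup>2 / mi_fact \<alpha>" for \<alpha> using mi_fact_pos[of \<alpha>] by simp
    have "ennreal ((cmod (tpoly (Suc k) g n x))\<^sup>2) \<le> ennreal (exp ?p *
       (\<Sum>\<alpha> | mi_abs \<alpha> \<le> k. (mi_pow (x - z n) \<alpha>)\<^sup>2 / mi_fact \<alpha> * (cmod (deriv_at g \<alpha> n))\<^sup>2))"
      by (rule ennreal_leI[OF tpoly_sq_le[OF A g]])
    also have "\<dots> = ennreal (exp ?p) * ?T n x"
      using nn by (simp only: ennreal_mult'[OF exp_ge_zero] sum_ennreal[symmetric] ennreal_mult' mult_nonneg_nonneg zero_le_power2)
    finally show "ennreal ((cmod (tpoly (Suc k) g n x))\<^sup>2) \<le> ennreal (exp ?p) * ?T n x" .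
  qed
  also have "\<dots> = ennreal (exp ?p) * wsum k g"
    unfolding wsum_eq_cellint by (rule cellint_cmult) (use m in measurable)
  finally have le: "ennreal ((1 - q)\<^sup>2) * nsq (ift g) \<le> ennreal (exp ?p) * wsum k g" .
  have "ennreal (exp (- ?p) * (1 - q)\<^sup>2) * nsq (ift g) = ennreal (exp (- ?p)) * (ennreal ((1 - q)\<^sup>2) * nsq (ift g))"
    by (simp only: ennreal_mult' exp_ge_zero mult.assoc)
  also have "\<dots> \<le> ennreal (exp (- ?p)) * (ennreal (exp ?p) * wsum k g)" by (intro mult_left_mono le) simp
  also have "\<dots> = wsum k g"
    by (simp add: mult.assoc[symmetric] exp_minus_inverse flip: ennreal_mult exp_add)
  finally show ?thesis .
qed

text \<open>On a cell the squared monomials are at most R^(2 |\<alpha>|), and \<open>samp\<close>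
  applies to each derivative. By Plancherel the sum over \<alpha> is then taken pointwise in
  \<omega>, where the multinomial theorem turns it into a partial sum of exp((R
  |\<omega>|)^2).\<close>

lemma wsum_upper:
  assumes A: "bounded A" and g: "g \<in> PW A" and m: "\<And>\<omega>. \<omega> \<in> A \<Longrightarrow> norm \<omega> \<le> m"
    and samp: "\<And>g. g \<in> PW A \<Longrightarrow> cellint (\<lambda>n x. ennreal ((cmod (ift g (z n)))\<^sup>2)) \<le> ennreal (K\<^sup>2) * nsq (ift g)"
  shows "wsum k g \<le> ennreal (K\<^sup>2 * exp ((m * R)\<^sup>2)) * nsq (ift g)"
proof -
  let ?F = "{\<alpha> :: 'n \<Rightarrow> nat. mi_abs \<alpha> \<le> k}"
  have P: "(\<lambda>\<omega>. zfac \<alpha> \<omega> * g \<omega>) \<in> PW A" for \<alpha> by (intro PW_mult_continuous[OF A g] continuous_on_zfac)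
  have gm[measurable]: "g \<in> borel_measurable borel" using g by (rule PW_measurable)
  have zm[measurable]: "zfac \<alpha> \<in> borel_measurable borel" for \<alpha> by (rule borel_measurable_continuous_onI[OF continuous_on_zfac])
  let ?r = "\<lambda>\<alpha>. R ^ (2 * mi_abs \<alpha>) / mi_fact \<alpha>"
  have r0: "0 \<le> ?r \<alpha>" for \<alpha> :: "'n \<Rightarrow> nat" using R mi_fact_pos[of \<alpha>] by simp
  have "wsum k g \<le> cellint (\<lambda>n x. \<Sum>\<alpha>\<in>?F. ennreal (?r \<alpha>) * ennreal ((cmod (deriv_at g \<alpha> n))\<^sup>2))"
    unfolding wsum_eq_cellint
  proof (intro cellint_mono sum_mono mult_right_mono ennreal_leI divide_right_mono)
    fix n x and \<alpha> :: "'n \<Rightarrow> nat" assume "n \<in> I" "x \<in> V n"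
    then have "norm (x - z n) ^ (2 * mi_abs \<alpha>) \<le> R ^ (2 * mi_abs \<alpha>)" using rad by (intro power_mono) auto
    then show "(mi_pow (x - z n) \<alpha>)\<^sup>2 \<le> R ^ (2 * mi_abs \<alpha>)" using mi_pow_sq_le order_trans by blast
  qed (use less_imp_le[OF mi_fact_pos] in auto)
  also have "\<dots> = (\<Sum>\<alpha>\<in>?F. ennreal (?r \<alpha>) * cellint (\<lambda>n x. ennreal ((cmod (deriv_at g \<alpha> n))\<^sup>2)))"
  proof -
    have "cellint (\<lambda>n x. \<Sum>\<alpha>\<in>F. ennreal (?r \<alpha>) * ennreal ((cmod (deriv_at g \<alpha> n))\<^sup>2)) =
      (\<Sum>\<alpha>\<in>F. ennreal (?r \<alpha>) * cellint (\<lambda>n x. ennreal ((cmod (deriv_at g \<alpha> n))\<^sup>2)))" if "finite F" for F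
      using that
    proof (induction F rule: finite_induct)
      case empty
      then show ?case by (simp add: cellint_def)
    next
      case (insert \<alpha> F)
      then show ?case by (simp add: cellint_add cellint_cmult)
    qed
    then show ?thesis using finite_multiindex by blast
  qed
  also have "\<dots> \<le> (\<Sum>\<alpha>\<in>?F. ennreal (?r \<alpha>) * (ennreal (K\<^sup>2) * nsq (ift (\<lambda>\<omega>. zfac \<alpha> \<omega> * g \<omega>))))"
    unfolding deriv_at_def by (intro sum_mono mult_left_mono samp P) simp
  also have "\<dots> = ennreal (K\<^sup>2) * (ennreal ((2 * pi) ^ DIM((real, 'n) vec)) * (\<Sum>\<alpha>\<in>?F. ennreal (?r \<alpha>) * nsq (\<lambda>\<omega>. zfac \<alpha> \<omega> * g \<omega>)))"
    unfolding nsq_ift_PW[OF A P] sum_distrib_left by (simp only: mult_ac)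
  also have "(\<Sum>\<alpha>\<in>?F. ennreal (?r \<alpha>) * nsq (\<lambda>\<omega>. zfac \<alpha> \<omega> * g \<omega>)) \<le> ennreal (exp ((m * R)\<^sup>2)) * nsq g"
  proof -
    have "(\<Sum>\<alpha>\<in>?F. ennreal (?r \<alpha>) * nsq (\<lambda>\<omega>. zfac \<alpha> \<omega> * g \<omega>)) = (\<Sum>\<alpha>\<in>?F. \<integral>\<^sup>+\<omega>. ennreal (?r \<alpha>) * ennreal ((cmod (zfac \<alpha> \<omega> * g \<omega>))\<^sup>2) \<partial>lborel)"
      unfolding nsq_def by (intro sum.cong refl nn_integral_cmult[symmetric]) measurable
    also have "\<dots> = (\<integral>\<^sup>+\<omega>. (\<Sum>\<alpha>\<in>?F. ennreal (?r \<alpha>) * ennreal ((cmod (zfac \<alpha> \<omega> * g \<omega>))\<^sup>2)) \<partial>lborel)"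
      by (rule nn_integral_sum[symmetric]) measurable
    also have "\<dots> \<le> (\<integral>\<^sup>+\<omega>. ennreal (exp ((m * R)\<^sup>2)) * ennreal ((cmod (g \<omega>))\<^sup>2) \<partial>lborel)"
    proof (rule nn_integral_mono)
      fix \<omega>
      show "(\<Sum>\<alpha>\<in>?F. ennreal (?r \<alpha>) * ennreal ((cmod (zfac \<alpha> \<omega> * g \<omega>))\<^sup>2)) \<le> ennreal (exp ((m * R)\<^sup>2)) * ennreal ((cmod (g \<omega>))\<^sup>2)"
      proof (cases "\<omega> \<in> A")
        case True
        have z2: "(cmod (zfac \<alpha> \<omega>))\<^sup>2 = (\<Prod>j\<in>UNIV. ((\<omega> $ j)\<^sup>2) ^ \<alpha> j)" for \<alpha>
        proof -
          have "(cmod ((\<i> * complex_of_real (\<omega> $ j)) ^ \<alpha> j))\<^sup>2 = ((\<omega> $ j)\<^sup>2) ^ \<alpha> j" for j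
            by (simp add: norm_power norm_mult power2_eq_square flip: power_mult_distrib)
          then show ?thesis unfolding zfac_def by (simp add: prod_norm[symmetric] prod_power_distrib)
        qed
        have "(\<Sum>\<alpha>\<in>?F. ?r \<alpha> * (cmod (zfac \<alpha> \<omega>))\<^sup>2) = (\<Sum>\<alpha>\<in>?F. \<Prod>j\<in>UNIV. (R\<^sup>2 * (\<omega> $ j)\<^sup>2) ^ \<alpha> j / fact (\<alpha> j))"
        proof (intro sum.cong refl)
          fix \<alpha> :: "'n \<Rightarrow> nat"
          have "(\<Prod>j\<in>UNIV. (R\<^sup>2) ^ \<alpha> j) = R ^ (2 * mi_abs \<alpha>)"
            unfolding mi_abs_def power_mult by (rule power_sum[symmetric])
          then show "?r \<alpha> * (cmod (zfac \<alpha> \<omega>))\<^sup>2 = (\<Prod>j\<in>UNIV. (R\<^sup>2 * (\<omega> $ j)\<^sup>2) ^ \<alpha> j / fact (\<alpha> j))"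
            unfolding mi_prod_divide unfolding power_mult_distrib[of "R\<^sup>2"] prod.distrib z2 mi_fact_def by simp
        qed
        also have "\<dots> = (\<Sum>r\<le>k. (\<Sum>j\<in>UNIV. R\<^sup>2 * (\<omega> $ j)\<^sup>2) ^ r / fact r)" by (rule sum_multiindex_le)
        also have "(\<Sum>j\<in>UNIV. R\<^sup>2 * (\<omega> $ j)\<^sup>2) = (norm \<omega> * R)\<^sup>2"
        proof -
          have "(norm \<omega>)\<^sup>2 = (\<Sum>j\<in>UNIV. (\<omega> $ j)\<^sup>2)" by (simp only: power2_norm_eq_inner inner_vec_def) (simp add: power2_eq_square)
          then show ?thesis by (simp only: sum_distrib_left[symmetric] power_mult_distrib mult.commute)
        qed
        also have "(\<Sum>r\<le>k. ((norm \<omega> * R)\<^sup>2) ^ r / fact r) \<le> exp ((norm \<omega> * R)\<^sup>2)"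
          using R_rem_nonneg[of "(norm \<omega> * R)\<^sup>2" k] by (simp add: R_rem_def)
        also have "\<dots> \<le> exp ((m * R)\<^sup>2)"
          using m[OF True] R by (simp add: mult_right_mono power_mono)
        finally have "(\<Sum>\<alpha>\<in>?F. ?r \<alpha> * (cmod (zfac \<alpha> \<omega>))\<^sup>2) * (cmod (g \<omega>))\<^sup>2 \<le> exp ((m * R)\<^sup>2) * (cmod (g \<omega>))\<^sup>2"
          by (rule mult_right_mono) simp
        then have le: "ennreal (\<Sum>\<alpha>\<in>?F. ?r \<alpha> * (cmod (zfac \<alpha> \<omega> * g \<omega>))\<^sup>2) \<le> ennreal (exp ((m * R)\<^sup>2) * (cmod (g \<omega>))\<^sup>2)"
          by (intro ennreal_leI) (simp add: sum_distrib_right norm_mult power_mult_distrib mult.assoc)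
        show ?thesis
        proof -
          have "(\<Sum>\<alpha>\<in>?F. ennreal (?r \<alpha>) * ennreal ((cmod (zfac \<alpha> \<omega> * g \<omega>))\<^sup>2)) = ennreal (\<Sum>\<alpha>\<in>?F. ?r \<alpha> * (cmod (zfac \<alpha> \<omega> * g \<omega>))\<^sup>2)"
            unfolding ennreal_mult'[OF r0, symmetric] by (intro sum_ennreal mult_nonneg_nonneg r0 zero_le_power2)
          then show ?thesis using le by (simp only: ennreal_mult' exp_ge_zero)
        qed
      next
        case False
        then have "g \<omega> = 0" using g by (simp add: PW_def)
        then show ?thesis by simp
      qed
    qed
    also have "\<dots> = ennreal (exp ((m * R)\<^sup>2)) * nsq g" unfolding nsq_def by (rule nn_integral_cmult) measurable
    finally show ?thesis .
  qed
  finally have "wsum k g \<le> ennreal (K\<^sup>2) * (ennreal ((2 * pi) ^ DIM((real, 'n) vec)) * (ennreal (exp ((m * R)\<^sup>2)) * nsq g))"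
    by (simp add: mult_left_mono)
  also have "\<dots> = ennreal (K\<^sup>2 * exp ((m * R)\<^sup>2)) * nsq (ift g)"
    unfolding nsq_ift_PW[OF A g] by (simp only: ennreal_mult' zero_le_power2 mult_ac)
  finally show ?thesis .
qed

lemma wsum_bounds_general:
  assumes A: "bounded A" and m: "\<And>\<omega>. \<omega> \<in> A \<Longrightarrow> norm \<omega> \<le> m" and m0: "m > 0" and d: "CARD('n) \<le> d"
    and lt1: "min (h_fn k (m * R)) (g_fn k d (m * R)) < 1" and g: "g \<in> PW A"
  shows "ennreal (exp (- real d) * (1 - min (h_fn k (m * R)) (g_fn k d (m * R)))\<^sup>2) * nsq (ift g) \<le> wsum k g"
    and "wsum k g \<le> ennreal (exp (2 * (m * R) + (m * R)\<^sup>2)) * nsq (ift g)"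
proof -
  define y where "y = m * R"
  have y0: "0 \<le> y" using m0 R by (simp add: y_def)
  have samp_exp: "cellint (\<lambda>n x. ennreal ((cmod (ift g (z n)))\<^sup>2)) \<le> ennreal ((exp y)\<^sup>2) * nsq (ift g)" if "g \<in> PW A" for g
    unfolding y_def by (rule sampling_exp[OF A m m0 that])
  have dim: "real CARD('n) \<le> real d" using d by simp
  \<comment> \<open>The sampling constant is chosen according to which of the two products with
    \<open>R_rem k y\<close> is smaller.\<close>
  have "\<exists>K. 0 \<le> K \<and> K * R_rem k y = min (h_fn k y) (g_fn k d y) \<and>
      (\<forall>g\<in>PW A. cellint (\<lambda>n x. ennreal ((cmod (ift g (z n)))\<^sup>2)) \<le> ennreal (K\<^sup>2) * nsq (ift g))"
  proof (cases "h_fn k y \<le> g_fn k d y")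
    case True
    then show ?thesis using samp_exp by (intro exI[of _ "exp y"]) (auto simp: h_fn_def)
  next
    case False
    then have "y \<noteq> 0" by (auto simp: h_fn_def g_fn_def R_rem_0)
    then have y: "y > 0" using y0 by simp
    have "0 < CARD('n)" by simp
    then have d0: "d > 0" using d by linarith
    define \<sigma> where "\<sigma> = \<sigma>_star d y"
    have s: "\<sigma> > 0" unfolding \<sigma>_def by (rule \<sigma>_star_pos[OF d0 y])
    define K where "K = (1 + 2 * \<sigma>) powr (real d / 2) * exp (y / \<sigma>)"
    have Rp: "R > 0" using y m0 unfolding y_def by (simp add: zero_less_mult_iff)
    \<comment> \<open>With this radius \<open>(\<epsilon> + R) / \<epsilon> = 1 + \<sigma>\<close>
      and \<open>m * \<epsilon> = y / \<sigma>\<close>, so the averaging bound depends on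
      \<open>y\<close> and \<open>\<sigma>\<close> alone.\<close>
    define \<epsilon> where "\<epsilon> = R / \<sigma>"
    have e: "\<epsilon> > 0" using Rp s by (simp add: \<epsilon>_def)
    have "(\<epsilon> + R) / \<epsilon> = 1 + \<sigma>" using Rp s by (simp add: \<epsilon>_def field_simps)
    moreover have "m * \<epsilon> = y / \<sigma>" by (simp add: \<epsilon>_def y_def)
    \<comment> \<open>The averaging bound has base \<open>1 + \<sigma>\<close> and exponent
      \<open>CARD('n)\<close>; both are enlarged to reach the prefactor of
      \<open>g_fn\<close>.\<close>
    moreover have "(1 + \<sigma>) ^ CARD('n) * (exp (y / \<sigma>))\<^sup>2 \<le> K\<^sup>2"
    proof -
      have "(1 + \<sigma>) ^ CARD('n) \<le> (1 + 2 * \<sigma>) ^ CARD('n)" using s by (intro power_mono) auto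
      also have "\<dots> \<le> (1 + 2 * \<sigma>) ^ d" using s d by (intro power_increasing) auto
      also have "\<dots> = ((1 + 2 * \<sigma>) powr (real d / 2))\<^sup>2"
        using s by (simp add: power2_eq_square powr_add[symmetric] powr_realpow)
      finally have "(1 + \<sigma>) ^ CARD('n) * (exp (y / \<sigma>))\<^sup>2 \<le> ((1 + 2 * \<sigma>) powr (real d / 2))\<^sup>2 * (exp (y / \<sigma>))\<^sup>2"
        by (rule mult_right_mono) simp
      then show ?thesis by (simp only: K_def power_mult_distrib)
    qed
    ultimately have le: "((\<epsilon> + R) / \<epsilon>) ^ DIM((real, 'n) vec) * (exp (m * \<epsilon>))\<^sup>2 \<le> K\<^sup>2" by simp
    have "cellint (\<lambda>n x. ennreal ((cmod (ift g (z n)))\<^sup>2)) \<le> ennreal (K\<^sup>2) * nsq (ift g)" if "g \<in> PW A" for g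
      by (rule order_trans[OF sampling_ball[OF A m m0 that e] mult_right_mono[OF ennreal_leI[OF le]]]) simp_all
    moreover have "K * R_rem k y = min (h_fn k y) (g_fn k d y)"
      using False by (simp add: g_fn_def K_def \<sigma>_def)
    ultimately show ?thesis by (intro exI[of _ K]) (auto simp: K_def)
  qed
  then obtain K where K: "0 \<le> K" "K * R_rem k y = min (h_fn k y) (g_fn k d y)"
    and samp: "\<And>g. g \<in> PW A \<Longrightarrow> cellint (\<lambda>n x. ennreal ((cmod (ift g (z n)))\<^sup>2)) \<le> ennreal (K\<^sup>2) * nsq (ift g)"
    by blast
  let ?q = "min (h_fn k y) (g_fn k d y)"
  have q0: "0 \<le> ?q" using K R_rem_nonneg[OF y0, of k] by (metis mult_nonneg_nonneg)
  have close: "cellint (\<lambda>n x. ennreal ((cmod (ift g x - tpoly (Suc k) g n x))\<^sup>2)) \<le> ennreal (?q\<^sup>2) * nsq (ift g)"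
    using tpoly_close[where k=k, OF A m m0 g K(1)] samp unfolding y_def[symmetric] K(2) by blast
  \<comment> \<open>Cauchy-Schwarz over the multi-indices costs the exponential of the spatial
    dimension, which is weakened here to that of \<open>d\<close>.\<close>
  have "ennreal (exp (- real d) * (1 - ?q)\<^sup>2) * nsq (ift g) \<le> ennreal (exp (- real CARD('n)) * (1 - ?q)\<^sup>2) * nsq (ift g)"
    using dim by (intro mult_right_mono ennreal_leI) auto
  also have "\<dots> \<le> wsum k g" by (rule wsum_lower[OF A g q0 _ close]) (use lt1 in \<open>simp add: y_def\<close>)
  finally show "ennreal (exp (- real d) * (1 - min (h_fn k (m * R)) (g_fn k d (m * R)))\<^sup>2) * nsq (ift g) \<le> wsum k g"
    unfolding y_def .
  have "wsum k g \<le> ennreal ((exp y)\<^sup>2 * exp ((m * R)\<^sup>2)) * nsq (ift g)"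
    by (rule wsum_upper[OF A g m samp_exp])
  also have "(exp y)\<^sup>2 * exp ((m * R)\<^sup>2) = exp (2 * (m * R) + (m * R)\<^sup>2)"
    by (simp only: y_def[symmetric] exp_add exp_double)
  finally show "wsum k g \<le> ennreal (exp (2 * (m * R) + (m * R)\<^sup>2)) * nsq (ift g)" .
qed

lemma wsum_bounds_interval:
  assumes A: "bounded A" and m: "\<And>\<omega>. \<omega> \<in> A \<Longrightarrow> norm \<omega> \<le> m" and m0: "m > 0" and card: "CARD('n) = 1"
    and ic: "interval_cells I V z R e"
    and lt1: "(m * poincare_const (k + 1) * R) ^ (k + 1) < 1" and g: "g \<in> PW A"
  shows "ennreal (exp (- 1) * (1 - (m * poincare_const (k + 1) * R) ^ (k + 1))\<^sup>2) * nsq (ift g) \<le> wsum k g"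
    and "wsum k g \<le> ennreal ((1 + 2 * m * R / pi)\<^sup>2 * exp ((m * R)\<^sup>2)) * nsq (ift g)"
proof -
  interpret interval_cells I V z R e by fact
  let ?q = "(m * poincare_const (Suc k) * R) ^ Suc k"
  have q0: "0 \<le> ?q" using m0 R poincare_const_nonneg by simp
  have "ennreal (exp (- real CARD('n)) * (1 - ?q)\<^sup>2) * nsq (ift g) \<le> wsum k g"
    by (rule wsum_lower[OF A g q0 _ poincare_cells[OF A m _ g]]) (use lt1 m0 in auto)
  then show "ennreal (exp (- 1) * (1 - (m * poincare_const (k + 1) * R) ^ (k + 1))\<^sup>2) * nsq (ift g) \<le> wsum k g"
    by (simp add: card)
  have "wsum k g \<le> ennreal ((1 + 2 * R * m / pi)\<^sup>2 * exp ((m * R)\<^sup>2)) * nsq (ift g)"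
    by (rule wsum_upper[OF A g m sampling_wirtinger(1)[OF A m]]) (use m0 in auto)
  then show "wsum k g \<le> ennreal ((1 + 2 * m * R / pi)\<^sup>2 * exp ((m * R)\<^sup>2)) * nsq (ift g)"
    by (simp add: mult_ac)
qed

end

section \<open>Sampling in space and time\<close>

lemma time_sampling:
  fixes t :: "int \<Rightarrow> real"
  assumes mono: "\<And>m. t m < t (m + 1)" and cov: "covering_radius (\<lambda>s. \<bar>s\<bar>) UNIV t \<le> ereal \<delta>"
    and B: "bounded B" and m: "\<And>\<omega>. \<omega> \<in> B \<Longrightarrow> \<bar>\<omega>\<bar> \<le> M" and M: "0 \<le> M" and q: "2 * \<delta> * M / pi < 1" and g: "g \<in> PW B"
  shows "ennreal ((1 - 2 * \<delta> * M / pi)\<^sup>2) * nsq (ift g) \<le>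
      (\<integral>\<^sup>+m. ennreal ((t (m + 1) - t (m - 1)) / 2) * ennreal ((cmod (ift g (t m)))\<^sup>2) \<partial>count_space UNIV)"
    and "(\<integral>\<^sup>+m. ennreal ((t (m + 1) - t (m - 1)) / 2) * ennreal ((cmod (ift g (t m)))\<^sup>2) \<partial>count_space UNIV) \<le>
      ennreal ((1 + 2 * \<delta> * M / pi)\<^sup>2) * nsq (ift g)"
proof -
  note gap = time_cells(1)[of t, OF mono cov]
  have d0: "0 \<le> \<delta>" using gap[of 0] mono[of 0] by linarith
  have le: "t (m - 1) < t m" for m using mono[of "m - 1"] by simp
  have gap': "t m - t (m - 1) \<le> 2 * \<delta>" for m using gap[of "m - 1"] by simp
  interpret interval_cells UNIV "time_cell t" t \<delta> 1
  proof
    show "norm (x - t n) \<le> \<delta>" if "x \<in> time_cell t n" for n x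
      using that gap[of n] gap'[of n] unfolding time_cell_def real_norm_def by (simp add: abs_le_iff field_simps)
    show "t n \<in> time_cell t n" for n using mono[of n] le[of n] by (simp add: time_cell_def)
    show "ae_partition UNIV (time_cell t)" by (rule time_cells(2)[of t, OF mono cov])
  qed (use d0 in \<open>auto simp: time_cell_def\<close>)
  have em: "emeasure lborel (time_cell t m) = ennreal ((t (m + 1) - t (m - 1)) / 2)" for m
    using mono[of m] le[of m] by (simp add: time_cell_def diff_divide_distrib[symmetric])
  have ci: "cellint (\<lambda>m x. ennreal ((cmod (ift g (t m)))\<^sup>2)) =
      (\<integral>\<^sup>+m. ennreal ((t (m + 1) - t (m - 1)) / 2) * ennreal ((cmod (ift g (t m)))\<^sup>2) \<partial>count_space UNIV)"
    unfolding cellint_points em by (simp only: mult.commute)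
  have m': "\<omega> \<in> B \<Longrightarrow> norm \<omega> \<le> M" for \<omega> using m by simp
  show "ennreal ((1 - 2 * \<delta> * M / pi)\<^sup>2) * nsq (ift g) \<le>
      (\<integral>\<^sup>+m. ennreal ((t (m + 1) - t (m - 1)) / 2) * ennreal ((cmod (ift g (t m)))\<^sup>2) \<partial>count_space UNIV)"
    using sampling_wirtinger(2)[OF B m' M g q] unfolding ci .
  show "(\<integral>\<^sup>+m. ennreal ((t (m + 1) - t (m - 1)) / 2) * ennreal ((cmod (ift g (t m)))\<^sup>2) \<partial>count_space UNIV) \<le>
      ennreal ((1 + 2 * \<delta> * M / pi)\<^sup>2) * nsq (ift g)"
    using sampling_wirtinger(1)[OF B m' M g] unfolding ci .
qed

section \<open>Iterated sums and sums over the index set\<close>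

lemma nn_integral_count_space_Times:
  assumes A: "countable A" and B: "countable B"
  shows "(\<integral>\<^sup>+p. F p \<partial>count_space (A \<times> B)) = (\<integral>\<^sup>+a. \<integral>\<^sup>+b. F (a, b) \<partial>count_space B \<partial>count_space A)"
proof -
  interpret sigma_finite_measure "count_space B" by (rule sigma_finite_measure_count_space_countable[OF B])
  show ?thesis
    using nn_integral_fst[of F "count_space A"] unfolding pair_measure_countable[OF A B] by simp
qed

lemma nn_integral_count_space_triple:
  fixes F :: "int \<times> 'i \<times> 'a \<Rightarrow> ennreal"
  assumes I: "countable I" and K: "finite K"
  shows "(\<integral>\<^sup>+s. F s \<partial>count_space (UNIV \<times> I \<times> K)) =
    (\<integral>\<^sup>+n. (\<Sum>\<alpha>\<in>K. \<integral>\<^sup>+m. F (m, n, \<alpha>) \<partial>count_space UNIV) \<partial>count_space I)"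
proof -
  have "(\<integral>\<^sup>+s. F s \<partial>count_space (UNIV \<times> I \<times> K)) = (\<integral>\<^sup>+m. \<integral>\<^sup>+n. (\<Sum>\<alpha>\<in>K. F (m, n, \<alpha>)) \<partial>count_space I \<partial>count_space UNIV)"
    using I K by (simp add: nn_integral_count_space_Times countable_finite nn_integral_count_space_finite)
  also have "\<dots> = (\<integral>\<^sup>+n. \<integral>\<^sup>+m. (\<Sum>\<alpha>\<in>K. F (m, n, \<alpha>)) \<partial>count_space UNIV \<partial>count_space I)"
    by (rule nn_integral_count_space_swap(1)[OF I, symmetric]) (auto intro: sigma_finite_measure_count_space)
  also have "\<dots> = (\<integral>\<^sup>+n. (\<Sum>\<alpha>\<in>K. \<integral>\<^sup>+m. F (m, n, \<alpha>) \<partial>count_space UNIV) \<partial>count_space I)"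
    by (simp add: nn_integral_sum)
  finally show ?thesis .
qed

text \<open>The finite upper bound is what yields summability; without it \<open>infsum\<close>
  could take its default value 0.\<close>

lemma infsum_bounds_of_nn_integral:
  fixes F :: "'s \<Rightarrow> real"
  assumes nn: "\<And>s. s \<in> S \<Longrightarrow> 0 \<le> F s" and a: "0 \<le> a" and b: "0 \<le> b"
    and lo: "ennreal a \<le> (\<integral>\<^sup>+s. ennreal (F s) \<partial>count_space S)" and up: "(\<integral>\<^sup>+s. ennreal (F s) \<partial>count_space S) \<le> ennreal b"
  shows "F summable_on S" and "a \<le> infsum F S" and "infsum F S \<le> b"
proof -
  have "integrable (count_space S) F"
    by (rule integrableI_nonneg) (use nn order_le_less_trans[OF up ennreal_less_top] in \<open>auto simp: AE_count_space\<close>)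
  then have s: "Infinite_Set_Sum.abs_summable_on F S" by (simp add: Infinite_Set_Sum.abs_summable_on_def)
  then have s': "Infinite_Sum.abs_summable_on F S" by (rule abs_summable_equivalent[THEN iffD2])
  then show "F summable_on S" by (rule Infinite_Sum.abs_summable_summable)
  have "(\<integral>\<^sup>+s. ennreal (F s) \<partial>count_space S) = ennreal (infsum F S)"
    using nn_integral_conv_infsetsum[OF s nn] infsetsum_infsum[OF s] by simp
  moreover have "0 \<le> infsum F S" by (rule infsum_nonneg[OF nn])
  ultimately show "a \<le> infsum F S" "infsum F S \<le> b" using lo up a b by simp_all
qed

locale grid_cells = mcells I V z R
  for I :: "'i set" and V :: "'i \<Rightarrow> (real, 'n::{finite,linorder}) vec set" and z R
begin

text \<open>The sampling times depend on \<open>n\<close>, so the sum over \<open>m\<close> has to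
  be estimated first, separately for every \<open>n\<close> and \<open>\<alpha>\<close>. What
  remains is an integral over all times, in which the spatial inequality holds for each
  time.\<close>

lemma space_time_sampling:
  assumes A: "bounded A" and B: "bounded B" and g: "g \<in> PW (A \<times> B)"
    and w: "\<And>m n. n \<in> I \<Longrightarrow> 0 \<le> w m n" and pos: "0 \<le> lz" "0 \<le> uz" "0 \<le> lt" "0 \<le> ut"
    and space: "\<And>h. h \<in> PW A \<Longrightarrow> ennreal lz * nsq (ift h) \<le> wsum k h" "\<And>h. h \<in> PW A \<Longrightarrow> wsum k h \<le> ennreal uz * nsq (ift h)"
    and time: "\<And>n h. n \<in> I \<Longrightarrow> h \<in> PW B \<Longrightarrow> ennreal lt * nsq (ift h) \<le>
        (\<integral>\<^sup>+m. ennreal (w m n) * ennreal ((cmod (ift h (t m n)))\<^sup>2) \<partial>count_space (UNIV :: int set))"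
      "\<And>n h. n \<in> I \<Longrightarrow> h \<in> PW B \<Longrightarrow>
        (\<integral>\<^sup>+m. ennreal (w m n) * ennreal ((cmod (ift h (t m n)))\<^sup>2) \<partial>count_space (UNIV :: int set)) \<le> ennreal ut * nsq (ift h)"
  defines "Q \<equiv> (\<integral>\<^sup>+s. ennreal ((\<lambda>(m, n, \<alpha>). w m n * cweight n \<alpha> * (cmod (Dz \<alpha> (ift g) (z n, t m n)))\<^sup>2) s)
    \<partial>count_space (UNIV \<times> I \<times> {\<alpha>. mi_abs \<alpha> \<le> k}))"
  shows "ennreal (lt * lz) * nsq (ift g) \<le> Q" and "Q \<le> ennreal (ut * uz) * nsq (ift g)"
proof -
  let ?K = "{\<alpha> :: 'n \<Rightarrow> nat. mi_abs \<alpha> \<le> k}"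
  \<comment> \<open>\<open>H s\<close> is the spectrum of the slice of \<open>ift g\<close> at the
    fixed time \<open>s\<close>; \<open>G n \<alpha>\<close> below is that of the derivative of
    order \<open>\<alpha>\<close> at the fixed point \<open>z n\<close>.\<close>
  define H where "H s = (\<lambda>x. \<integral>y. exp (\<i> * complex_of_real (y * s)) * g (x, y) \<partial>lborel)" for s
  define G where "G n \<alpha> = (\<lambda>y. \<integral>x. (zfac \<alpha> x * exp (\<i> * complex_of_real (x \<bullet> z n))) * g (x, y) \<partial>lborel)" for n \<alpha>
  have AB: "bounded (A \<times> B)" by (rule bounded_Times[OF A B])
  have P: "(\<lambda>p. zfac \<alpha> (fst p) * g p) \<in> PW (A \<times> B)" for \<alpha>
    by (intro PW_mult_continuous[OF AB g] continuous_on_compose2[OF continuous_on_zfac]) (auto intro: continuous_intros)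
  have H: "H s \<in> PW A" for s
    using PW_partial[OF B A PW_swap[OF g], of "\<lambda>y. exp (\<i> * complex_of_real (y * s))"]
    unfolding H_def by (simp add: continuous_intros)
  have G: "G n \<alpha> \<in> PW B" for n \<alpha>
    unfolding G_def by (intro PW_partial[OF A B g] continuous_intros continuous_on_zfac)
  have DG: "Dz \<alpha> (ift g) (z n, s) = ift (G n \<alpha>) s" for \<alpha> n s
    unfolding Dz_ift[OF AB g] G_def by (rule ift_partial[OF A B g continuous_on_zfac])
  have DH: "Dz \<alpha> (ift g) (x, s) = ift (\<lambda>\<omega>. zfac \<alpha> \<omega> * H s \<omega>) x" for \<alpha> x s
  proof -
    have "Dz \<alpha> (ift g) (x, s) = ift (\<lambda>p. zfac \<alpha> (snd p) * g (snd p, fst p)) (s, x)"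
      unfolding Dz_ift[OF AB g] by (subst ift_swap[OF PW_integrable[OF AB P]]) simp
    also have "\<dots> = ift (\<lambda>y. \<integral>x. (1 * exp (\<i> * complex_of_real (x \<bullet> s))) * (zfac \<alpha> y * g (y, x)) \<partial>lborel) x"
      using ift_partial[OF B A PW_swap[OF P], of "\<lambda>_. 1" \<alpha> s x] by simp
    also have "\<dots> = ift (\<lambda>\<omega>. zfac \<alpha> \<omega> * H s \<omega>) x"
    proof -
      have "(\<integral>x. (1 * exp (\<i> * complex_of_real (x \<bullet> s))) * (zfac \<alpha> y * g (y, x)) \<partial>lborel) = zfac \<alpha> y * H s y" for y
        unfolding H_def integral_mult_right_zero[symmetric] by (intro Bochner_Integration.integral_cong) (auto simp: mult_ac)
      then show ?thesis by simp
    qed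
    finally show ?thesis .
  qed
  have fH: "ift g (x, s) = ift (H s) x" for x s
    using DH[of "\<lambda>_. 0" x s] unfolding Dz_ift[OF AB g] by (simp add: zfac_def)
  have fm: "ift g \<in> borel_measurable borel" by (rule ift_measurable[OF PW_measurable[OF g]])
  \<comment> \<open>The intermediate quantity, sampled in space but integrated in time. Time
    sampling compares it with \<open>Q\<close>; after Tonelli, spatial sampling compares it with the
    norm of \<open>ift g\<close>.\<close>
  define X where "X = (\<integral>\<^sup>+n. (\<Sum>\<alpha>\<in>?K. ennreal (cweight n \<alpha>) * nsq (ift (G n \<alpha>))) \<partial>count_space I)"
  have Q: "Q = (\<integral>\<^sup>+n. (\<Sum>\<alpha>\<in>?K. ennreal (cweight n \<alpha>) *
      (\<integral>\<^sup>+m. ennreal (w m n) * ennreal ((cmod (ift (G n \<alpha>) (t m n)))\<^sup>2) \<partial>count_space UNIV)) \<partial>count_space I)"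
    unfolding Q_def nn_integral_count_space_triple[OF I finite_multiindex]
  proof (intro nn_integral_cong sum.cong refl)
    fix n and \<alpha> :: "'n \<Rightarrow> nat" assume "n \<in> space (count_space I)"
    then have n: "n \<in> I" by simp
    have "ennreal (w m n * cweight n \<alpha> * (cmod (Dz \<alpha> (ift g) (z n, t m n)))\<^sup>2) =
      ennreal (cweight n \<alpha>) * (ennreal (w m n) * ennreal ((cmod (ift (G n \<alpha>) (t m n)))\<^sup>2))" for m
      unfolding DG using w[OF n, of m] cweight_nonneg[of n \<alpha>]
      by (simp only: ennreal_mult' mult_nonneg_nonneg) (simp only: mult_ac)
    then show "(\<integral>\<^sup>+m. ennreal (case (m, n, \<alpha>) of (m, n, \<alpha>) \<Rightarrow> w m n * cweight n \<alpha> * (cmod (Dz \<alpha> (ift g) (z n, t m n)))\<^sup>2) \<partial>count_space UNIV) =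
      ennreal (cweight n \<alpha>) * (\<integral>\<^sup>+m. ennreal (w m n) * ennreal ((cmod (ift (G n \<alpha>) (t m n)))\<^sup>2) \<partial>count_space UNIV)"
      by (simp add: nn_integral_cmult)
  qed
  have scale: "(\<integral>\<^sup>+n. (\<Sum>\<alpha>\<in>?K. ennreal (cweight n \<alpha>) * (ennreal c * nsq (ift (G n \<alpha>)))) \<partial>count_space I) = ennreal c * X" for c
    unfolding X_def by (subst nn_integral_cmult[symmetric]) (simp_all add: sum_distrib_left mult_ac)
  have QX: "ennreal lt * X \<le> Q" "Q \<le> ennreal ut * X"
    unfolding Q scale[symmetric] using time G by (auto intro!: nn_integral_mono sum_mono mult_left_mono)
  have gm: "ift (G n \<alpha>) \<in> borel_measurable borel" for n \<alpha> by (rule ift_measurable[OF PW_measurable[OF G]])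
  have X: "X = (\<integral>\<^sup>+s. wsum k (H s) \<partial>lborel)"
  proof -
    have "X = (\<integral>\<^sup>+n. \<integral>\<^sup>+s. (\<Sum>\<alpha>\<in>?K. ennreal (cweight n \<alpha>) * ennreal ((cmod (ift (G n \<alpha>) s))\<^sup>2)) \<partial>lborel \<partial>count_space I)"
      unfolding X_def nsq_def using gm by (simp add: nn_integral_sum nn_integral_cmult)
    also have "\<dots> = (\<integral>\<^sup>+s. \<integral>\<^sup>+n. (\<Sum>\<alpha>\<in>?K. ennreal (cweight n \<alpha>) * ennreal ((cmod (ift (G n \<alpha>) s))\<^sup>2)) \<partial>count_space I \<partial>lborel)"
      by (rule nn_integral_count_space_swap(1)[OF I]) (use gm in \<open>auto intro: lborel.sigma_finite_measure_axioms\<close>)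
    also have "\<dots> = (\<integral>\<^sup>+s. wsum k (H s) \<partial>lborel)"
      unfolding wsum_def deriv_at_def DG[symmetric] DH ..
    finally show ?thesis .
  qed
  have nH: "nsq (ift g) = (\<integral>\<^sup>+s. nsq (ift (H s)) \<partial>lborel)"
    unfolding nsq_pair(1)[OF fm] by (simp add: fH)
  have nHm: "(\<lambda>s. nsq (ift (H s))) \<in> borel_measurable lborel"
  proof -
    have "(\<lambda>(s, x). ennreal ((cmod (ift g (x, s)))\<^sup>2)) \<in> borel_measurable (lborel \<Otimes>\<^sub>M lborel)"
    proof -
      have "(\<lambda>p. (snd p, fst p)) \<in> (borel :: (real \<times> (real, 'n) vec) measure) \<rightarrow>\<^sub>M borel"
        by (intro borel_measurable_continuous_onI continuous_intros)
      then have m1: "(\<lambda>p. ift g (snd p, fst p)) \<in> borel_measurable borel" by (rule measurable_compose[OF _ fm])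
      have "(\<lambda>p. ennreal ((cmod (ift g (snd p, fst p)))\<^sup>2)) \<in> borel_measurable (borel :: (real \<times> (real, 'n) vec) measure)"
        by (rule measurable_compose[OF m1, where g = "\<lambda>c. ennreal ((cmod c)\<^sup>2)"]) measurable
      then show ?thesis by (simp add: lborel_prod split_def)
    qed
    then have "(\<lambda>s. \<integral>\<^sup>+x. ennreal ((cmod (ift g (x, s)))\<^sup>2) \<partial>lborel) \<in> borel_measurable lborel"
      by (rule lborel.borel_measurable_nn_integral)
    then show ?thesis by (simp add: nsq_def fH)
  qed
  have XN: "ennreal lz * nsq (ift g) \<le> X" "X \<le> ennreal uz * nsq (ift g)"
    unfolding X nH nn_integral_cmult[OF nHm, symmetric] by (intro nn_integral_mono space H)+
  have "ennreal (lt * lz) * nsq (ift g) = ennreal lt * (ennreal lz * nsq (ift g))" using pos by (simp add: ennreal_mult' mult.assoc)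
  also have "\<dots> \<le> ennreal lt * X" by (intro mult_left_mono XN) simp
  also note QX(1)
  finally show "ennreal (lt * lz) * nsq (ift g) \<le> Q" .
  note QX(2)
  also have "ennreal ut * X \<le> ennreal ut * (ennreal uz * nsq (ift g))" by (intro mult_left_mono XN) simp
  also have "\<dots> = ennreal (ut * uz) * nsq (ift g)" using pos by (simp add: ennreal_mult' mult.assoc)
  finally show "Q \<le> ennreal (ut * uz) * nsq (ift g)" .
qed

end

section \<open>Band limits, degenerate spectra and the assembly of the bounds\<close>

lemma norm_le_max_norm:
  assumes "compact S" "x \<in> S"
  shows "norm x \<le> max_norm S"
proof -
  have "bdd_above (norm ` S)"
    using compact_imp_bounded[OF assms(1)] by (auto simp: bounded_iff bdd_above_def)
  then show ?thesis unfolding max_norm_def using assms(2) by (intro cSup_upper) auto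
qed

lemma max_norm_nonneg:
  assumes "compact S"
  shows "0 \<le> max_norm S"
proof -
  have "bdd_above (norm ` S)"
    using compact_imp_bounded[OF assms(1)] by (auto simp: bounded_iff bdd_above_def)
  then show ?thesis unfolding max_norm_def by (intro cSup_upper) auto
qed

text \<open>For the Euclidean norm the condition of being no farther from one point than from
  another describes a half-space, so the cell is an intersection of half-spaces.\<close>

lemma convex_voronoi:
  fixes z :: "'i \<Rightarrow> 'a::euclidean_space"
  assumes N: "\<And>x. N x = norm x"
  shows "convex (voronoi N I z n)"
proof -
  have "norm (x - a) \<le> norm (x - b) \<longleftrightarrow> (2 *\<^sub>R (b - a)) \<bullet> x \<le> b \<bullet> b - a \<bullet> a" for x a b :: 'a
    unfolding norm_le by (simp add: inner_diff inner_commute algebra_simps)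
  then have "voronoi N I z n = (\<Inter>l\<in>I - {n}. {x. (2 *\<^sub>R (z l - z n)) \<bullet> x \<le> z l \<bullet> z l - z n \<bullet> z n})"
    by (auto simp: voronoi_def N)
  then show ?thesis by (simp only:) (intro convex_INT convex_halfspace_le)
qed

text \<open>A hyperplane is a null set; the multiplier \<open>k\<close> covers all partial
  derivatives along with the function itself.\<close>

lemma PW_hyperplane:
  assumes g: "g \<in> PW A" and a: "a \<noteq> 0" and A: "\<And>x. x \<in> A \<Longrightarrow> a \<bullet> x = 0"
  shows "ift (\<lambda>\<omega>. k \<omega> * g \<omega>) = (\<lambda>_. 0)"
proof -
  have "{x. a \<bullet> x = 0} \<in> null_sets lborel"
    using a by (intro negligible_borel_null_sets negligible_hyperplane borel_closed closed_hyperplane) simp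
  then have "AE x in lborel. x \<notin> {x. a \<bullet> x = 0}" by (rule AE_not_in)
  then have ae: "AE x in lborel. g x = 0" by eventually_elim (use g A in \<open>auto simp: PW_def\<close>)
  show ?thesis unfolding ift_def by (intro ext integral_eq_zero_AE) (use ae in eventually_elim, simp)
qed

lemma ereal_less_divideD:
  assumes "ereal x < ereal c / ereal y" "0 < y"
  shows "x * y < c"
  using assms by (simp add: field_simps)

theorem proposition3p12:
  fixes d k :: nat
    and \<Omega>z :: "(real, 'n::{finite,linorder}) vec set" and \<Omega>t :: "real set"
    and star :: "(real, 'n) vec \<Rightarrow> real"
    and I :: "'i set" and z :: "'i \<Rightarrow> (real, 'n) vec" and t :: "int \<Rightarrow> 'i \<Rightarrow> real"
    and \<delta>z \<delta>t mz mt b :: real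
    and S :: "(int \<times> 'i \<times> ('n \<Rightarrow> nat)) set"
    and \<mu> :: "int \<Rightarrow> 'i \<Rightarrow> ('n \<Rightarrow> nat) \<Rightarrow> real"
  assumes d: "d = CARD('n) + 1"
    and compact: "compact \<Omega>z" "compact \<Omega>t"
    and star: "is_norm star"
    and I: "countable I"
    and partition: "ae_partition I (voronoi star I z)"
    and star_2: "d = 2 \<Longrightarrow> \<forall>v j. star v = \<bar>v $ j\<bar>"
    and I_2: "d = 2 \<Longrightarrow>
      \<exists>e :: int \<Rightarrow> 'i. bij_betw e UNIV I \<and> (\<forall>n j. z (e n) $ j < z (e (n + 1)) $ j)"
    and t: "\<And>m n. n \<in> I \<Longrightarrow> t m n < t (m + 1) n"
    and \<delta>z: "ereal \<delta>z = covering_radius star I z"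
    and \<delta>t: "ereal \<delta>t = (SUP n\<in>I. covering_radius (\<lambda>s. \<bar>s\<bar>) UNIV (\<lambda>m. t m n))"
    and mz: "mz = max_norm \<Omega>z" and mt: "mt = max_norm \<Omega>t"
    and b: "b = norm_const star"
    and \<mu>: "\<mu> = weight star I z t"
    and S: "S = UNIV \<times> I \<times> {\<alpha>. mi_abs \<alpha> \<le> k}"
    \<comment> \<open>The quotients are extended reals: \<open>\<infinity>\<close> if the denominator vanishes\<close>
    and density_t: "ereal \<delta>t < ereal pi / ereal (2 * mt)"
    and density_z: "ereal \<delta>z < ereal (C_const k d) / ereal (mz * b)"
  shows "\<exists>Az Bz.
      (d = 2 \<longrightarrow>
        Az \<ge> exp (- 1) * (1 - (mz * poincare_const (k + 1) * \<delta>z) ^ (k + 1))\<^sup>2 \<and>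
        Bz \<le> (1 + 2 * mz * \<delta>z / pi)\<^sup>2 * exp ((mz * \<delta>z)\<^sup>2)) \<and>
      (d \<ge> 3 \<longrightarrow>
        Az \<ge> exp (- real d) * (1 - min (h_fn k (mz * b * \<delta>z)) (g_fn k d (mz * b * \<delta>z)))\<^sup>2 \<and>
        Bz \<le> exp (2 * mz * b * \<delta>z + (mz * b * \<delta>z)\<^sup>2)) \<and>
      (\<forall>f \<in> bandlimited (\<Omega>z \<times> \<Omega>t).
        (\<lambda>(m, n, \<alpha>). \<mu> m n \<alpha> * (cmod (Dz \<alpha> f (z n, t m n)))\<^sup>2) summable_on S \<and>
        (1 - 2 * \<delta>t * mt / pi)\<^sup>2 * Az * (L2_norm f)\<^sup>2
          \<le> (\<Sum>\<^sub>\<infinity>(m, n, \<alpha>)\<in>S. \<mu> m n \<alpha> * (cmod (Dz \<alpha> f (z n, t m n)))\<^sup>2) \<and>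
        (\<Sum>\<^sub>\<infinity>(m, n, \<alpha>)\<in>S. \<mu> m n \<alpha> * (cmod (Dz \<alpha> f (z n, t m n)))\<^sup>2)
          \<le> (1 + 2 * \<delta>t * mt / pi)\<^sup>2 * Bz * (L2_norm f)\<^sup>2) \<and>
      (\<exists>A B. is_frame (bandlimited (\<Omega>z \<times> \<Omega>t)) S
          (\<lambda>(m, n, \<alpha>) x. complex_of_real (sqrt (\<mu> m n \<alpha>)) *
             Dz \<alpha> (\<Phi> (\<Omega>z \<times> \<Omega>t)) (x - (z n, t m n))) A B \<and>
        A \<ge> (1 - 2 * \<delta>t * mt / pi)\<^sup>2 * Az \<and>
        B \<le> (1 + 2 * \<delta>t * mt / pi)\<^sup>2 * Bz)"
proof -
  let ?\<Omega> = "\<Omega>z \<times> \<Omega>t"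
  \<comment> \<open>The covering radius of an empty set of points is infinite, whereas
    \<open>\<delta>z\<close> is real.\<close>
  have "I \<noteq> {}" using \<delta>z by (auto simp: covering_radius_def top_ereal_def)
  then obtain n0 where n0: "n0 \<in> I" by blast
  note star0 = is_norm_nonneg[OF star]
  have "star 0 = 0" using star by (simp add: is_norm_def)
  then have zV: "z n \<in> voronoi star I z n" for n
    by (simp add: voronoi_def star0)
  have rad: "star (x - z n) \<le> \<delta>z" if "n \<in> I" "x \<in> voronoi star I z n" for n x
    using voronoi_radius[OF that] \<delta>z by (metis ereal_less_eq(3))
  have \<delta>z0: "0 \<le> \<delta>z" using rad[OF n0 zV] star0[of "z n0 - z n0"] by linarith
  have cov: "covering_radius (\<lambda>s. \<bar>s\<bar>) UNIV (\<lambda>m. t m n) \<le> ereal \<delta>t" if "n \<in> I" for n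
    unfolding \<delta>t using that by (rule SUP_upper)
  have "t 1 n0 - t 0 n0 \<le> 2 * \<delta>t" using time_cells(1)[of "\<lambda>m. t m n0" \<delta>t 0, OF t[OF n0] cov[OF n0]] by simp
  then have \<delta>t0: "0 < \<delta>t" using t[OF n0, of 0] by simp
  have mz0: "0 \<le> mz" and mt0: "0 \<le> mt" unfolding mz mt by (intro max_norm_nonneg compact)+
  have b0: "0 < b" unfolding b by (rule norm_le_norm_const(2)[OF star])
  have b_1: "b = 1 \<and> (\<forall>v. star v = norm v)" if "d = 2"
  proof -
    have "CARD('n) = 1" using that d by simp
    then obtain j :: 'n where U: "UNIV = {j}" by (auto simp: card_1_singleton_iff)
    have "star v = norm v" for v
      using star_2[OF that] star0[of v] unfolding norm_vec_def L2_set_def U by simp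
    then show ?thesis unfolding b by (simp add: norm_const_eq_1)
  qed
  define V where "V = voronoi star I z"
  \<comment> \<open>The cells have radius \<open>\<delta>z\<close> with respect to
    \<open>star\<close>; the constant \<open>b\<close> converts this to the Euclidean norm.\<close>
  interpret grid_cells I V z "b * \<delta>z"
  proof
    show "V n \<in> sets borel" for n unfolding V_def by (intro borel_closed closed_voronoi star)
    show "norm (x - z n) \<le> b * \<delta>z" if "n \<in> I" "x \<in> V n" for n x
      using norm_le_norm_const(1)[OF star, of "x - z n"] mult_left_mono[OF rad[of n x], of b] that b0
      unfolding V_def b by linarith
  qed (use I partition \<delta>z0 b0 in \<open>auto simp: V_def\<close>)
  define q where "q = 2 * \<delta>t * mt / pi"
  have q0: "0 \<le> q" using \<delta>t0 mt0 by (simp add: q_def)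
  have q1: "q < 1"
  proof (cases "mt = 0")
    case False
    then show ?thesis
      using ereal_less_divideD[OF density_t] mt0 by (simp add: q_def mult_ac)
  qed (simp add: q_def)
  define a where "a = (mz * poincare_const (k + 1) * \<delta>z) ^ (k + 1)"
  define y where "y = mz * b * \<delta>z"
  define c where "c = min (h_fn k y) (g_fn k d y)"
  \<comment> \<open>The witnesses are the claimed bounds themselves, so the estimates required of
    them hold with equality.\<close>
  define Az where "Az = (if d = 2 then exp (- 1) * (1 - a)\<^sup>2 else exp (- real d) * (1 - c)\<^sup>2)"
  define Bz where "Bz = (if d = 2 then (1 + 2 * mz * \<delta>z / pi)\<^sup>2 * exp ((mz * \<delta>z)\<^sup>2) else exp (2 * mz * b * \<delta>z + (mz * b * \<delta>z)\<^sup>2))"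
  \<comment> \<open>For \<open>mz = 0\<close> the quotient in \<open>density_z\<close> is infinite
    and gives no information, but then \<open>y = 0\<close>.\<close>
  have dz: "mz = 0 \<or> y < C_const k d"
    using ereal_less_divideD[OF density_z] mz0 b0 by (cases "mz = 0") (auto simp: y_def mult_ac)
  have y0: "0 \<le> y" using mz0 b0 \<delta>z0 by (simp add: y_def)
  have a1: "a < 1" if "d = 2"
  proof -
    let ?p = "poincare_const (k + 1)"
    have p0: "0 \<le> ?p" by (rule poincare_const_nonneg)
    have "mz * ?p * \<delta>z < 1"
    \<comment> \<open>If the Poincare constant were 0, then \<open>1 / ?p\<close> would be 0 by
      convention, but in that case the product on the left is 0 anyway.\<close>
    proof (cases "mz = 0 \<or> ?p = 0")
      case False
      then have "mz * \<delta>z < 1 / ?p" "0 < ?p" using dz b_1[OF that] that p0 by (simp_all add: y_def C_const_def)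
      then show ?thesis by (simp add: field_simps)
    qed auto
    moreover have "0 \<le> mz * ?p * \<delta>z" using mz0 p0 \<delta>z0 by simp
    ultimately show ?thesis unfolding a_def by (simp only: power_less_one_iff) simp
  qed
  have c1: "c < 1" if "d \<noteq> 2"
    unfolding c_def
  proof (rule min_h_g_lt_1[OF _ y0])
    show "y = 0 \<or> y < max (H_fn k 1) (G_fn k d 1)" using dz that by (auto simp: C_const_def y_def)
  qed (use d in simp)
  have Az0: "0 < Az" using a1 c1 by (auto simp: Az_def)
  have Bz0: "0 < Bz"
  proof -
    have "0 \<le> 2 * mz * \<delta>z / pi" using mz0 \<delta>z0 by simp
    then have "0 < 1 + 2 * mz * \<delta>z / pi" by linarith
    then show ?thesis by (simp add: Bz_def)
  qed
  define w where "w m n = (t (m + 1) n - t (m - 1) n) / 2" for m n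
  have w0: "0 \<le> w m n" if "n \<in> I" for m n
    using t[OF that, of m] t[OF that, of "m - 1"] by (simp add: w_def)
  have \<mu>w: "\<mu> m n \<alpha> = w m n * cweight n \<alpha>" for m n \<alpha>
    by (simp add: \<mu> weight_def w_def cweight_def V_def[symmetric])
  define F where "F f = (\<lambda>(m, n, \<alpha>). \<mu> m n \<alpha> * (cmod (Dz \<alpha> f (z n, t m n)))\<^sup>2)" for f
  have F0: "0 \<le> F f s" if "s \<in> S" for f s
    using that w0 cweight_nonneg by (auto simp: F_def S \<mu>w)
  have bounds: "ennreal ((1 - q)\<^sup>2 * Az) * nsq f \<le> (\<integral>\<^sup>+s. ennreal (F f s) \<partial>count_space S) \<and>
      (\<integral>\<^sup>+s. ennreal (F f s) \<partial>count_space S) \<le> ennreal ((1 + q)\<^sup>2 * Bz) * nsq f" if f: "f \<in> bandlimited ?\<Omega>" for f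
  proof -
    obtain g where g: "g \<in> PW ?\<Omega>" and fg: "f = ift g"
      using f compact by (auto elim: bandlimited_obtain_PW[OF compact_Times])
    have bz: "bounded \<Omega>z" and bt: "bounded \<Omega>t" using compact by (simp_all add: compact_imp_bounded)
    have mzb: "norm \<omega> \<le> mz" if "\<omega> \<in> \<Omega>z" for \<omega> unfolding mz by (rule norm_le_max_norm[OF compact(1) that])
    have mtb: "\<bar>\<omega>\<bar> \<le> mt" if "\<omega> \<in> \<Omega>t" for \<omega> using norm_le_max_norm[OF compact(2) that] by (simp add: mt)
    show ?thesis
    proof (cases "mz = 0 \<or> mt = 0")
      case True
      \<comment> \<open>A zero band limit confines one factor to the origin, so the spectrum lies in
        a coordinate hyperplane.\<close>
      have "\<exists>a. a \<noteq> 0 \<and> (\<forall>x\<in>?\<Omega>. a \<bullet> x = 0)"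
      proof (cases "mz = 0")
        case True
        then have "fst x = 0" if "x \<in> ?\<Omega>" for x using mzb[of "fst x"] that by auto
        \<comment> \<open>Any spatial coordinate serves; \<open>undefined\<close> merely names
          one.\<close>
        then show ?thesis by (intro exI[of _ "(axis undefined 1, 0)"]) (auto simp: zero_prod_def axis_eq_0_iff inner_prod_def)
      next
        case False
        then have "snd x = 0" if "x \<in> ?\<Omega>" for x using mtb[of "snd x"] that \<open>mz = 0 \<or> mt = 0\<close> by auto
        then show ?thesis by (intro exI[of _ "(0, 1)"]) (auto simp: zero_prod_def inner_prod_def)
      qed
      then obtain a where a: "a \<noteq> 0" "\<And>x. x \<in> ?\<Omega> \<Longrightarrow> a \<bullet> x = 0" by blast
      have "Dz \<alpha> f = (\<lambda>_. 0)" for \<alpha>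
        unfolding fg Dz_ift[OF bounded_Times[OF bz bt] g] by (rule PW_hyperplane[OF g a])
      moreover have "f = (\<lambda>_. 0)" unfolding fg using PW_hyperplane[OF g a, of "\<lambda>_. 1"] by simp
      ultimately show ?thesis by (simp add: F_def nsq_def split_def)
    next
      case False
      then have mzp: "0 < mz" and mtp: "0 < mt" using mz0 mt0 by auto
      have space: "ennreal Az * nsq (ift h) \<le> wsum k h \<and> wsum k h \<le> ennreal Bz * nsq (ift h)" if h: "h \<in> PW \<Omega>z" for h
      proof (cases "d = 2")
        case True
        have b1: "b * \<delta>z = \<delta>z" and sn: "\<And>v. star v = norm v" using b_1[OF True] by auto
        have card: "CARD('n) = 1" using True d by simp
        then obtain j :: 'n where U: "UNIV = {j}" by (auto simp: card_1_singleton_iff)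
        \<comment> \<open>For d = 2 the norm \<open>star\<close> is the Euclidean one, so the closed
          cells are convex and therefore intervals.\<close>
        have "interval_cells I V z (b * \<delta>z) (axis j 1)"
        proof
          show "(Basis :: (real, 'n) vec set) = {axis j 1}" by (simp add: Basis_vec_def U)
          show "closed (V n)" for n unfolding V_def by (rule closed_voronoi[OF star])
          show "convex (V n)" for n unfolding V_def by (rule convex_voronoi[OF sn])
          show "z n \<in> V n" for n unfolding V_def by (rule zV)
        qed
        note * = wsum_bounds_interval[OF bz mzb mzp card this, of k, unfolded b1, OF _ _ h]
        show ?thesis using *[OF _ a1[OF True, unfolded a_def]] True by (simp add: Az_def Bz_def a_def)
      next
        case False
        have y: "mz * (b * \<delta>z) = y" by (simp add: y_def)
        have "CARD('n) \<le> d" using d by simp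
        note * = wsum_bounds_general[OF bz mzb mzp this, of k, unfolded y, folded c_def, OF _ c1[OF False] h]
        show ?thesis using * False by (simp add: Az_def Bz_def y_def mult_ac)
      qed
      have time: "ennreal ((1 - q)\<^sup>2) * nsq (ift h) \<le> (\<integral>\<^sup>+m. ennreal (w m n) * ennreal ((cmod (ift h (t m n)))\<^sup>2) \<partial>count_space UNIV) \<and>
          (\<integral>\<^sup>+m. ennreal (w m n) * ennreal ((cmod (ift h (t m n)))\<^sup>2) \<partial>count_space UNIV) \<le> ennreal ((1 + q)\<^sup>2) * nsq (ift h)"
        if n: "n \<in> I" and h: "h \<in> PW \<Omega>t" for n h
        using time_sampling[of "\<lambda>m. t m n" \<delta>t \<Omega>t mt h, OF t[OF n] cov[OF n] bt mtb mt0 q1[unfolded q_def] h]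
        unfolding q_def w_def by blast
      note * = space_time_sampling[OF bz bt g, where w = w and lz = Az and uz = Bz and lt = "(1 - q)\<^sup>2" and ut = "(1 + q)\<^sup>2" and t = t]
      have "ennreal ((1 - q)\<^sup>2 * Az) * nsq (ift g) \<le> (\<integral>\<^sup>+s. ennreal ((\<lambda>(m, n, \<alpha>). w m n * cweight n \<alpha> * (cmod (Dz \<alpha> (ift g) (z n, t m n)))\<^sup>2) s) \<partial>count_space (UNIV \<times> I \<times> {\<alpha>. mi_abs \<alpha> \<le> k}))"
        by (rule *(1)) (use w0 Az0 Bz0 space time in auto)
      moreover have "(\<integral>\<^sup>+s. ennreal ((\<lambda>(m, n, \<alpha>). w m n * cweight n \<alpha> * (cmod (Dz \<alpha> (ift g) (z n, t m n)))\<^sup>2) s) \<partial>count_space (UNIV \<times> I \<times> {\<alpha>. mi_abs \<alpha> \<le> k})) \<le> ennreal ((1 + q)\<^sup>2 * Bz) * nsq (ift g)"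
        by (rule *(2)) (use w0 Az0 Bz0 space time in auto)
      ultimately show ?thesis unfolding F_def S \<mu>w fg by blast
    qed
  qed
  have sums: "F f summable_on S" "(1 - q)\<^sup>2 * Az * (L2_norm f)\<^sup>2 \<le> infsum (F f) S" "infsum (F f) S \<le> (1 + q)\<^sup>2 * Bz * (L2_norm f)\<^sup>2"
    if f: "f \<in> bandlimited ?\<Omega>" for f
  proof -
    have "f \<in> L2" using f by (simp add: bandlimited_def)
    then have n: "nsq f = ennreal ((L2_norm f)\<^sup>2)" by (rule nsq_eq)
    have p: "0 \<le> (1 - q)\<^sup>2 * Az * (L2_norm f)\<^sup>2" "0 \<le> (1 + q)\<^sup>2 * Bz * (L2_norm f)\<^sup>2" using Az0 Bz0 by simp_all
    note * = infsum_bounds_of_nn_integral[where F = "F f", OF F0 p]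
    have le: "ennreal ((1 - q)\<^sup>2 * Az * (L2_norm f)\<^sup>2) \<le> (\<integral>\<^sup>+s. ennreal (F f s) \<partial>count_space S)"
      "(\<integral>\<^sup>+s. ennreal (F f s) \<partial>count_space S) \<le> ennreal ((1 + q)\<^sup>2 * Bz * (L2_norm f)\<^sup>2)"
      using bounds[OF f] unfolding n by (simp_all add: ennreal_mult'')
    show "F f summable_on S" by (rule *(1)[OF _ le])
    show "(1 - q)\<^sup>2 * Az * (L2_norm f)\<^sup>2 \<le> infsum (F f) S" by (rule *(2)[OF _ le])
    show "infsum (F f) S \<le> (1 + q)\<^sup>2 * Bz * (L2_norm f)\<^sup>2" by (rule *(3)[OF _ le])
  qed
  let ?\<phi> = "\<lambda>(m, n, \<alpha>) x. complex_of_real (sqrt (\<mu> m n \<alpha>)) * Dz \<alpha> (\<Phi> ?\<Omega>) (x - (z n, t m n))"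
  have comp: "compact ?\<Omega>" by (intro compact_Times compact)
  \<comment> \<open>Nonnegativity of the weights lets the square of
    \<open>sqrt (\<mu> m n \<alpha>)\<close> return the weight, so that the frame sum is term by
    term the sampling sum.\<close>
  have inner: "(cmod (L2_inner f (?\<phi> s)))\<^sup>2 = F f s" if "f \<in> bandlimited ?\<Omega>" "s \<in> S" for f s
  proof -
    obtain m n \<alpha> where s: "s = (m, n, \<alpha>)" by (cases s) auto
    have "0 \<le> \<mu> m n \<alpha>" using that(2) w0 cweight_nonneg by (auto simp: s S \<mu>w)
    then show ?thesis
      using frame_element(2)[OF comp that(1), of "sqrt (\<mu> m n \<alpha>)" \<alpha> "(z n, t m n)"]
      by (simp add: s F_def power_mult_distrib)
  qed
  have frame: "is_frame (bandlimited ?\<Omega>) S ?\<phi> ((1 - q)\<^sup>2 * Az) ((1 + q)\<^sup>2 * Bz)"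
    unfolding is_frame_def
  proof (intro conjI ballI)
    show "0 < (1 - q)\<^sup>2 * Az" "0 < (1 + q)\<^sup>2 * Bz" using q0 q1 Az0 Bz0 by simp_all
    show "?\<phi> s \<in> bandlimited ?\<Omega>" if "s \<in> S" for s
      using frame_element(1)[OF comp] by (cases s) simp
    fix f assume f: "f \<in> bandlimited ?\<Omega>"
    have "((\<lambda>s. (cmod (L2_inner f (?\<phi> s)))\<^sup>2) summable_on S) = (F f summable_on S)"
      by (rule summable_on_cong) (rule inner[OF f])
    then show "(\<lambda>s. (cmod (L2_inner f (?\<phi> s)))\<^sup>2) summable_on S" using sums(1)[OF f] by blast
    have "(\<Sum>\<^sub>\<infinity>s\<in>S. (cmod (L2_inner f (?\<phi> s)))\<^sup>2) = infsum (F f) S" by (rule infsum_cong) (rule inner[OF f])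
    then show "(1 - q)\<^sup>2 * Az * (L2_norm f)\<^sup>2 \<le> (\<Sum>\<^sub>\<infinity>s\<in>S. (cmod (L2_inner f (?\<phi> s)))\<^sup>2)"
      "(\<Sum>\<^sub>\<infinity>s\<in>S. (cmod (L2_inner f (?\<phi> s)))\<^sup>2) \<le> (1 + q)\<^sup>2 * Bz * (L2_norm f)\<^sup>2"
      using sums(2,3)[OF f] by simp_all
  qed
  show ?thesis
    unfolding q_def[symmetric]
  proof (rule exI[of _ Az], rule exI[of _ Bz], intro conjI impI ballI)
    fix f assume f: "f \<in> bandlimited ?\<Omega>"
    show "(\<lambda>(m, n, \<alpha>). \<mu> m n \<alpha> * (cmod (Dz \<alpha> f (z n, t m n)))\<^sup>2) summable_on S"
      "(1 - q)\<^sup>2 * Az * (L2_norm f)\<^sup>2 \<le> (\<Sum>\<^sub>\<infinity>(m, n, \<alpha>)\<in>S. \<mu> m n \<alpha> * (cmod (Dz \<alpha> f (z n, t m n)))\<^sup>2)"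
      "(\<Sum>\<^sub>\<infinity>(m, n, \<alpha>)\<in>S. \<mu> m n \<alpha> * (cmod (Dz \<alpha> f (z n, t m n)))\<^sup>2) \<le> (1 + q)\<^sup>2 * Bz * (L2_norm f)\<^sup>2"
      using sums[OF f] unfolding F_def .
  next
    show "\<exists>A B. is_frame (bandlimited ?\<Omega>) S ?\<phi> A B \<and> (1 - q)\<^sup>2 * Az \<le> A \<and> B \<le> (1 + q)\<^sup>2 * Bz"
      using frame by blast
  qed (simp_all add: Az_def Bz_def a_def c_def y_def)
qed

end
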